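(* Let $n\ge1$, $d\ge 0$ be integers, $N(n,d):=\dim \mathrm{P}_d\mathrm{LV}(\mathbb{R}^n)^{tr}$, and let $\Psi_j$, $1\le j\le N(n,d)$, be a basis of $\mathrm{P}_d\mathrm{LV}(\mathbb{R}^n)^{tr}$. A local functional $\Psi\in\mathrm{P}_d\mathrm{LV}(\mathbb{R}^n)$ is smooth if and only if there exist smooth functions $\phi_j\in C^\infty(\mathbb{R}^n)$ such that $$\Psi(f;B)=\sum_{j=1}^{N(n,d)}\int_B\phi_j(x)\,d\Psi_j(f;x)$$ for all $f\in\mathrm{Conv}(\mathbb{R}^n,\mathbb{R})$ and all bounded Borel sets $B\subset\mathbb{R}^n$. In this case, the functions $\phi_j$ are uniquely determined by $\Psi$ and the chosen basis.
   Context: $\mathrm{Conv}(\mathbb{R}^n,\mathbb{R})$ is the space of all finite convex functions $f:\mathbb{R}^n\to\mathbb{R}$ with the topology of locally uniform (equivalently, pointwise) convergence. $\mathcal{M}(\mathbb{R}^n)$ is the space of complex Radon measures, i.e. the topological dual of the space $C_c(\mathbb{R}^n)$ of compactly supported continuous complex-valued functions (with its usual inductive topology), equipped with the weak* topology. A map $\Psi:\mathrm{Conv}(\mathbb{R}^n,\mathbb{R})\to\mathcal{M}(\mathbb{R}^n)$ is a local functional if $f|_U=h|_U$ for an open set $U$ implies $\Psi(f)|_U=\Psi(h)|_U$. Write $\Psi(f;B)$ for the measure of $B$ under $\Psi(f)$ and $\Psi(f;\phi)=\int\phi\,d\Psi(f)$ for $\phi\in C_c(\mathbb{R}^n)$.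 With $\mathrm{A}(n,\mathbb{R})$ the space of affine maps $\ell:\mathbb{R}^n\to\mathbb{R}$, $\Psi$ is polynomial of degree at most $d$ if for every $f$ the map $\mathrm{A}(n,\mathbb{R})\to\mathcal{M}(\mathbb{R}^n)$, $\ell\mapsto\Psi(f+\ell)$, is a polynomial of degree at most $d$. $\mathrm{P}_d\mathrm{LV}(\mathbb{R}^n)$ is the complex vector space of all continuous local functionals that are polynomial of degree at most $d$. The group $\mathrm{Aff}(n,\mathbb{R})$ of invertible affine transformations acts by $[\pi(g)\Psi](f;B)=\Psi(f\circ g;g^{-1}(B))$, and $\mathrm{P}_d\mathrm{LV}(\mathbb{R}^n)^{tr}$ is the (finite dimensional) subspace of translation invariant elements. The compact-to-weak* topology on $\mathrm{P}_d\mathrm{LV}(\mathbb{R}^n)$ is generated by the semi-norms $\Psi\mapsto\sup_{f\in K}|\Psi(f;\phi)|$, for $\phi\in C_c(\mathbb{R}^n)$ and $K\subset\mathrm{Conv}(\mathbb{R}^n,\mathbb{R})$ compact. $\Psi$ is called smooth if the map $\mathbb{R}^n\to\mathrm{P}_d\mathrm{LV}(\mathbb{R}^n)$, $x\mapsto\pi(x)\Psi$ ($x$ identified with the translation by $x$), is smooth with respect to the compact-to-weak* topology. *)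

theory Defs
  imports "HOL-Analysis.Analysis" "HOL-Library.Function_Algebras"
begin

section \<open>Convex functions and complex Radon measures\<close>

text \<open>
  Functions carry the library's topology of pointwise convergence. On \<open>Conv\<close> it coincides with
  the topology of locally uniform convergence.
\<close>

definition Conv :: "(real^'n::finite \<Rightarrow> real) set" where
  "Conv = {f. convex_on UNIV f}"

definition supp :: "(real^'n::finite \<Rightarrow> complex) \<Rightarrow> (real^'n) set" where
  "supp \<phi> = closure {x. \<phi> x \<noteq> 0}"

definition Cc :: "(real^'n::finite \<Rightarrow> complex) set" where
  "Cc = {\<phi>. continuous_on UNIV \<phi> \<and> compact (supp \<phi>)}"

text \<open>
  Complex Radon measures are the continuous linear functionals on \<open>Cc\<close>. For the inductive limit
  topology, a linear functional is continuous iff for every compact \<open>A\<close> its restriction to the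
  functions supported in \<open>A\<close> is continuous in the supremum norm. Functionals are extended by \<open>0\<close>
  outside \<open>Cc\<close>, so that equality is equality on \<open>Cc\<close> and the weak* topology on \<open>Radon\<close> is the one
  induced by the topology of pointwise convergence of the function type.
\<close>

type_synonym 'n radon = "(real^'n \<Rightarrow> complex) \<Rightarrow> complex"

definition Radon :: "'n::finite radon set" where
  "Radon = {L.
     (\<forall>\<phi>. \<phi> \<notin> Cc \<longrightarrow> L \<phi> = 0) \<and>
     (\<forall>\<phi>\<in>Cc. \<forall>\<psi>\<in>Cc. L (\<lambda>x. \<phi> x + \<psi> x) = L \<phi> + L \<psi>) \<and>
     (\<forall>c. \<forall>\<phi>\<in>Cc. L (\<lambda>x. c * \<phi> x) = c * L \<phi>) \<and>
     (\<forall>A. compact A \<longrightarrow>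
        (\<exists>C. \<forall>\<phi>\<in>Cc. supp \<phi> \<subseteq> A \<longrightarrow> norm (L \<phi>) \<le> C * (SUP x. norm (\<phi> x))))}"

text \<open>
  By the Riesz representation theorem, every \<open>L \<in> Radon\<close> is of the form
  \<open>\<mu>\<^sub>0 + \<i> \<mu>\<^sub>1 - \<mu>\<^sub>2 - \<i> \<mu>\<^sub>3\<close> with locally finite positive Borel measures \<open>\<mu>\<^sub>k\<close>. These are not unique,
  but the measure of a bounded Borel set and the integral over it of a bounded Borel function do
  not depend on the choice.
\<close>

definition represents :: "(nat \<Rightarrow> (real^'n::finite) measure) \<Rightarrow> 'n radon \<Rightarrow> bool" where
  "represents \<mu> L \<longleftrightarrow>
     (\<forall>k<4. sets (\<mu> k) = sets borel \<and> (\<forall>A. compact A \<longrightarrow> emeasure (\<mu> k) A < \<infinity>)) \<and>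
     (\<forall>\<phi>\<in>Cc. L \<phi> = (\<Sum>k<4. \<i> ^ k * (LINT x|\<mu> k. \<phi> x)))"

definition riesz :: "'n::finite radon \<Rightarrow> nat \<Rightarrow> (real^'n) measure" where
  "riesz L = (SOME \<mu>. represents \<mu> L)"

definition radon_measure :: "'n::finite radon \<Rightarrow> (real^'n) set \<Rightarrow> complex" where
  "radon_measure L B = (\<Sum>k<4. \<i> ^ k * of_real (measure (riesz L k) B))"

definition radon_integral ::
    "'n::finite radon \<Rightarrow> (real^'n) set \<Rightarrow> (real^'n \<Rightarrow> complex) \<Rightarrow> complex" where
  "radon_integral L B g = (\<Sum>k<4. \<i> ^ k * (LINT x:B|riesz L k. g x))"


section \<open>Polynomial local functionals\<close>

type_synonym 'n functional = "(real^'n \<Rightarrow> real) \<Rightarrow> 'n radon"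

definition local_functional :: "'n::finite functional \<Rightarrow> bool" where
  "local_functional \<Psi> \<longleftrightarrow>
     (\<forall>f\<in>Conv. \<forall>h\<in>Conv. \<forall>U. open U \<longrightarrow> (\<forall>x\<in>U. f x = h x) \<longrightarrow>
        (\<forall>\<phi>\<in>Cc. supp \<phi> \<subseteq> U \<longrightarrow> \<Psi> f \<phi> = \<Psi> h \<phi>))"

text \<open>
  \<open>P\<close> is a polynomial of degree at most \<open>d\<close> with values in \<open>Radon\<close> on the space of affine functions
  \<open>x \<mapsto> v \<bullet> x + c\<close>, written in the \<open>n + 1\<close> linear coordinates \<open>(v, c)\<close> of that space.
\<close>

definition polynomial_on_affine :: "nat \<Rightarrow> 'n::finite functional \<Rightarrow> bool" where
  "polynomial_on_affine d P \<longleftrightarrow>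
     (\<exists>w :: ('n \<Rightarrow> nat) \<Rightarrow> nat \<Rightarrow> 'n radon.
        (\<forall>\<alpha> k. w \<alpha> k \<in> Radon) \<and>
        (\<forall>v c \<phi>. P (\<lambda>x. v \<bullet> x + c) \<phi> =
           (\<Sum>(\<alpha>, k) \<in> {(\<alpha>, k). (\<Sum>i\<in>UNIV. \<alpha> i) + k \<le> d}.
              of_real ((\<Prod>i\<in>UNIV. (v $ i) ^ \<alpha> i) * c ^ k) * w \<alpha> k \<phi>)))"

text \<open>
  A functional is extended by \<open>0\<close> outside \<open>Conv\<close>, so that equality is equality on \<open>Conv\<close>.
\<close>

definition PLV :: "nat \<Rightarrow> 'n::finite functional set" where
  "PLV d = {\<Psi>.
     (\<forall>f. f \<notin> Conv \<longrightarrow> \<Psi> f = 0) \<and>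
     (\<forall>f\<in>Conv. \<Psi> f \<in> Radon) \<and>
     continuous_on Conv \<Psi> \<and>
     local_functional \<Psi> \<and>
     (\<forall>f\<in>Conv. polynomial_on_affine d (\<lambda>l. \<Psi> (f + l)))}"

text \<open>
  The action \<open>[\<pi>(g)\<Psi>](f; B) = \<Psi>(f \<circ> g; g\<^sup>-\<^sup>1(B))\<close>: the measure \<open>\<pi>(g)\<Psi> f\<close> is the push-forward of
  \<open>\<Psi> (f \<circ> g)\<close> under \<open>g\<close>, whose integral of \<open>\<phi>\<close> is the integral of \<open>\<phi> \<circ> g\<close> under \<open>\<Psi> (f \<circ> g)\<close>.
\<close>

definition aff_act :: "(real^'n::finite \<Rightarrow> real^'n) \<Rightarrow> 'n functional \<Rightarrow> 'n functional" where
  "aff_act g \<Psi> = (\<lambda>f \<phi>. \<Psi> (f \<circ> g) (\<phi> \<circ> g))"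

definition trans_act :: "real^'n::finite \<Rightarrow> 'n functional \<Rightarrow> 'n functional" where
  "trans_act x = aff_act (\<lambda>y. y + x)"

definition PLV_tr :: "nat \<Rightarrow> 'n::finite functional set" where
  "PLV_tr d = {\<Psi> \<in> PLV d. \<forall>x. trans_act x \<Psi> = \<Psi>}"

definition scale_functional :: "complex \<Rightarrow> 'n::finite functional \<Rightarrow> 'n functional" where
  "scale_functional c \<Psi> = (\<lambda>f \<phi>. c * \<Psi> f \<phi>)"

global_interpretation functional: vector_space "scale_functional :: complex \<Rightarrow> 'n::finite functional \<Rightarrow> _"
  defines functional_span = functional.span
    and functional_dependent = functional.dependent
    and functional_dim = functional.dim
  by unfold_locales (auto simp: scale_functional_def fun_eq_iff algebra_simps)

definition is_basis ::
    "'n::finite functional set \<Rightarrow> nat \<Rightarrow> (nat \<Rightarrow> 'n functional) \<Rightarrow> bool" where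
  "is_basis E N \<Psi> \<longleftrightarrow>
     inj_on \<Psi> {1..N} \<and> \<not> functional_dependent (\<Psi> ` {1..N}) \<and> functional_span (\<Psi> ` {1..N}) = E"


section \<open>Smoothness\<close>

text \<open>
  The values of \<open>cw_seminorm\<close> are used only for nonempty compact \<open>K \<subseteq> Conv\<close> and for
  continuous functionals, where the supremum is finite.
\<close>

definition cw_seminorm ::
    "(real^'n::finite \<Rightarrow> real) set \<Rightarrow> (real^'n \<Rightarrow> complex) \<Rightarrow> 'n functional \<Rightarrow> real" where
  "cw_seminorm K \<phi> \<Psi> = (SUP f\<in>K. norm (\<Psi> f \<phi>))"

definition cw_topology :: "nat \<Rightarrow> 'n::finite functional topology" where
  "cw_topology d = topology_generated_by
     {{\<Psi> \<in> PLV d. cw_seminorm K \<phi> (\<Psi> - \<Psi>\<^sub>0) < r} | K \<phi> \<Psi>\<^sub>0 r.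
        compact K \<and> K \<noteq> {} \<and> K \<subseteq> Conv \<and> \<phi> \<in> Cc \<and> \<Psi>\<^sub>0 \<in> PLV d \<and> r > 0}"

text \<open>
  Smooth maps from \<open>\<real>\<^sup>n\<close> into a Hausdorff topological vector space with topology \<open>T\<close> and scalar
  multiplication \<open>sc\<close>: all iterated partial derivatives exist and are continuous. Limits, and hence
  derivatives, are taken in \<open>T\<close> and belong to its carrier.
\<close>

definition has_partial_derivative ::
    "'b::ab_group_add topology \<Rightarrow> (real \<Rightarrow> 'b \<Rightarrow> 'b) \<Rightarrow>
     (real^'n::finite \<Rightarrow> 'b) \<Rightarrow> 'n \<Rightarrow> (real^'n \<Rightarrow> 'b) \<Rightarrow> bool" where
  "has_partial_derivative T sc F i G \<longleftrightarrow>
     (\<forall>x. limitin T (\<lambda>t. sc (inverse t) (F (x + t *\<^sub>R axis i 1) - F x)) (G x) (at 0))"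

primrec C_k ::
    "nat \<Rightarrow> 'b::ab_group_add topology \<Rightarrow> (real \<Rightarrow> 'b \<Rightarrow> 'b) \<Rightarrow> (real^'n::finite \<Rightarrow> 'b) \<Rightarrow> bool" where
  "C_k 0 T sc F \<longleftrightarrow> continuous_map euclidean T F"
| "C_k (Suc k) T sc F \<longleftrightarrow>
     continuous_map euclidean T F \<and>
     (\<forall>i. \<exists>G. has_partial_derivative T sc F i G \<and> C_k k T sc G)"

definition smooth_map ::
    "'b::ab_group_add topology \<Rightarrow> (real \<Rightarrow> 'b \<Rightarrow> 'b) \<Rightarrow> (real^'n::finite \<Rightarrow> 'b) \<Rightarrow> bool" where
  "smooth_map T sc F \<longleftrightarrow> (\<forall>k. C_k k T sc F)"

definition smooth_functional :: "nat \<Rightarrow> 'n::finite functional \<Rightarrow> bool" where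
  "smooth_functional d \<Psi> \<longleftrightarrow>
     smooth_map (cw_topology d) (\<lambda>r. scale_functional (of_real r)) (\<lambda>x. trans_act x \<Psi>)"

definition smooth_function :: "(real^'n::finite \<Rightarrow> complex) \<Rightarrow> bool" where
  "smooth_function \<phi> \<longleftrightarrow> smooth_map euclidean scaleR \<phi>"

definition has_densities ::
    "'n::finite functional \<Rightarrow> nat \<Rightarrow> (nat \<Rightarrow> 'n functional) \<Rightarrow> (nat \<Rightarrow> real^'n \<Rightarrow> complex) \<Rightarrow> bool" where
  "has_densities \<Psi> N \<Psi>s \<phi> \<longleftrightarrow>
     (\<forall>f\<in>Conv. \<forall>B. bounded B \<longrightarrow> B \<in> sets borel \<longrightarrow>
        radon_measure (\<Psi> f) B = (\<Sum>j=1..N. radon_integral (\<Psi>s j f) B (\<phi> j)))"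

end

theory Submission
  imports Defs
begin

text \<open>
  Write \<open>\<pi>(x)\<close> for the action of the translation by \<open>x\<close> on
  functionals, so that
  \<open>\<pi>(x)\<Theta>(f; \<psi>) = \<Theta>(f(\<cdot> + x); \<psi>(\<cdot> + x))\<close>.
  The idea is to produce densities by averaging: a functional becomes translation invariant
  after multiplication by a test function \<open>\<rho>\<close> and integration over all its
  translates, and a smooth functional can be recovered from such averages.

  Averages. For \<open>\<rho> \<in> Cc\<close> and \<open>\<Theta> \<in> PLV d\<close> the
  integral of \<open>\<pi>(x)(\<rho>\<Theta>)\<close> over all \<open>x\<close> is an element of
  \<open>PLV_tr d\<close> (\<open>average_in_PLV_tr\<close>), hence a combination of the basis.
  Using the kernel \<open>\<rho>(z - \<cdot>)\<close> for every \<open>z\<close> gives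
  coefficients \<open>b\<^sub>j(z)\<close>. Conversely these coefficients are densities of the
  convolution of the orbit with \<open>\<rho>\<close>: the combination of the
  \<open>\<Psi>\<^sub>j\<close> with densities \<open>b\<^sub>j\<close> is the integral of
  \<open>\<rho>(x) \<pi>(x)\<Theta>\<close> (\<open>convolution_from_frozen_averages\<close>).
  This is seen by cutting a test function into small pieces and freezing the coefficients at the
  centre of each piece: near \<open>y + x = z\<close> the kernel \<open>\<rho>(z - y)\<close> is
  almost \<open>\<rho>(x)\<close>. The coefficients are linear combinations of finitely many
  values of the averages (\<open>interpolation_nodes\<close>), and since moving \<open>z\<close>
  amounts to translating \<open>\<Theta>\<close>, they are smooth when \<open>\<Theta>\<close>
  is (\<open>frozen_coefficient_smooth\<close>).

  From smooth functionals to convolutions. In one variable,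
  \<open>g(0) = \<integral>\<^sub>0\<^sup>1 p g'' - p'' g\<close> for a polynomial
  \<open>p\<close> whose boundary values single out \<open>g(0)\<close>. Applied along each
  coordinate to \<open>x \<mapsto> \<pi>(x)\<Psi>\<close>, this writes a smooth
  \<open>\<Psi>\<close> as a finite sum of integrals of
  \<open>\<rho>(x) \<pi>(x)\<Theta>\<close> with continuous kernels \<open>\<rho>\<close>
  supported in the unit cube and with \<open>\<Theta>\<close> among the iterated second
  derivatives of \<open>\<Psi>\<close>, which are again smooth elements of \<open>PLV d\<close>
  (\<open>parametrix\<close>). Together with the averages, every smooth \<open>\<Psi>\<close>
  has smooth densities (\<open>smooth_densities_exist\<close>).

  Converse and uniqueness. If \<open>\<Psi>\<close> has smooth densities
  \<open>g\<^sub>j\<close>, then \<open>\<pi>(x)\<Psi>\<close> has densities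
  \<open>g\<^sub>j(\<cdot> - x)\<close>, because the \<open>\<Psi>\<^sub>j\<close> are
  translation invariant, and these can be differentiated in \<open>x\<close> uniformly on
  compact sets (\<open>smooth_functional_of_smooth_densities\<close>). If a combination of the
  \<open>\<Psi>\<^sub>j\<close> with continuous densities vanishes, then freezing the densities
  at any point gives a vanishing linear combination (\<open>density_combination_frozen\<close>),
  so all densities are zero by linear independence (\<open>densities_unique\<close>).

  Two bodies of analysis support this. Continuity statements rest on the uniform boundedness
  principle for Radon functionals (\<open>Radon_tendsto\<close>) and on the fact that pointwise
  convergence of convex functions on a suitable countable set implies continuous convergence, at
  moving points (\<open>convex_tendsto\<close>). Statements about measures of bounded Borel sets
  are translated into identities on test functions (\<open>radon_density_iff\<close>) by means
  of the Riesz representation theorem.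
\<close>

section \<open>Compactly supported functions\<close>

lemma in_Cc_and_supp:
  assumes "continuous_on UNIV \<phi>" and "compact K" and "\<And>x. x \<notin> K \<Longrightarrow> \<phi> x = 0"
  shows "\<phi> \<in> Cc" and "supp \<phi> \<subseteq> K"
proof -
  have "closed K" using assms(2) by (rule compact_imp_closed)
  moreover have "{x. \<phi> x \<noteq> 0} \<subseteq> K" using assms(3) by auto
  ultimately show s: "supp \<phi> \<subseteq> K" unfolding supp_def by (rule closure_minimal[rotated])
  have "closed (supp \<phi>)" unfolding supp_def by simp
  then have "compact (supp \<phi>)"
    using s assms(2) by (metis compact_Int_closed inf.absorb_iff2)
  then show "\<phi> \<in> Cc" using assms(1) by (simp add: Cc_def)
qed

lemma Cc_continuous: "\<phi> \<in> Cc \<Longrightarrow> continuous_on UNIV \<phi>"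
  and Cc_compact_supp: "\<phi> \<in> Cc \<Longrightarrow> compact (supp \<phi>)"
  by (auto simp: Cc_def)

lemma outside_supp: "x \<notin> supp \<phi> \<Longrightarrow> \<phi> x = 0"
  unfolding supp_def using closure_subset[of "{x. \<phi> x \<noteq> 0}"] by auto

lemma Cc_mult:
  assumes "\<phi> \<in> Cc" and "continuous_on UNIV g"
  shows "(\<lambda>x. g x * \<phi> x) \<in> Cc" and "(\<lambda>x. \<phi> x * g x) \<in> Cc"
proof -
  show "(\<lambda>x. g x * \<phi> x) \<in> Cc"
    by (rule in_Cc_and_supp(1)[where K="supp \<phi>"])
       (use assms in \<open>auto intro!: continuous_on_mult simp: Cc_def outside_supp\<close>)
  then show "(\<lambda>x. \<phi> x * g x) \<in> Cc" by (simp add: mult.commute)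
qed

lemma Cc_add: "\<phi> \<in> Cc \<Longrightarrow> \<psi> \<in> Cc \<Longrightarrow> (\<lambda>x. \<phi> x + \<psi> x) \<in> Cc"
  by (rule in_Cc_and_supp(1)[where K="supp \<phi> \<union> supp \<psi>"])
     (auto intro!: continuous_intros compact_Un simp: Cc_def outside_supp)

lemma Cc_cmult: "\<phi> \<in> Cc \<Longrightarrow> (\<lambda>x. c * \<phi> x) \<in> Cc"
  by (rule Cc_mult(1)) auto

lemma Cc_diff: "\<phi> \<in> Cc \<Longrightarrow> \<psi> \<in> Cc \<Longrightarrow> (\<lambda>x. \<phi> x - \<psi> x) \<in> Cc"
  using Cc_add[OF _ Cc_cmult[of \<psi> "-1"], of \<phi>] by simp

lemma Cc_zero: "(\<lambda>x. 0) \<in> Cc"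
  by (rule in_Cc_and_supp(1)[where K="{}"]) auto

lemma Cc_sum: "(\<And>i. i \<in> I \<Longrightarrow> \<phi> i \<in> Cc) \<Longrightarrow> (\<lambda>x. \<Sum>i\<in>I. \<phi> i x) \<in> Cc"
  by (induction I rule: infinite_finite_induct) (auto intro: Cc_zero Cc_add)

lemma Cc_translate:
  assumes "\<phi> \<in> Cc" shows "(\<lambda>y. \<phi> (y + x)) \<in> Cc"
proof (rule in_Cc_and_supp(1)[where K="(\<lambda>y. y - x) ` supp \<phi>"])
  show "continuous_on UNIV (\<lambda>y. \<phi> (y + x))"
    by (rule continuous_on_compose2[OF Cc_continuous[OF assms]]) (auto intro!: continuous_intros)
  show "compact ((\<lambda>y. y - x) ` supp \<phi>)"
    using Cc_compact_supp[OF assms] by (intro compact_continuous_image continuous_intros)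
  fix y assume "y \<notin> (\<lambda>y. y - x) ` supp \<phi>"
  then have "y + x \<notin> supp \<phi>" by (metis add_diff_cancel_right' image_eqI)
  then show "\<phi> (y + x) = 0" by (rule outside_supp)
qed

lemma Cc_translate_iff: "(\<lambda>y. \<phi> (y + x)) \<in> Cc \<longleftrightarrow> \<phi> \<in> Cc"
  using Cc_translate[of \<phi> x] Cc_translate[of "\<lambda>y. \<phi> (y + x)" "- x"] by auto

lemma Cc_bounded:
  assumes "\<phi> \<in> Cc" obtains s where "s > 0" "\<And>x. norm (\<phi> x) \<le> s"
proof -
  have "compact (\<phi> ` supp \<phi>)"
    using assms by (intro compact_continuous_image) (auto simp: Cc_def intro: continuous_on_subset)
  then obtain s where s: "s > 0" "\<And>y. y \<in> \<phi> ` supp \<phi> \<Longrightarrow> norm y \<le> s"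
    by (meson bounded_pos compact_imp_bounded)
  then have "norm (\<phi> x) \<le> s" for x
    by (cases "x \<in> supp \<phi>") (auto simp: outside_supp)
  with s show ?thesis using that by blast
qed

lemma Cc_uniformly_continuous:
  assumes "\<phi> \<in> Cc" and "e > 0"
  obtains \<delta> where "\<delta> > 0" "\<And>x y. dist x y < \<delta> \<Longrightarrow> norm (\<phi> x - \<phi> y) < e"
proof -
  define K where "K = {x + y |x y. x \<in> supp \<phi> \<and> y \<in> cball 0 1}"
  have "compact K" unfolding K_def
    using Cc_compact_supp[OF assms(1)] by (intro compact_sums) auto
  then have "uniformly_continuous_on K \<phi>"
    using assms by (intro compact_uniformly_continuous) (auto simp: Cc_def intro: continuous_on_subset)
  then obtain \<delta> where \<delta>: "\<delta> > 0" "\<And>x y. x \<in> K \<Longrightarrow> y \<in> K \<Longrightarrow> dist y x < \<delta> \<Longrightarrow> dist (\<phi> y) (\<phi> x) < e"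
    using assms(2) unfolding uniformly_continuous_on_def by metis
  have near: "y \<in> K" if "x \<in> supp \<phi>" "dist x y < min \<delta> 1" for x y
  proof -
    have "y = x + (y - x)" "y - x \<in> cball 0 1" using that by (auto simp: dist_norm norm_minus_commute)
    then show ?thesis unfolding K_def using that(1) by blast
  qed
  show ?thesis
  proof (rule that[of "min \<delta> 1"])
    show "min \<delta> 1 > 0" using \<delta> by simp
    fix x y :: "real^'a" assume d: "dist x y < min \<delta> 1"
    consider "x \<in> supp \<phi>" | "y \<in> supp \<phi>" | "x \<notin> supp \<phi>" "y \<notin> supp \<phi>" by blast
    then show "norm (\<phi> x - \<phi> y) < e"
    proof cases
      case 1 then show ?thesis using \<delta>(2)[of x y] near[of x y] near[of x x] d \<delta>(1)
        by (auto simp: dist_norm norm_minus_commute)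
    next
      case 2 then show ?thesis using \<delta>(2)[of x y] near[of y x] near[of y y] d \<delta>(1)
        by (auto simp: dist_norm norm_minus_commute)
    next
      case 3 then show ?thesis using assms(2) by (simp add: outside_supp)
    qed
  qed
qed

lemma Cc_cutoff:
  fixes A :: "(real^'n::finite) set"
  assumes "compact A"
  obtains \<theta> where "\<theta> \<in> Cc" "\<And>x. x \<in> A \<Longrightarrow> \<theta> x = (1::complex)" "\<And>x. norm (\<theta> x) \<le> 1"
proof -
  obtain R where R: "\<And>x. x \<in> A \<Longrightarrow> norm x \<le> R"
    using assms by (meson bounded_iff compact_imp_bounded)
  define \<theta> where "\<theta> x = complex_of_real (max 0 (min 1 (R + 1 - norm x)))" for x :: "real^'n"
  show ?thesis
  proof (rule that[of \<theta>])
    show "\<theta> \<in> Cc" unfolding \<theta>_def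
      by (rule in_Cc_and_supp(1)[where K="cball 0 (R + 1)"]) (auto intro!: continuous_intros)
    show "\<theta> x = 1" if "x \<in> A" for x using R[OF that] by (simp add: \<theta>_def)
    show "norm (\<theta> x) \<le> 1" for x by (auto simp: \<theta>_def)
  qed
qed

section \<open>Radon functionals\<close>

lemma Radon_outside: "L \<in> Radon \<Longrightarrow> \<phi> \<notin> Cc \<Longrightarrow> L \<phi> = 0"
  and Radon_add: "L \<in> Radon \<Longrightarrow> \<phi> \<in> Cc \<Longrightarrow> \<psi> \<in> Cc \<Longrightarrow> L (\<lambda>x. \<phi> x + \<psi> x) = L \<phi> + L \<psi>"
  and Radon_cmult: "L \<in> Radon \<Longrightarrow> \<phi> \<in> Cc \<Longrightarrow> L (\<lambda>x. c * \<phi> x) = c * L \<phi>"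
  by (auto simp: Radon_def)

lemma Radon_diff:
  assumes "L \<in> Radon" "\<phi> \<in> Cc" "\<psi> \<in> Cc"
  shows "L (\<lambda>x. \<phi> x - \<psi> x) = L \<phi> - L \<psi>"
  using Radon_add[OF assms(1,2) Cc_cmult[OF assms(3), of "-1"]] Radon_cmult[OF assms(1,3), of "-1"]
  by simp

lemma Radon_zero: "L \<in> Radon \<Longrightarrow> L (\<lambda>x. 0) = 0"
  using Radon_cmult[OF _ Cc_zero, of L 0] by simp

lemma Radon_sum:
  assumes L: "L \<in> Radon" and "\<And>i. i \<in> I \<Longrightarrow> \<phi> i \<in> Cc"
  shows "L (\<lambda>x. \<Sum>i\<in>I. \<phi> i x) = (\<Sum>i\<in>I. L (\<phi> i))"
  using assms(2)
proof (induction I rule: infinite_finite_induct)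
  case (insert i I)
  have "L (\<lambda>x. \<phi> i x + (\<Sum>j\<in>I. \<phi> j x)) = L (\<phi> i) + L (\<lambda>x. \<Sum>j\<in>I. \<phi> j x)"
    by (rule Radon_add[OF L]) (use insert in \<open>auto intro: Cc_sum\<close>)
  with insert show ?case by simp
qed (simp_all add: Radon_zero[OF L])

lemma Radon_bound:
  assumes "L \<in> Radon" "compact A"
  obtains C where "C \<ge> 0"
    "\<And>\<phi> s. \<phi> \<in> Cc \<Longrightarrow> (\<And>x. x \<notin> A \<Longrightarrow> \<phi> x = 0) \<Longrightarrow> (\<And>x. norm (\<phi> x) \<le> s) \<Longrightarrow> norm (L \<phi>) \<le> C * s"
proof -
  obtain C where C: "\<And>\<phi>. \<phi> \<in> Cc \<Longrightarrow> supp \<phi> \<subseteq> A \<Longrightarrow> norm (L \<phi>) \<le> C * (SUP x. norm (\<phi> x))"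
    using assms unfolding Radon_def mem_Collect_eq by metis
  show ?thesis
  proof (rule that[of "max C 0"])
    fix \<phi> s assume \<phi>: "\<phi> \<in> Cc" "\<And>x. x \<notin> A \<Longrightarrow> \<phi> x = 0" "\<And>x. norm (\<phi> x) \<le> s"
    have "supp \<phi> \<subseteq> A" using in_Cc_and_supp(2)[OF Cc_continuous[OF \<phi>(1)] assms(2) \<phi>(2)] .
    then have "norm (L \<phi>) \<le> C * (SUP x. norm (\<phi> x))" using C \<phi> by blast
    also have "\<dots> \<le> max C 0 * (SUP x. norm (\<phi> x))"
      by (intro mult_right_mono cSUP_upper2[where x=undefined] bdd_aboveI[of _ s]) (use \<phi> in auto)
    also have "\<dots> \<le> max C 0 * s"
      by (intro mult_left_mono cSUP_least) (use \<phi> in auto)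
    finally show "norm (L \<phi>) \<le> max C 0 * s" .
  qed auto
qed

text \<open>
  Bounding by an arbitrary majorant \<open>s\<close> of the test function avoids handling the
  supremum norm.
\<close>

lemma RadonI:
  fixes L :: "'n::finite radon"
  assumes "\<And>\<phi>. \<phi> \<notin> Cc \<Longrightarrow> L \<phi> = 0"
    and "\<And>\<phi> \<psi>. \<phi> \<in> Cc \<Longrightarrow> \<psi> \<in> Cc \<Longrightarrow> L (\<lambda>x. \<phi> x + \<psi> x) = L \<phi> + L \<psi>"
    and "\<And>c \<phi>. \<phi> \<in> Cc \<Longrightarrow> L (\<lambda>x. c * \<phi> x) = c * L \<phi>"
    and bd: "\<And>A. compact A \<Longrightarrow> \<exists>C. \<forall>\<phi>\<in>Cc. \<forall>s. (\<forall>x. x \<notin> A \<longrightarrow> \<phi> x = 0) \<longrightarrow>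
        (\<forall>x. norm (\<phi> x) \<le> s) \<longrightarrow> norm (L \<phi>) \<le> C * s"
  shows "L \<in> Radon"
  unfolding Radon_def
proof (intro CollectI conjI allI impI ballI)
  fix A :: "(real^'n) set" assume "compact A"
  then obtain C where C: "\<And>\<phi> s. \<phi> \<in> Cc \<Longrightarrow> (\<forall>x. x \<notin> A \<longrightarrow> \<phi> x = 0) \<Longrightarrow>
      (\<forall>x. norm (\<phi> x) \<le> s) \<Longrightarrow> norm (L \<phi>) \<le> C * s" using bd by metis
  have "norm (L \<phi>) \<le> C * (SUP x. norm (\<phi> x))" if \<phi>: "\<phi> \<in> Cc" "supp \<phi> \<subseteq> A" for \<phi>
  proof (rule C)
    obtain s where s: "\<And>x. norm (\<phi> x) \<le> s" using Cc_bounded[OF \<phi>(1)] by blast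
    show "\<forall>x. norm (\<phi> x) \<le> (SUP x. norm (\<phi> x))"
      using s by (intro allI cSUP_upper bdd_aboveI[of _ s]) auto
  qed (use \<phi> outside_supp in auto)
  then show "\<exists>C. \<forall>\<phi>\<in>Cc. supp \<phi> \<subseteq> A \<longrightarrow> norm (L \<phi>) \<le> C * (SUP x. norm (\<phi> x))" by blast
qed (use assms in auto)

lemma Radon_lincomb:
  fixes L :: "'i \<Rightarrow> 'n::finite radon"
  assumes "\<And>i. i \<in> I \<Longrightarrow> L i \<in> Radon"
  shows "(\<lambda>\<phi>. \<Sum>i\<in>I. c i * L i \<phi>) \<in> Radon"
proof (rule RadonI)
  fix A :: "(real^'n) set" assume A: "compact A"
  have "\<forall>i. \<exists>C. i \<in> I \<longrightarrow> (\<forall>\<phi>\<in>Cc. \<forall>s. (\<forall>x. x \<notin> A \<longrightarrow> \<phi> x = 0) \<longrightarrow>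
        (\<forall>x. norm (\<phi> x) \<le> s) \<longrightarrow> norm (L i \<phi>) \<le> C * s)"
    using Radon_bound[OF assms A] by metis
  then obtain C where C: "\<And>i \<phi> s. i \<in> I \<Longrightarrow> \<phi> \<in> Cc \<Longrightarrow> (\<forall>x. x \<notin> A \<longrightarrow> \<phi> x = 0) \<Longrightarrow>
      (\<forall>x. norm (\<phi> x) \<le> s) \<Longrightarrow> norm (L i \<phi>) \<le> C i * s" by metis
  have "norm (\<Sum>i\<in>I. c i * L i \<phi>) \<le> (\<Sum>i\<in>I. norm (c i) * C i) * s"
    if "\<phi> \<in> Cc" "\<forall>x. x \<notin> A \<longrightarrow> \<phi> x = 0" "\<forall>x. norm (\<phi> x) \<le> s" for \<phi> s
    unfolding sum_distrib_right
    by (rule sum_norm_le) (use C[OF _ that] in \<open>auto simp: norm_mult mult.assoc intro!: mult_left_mono\<close>)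
  then show "\<exists>C. \<forall>\<phi>\<in>Cc. \<forall>s. (\<forall>x. x \<notin> A \<longrightarrow> \<phi> x = 0) \<longrightarrow>
        (\<forall>x. norm (\<phi> x) \<le> s) \<longrightarrow> norm (\<Sum>i\<in>I. c i * L i \<phi>) \<le> C * s" by blast
next
  fix \<phi> :: "real^'n \<Rightarrow> complex" assume "\<phi> \<notin> Cc"
  then show "(\<Sum>i\<in>I. c i * L i \<phi>) = 0" using Radon_outside[OF assms] by simp
next
  fix \<phi> \<psi> :: "real^'n \<Rightarrow> complex" assume "\<phi> \<in> Cc" "\<psi> \<in> Cc"
  then show "(\<Sum>i\<in>I. c i * L i (\<lambda>x. \<phi> x + \<psi> x)) = (\<Sum>i\<in>I. c i * L i \<phi>) + (\<Sum>i\<in>I. c i * L i \<psi>)"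
    unfolding sum.distrib[symmetric]
    by (intro sum.cong refl) (simp add: Radon_add[OF assms] algebra_simps)
next
  fix a and \<phi> :: "real^'n \<Rightarrow> complex" assume "\<phi> \<in> Cc"
  then show "(\<Sum>i\<in>I. c i * L i (\<lambda>x. a * \<phi> x)) = a * (\<Sum>i\<in>I. c i * L i \<phi>)"
    unfolding sum_distrib_left
    by (intro sum.cong refl) (simp add: Radon_cmult[OF assms] algebra_simps)
qed

section \<open>Uniform boundedness\<close>

text \<open>
  By Baire's theorem one of the closed sets on which the whole family is bounded by an integer
  has an interior point; a ball around it bounds the family on the unit ball.
\<close>

lemma banach_steinhaus:
  fixes F :: "('a::{real_normed_vector,complete_space} \<Rightarrow> 'b::real_normed_vector) set"
  assumes lin: "\<And>T. T \<in> F \<Longrightarrow> bounded_linear T"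
    and pt: "\<And>x. \<exists>C. \<forall>T\<in>F. norm (T x) \<le> C"
  obtains C where "C \<ge> 0" "\<And>T x. T \<in> F \<Longrightarrow> norm (T x) \<le> C * norm x"
proof -
  define B where "B m = (\<Inter>T\<in>F. {x. norm (T x) \<le> real m})" for m :: nat
  have closed_B: "closed (B m)" for m
    unfolding B_def
    by (intro closed_INT ballI closed_Collect_le continuous_on_norm continuous_on_const)
       (auto dest!: lin intro: linear_continuous_on)
  have "\<exists>m. x \<in> B m" for x
  proof -
    obtain C where "\<forall>T\<in>F. norm (T x) \<le> C" using pt by blast
    moreover obtain m :: nat where "C \<le> real m" using real_arch_simple by blast
    ultimately show ?thesis unfolding B_def by (auto intro!: exI[of _ m] order_trans[of _ C "real m"])
  qed
  then have cover: "\<Union>(range B) = UNIV" by auto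
  have "\<exists>m. interior (B m) \<noteq> {}"
  proof (rule ccontr)
    assume "\<not> ?thesis"
    then have "interior (\<Union>(range B)) = {}"
      using Met_TC.metric_Baire_category_alt[of "range B"] closed_B
      by (auto simp: mcomplete_iff_complete complete_UNIV)
    then show False using cover by simp
  qed
  then obtain m x0 where "x0 \<in> interior (B m)" by blast
  then obtain r where r: "r > 0" "ball x0 r \<subseteq> B m" by (auto simp: mem_interior)
  have "norm (T x) \<le> (4 * real m / r) * norm x" if T: "T \<in> F" for T x
  proof (cases "x = 0")
    case True then show ?thesis using lin[OF T] by (simp add: linear_simps)
  next
    case False
    interpret bounded_linear T by (rule lin[OF T])
    define c where "c = r / (2 * norm x)"
    have c: "c > 0" using r False by (simp add: c_def)
    have "norm (c *\<^sub>R x) < r" using r False by (simp add: c_def)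
    then have "x0 + c *\<^sub>R x \<in> ball x0 r" "x0 \<in> ball x0 r" using r by (auto simp: dist_norm)
    then have "norm (T (x0 + c *\<^sub>R x)) \<le> m" "norm (T x0) \<le> m"
      using r(2) T unfolding B_def by blast+
    then have "norm (T (x0 + c *\<^sub>R x) - T x0) \<le> 2 * m" using norm_triangle_ineq4[of "T (x0 + c *\<^sub>R x)" "T x0"] by linarith
    then have "c * norm (T x) \<le> 2 * m" using c by (simp add: add scaleR)
    then have "norm (T x) \<le> 2 * m / c" using c by (simp add: field_simps)
    also have "\<dots> = (4 * real m / r) * norm x" using r False by (simp add: c_def field_simps)
    finally show ?thesis .
  qed
  moreover have "4 * real m / r \<ge> 0" using r by simp
  ultimately show ?thesis using that by blast
qed

text \<open>
  The test functions are not a Banach space, but multiplication by a cutoff that is 1 on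
  \<open>A\<close> extends each functional to a bounded linear map on the Banach space of
  bounded continuous functions, which does not change its values at test functions supported in
  \<open>A\<close>. There the Banach-Steinhaus theorem applies.
\<close>

lemma Radon_uniform_bound:
  fixes F :: "'n::finite radon set"
  assumes F: "F \<subseteq> Radon" and pt: "\<And>\<psi>. \<psi> \<in> Cc \<Longrightarrow> \<exists>C. \<forall>L\<in>F. norm (L \<psi>) \<le> C"
    and A: "compact A"
  obtains C where "C \<ge> 0"
    "\<And>L \<phi> s. L \<in> F \<Longrightarrow> \<phi> \<in> Cc \<Longrightarrow> (\<And>x. x \<notin> A \<Longrightarrow> \<phi> x = 0) \<Longrightarrow> (\<And>x. norm (\<phi> x) \<le> s)
      \<Longrightarrow> norm (L \<phi>) \<le> C * s"
proof -
  obtain \<theta> where \<theta>: "\<theta> \<in> Cc" "\<And>x. x \<in> A \<Longrightarrow> \<theta> x = (1::complex)" "\<And>x. norm (\<theta> x) \<le> 1"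
    using Cc_cutoff[OF A] by blast
  define T where "T L = (\<lambda>g :: (real^'n) \<Rightarrow>\<^sub>C complex. L (\<lambda>x. apply_bcontfun g x * \<theta> x))" for L :: "'n radon"
  have cc: "(\<lambda>x. apply_bcontfun g x * \<theta> x) \<in> Cc" for g
    by (rule Cc_mult(1)[OF \<theta>(1)]) simp
  have lin: "bounded_linear (T L)" if L: "L \<in> Radon" for L
  proof -
    obtain C where C: "C \<ge> 0" "\<And>\<phi> s. \<phi> \<in> Cc \<Longrightarrow> (\<And>x. x \<notin> supp \<theta> \<Longrightarrow> \<phi> x = 0) \<Longrightarrow>
        (\<And>x. norm (\<phi> x) \<le> s) \<Longrightarrow> norm (L \<phi>) \<le> C * s"
      using Radon_bound[OF L Cc_compact_supp[OF \<theta>(1)]] by blast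
    show ?thesis
    proof (rule bounded_linear_intro[where K=C])
      show "T L (g + h) = T L g + T L h" for g h
        using Radon_add[OF L cc cc, of g h] by (simp add: T_def algebra_simps)
      show "T L (r *\<^sub>R g) = r *\<^sub>R T L g" for r g
        using Radon_cmult[OF L cc, of "of_real r" g] by (simp add: T_def scaleR_conv_of_real mult.assoc)
      show "norm (T L g) \<le> norm g * C" for g
        unfolding T_def
        by (subst mult.commute, rule C(2)[OF cc])
           (use \<theta>(3) in \<open>auto simp: outside_supp norm_mult intro!: mult_left_le[THEN order_trans] norm_bounded\<close>)
    qed
  qed
  have "\<exists>C. \<forall>S\<in>T ` F. norm (S g) \<le> C" for g
    using pt[OF cc, of g] by (simp add: T_def)
  then obtain C where C: "C \<ge> 0" "\<And>S g. S \<in> T ` F \<Longrightarrow> norm (S g) \<le> C * norm g"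
    using banach_steinhaus[of "T ` F"] lin F by (metis (no_types, lifting) imageE subsetD)
  show ?thesis
  proof (rule that[OF C(1)])
    fix L \<phi> s assume L: "L \<in> F" and \<phi>: "\<phi> \<in> Cc" "\<And>x. x \<notin> A \<Longrightarrow> \<phi> x = 0" "\<And>x. norm (\<phi> x) \<le> s"
    define g where "g = Bcontfun \<phi>"
    have g: "apply_bcontfun g = \<phi>"
      unfolding g_def using Cc_continuous[OF \<phi>(1)] \<phi>(3) by (intro Bcontfun_inverse bcontfun_normI) auto
    have "\<phi> x * \<theta> x = \<phi> x" for x using \<theta>(2)[of x] \<phi>(2)[of x] by (cases "x \<in> A") auto
    then have "(\<lambda>x. \<phi> x * \<theta> x) = \<phi>" by blast
    then have "L \<phi> = T L g" by (simp add: T_def g)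
    moreover have "norm (T L g) \<le> C * norm g" using C(2) L by blast
    moreover have "norm g \<le> s" by (rule norm_bound) (simp add: g \<phi>)
    ultimately show "norm (L \<phi>) \<le> C * s" using C(1) by (metis mult_left_mono order_trans)
  qed
qed

text \<open>
  Pointwise convergence of functionals is uniformly bounded in norm, so the test function may
  converge at the same time.
\<close>

lemma Radon_tendsto:
  assumes L: "\<And>m. L m \<in> Radon" "L' \<in> Radon" and lim: "\<And>\<psi>. \<psi> \<in> Cc \<Longrightarrow> (\<lambda>m. L m \<psi>) \<longlonglongrightarrow> L' \<psi>"
    and A: "compact A" and \<psi>m: "\<And>m. \<psi>m m \<in> Cc" "\<And>m x. x \<notin> A \<Longrightarrow> \<psi>m m x = 0"
    and \<psi>: "\<psi> \<in> Cc" "\<And>x. x \<notin> A \<Longrightarrow> \<psi> x = 0" and unif: "uniform_limit UNIV \<psi>m \<psi> sequentially"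
  shows "(\<lambda>m. L m (\<psi>m m)) \<longlonglongrightarrow> L' \<psi>"
proof -
  have pt: "\<exists>C. \<forall>L\<in>range L. norm (L \<psi>) \<le> C" if "\<psi> \<in> Cc" for \<psi>
  proof -
    have "bounded (range (\<lambda>m. L m \<psi>))" using lim[OF that] by (intro convergent_imp_bounded)
    then show ?thesis by (auto simp: bounded_iff)
  qed
  obtain C where C: "C \<ge> 0" "\<And>K \<phi> s. K \<in> range L \<Longrightarrow> \<phi> \<in> Cc \<Longrightarrow> (\<And>x. x \<notin> A \<Longrightarrow> \<phi> x = 0)
      \<Longrightarrow> (\<And>x. norm (\<phi> x) \<le> s) \<Longrightarrow> norm (K \<phi>) \<le> C * s"
    using Radon_uniform_bound[of "range L" A] L pt A by (metis image_subsetI)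
  have "(\<lambda>m. L m (\<psi>m m) - L m \<psi>) \<longlonglongrightarrow> 0"
  proof (rule LIMSEQ_I)
    fix e :: real assume e: "e > 0"
    define s where "s = e / (2 * (C + 1))"
    have s: "s > 0" using e C by (simp add: s_def)
    obtain M where M: "\<And>m x. m \<ge> M \<Longrightarrow> dist (\<psi>m m x) (\<psi> x) < s"
      using uniform_limitD[OF unif s] by (auto simp: eventually_sequentially)
    have "norm (L m (\<psi>m m) - L m \<psi> - 0) < e" if "m \<ge> M" for m
    proof -
      have "norm (L m (\<lambda>x. \<psi>m m x - \<psi> x)) \<le> C * s"
        by (rule C(2)) (use M[OF that] in \<open>auto intro!: Cc_diff \<psi>m \<psi> less_imp_le simp: dist_norm \<psi>m \<psi>\<close>)
      also have "\<dots> \<le> (C + 1) * s" using s by (intro mult_right_mono) auto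
      also have "\<dots> = e / 2" using C(1) by (simp add: s_def field_simps)
      also have "\<dots> < e" using e by simp
      finally show ?thesis by (simp add: Radon_diff[OF L(1) \<psi>m(1) \<psi>(1)])
    qed
    then show "\<exists>M. \<forall>m\<ge>M. norm (L m (\<psi>m m) - L m \<psi> - 0) < e" by blast
  qed
  from tendsto_add[OF this lim[OF \<psi>(1)]] show ?thesis by simp
qed

section \<open>Pointwise convergence of convex functions\<close>

lemma Conv_continuous: "f \<in> Conv \<Longrightarrow> continuous_on UNIV f"
  by (simp add: Conv_def convex_on_continuous)

lemma Conv_translate:
  assumes "f \<in> Conv" shows "(\<lambda>y. f (y + x)) \<in> Conv"
  unfolding Conv_def convex_on_def mem_Collect_eq
proof (intro conjI ballI allI impI)
  fix y z :: "real^'a" and u v :: real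
  assume uv: "0 \<le> u" "0 \<le> v" "u + v = 1"
  have "u *\<^sub>R y + v *\<^sub>R z + x = u *\<^sub>R (y + x) + v *\<^sub>R (z + x)"
    using uv by (simp add: algebra_simps flip: scaleR_left_distrib)
  then show "f (u *\<^sub>R y + v *\<^sub>R z + x) \<le> u * f (y + x) + v * f (z + x)"
    using assms uv unfolding Conv_def convex_on_def by auto
qed simp

lemma Conv_translate_iff: "(\<lambda>y. f (y + x)) \<in> Conv \<longleftrightarrow> f \<in> Conv"
  using Conv_translate[of f x] Conv_translate[of "\<lambda>y. f (y + x)" "- x"] by auto

lemma Conv_add_affine:
  assumes "f \<in> Conv" shows "f + (\<lambda>x. v \<bullet> x + c) \<in> Conv"
  unfolding Conv_def convex_on_def mem_Collect_eq
proof (intro conjI ballI allI impI)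
  fix y z :: "real^'a" and r s :: real
  assume rs: "0 \<le> r" "0 \<le> s" "r + s = 1"
  have "r * c + s * c = c" using rs by (simp flip: distrib_right)
  moreover have "f (r *\<^sub>R y + s *\<^sub>R z) \<le> r * f y + s * f z"
    using assms rs unfolding Conv_def convex_on_def by auto
  ultimately show "(f + (\<lambda>x. v \<bullet> x + c)) (r *\<^sub>R y + s *\<^sub>R z)
      \<le> r * (f + (\<lambda>x. v \<bullet> x + c)) y + s * (f + (\<lambda>x. v \<bullet> x + c)) z"
    by (simp add: inner_add_right algebra_simps)
qed simp

text \<open>
  On a small cube a convex function is bounded above by its values at the vertices, and by
  reflection also below. So a countable set containing the vertices of arbitrarily small cubes
  around all points controls convergence everywhere.
\<close>

lemma countable_set_with_small_hulls:
  obtains D :: "(real^'n::finite) set" where "countable D"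
    "\<And>x r. r > 0 \<Longrightarrow> \<exists>S\<subseteq>D. finite S \<and> x \<in> interior (convex hull S) \<and> convex hull S \<subseteq> ball x r"
proof -
  obtain Q :: "(real^'n) set" where Q: "countable Q" "\<And>X. open X \<Longrightarrow> X \<noteq> {} \<Longrightarrow> \<exists>q\<in>Q. q \<in> X"
    using countable_dense_exists by metis
  let ?e = "\<lambda>k. \<Sum>i\<in>Basis. (inverse (real (Suc k))) *\<^sub>R i :: real^'n"
  have "\<exists>S. finite S \<and> cbox (q - ?e k) (q + ?e k) = convex hull S" for q k
    using cube_convex_hull[of "inverse (real (Suc k))" q] by (metis inverse_positive_iff_positive of_nat_0_less_iff zero_less_Suc)
  then obtain S where S: "\<And>q k. finite (S q k)" "\<And>q k. cbox (q - ?e k) (q + ?e k) = convex hull (S q k)"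
    by metis
  define D where "D = (\<Union>q\<in>Q. \<Union>k. S q k)"
  show ?thesis
  proof (rule that[of D])
    show "countable D" unfolding D_def by (intro countable_UN Q(1) countable_finite S(1) countableI_type)
    fix x :: "real^'n" and r :: real assume r: "r > 0"
    define c where "c = real CARD('n)"
    have c: "c \<ge> 1" unfolding c_def using card_ge_0_finite[of "UNIV :: 'n set"]
      by (simp add: Suc_leI)
    obtain k where k: "inverse (real (Suc k)) < r / (2 * c)"
      using reals_Archimedean[of "r / (2 * c)"] r c by auto
    let ?d = "inverse (real (Suc k))"
    have inn: "?e k \<bullet> i = ?d" if "i \<in> Basis" for i using that by (simp add: inner_sum_left_Basis)
    obtain q where q: "q \<in> Q" "q \<in> ball x ?d" using Q(2)[of "ball x ?d"] by auto
    have comp: "\<bar>(q - x) \<bullet> i\<bar> < ?d" if "i \<in> Basis" for i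
      using Basis_le_norm[OF that, of "q - x"] q(2) by (simp add: dist_norm norm_minus_commute)
    have "x \<in> box (q - ?e k) (q + ?e k)"
      unfolding mem_box
    proof
      fix i :: "real^'n" assume i: "i \<in> Basis"
      show "(q - ?e k) \<bullet> i < x \<bullet> i \<and> x \<bullet> i < (q + ?e k) \<bullet> i"
        unfolding inner_diff_left inner_add_left inn[OF i]
        using comp[OF i] unfolding inner_diff_left by linarith
    qed
    then have 1: "x \<in> interior (convex hull (S q k))"
      unfolding S(2)[symmetric] by (simp add: interior_cbox)
    have "dist x y < r" if "y \<in> cbox (q - ?e k) (q + ?e k)" for y
    proof -
      have "\<bar>(y - x) \<bullet> i\<bar> \<le> 2 * ?d" if i: "i \<in> Basis" for i
      proof -
        have "(q - ?e k) \<bullet> i \<le> y \<bullet> i \<and> y \<bullet> i \<le> (q + ?e k) \<bullet> i"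
          using \<open>y \<in> _\<close> i unfolding mem_box by blast
        then show ?thesis unfolding inner_diff_left inner_add_left inn[OF i]
          using comp[OF i] unfolding inner_diff_left by linarith
      qed
      then have "norm (y - x) \<le> (\<Sum>i\<in>(Basis :: (real^'n) set). 2 * ?d)"
        by (intro order_trans[OF norm_le_l1 sum_mono])
      also have "\<dots> = 2 * c * ?d" by (simp add: c_def)
      also have "\<dots> < r" using k c by (simp add: field_simps)
      finally show ?thesis by (simp add: dist_norm norm_minus_commute)
    qed
    then have 2: "convex hull (S q k) \<subseteq> ball x r" unfolding S(2)[symmetric] by auto
    show "\<exists>S\<subseteq>D. finite S \<and> x \<in> interior (convex hull S) \<and> convex hull S \<subseteq> ball x r"
      by (rule exI[of _ "S q k"]) (use 1 2 S(1) q(1) in \<open>auto simp: D_def\<close>)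
  qed
qed

text \<open>
  One such countable set, fixed so that hypotheses on sequences of convex functions can refer to
  it.
\<close>

definition convergence_set :: "(real^'n::finite) set" where
  "convergence_set = (SOME D. countable D \<and> (\<forall>x r. r > 0 \<longrightarrow>
     (\<exists>S\<subseteq>D. finite S \<and> x \<in> interior (convex hull S) \<and> convex hull S \<subseteq> ball x r)))"

lemma countable_convergence_set: "countable (convergence_set :: (real^'n::finite) set)"
  and convergence_set_hull: "r > 0 \<Longrightarrow> \<exists>S\<subseteq>convergence_set. finite S \<and>
     (x :: real^'n) \<in> interior (convex hull S) \<and> convex hull S \<subseteq> ball x r"
proof -
  have *: "\<exists>D :: (real^'n) set. countable D \<and> (\<forall>x r. r > 0 \<longrightarrow>
     (\<exists>S\<subseteq>D. finite S \<and> x \<in> interior (convex hull S) \<and> convex hull S \<subseteq> ball x r))"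
    using countable_set_with_small_hulls by metis
  from someI_ex[OF *] show "countable (convergence_set :: (real^'n::finite) set)"
    and "r > 0 \<Longrightarrow> \<exists>S\<subseteq>convergence_set. finite S \<and>
     (x :: real^'n) \<in> interior (convex hull S) \<and> convex hull S \<subseteq> ball x r"
    unfolding convergence_set_def[symmetric] by blast+
qed

text \<open>
  Upper bounds near \<open>a\<close> come from the vertices of a small hull containing
  \<open>a\<close> in its interior. For the lower bound at \<open>x m\<close>, this point is
  reflected in a nearby point \<open>q\<close> of the countable set: the value at the reflected
  point is bounded above, the value at \<open>q\<close> is known, and \<open>q\<close> is the
  midpoint.
\<close>

lemma convex_tendsto:
  fixes f :: "nat \<Rightarrow> real^'n::finite \<Rightarrow> real"
  assumes f: "\<And>m. f m \<in> Conv" and g: "g \<in> Conv"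
    and lim: "\<And>q. q \<in> convergence_set \<Longrightarrow> (\<lambda>m. f m q) \<longlonglongrightarrow> g q"
    and x: "x \<longlonglongrightarrow> a"
  shows "(\<lambda>m. f m (x m)) \<longlonglongrightarrow> g a"
proof (rule LIMSEQ_I)
  fix e' :: real assume "e' > 0"
  \<comment> \<open>The upper bound loses \<open>2 * e\<close> and the lower bound, through the
      midpoint, \<open>6 * e\<close>.\<close>
  define e where "e = e' / 8"
  have e: "e > 0" using \<open>e' > 0\<close> by (simp add: e_def)
  obtain r where r: "r > 0" "\<And>y. dist y a < r \<Longrightarrow> dist (g y) (g a) < e"
    using Conv_continuous[OF g] e unfolding continuous_on_iff by (metis UNIV_I)
  obtain S where S: "S \<subseteq> convergence_set" "finite S" "a \<in> interior (convex hull S)" "convex hull S \<subseteq> ball a r"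
    using convergence_set_hull[OF r(1)] by metis
  obtain s where s: "s > 0" "ball a s \<subseteq> convex hull S" using S(3) by (auto simp: mem_interior)
  obtain q where q: "q \<in> convergence_set" "dist a q < min (s / 4) r"
  proof -
    obtain S' where S': "S' \<subseteq> convergence_set" "a \<in> interior (convex hull S')" "convex hull S' \<subseteq> ball a (min (s / 4) r)"
      using convergence_set_hull[of "min (s / 4) r" a] s r by auto
    then have "S' \<noteq> {}" by auto
    then obtain q where "q \<in> S'" by blast
    then have "q \<in> ball a (min (s / 4) r)" using S'(3) hull_subset[of S' convex] by blast
    then show ?thesis using that[of q] S'(1) \<open>q \<in> S'\<close> by auto
  qed
  have "\<forall>\<^sub>F m in sequentially. \<forall>c\<in>insert q S. dist (f m c) (g c) < e"
    using S(1,2) q(1) lim e by (intro eventually_ball_finite) (auto intro!: tendstoD)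
  moreover have "\<forall>\<^sub>F m in sequentially. dist (x m) a < s / 4"
    using x s(1) by (intro tendstoD) auto
  ultimately have "\<forall>\<^sub>F m in sequentially. norm (f m (x m) - g a) < e'"
  proof eventually_elim
    case (elim m)
    have cv: "convex_on UNIV (f m)" using f by (simp add: Conv_def)
    have gS: "g c < g a + e" if "c \<in> S" for c
    proof -
      have "c \<in> ball a r" using that S(4) hull_subset[of S convex] by blast
      then show ?thesis using r(2)[of c] by (auto simp: dist_commute dist_real_def)
    qed
    have up: "f m y \<le> g a + 2 * e" if "dist a y < s" for y
    proof -
      have "\<forall>y\<in>convex hull S. f m y \<le> g a + 2 * e"
      proof (rule convex_on_convex_hull_bound)
        show "convex_on (convex hull S) (f m)" by (rule convex_on_subset[OF cv]) (auto simp: convex_convex_hull)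
        show "\<forall>x\<in>S. f m x \<le> g a + 2 * e"
        proof
          fix c assume c: "c \<in> S"
          have "dist (f m c) (g c) < e" using elim(1) c by auto
          then show "f m c \<le> g a + 2 * e" using gS[OF c] by (auto simp: dist_real_def)
        qed
      qed
      then show ?thesis using s(2) that by auto
    qed
    have "dist a (2 *\<^sub>R q - x m) < s"
    proof -
      have eq: "a - (2 *\<^sub>R q - x m) = 2 *\<^sub>R (a - q) + (x m - a)" by (simp add: scaleR_2)
      have "norm (2 *\<^sub>R (a - q) + (x m - a)) \<le> norm (2 *\<^sub>R (a - q)) + norm (x m - a)"
        by (rule norm_triangle_ineq)
      then have "norm (a - (2 *\<^sub>R q - x m)) \<le> 2 * norm (a - q) + norm (x m - a)"
        unfolding eq by simp
      then show ?thesis using q(2) elim(2) s(1) by (simp add: dist_norm)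
    qed
    then have 1: "f m (2 *\<^sub>R q - x m) \<le> g a + 2 * e" by (rule up)
    have 2: "f m (x m) \<le> g a + 2 * e" using elim(2) s(1) by (intro up) (simp add: dist_commute)
    have 3: "g q > g a - e" using r(2)[of q] q(2) by (auto simp: dist_commute dist_real_def)
    have 4: "f m q > g q - e" using elim(1) by (auto simp: dist_real_def)
    have "f m ((1/2) *\<^sub>R x m + (1/2) *\<^sub>R (2 *\<^sub>R q - x m)) \<le> (1/2) * f m (x m) + (1/2) * f m (2 *\<^sub>R q - x m)"
      using convex_onD[OF cv, of "1/2" "x m" "2 *\<^sub>R q - x m"] by simp
    moreover have "(1/2) *\<^sub>R x m + (1/2) *\<^sub>R (2 *\<^sub>R q - x m) = q" by (simp add: algebra_simps)
    ultimately have 5: "f m q \<le> (1/2) * f m (x m) + (1/2) * f m (2 *\<^sub>R q - x m)" by simp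
    have "\<bar>f m (x m) - g a\<bar> < e'" using 1 2 3 4 5 e unfolding e_def by (simp add: abs_less_iff; linarith)
    then show ?case by simp
  qed
  then show "\<exists>no. \<forall>n\<ge>no. norm (f n (x n) - g a) < e'" by (simp add: eventually_sequentially)
qed

lemma convex_pointwise_tendsto:
  fixes f :: "nat \<Rightarrow> real^'n::finite \<Rightarrow> real"
  assumes "\<And>m. f m \<in> Conv" "g \<in> Conv" "\<And>q. q \<in> convergence_set \<Longrightarrow> (\<lambda>m. f m q) \<longlonglongrightarrow> g q"
  shows "f \<longlonglongrightarrow> g"
proof -
  have "limitin (product_topology (\<lambda>i. euclidean) UNIV) f g sequentially"
    unfolding limitin_componentwise using convex_tendsto[OF assms tendsto_const] by simp
  then show ?thesis by (simp add: euclidean_product_topology)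
qed

lemma tendsto_function_iff:
  fixes f :: "'c \<Rightarrow> 'a \<Rightarrow> 'b::topological_space"
  shows "(f \<longlongrightarrow> g) F \<longleftrightarrow> (\<forall>x. ((\<lambda>m. f m x) \<longlongrightarrow> g x) F)"
proof -
  have "(f \<longlongrightarrow> g) F \<longleftrightarrow> limitin (product_topology (\<lambda>i. euclidean) UNIV) f g F"
    by (simp add: euclidean_product_topology)
  then show ?thesis unfolding limitin_componentwise by simp
qed

text \<open>
  The topology of pointwise convergence on all functions is not first countable. On convex
  functions countably many evaluations determine convergence, so a failure of continuity is
  witnessed by a sequence.
\<close>

lemma Conv_continuous_on_sequentially:
  fixes F :: "(real^'n::finite \<Rightarrow> real) \<Rightarrow> 'b::metric_space"
  assumes seq: "\<And>f g. (\<And>m. f m \<in> Conv) \<Longrightarrow> g \<in> Conv \<Longrightarrow> f \<longlonglongrightarrow> g \<Longrightarrow> (\<lambda>m. F (f m)) \<longlonglongrightarrow> F g"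
  shows "continuous_on Conv F"
proof (rule ccontr)
  assume "\<not> continuous_on Conv F"
  then obtain g where g: "g \<in> Conv" "\<not> (F \<longlongrightarrow> F g) (at g within Conv)"
    by (auto simp: continuous_on_def)
  then obtain e where e: "e > 0" "\<not> (\<forall>\<^sub>F f in at g within Conv. dist (F f) (F g) < e)"
    by (auto simp: tendsto_iff)
  define q where "q = from_nat_into (convergence_set :: (real^'n) set)"
  have ne: "(convergence_set :: (real^'n) set) \<noteq> {}"
    using convergence_set_hull[of 1 "0 :: real^'n"] by auto
  have range_q: "range q = convergence_set"
    unfolding q_def by (rule range_from_nat_into[OF ne countable_convergence_set])
  \<comment> \<open>The functions close to \<open>g\<close> at the first points of the countable set
      form a neighbourhood of \<open>g\<close>, so it contains a function where
      \<open>F\<close> is far from \<open>F g\<close>.\<close>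
  have "\<exists>f\<in>Conv. (\<forall>i\<le>m. dist (f (q i)) (g (q i)) < 1 / real (Suc m)) \<and> \<not> dist (F f) (F g) < e" for m
  proof (rule ccontr)
    assume neg: "\<not> ?thesis"
    have "\<forall>\<^sub>F f in at g within Conv. dist (f (q i)) (g (q i)) < 1 / real (Suc m)" for i
    proof -
      have "((\<lambda>f. f (q i)) \<longlongrightarrow> g (q i)) (at g within Conv)"
        using continuous_on_product_coordinates[of "q i"] continuous_on_subset[of UNIV _ Conv] g(1)
        unfolding continuous_on_def by blast
      then show ?thesis by (rule tendstoD) simp
    qed
    then have "\<forall>\<^sub>F f in at g within Conv. \<forall>i\<in>{..m}. dist (f (q i)) (g (q i)) < 1 / real (Suc m)"
      by (intro eventually_ball_finite) auto
    moreover have "\<forall>\<^sub>F f in at g within Conv. f \<in> Conv"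
      by (simp add: eventually_at_filter)
    ultimately have "\<forall>\<^sub>F f in at g within Conv. dist (F f) (F g) < e"
      by eventually_elim (use neg in auto)
    with e(2) show False by blast
  qed
  then have "\<forall>m. \<exists>f. f \<in> Conv \<and> (\<forall>i\<le>m. dist (f (q i)) (g (q i)) < 1 / real (Suc m)) \<and> \<not> dist (F f) (F g) < e"
    unfolding Bex_def by (rule allI)
  from choice[OF this] obtain f where f': "\<forall>m. f m \<in> Conv \<and>
      (\<forall>i\<le>m. dist (f m (q i)) (g (q i)) < 1 / real (Suc m)) \<and> \<not> dist (F (f m)) (F g) < e"
    by (rule exE)
  have f: "\<And>m. f m \<in> Conv"
    "\<And>m i. i \<le> m \<Longrightarrow> dist (f m (q i)) (g (q i)) < 1 / real (Suc m)" "\<And>m. \<not> dist (F (f m)) (F g) < e"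
    using f' by simp_all
  have "(\<lambda>m. f m x) \<longlonglongrightarrow> g x" if "x \<in> convergence_set" for x
  proof -
    from that have "x \<in> range q" unfolding range_q .
    then obtain i where i: "x = q i" by (rule rangeE)
    have "norm (f m x - g x) \<le> 1 / real (Suc m)" if "i \<le> m" for m
      using f(2)[OF that] unfolding i dist_norm by (rule less_imp_le)
    then have "\<forall>\<^sub>F m in sequentially. norm (f m x - g x) \<le> 1 / real (Suc m)"
      unfolding eventually_sequentially by blast
    moreover have "(\<lambda>m. 1 / real (Suc m)) \<longlonglongrightarrow> 0" by (rule LIMSEQ_Suc[OF lim_1_over_n])
    ultimately have "(\<lambda>m. f m x - g x) \<longlonglongrightarrow> 0"
      by (rule Lim_null_comparison)
    then show ?thesis by (rule LIM_zero_cancel)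
  qed
  then have "f \<longlonglongrightarrow> g" by (intro convex_pointwise_tendsto f(1) g(1))
  then have "(\<lambda>m. F (f m)) \<longlonglongrightarrow> F g" by (rule seq[OF f(1) g(1)])
  then have "\<forall>\<^sub>F m in sequentially. dist (F (f m)) (F g) < e" using e(1) by (rule tendstoD)
  from eventually_happens'[OF sequentially_bot this] obtain m where "dist (F (f m)) (F g) < e" by (rule exE)
  with f(3)[of m] show False by (rule notE)
qed

lemma Conv_translate_tendsto:
  assumes "\<And>m. f m \<in> Conv" "g \<in> Conv" "f \<longlonglongrightarrow> g" "x \<longlonglongrightarrow> a"
  shows "(\<lambda>m y. f m (y + x m)) \<longlonglongrightarrow> (\<lambda>y. g (y + a))"
  unfolding tendsto_function_iff
proof
  fix y
  show "(\<lambda>m. f m (y + x m)) \<longlonglongrightarrow> g (y + a)"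
  proof (rule convex_tendsto[OF assms(1,2)])
    show "(\<lambda>m. f m q) \<longlonglongrightarrow> g q" for q
      using assms(3) unfolding tendsto_function_iff by (rule spec)
    show "(\<lambda>m. y + x m) \<longlonglongrightarrow> y + a"
      by (intro tendsto_add tendsto_const assms(4))
  qed
qed

lemma compact_translates:
  assumes "f \<in> Conv" "compact X"
  shows "compact ((\<lambda>x y. f (y + x)) ` X)"
proof (rule compact_continuous_image[OF _ assms(2)])
  show "continuous_on X (\<lambda>x y. f (y + x))"
    by (intro continuous_on_coordinatewise_then_product continuous_on_compose2[OF Conv_continuous[OF assms(1)]])
       (auto intro!: continuous_intros)
qed

section \<open>Interpolation and polynomials on affine functions\<close>

text \<open>
  Coefficients of an expansion in the functions \<open>g l\<close> can be read off from finitely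
  many values, also when the \<open>g l\<close> are linearly dependent: the span has nodes
  \<open>p m\<close> with dual functions in the span. By induction on \<open>J\<close>: if the
  functions for \<open>J\<close> do not already interpolate \<open>g i\<close>, the error
  \<open>h\<close> is nonzero at some point \<open>q\<close>, which becomes a new node with dual
  function \<open>h / h q\<close>, and the old dual functions are corrected so that they vanish
  there.
\<close>

lemma interpolation_nodes:
  fixes g :: "'j \<Rightarrow> 'x \<Rightarrow> complex"
  assumes "finite J"
  shows "\<exists>(k::nat) p e. \<forall>j\<in>J. \<forall>x. g j x = (\<Sum>m<k. g j (p m) * (\<Sum>l\<in>J. e m l * g l x))"
  using assms
proof (induction J)
  case empty then show ?case by simp
next
  case (insert i J)
  from insert.IH obtain k :: nat and p e where e: "\<forall>j\<in>J. \<forall>x. g j x = (\<Sum>m<k. g j (p m) * (\<Sum>l\<in>J. e m l * g l x))"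
    by blast
  define E where "E m x = (\<Sum>l\<in>J. e m l * g l x)" for m x
  define h where "h x = g i x - (\<Sum>m<k. g i (p m) * E m x)" for x
  have eJ: "g j x = (\<Sum>m<k. g j (p m) * E m x)" if "j \<in> J" for j x
    unfolding E_def using e that by blast
  show ?case
  proof (cases "\<exists>q. h q \<noteq> 0")
    case False
    define e' where "e' m l = (if l = i then 0 else e m l)" for m l
    have "(\<Sum>l\<in>insert i J. e' m l * g l x) = E m x" for m x
    proof -
      have "(\<Sum>l\<in>J. e' m l * g l x) = (\<Sum>l\<in>J. e m l * g l x)"
        by (rule sum.cong) (use insert.hyps in \<open>auto simp: e'_def\<close>)
      then show ?thesis using insert.hyps by (simp add: e'_def E_def)
    qed
    moreover have "g j x = (\<Sum>m<k. g j (p m) * E m x)" if "j \<in> insert i J" for j x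
      using that eJ False by (auto simp: h_def)
    ultimately have "\<forall>j\<in>insert i J. \<forall>x. g j x = (\<Sum>m<k. g j (p m) * (\<Sum>l\<in>insert i J. e' m l * g l x))"
      by (simp only:) blast
    then show ?thesis by blast
  next
    case True
    then obtain q where q: "h q \<noteq> 0" by blast
    define c where "c l = (if l = i then 1 else - (\<Sum>m<k. g i (p m) * e m l))" for l
    have hc: "h x = (\<Sum>l\<in>insert i J. c l * g l x)" for x
    proof -
      have "(\<Sum>l\<in>J. c l * g l x) = (\<Sum>l\<in>J. - (\<Sum>m<k. g i (p m) * e m l) * g l x)"
        by (rule sum.cong) (use insert.hyps in \<open>auto simp: c_def\<close>)
      also have "\<dots> = - (\<Sum>l\<in>J. \<Sum>m<k. g i (p m) * (e m l * g l x))"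
        by (simp add: sum_negf sum_distrib_right mult.assoc)
      also have "(\<Sum>l\<in>J. \<Sum>m<k. g i (p m) * (e m l * g l x)) = (\<Sum>m<k. \<Sum>l\<in>J. g i (p m) * (e m l * g l x))"
        by (rule sum.swap)
      also have "\<dots> = (\<Sum>m<k. g i (p m) * E m x)" by (simp add: E_def sum_distrib_left)
      finally show ?thesis using insert.hyps by (simp add: h_def c_def)
    qed
    define p' where "p' m = (if m < k then p m else q)" for m
    define e' where "e' m l = (if m < k then (if l = i then 0 else e m l) - E m q / h q * c l else c l / h q)" for m l
    have e'1: "(\<Sum>l\<in>insert i J. e' m l * g l x) = E m x - E m q / h q * h x" if m: "m < k" for m x
    proof -
      have "(\<Sum>l\<in>insert i J. e' m l * g l x) = (\<Sum>l\<in>insert i J. (if l = i then 0 else e m l) * g l x) - (\<Sum>l\<in>insert i J. E m q / h q * (c l * g l x))"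
        using m by (simp add: e'_def sum_subtractf[symmetric] algebra_simps)
      also have "(\<Sum>l\<in>insert i J. (if l = i then 0 else e m l) * g l x) = E m x"
      proof -
        have "(\<Sum>l\<in>J. (if l = i then 0 else e m l) * g l x) = E m x"
          unfolding E_def by (rule sum.cong) (use insert.hyps in auto)
        then show ?thesis using insert.hyps by simp
      qed
      finally show ?thesis by (simp add: hc sum_distrib_left)
    qed
    have e'2: "(\<Sum>l\<in>insert i J. e' k l * g l x) = h x / h q" for x
      unfolding hc[of x] by (simp add: e'_def sum_divide_distrib del: sum.insert)
    have "g j x = (\<Sum>m<Suc k. g j (p' m) * (\<Sum>l\<in>insert i J. e' m l * g l x))" if j: "j \<in> insert i J" for j x
    proof -
      define R where "R x = g j x - (\<Sum>m<k. g j (p m) * E m x)" for x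
      have R: "R x * h q = R q * h x"
        using j eJ by (auto simp: R_def h_def)
      have "(\<Sum>m<Suc k. g j (p' m) * (\<Sum>l\<in>insert i J. e' m l * g l x))
          = (\<Sum>m<k. g j (p m) * (E m x - E m q / h q * h x)) + g j q * (h x / h q)"
        by (simp add: e'1 e'2 p'_def del: sum.insert)
      also have "(\<Sum>m<k. g j (p m) * (E m x - E m q / h q * h x)) =
          (\<Sum>m<k. g j (p m) * E m x) - (\<Sum>m<k. g j (p m) * E m q) * (h x / h q)"
        unfolding sum_distrib_right sum_subtractf[symmetric]
        by (intro sum.cong refl) (simp add: algebra_simps)
      also have "\<dots> + g j q * (h x / h q) = g j x - R x + R q * (h x / h q)"
        by (simp add: R_def algebra_simps)
      also have "\<dots> = g j x" using R q by (simp add: field_simps)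
      finally show ?thesis by simp
    qed
    then have "\<forall>j\<in>insert i J. \<forall>x. g j x = (\<Sum>m<Suc k. g j (p' m) * (\<Sum>l\<in>insert i J. e' m l * g l x))"
      by blast
    then show ?thesis by blast
  qed
qed

text \<open>
  The coordinates of the affine function \<open>y \<mapsto> v \<bullet> y + c\<close> are
  \<open>(v, c)\<close>; the exponents of \<open>v\<close> come first.
\<close>

definition poly_index :: "nat \<Rightarrow> (('n::finite \<Rightarrow> nat) \<times> nat) set" where
  "poly_index d = {(\<alpha>, k). (\<Sum>i\<in>UNIV. \<alpha> i) + k \<le> d}"

definition monomial :: "('n::finite \<Rightarrow> nat) \<times> nat \<Rightarrow> (real^'n) \<times> real \<Rightarrow> complex" where
  "monomial p = (\<lambda>(v, c). of_real ((\<Prod>i\<in>UNIV. (v $ i) ^ fst p i) * c ^ snd p))"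

definition polynomial_fun :: "nat \<Rightarrow> ((real^'n::finite) \<times> real \<Rightarrow> complex) \<Rightarrow> bool" where
  "polynomial_fun d q \<longleftrightarrow> (\<exists>w. \<forall>z. q z = (\<Sum>p\<in>poly_index d. monomial p z * w p))"

lemma finite_poly_index: "finite (poly_index d :: (('n::finite \<Rightarrow> nat) \<times> nat) set)"
proof (rule finite_subset)
  show "(poly_index d :: (('n \<Rightarrow> nat) \<times> nat) set) \<subseteq> (Pi\<^sub>E UNIV (\<lambda>_. {..d})) \<times> {..d}"
  proof
    fix p :: "('n \<Rightarrow> nat) \<times> nat" assume "p \<in> poly_index d"
    then have *: "(\<Sum>i\<in>UNIV. fst p i) + snd p \<le> d" by (auto simp: poly_index_def)
    have "fst p i \<le> d" for i
      using member_le_sum[of i UNIV "fst p"] * by simp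
    then show "p \<in> (Pi\<^sub>E UNIV (\<lambda>_. {..d})) \<times> {..d}" using * by (cases p) auto
  qed
  show "finite ((Pi\<^sub>E UNIV (\<lambda>_. {..d}) :: ('n \<Rightarrow> nat) set) \<times> {..d})" by (intro finite_cartesian_product finite_PiE) auto
qed

lemma polynomial_fun_monomial:
  assumes "p \<in> poly_index d" shows "polynomial_fun d (monomial p)"
  unfolding polynomial_fun_def
  by (rule exI[of _ "\<lambda>r. if r = p then 1 else 0"]) (use assms in \<open>simp add: finite_poly_index if_distrib cong: if_cong\<close>)

lemma polynomial_fun_sum:
  assumes "\<And>i. i \<in> I \<Longrightarrow> polynomial_fun d (q i)"
  shows "polynomial_fun d (\<lambda>z. \<Sum>i\<in>I. q i z * c i)"
proof -
  have "\<forall>i. \<exists>w. i \<in> I \<longrightarrow> (\<forall>z. q i z = (\<Sum>p\<in>poly_index d. monomial p z * w p))"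
    using assms unfolding polynomial_fun_def by blast
  from choice[OF this] obtain w where w: "\<forall>i. i \<in> I \<longrightarrow> (\<forall>z. q i z = (\<Sum>p\<in>poly_index d. monomial p z * w i p))"
    by (rule exE)
  have "(\<Sum>i\<in>I. q i z * c i) = (\<Sum>p\<in>poly_index d. monomial p z * (\<Sum>i\<in>I. w i p * c i))" for z
  proof -
    have "(\<Sum>i\<in>I. q i z * c i) = (\<Sum>i\<in>I. \<Sum>p\<in>poly_index d. monomial p z * (w i p * c i))"
      by (intro sum.cong refl) (simp add: w sum_distrib_right mult.assoc)
    also have "\<dots> = (\<Sum>p\<in>poly_index d. \<Sum>i\<in>I. monomial p z * (w i p * c i))" by (rule sum.swap)
    finally show ?thesis by (simp add: sum_distrib_left)
  qed
  then show ?thesis unfolding polynomial_fun_def by (intro exI allI)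
qed

lemma polynomial_fun_add:
  assumes "polynomial_fun d q" "polynomial_fun d r" shows "polynomial_fun d (\<lambda>z. q z + r z)"
  using polynomial_fun_sum[of "{True, False}" d "\<lambda>b. if b then q else r" "\<lambda>_. 1"] assms by simp

text \<open>
  For operations \<open>T\<close> on functions that are linear in the polynomial, such as
  multiplication by a coordinate or a linear substitution.
\<close>

lemma polynomial_fun_induct:
  assumes q: "polynomial_fun d q"
    and m: "\<And>p. p \<in> poly_index d \<Longrightarrow> polynomial_fun d' (\<lambda>z. T (monomial p) z)"
    and lin: "\<And>w z. T (\<lambda>z. \<Sum>p\<in>poly_index d. monomial p z * w p) z = (\<Sum>p\<in>poly_index d. T (monomial p) z * w p)"
  shows "polynomial_fun d' (\<lambda>z. T q z)"
proof -
  obtain w where "\<forall>z. q z = (\<Sum>p\<in>poly_index d. monomial p z * w p)"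
    using q unfolding polynomial_fun_def by (rule exE)
  then have "q = (\<lambda>z. \<Sum>p\<in>poly_index d. monomial p z * w p)" by blast
  then show ?thesis using polynomial_fun_sum[of "poly_index d" d' "\<lambda>p z. T (monomial p) z" w, OF m] by (simp only: lin)
qed

lemma polynomial_fun_mult_var:
  fixes q :: "(real^'n::finite) \<times> real \<Rightarrow> complex"
  assumes q: "polynomial_fun d q"
  shows "polynomial_fun (Suc d) (\<lambda>z. of_real (fst z $ i) * q z)"
    and "polynomial_fun (Suc d) (\<lambda>z. of_real (snd z) * q z)"
proof -
  have 1: "polynomial_fun (Suc d) (\<lambda>z. of_real (fst z $ i) * monomial p z)"
    if p: "p \<in> poly_index d" for p :: "('n \<Rightarrow> nat) \<times> nat"
  proof -
    let ?p = "((fst p)(i := Suc (fst p i)), snd p)"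
    have "(\<Sum>j\<in>UNIV. fst ?p j) = Suc (\<Sum>j\<in>UNIV. fst p j)"
      by (simp add: sum.remove[of UNIV i])
    then have "?p \<in> poly_index (Suc d)" using p by (auto simp: poly_index_def)
    moreover have "monomial ?p = (\<lambda>z. of_real (fst z $ i) * monomial p z)"
      by (rule ext) (simp add: monomial_def split_beta prod.remove[of UNIV i] mult_ac)
    ultimately show ?thesis using polynomial_fun_monomial by metis
  qed
  show "polynomial_fun (Suc d) (\<lambda>z. of_real (fst z $ i) * q z)"
    by (rule polynomial_fun_induct[OF q, of "Suc d" "\<lambda>q z. of_real (fst z $ i) * q z"])
       (simp_all add: 1 sum_distrib_left mult.assoc)
  have 2: "polynomial_fun (Suc d) (\<lambda>z. of_real (snd z) * monomial p z)"
    if p: "p \<in> poly_index d" for p :: "('n \<Rightarrow> nat) \<times> nat"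
  proof -
    let ?p = "(fst p, Suc (snd p))"
    have "?p \<in> poly_index (Suc d)" using p by (auto simp: poly_index_def)
    moreover have "monomial ?p = (\<lambda>z. of_real (snd z) * monomial p z)"
      by (rule ext) (simp add: monomial_def split_beta mult_ac)
    ultimately show ?thesis using polynomial_fun_monomial by metis
  qed
  show "polynomial_fun (Suc d) (\<lambda>z. of_real (snd z) * q z)"
    by (rule polynomial_fun_induct[OF q, of "Suc d" "\<lambda>q z. of_real (snd z) * q z"])
       (simp_all add: 2 sum_distrib_left mult.assoc)
qed

lemma polynomial_fun_mono:
  assumes q: "polynomial_fun d q" and "d \<le> d'" shows "polynomial_fun d' q"
  by (rule polynomial_fun_induct[OF q, of d' "\<lambda>q. q"])
     (use assms(2) in \<open>auto intro!: polynomial_fun_monomial simp: poly_index_def\<close>)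

text \<open>
  The substitution is what translation by \<open>x\<close> does to an affine function:
  \<open>v \<bullet> (y + x) + c\<close> has the constant term \<open>c + v \<bullet> x\<close>.
\<close>

lemma polynomial_fun_affine:
  fixes q :: "(real^'n::finite) \<times> real \<Rightarrow> complex"
  assumes q: "polynomial_fun d q"
  shows "polynomial_fun d (\<lambda>z. q (fst z, snd z + fst z \<bullet> x))"
proof (rule polynomial_fun_induct[OF q, of d "\<lambda>q z. q (fst z, snd z + fst z \<bullet> x)"])
  fix p :: "('n \<Rightarrow> nat) \<times> nat" assume p: "p \<in> poly_index d"
  define a where "a = (\<Sum>i\<in>UNIV. fst p i)"
  define M where "M k z = monomial (fst p, 0) z * of_real (snd z + fst z \<bullet> x) ^ k" for k and z :: "(real^'n) \<times> real"
  have "polynomial_fun (a + k) (M k)" for k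
  proof (induction k)
    case 0
    have "M 0 = monomial (fst p, 0)" by (rule ext) (simp add: M_def)
    then show ?case by (simp add: polynomial_fun_monomial poly_index_def a_def)
  next
    case (Suc k)
    have "M (Suc k) z = of_real (snd z) * M k z + (\<Sum>i\<in>UNIV. of_real (fst z $ i) * M k z * of_real (x $ i))" for z
    proof -
      have "M (Suc k) z = M k z * of_real (snd z + fst z \<bullet> x)" by (simp add: M_def mult_ac)
      also have "fst z \<bullet> x = (\<Sum>i\<in>UNIV. fst z $ i * x $ i)" by (simp add: inner_vec_def)
      finally show ?thesis by (simp add: distrib_left sum_distrib_left mult_ac)
    qed
    then have "M (Suc k) = (\<lambda>z. of_real (snd z) * M k z + (\<Sum>i\<in>UNIV. of_real (fst z $ i) * M k z * of_real (x $ i)))"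
      by blast
    then show ?case
      using polynomial_fun_add[OF polynomial_fun_mult_var(2)[OF Suc] polynomial_fun_sum[OF polynomial_fun_mult_var(1)[OF Suc]]]
      by simp
  qed
  moreover have "(\<lambda>z. monomial p (fst z, snd z + fst z \<bullet> x)) = M (snd p)"
    by (rule ext) (simp add: M_def monomial_def split_beta)
  moreover have "a + snd p \<le> d" using p by (auto simp: a_def poly_index_def)
  ultimately show "polynomial_fun d (\<lambda>z. monomial p (fst z, snd z + fst z \<bullet> x))"
    using polynomial_fun_mono by metis
qed simp

text \<open>
  A polynomial is determined by its values at finitely many nodes, with coefficient functions
  that are the same for all polynomials of degree at most \<open>d\<close>. In this form
  polynomiality passes to integrals and sums of functionals without any control of coefficients.
\<close>

lemma polynomial_fun_nodes:
  obtains k :: nat and zs :: "nat \<Rightarrow> (real^'n::finite) \<times> real" and e where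
    "\<And>q z. polynomial_fun d q \<Longrightarrow> q z = (\<Sum>m<k. (\<Sum>p\<in>poly_index d. e m p * monomial p z) * q (zs m))"
proof -
  obtain k :: nat and zs :: "nat \<Rightarrow> (real^'n) \<times> real" and e where
    e: "\<forall>j\<in>poly_index d. \<forall>z. monomial j z = (\<Sum>m<k. monomial j (zs m) * (\<Sum>l\<in>poly_index d. e m l * monomial l z))"
    using interpolation_nodes[OF finite_poly_index, of d monomial] by blast
  have "q z = (\<Sum>m<k. (\<Sum>p\<in>poly_index d. e m p * monomial p z) * q (zs m))" if q: "polynomial_fun d q" for q z
  proof -
    obtain w where w: "\<forall>z. q z = (\<Sum>p\<in>poly_index d. monomial p z * w p)"
      using q unfolding polynomial_fun_def by (rule exE)
    have "q z = (\<Sum>j\<in>poly_index d. (\<Sum>m<k. monomial j (zs m) * (\<Sum>l\<in>poly_index d. e m l * monomial l z)) * w j)"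
      unfolding w[rule_format, of z] by (intro sum.cong refl arg_cong2[where f="(*)"]) (use e in blast)
    also have "\<dots> = (\<Sum>j\<in>poly_index d. \<Sum>m<k. (\<Sum>l\<in>poly_index d. e m l * monomial l z) * (monomial j (zs m) * w j))"
    proof (rule sum.cong[OF refl])
      fix j
      show "(\<Sum>m<k. monomial j (zs m) * (\<Sum>l\<in>poly_index d. e m l * monomial l z)) * w j
          = (\<Sum>m<k. (\<Sum>l\<in>poly_index d. e m l * monomial l z) * (monomial j (zs m) * w j))"
        unfolding sum_distrib_right[of _ "{..<k}"] by (intro sum.cong refl) (simp only: mult_ac)
    qed
    also have "\<dots> = (\<Sum>m<k. \<Sum>j\<in>poly_index d. (\<Sum>l\<in>poly_index d. e m l * monomial l z) * (monomial j (zs m) * w j))"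
      by (rule sum.swap)
    also have "\<dots> = (\<Sum>m<k. (\<Sum>l\<in>poly_index d. e m l * monomial l z) * q (zs m))"
      unfolding w[rule_format] by (simp add: sum_distrib_left)
    finally show ?thesis .
  qed
  then show ?thesis by (rule that)
qed

lemma polynomial_on_affineD:
  assumes "polynomial_on_affine d P"
  shows "polynomial_fun d (\<lambda>(v, c). P (\<lambda>x. v \<bullet> x + c) \<phi>)"
proof -
  obtain w where w: "\<forall>v c \<phi>. P (\<lambda>x. v \<bullet> x + c) \<phi> =
      (\<Sum>(\<alpha>, k) \<in> {(\<alpha>, k). (\<Sum>i\<in>UNIV. \<alpha> i) + k \<le> d}.
              of_real ((\<Prod>i\<in>UNIV. (v $ i) ^ \<alpha> i) * c ^ k) * w \<alpha> k \<phi>)"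
    using assms unfolding polynomial_on_affine_def by blast
  show ?thesis
    unfolding polynomial_fun_def
    by (rule exI[of _ "\<lambda>p. w (fst p) (snd p) \<phi>"]) (simp add: w poly_index_def[symmetric] monomial_def split_beta)
qed

text \<open>
  Polynomiality at each test function suffices: by interpolation the coefficients are linear
  combinations of finitely many values of \<open>P\<close>, hence Radon functionals.
\<close>

lemma polynomial_on_affineI:
  fixes P :: "'n::finite functional"
  assumes R: "\<And>v c. P (\<lambda>x. v \<bullet> x + c) \<in> Radon"
    and pol: "\<And>\<phi>. polynomial_fun d (\<lambda>(v, c). P (\<lambda>x. v \<bullet> x + c) \<phi>)"
  shows "polynomial_on_affine d P"
proof -
  obtain k :: nat and zs :: "nat \<Rightarrow> (real^'n) \<times> real" and e where
    e: "\<And>q z. polynomial_fun d q \<Longrightarrow> q z = (\<Sum>m<k. (\<Sum>p\<in>poly_index d. e m p * monomial p z) * q (zs m))"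
    by (rule polynomial_fun_nodes) blast
  define V where "V m = (\<lambda>x. fst (zs m) \<bullet> x + snd (zs m))" for m
  define w where "w \<alpha> j = (\<lambda>\<phi>. \<Sum>m<k. e m (\<alpha>, j) * P (V m) \<phi>)" for \<alpha> j
  have "w \<alpha> j \<in> Radon" for \<alpha> j
    unfolding w_def V_def by (intro Radon_lincomb R)
  moreover have "P (\<lambda>x. v \<bullet> x + c) \<phi> = (\<Sum>(\<alpha>, k) \<in> {(\<alpha>, k). (\<Sum>i\<in>UNIV. \<alpha> i) + k \<le> d}.
              of_real ((\<Prod>i\<in>UNIV. (v $ i) ^ \<alpha> i) * c ^ k) * w \<alpha> k \<phi>)" for v c \<phi>
  proof -
    have "P (\<lambda>x. v \<bullet> x + c) \<phi> = (\<Sum>m<k. (\<Sum>p\<in>poly_index d. e m p * monomial p (v, c)) * P (V m) \<phi>)"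
      using e[OF pol[of \<phi>], of "(v, c)"] by (simp add: V_def split_beta)
    also have "\<dots> = (\<Sum>m<k. \<Sum>p\<in>poly_index d. monomial p (v, c) * (e m p * P (V m) \<phi>))"
    proof (rule sum.cong[OF refl])
      fix m
      show "(\<Sum>p\<in>poly_index d. e m p * monomial p (v, c)) * P (V m) \<phi>
          = (\<Sum>p\<in>poly_index d. monomial p (v, c) * (e m p * P (V m) \<phi>))"
        unfolding sum_distrib_right by (intro sum.cong refl) (simp only: mult_ac)
    qed
    also have "\<dots> = (\<Sum>p\<in>poly_index d. \<Sum>m<k. monomial p (v, c) * (e m p * P (V m) \<phi>))"
      by (rule sum.swap)
    also have "\<dots> = (\<Sum>p\<in>poly_index d. monomial p (v, c) * w (fst p) (snd p) \<phi>)"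
      by (simp add: w_def sum_distrib_left)
    finally show ?thesis by (simp add: poly_index_def[symmetric] monomial_def split_beta)
  qed
  ultimately show ?thesis unfolding polynomial_on_affine_def by blast
qed

section \<open>The Riesz representation theorem\<close>

definition rCc :: "(real^'n::finite \<Rightarrow> real) set" where
  "rCc = {u. (\<lambda>x. complex_of_real (u x)) \<in> Cc}"

lemma rCc_iff: "u \<in> rCc \<longleftrightarrow> continuous_on UNIV u \<and> (\<exists>K. compact K \<and> (\<forall>x. x \<notin> K \<longrightarrow> u x = 0))"
proof
  assume u: "u \<in> rCc"
  then have "continuous_on UNIV (\<lambda>x. complex_of_real (u x))"
    unfolding rCc_def mem_Collect_eq by (rule Cc_continuous)
  from continuous_on_Re[OF this] have "continuous_on UNIV u" by simp
  moreover have "u x = 0" if "x \<notin> supp (\<lambda>x. complex_of_real (u x))" for x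
    using outside_supp[OF that] by simp
  ultimately show "continuous_on UNIV u \<and> (\<exists>K. compact K \<and> (\<forall>x. x \<notin> K \<longrightarrow> u x = 0))"
    using u unfolding rCc_def by (auto intro!: exI[of _ "supp (\<lambda>x. complex_of_real (u x))"] Cc_compact_supp)
next
  assume "continuous_on UNIV u \<and> (\<exists>K. compact K \<and> (\<forall>x. x \<notin> K \<longrightarrow> u x = 0))"
  then obtain K where "continuous_on UNIV u" "compact K" "\<And>x. x \<notin> K \<Longrightarrow> u x = 0" by blast
  then show "u \<in> rCc" unfolding rCc_def mem_Collect_eq
    by (intro in_Cc_and_supp(1)[of _ K]) (auto intro!: continuous_intros)
qed

lemma rCc_continuous: "u \<in> rCc \<Longrightarrow> continuous_on UNIV u"
  by (simp add: rCc_iff)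

lemma rCc_comb:
  assumes "u \<in> rCc" "v \<in> rCc" and h: "continuous_on UNIV (\<lambda>p :: real \<times> real. h (fst p) (snd p))" "h 0 0 = 0"
  shows "(\<lambda>x. h (u x) (v x)) \<in> rCc"
proof -
  obtain K where K: "compact K" "\<And>x. x \<notin> K \<Longrightarrow> u x = 0" using assms(1) unfolding rCc_iff by blast
  obtain L where L: "compact L" "\<And>x. x \<notin> L \<Longrightarrow> v x = 0" using assms(2) unfolding rCc_iff by blast
  have "continuous_on UNIV (\<lambda>x. h (fst (u x, v x)) (snd (u x, v x)))"
    by (rule continuous_on_compose2[OF h(1)]) (auto intro!: continuous_intros rCc_continuous assms)
  then show ?thesis unfolding rCc_iff
    using K L h(2) by (intro conjI exI[of _ "K \<union> L"]) auto
qed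

lemma rCc_add: "u \<in> rCc \<Longrightarrow> v \<in> rCc \<Longrightarrow> (\<lambda>x. u x + v x) \<in> rCc"
  and rCc_diff: "u \<in> rCc \<Longrightarrow> v \<in> rCc \<Longrightarrow> (\<lambda>x. u x - v x) \<in> rCc"
  and rCc_max: "u \<in> rCc \<Longrightarrow> v \<in> rCc \<Longrightarrow> (\<lambda>x. max (u x) (v x)) \<in> rCc"
  and rCc_min: "u \<in> rCc \<Longrightarrow> v \<in> rCc \<Longrightarrow> (\<lambda>x. min (u x) (v x)) \<in> rCc"
  and rCc_cmult: "u \<in> rCc \<Longrightarrow> (\<lambda>x. c * u x) \<in> rCc"
proof -
  assume u: "u \<in> rCc"
  show "(\<lambda>x. c * u x) \<in> rCc"
    by (rule rCc_comb[OF u u, of "\<lambda>x y. c * x"]) (auto intro!: continuous_intros)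
  assume v: "v \<in> rCc"
  show "(\<lambda>x. u x + v x) \<in> rCc" by (rule rCc_comb[OF u v]) (auto intro!: continuous_intros)
  show "(\<lambda>x. u x - v x) \<in> rCc" by (rule rCc_comb[OF u v]) (auto intro!: continuous_intros)
  show "(\<lambda>x. max (u x) (v x)) \<in> rCc" by (rule rCc_comb[OF u v]) (auto intro!: continuous_intros)
  show "(\<lambda>x. min (u x) (v x)) \<in> rCc" by (rule rCc_comb[OF u v]) (auto intro!: continuous_intros)
qed

lemma rCc_zero: "(\<lambda>x. 0) \<in> rCc"
  by (auto simp: rCc_iff intro: exI[of _ "{}"])

lemma rCc_sum: "(\<And>i. i \<in> I \<Longrightarrow> u i \<in> rCc) \<Longrightarrow> (\<lambda>x. \<Sum>i\<in>I. u i x) \<in> rCc"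
  by (induction I rule: infinite_finite_induct) (auto intro: rCc_zero rCc_add)

lemma rCc_cutoff:
  fixes A :: "(real^'n::finite) set"
  assumes "compact A"
  obtains \<theta> where "\<theta> \<in> rCc" "\<And>x. x \<in> A \<Longrightarrow> \<theta> x = 1" "\<And>x. 0 \<le> \<theta> x" "\<And>x. \<theta> x \<le> 1"
proof -
  obtain R where R: "\<And>x. x \<in> A \<Longrightarrow> norm x \<le> R"
    using assms by (meson bounded_iff compact_imp_bounded)
  define \<theta> where "\<theta> x = max 0 (min 1 (R + 1 - norm x))" for x :: "real^'n"
  have "\<theta> \<in> rCc" unfolding rCc_iff \<theta>_def
    by (intro conjI exI[of _ "cball 0 (R + 1)"] continuous_intros) auto
  then show ?thesis by (rule that) (auto simp: \<theta>_def dest: R)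
qed

text \<open>
  Dini's theorem: the open sets where \<open>g k < e\<close> increase and cover the compact set.
\<close>

lemma dini:
  fixes g :: "nat \<Rightarrow> 'a::topological_space \<Rightarrow> real"
  assumes "compact A" and cont: "\<And>k. continuous_on UNIV (g k)"
    and dec: "\<And>k x. g (Suc k) x \<le> g k x" and lim: "\<And>x. (\<lambda>k. g k x) \<longlonglongrightarrow> 0" and e: "e > 0"
  obtains k where "\<And>x. x \<in> A \<Longrightarrow> g k x < e"
proof -
  define U where "U k = {x. g k x < e}" for k
  have op: "open (U k)" for k unfolding U_def by (intro open_Collect_less cont continuous_on_const)
  have cov: "A \<subseteq> (\<Union>k. U k)"
  proof
    fix x
    have "\<forall>\<^sub>F k in sequentially. g k x < e" using lim[of x] e by (rule order_tendstoD)
    then show "x \<in> (\<Union>k. U k)" by (auto simp: U_def eventually_sequentially)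
  qed
  obtain I where I: "finite I" "A \<subseteq> (\<Union>k\<in>I. U k)"
    by (rule compactE_image[OF assms(1), of UNIV U]) (use op cov in auto)
  have mono: "g l x \<le> g k x" if "k \<le> l" for k l x
    using that by (induction rule: dec_induct) (auto intro: order_trans dec)
  show ?thesis
  proof (rule that[of "Max (insert 0 I)"])
    fix x assume "x \<in> A"
    then obtain k where "k \<in> I" "g k x < e" using I(2) by (auto simp: U_def)
    moreover have "g (Max (insert 0 I)) x \<le> g k x" using \<open>k \<in> I\<close> I(1) by (intro mono) auto
    ultimately show "g (Max (insert 0 I)) x < e" by simp
  qed
qed

text \<open>
  Additivity and homogeneity are required on nonnegative functions only, where the positive part
  in the Jordan decomposition satisfies them.
\<close>

locale positive_functional =
  fixes I :: "(real^'n::finite \<Rightarrow> real) \<Rightarrow> real"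
  assumes add: "u \<in> rCc \<Longrightarrow> v \<in> rCc \<Longrightarrow> (\<And>x. 0 \<le> u x) \<Longrightarrow> (\<And>x. 0 \<le> v x) \<Longrightarrow> I (\<lambda>x. u x + v x) = I u + I v"
    and pos: "u \<in> rCc \<Longrightarrow> (\<And>x. 0 \<le> u x) \<Longrightarrow> 0 \<le> I u"
    and hom: "u \<in> rCc \<Longrightarrow> (\<And>x. 0 \<le> u x) \<Longrightarrow> c \<ge> 0 \<Longrightarrow> I (\<lambda>x. c * u x) = c * I u"
begin

lemma zero: "I (\<lambda>x. 0) = 0"
  using hom[OF rCc_zero, of 0] by simp

lemma mono:
  assumes "u \<in> rCc" "v \<in> rCc" "\<And>x. 0 \<le> u x" "\<And>x. u x \<le> v x"
  shows "I u \<le> I v"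
  using add[OF assms(1) rCc_diff[OF assms(2,1)]] pos[OF rCc_diff[OF assms(2,1)]] assms(3,4) by simp

lemma sum:
  assumes "\<And>i. i \<in> J \<Longrightarrow> u i \<in> rCc" "\<And>i x. i \<in> J \<Longrightarrow> 0 \<le> u i x"
  shows "I (\<lambda>x. \<Sum>i\<in>J. u i x) = (\<Sum>i\<in>J. I (u i))"
  using assms
proof (induction J rule: infinite_finite_induct)
  case (insert i J)
  have "I (\<lambda>x. u i x + (\<Sum>j\<in>J. u j x)) = I (u i) + I (\<lambda>x. \<Sum>j\<in>J. u j x)"
    by (rule add) (use insert in \<open>auto intro!: rCc_sum sum_nonneg\<close>)
  with insert show ?case by simp
qed (simp_all add: zero)

text \<open>
  The measure is built from the regions between the graphs of two test functions: such a region
  gets the value of the functional at their difference. Regions are half open in the second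
  coordinate, so that they form a semiring of sets.
\<close>

definition region :: "(real^'n \<Rightarrow> real) \<Rightarrow> (real^'n \<Rightarrow> real) \<Rightarrow> ((real^'n) \<times> real) set" where
  "region u v = {(x, t). u x \<le> t \<and> t < v x}"

definition region_bounds :: "(real^'n \<Rightarrow> real) \<Rightarrow> (real^'n \<Rightarrow> real) \<Rightarrow> bool" where
  "region_bounds u v \<longleftrightarrow> u \<in> rCc \<and> v \<in> rCc \<and> (\<forall>x. u x \<le> v x)"

definition region_measure :: "((real^'n) \<times> real) measure" where
  "region_measure = extend_measure UNIV {(u, v). region_bounds u v} (\<lambda>(u, v). region u v)
     (\<lambda>(u, v). ennreal (I (\<lambda>x. v x - u x)))"

lemma semiring_regions: "semiring_of_sets UNIV {region u v |u v. region_bounds u v}"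
proof (unfold_locales, safe)
  show "\<exists>u v. {} = region u v \<and> region_bounds u v"
    by (intro exI[of _ "\<lambda>x. 0"]) (auto simp: region_def region_bounds_def rCc_zero)
next
  fix u v u' v' assume "region_bounds u v" "region_bounds u' v'"
  then show "\<exists>a b. region u v \<inter> region u' v' = region a b \<and> region_bounds a b"
    by (intro exI[of _ "\<lambda>x. max (u x) (u' x)"] exI[of _ "\<lambda>x. max (max (u x) (u' x)) (min (v x) (v' x))"])
       (auto simp: region_def region_bounds_def rCc_max rCc_min)
next
  fix u v u' v' assume b: "region_bounds u v" "region_bounds u' v'"
  define w where "w x = max (u x) (min (v x) (u' x))" for x
  define z where "z x = min (v x) (max (u x) (v' x))" for x
  have "region_bounds u w" "region_bounds z v"
    using b unfolding region_bounds_def w_def[abs_def] z_def[abs_def] by (simp_all add: rCc_max rCc_min)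
  moreover have "region u v - region u' v' = region u w \<union> region z v"
  proof -
    have *: "(a \<le> t \<and> t < b) \<and> \<not> (a' \<le> t \<and> t < b') \<longleftrightarrow>
        (a \<le> t \<and> t < max a (min b a')) \<or> (min b (max a b') \<le> t \<and> t < b)"
      if "a \<le> b" "a' \<le> b'" for a b a' b' t :: real
      using that by (smt (verit))
    show ?thesis
    proof (rule set_eqI)
      fix p :: "(real^'n) \<times> real"
      obtain x t where p: "p = (x, t)" by fastforce
      have "u x \<le> v x" "u' x \<le> v' x" using b by (simp_all add: region_bounds_def)
      from *[OF this, of t] show "p \<in> region u v - region u' v' \<longleftrightarrow> p \<in> region u w \<union> region z v"
        unfolding p region_def w_def z_def by simp
    qed
  qed
  moreover have "region u w \<inter> region z v = {}"
  proof -
    have *: "\<not> (t < max a (min b a') \<and> a \<le> t \<and> min b (max a b') \<le> t \<and> t < b)"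
      if "a \<le> b" "a' \<le> b'" for a b a' b' t :: real
      using that by (smt (verit))
    show ?thesis
    proof (rule equals0I)
      fix p assume p': "p \<in> region u w \<inter> region z v"
      obtain x t where p: "p = (x, t)" by fastforce
      have "u x \<le> v x" "u' x \<le> v' x" using b by (simp_all add: region_bounds_def)
      from *[OF this, of t] p' show False unfolding p region_def w_def z_def by simp
    qed
  qed
  ultimately show "\<exists>C\<subseteq>{region u v |u v. region_bounds u v}. finite C \<and> disjoint C \<and>
      region u v - region u' v' = \<Union>C"
    by (intro exI[of _ "{region u w, region z v}"]) (auto simp: disjoint_def)
qed auto

text \<open>
  Over each point the regions are disjoint intervals filling the interval from
  \<open>a x\<close> to \<open>b x\<close>, so the lengths add up. The remainders decrease to
  zero pointwise, hence uniformly on the common compact support by Dini's theorem, and the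
  functional tends to zero along them.
\<close>

lemma region_countably_additive:
  assumes P: "\<And>n. region_bounds (A n) (B n)" and P': "region_bounds a b"
    and disj: "disjoint_family (\<lambda>n. region (A n) (B n))" and un: "(\<Union>n. region (A n) (B n)) = region a b"
  shows "(\<Sum>n. ennreal (I (\<lambda>x. B n x - A n x))) = ennreal (I (\<lambda>x. b x - a x))"
proof -
  have le: "\<And>n x. A n x \<le> B n x" "\<And>x. a x \<le> b x" using P P' by (auto simp: region_bounds_def)
  have cc: "\<And>n. A n \<in> rCc" "\<And>n. B n \<in> rCc" "a \<in> rCc" "b \<in> rCc" using P P' by (auto simp: region_bounds_def)
  have sm: "(\<lambda>n. B n x - A n x) sums (b x - a x)" for x
  proof -
    have "(\<lambda>n. emeasure lborel {A n x..<B n x}) sums emeasure lborel (\<Union>n. {A n x..<B n x})"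
    proof (rule sums_emeasure)
      show "disjoint_family (\<lambda>n. {A n x..<B n x})"
        using disj unfolding disjoint_family_on_def region_def by (fastforce simp: set_eq_iff)
    qed auto
    also have "(\<Union>n. {A n x..<B n x}) = {a x..<b x}"
    proof -
      have "t \<in> (\<Union>n. {A n x..<B n x}) \<longleftrightarrow> (x, t) \<in> (\<Union>n. region (A n) (B n))" for t
        by (simp add: region_def)
      also have "\<dots>t \<longleftrightarrow> t \<in> {a x..<b x}" for t
        unfolding un by (simp add: region_def)
      finally show ?thesis by blast
    qed
    finally have "(\<lambda>n. ennreal (B n x - A n x)) sums ennreal (b x - a x)" using le by simp
    then show ?thesis
      by (subst (asm) sums_ennreal) (use le in auto)
  qed
  define S where "S k x = b x - a x - (\<Sum>n<k. B n x - A n x)" for k x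
  have S0: "0 \<le> S k x" for k x
    using sum_le_suminf[OF sums_summable[OF sm], of "{..<k}"] sums_unique[OF sm] le by (simp add: S_def)
  have Scc: "S k \<in> rCc" for k unfolding S_def by (intro rCc_diff rCc_sum cc)
  have split: "I (\<lambda>x. b x - a x) = I (S k) + (\<Sum>n<k. I (\<lambda>x. B n x - A n x))" for k
  proof -
    have "I (\<lambda>x. b x - a x) = I (\<lambda>x. S k x + (\<Sum>n<k. B n x - A n x))" by (simp add: S_def)
    also have "\<dots> = I (S k) + I (\<lambda>x. \<Sum>n<k. B n x - A n x)"
      by (rule add[OF Scc]) (auto intro!: rCc_sum rCc_diff cc S0 sum_nonneg simp: le)
    also have "I (\<lambda>x. \<Sum>n<k. B n x - A n x) = (\<Sum>n<k. I (\<lambda>x. B n x - A n x))"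
      by (rule sum) (auto intro: rCc_diff cc simp: le)
    finally show ?thesis .
  qed
  obtain K where K: "compact K" "\<And>x. x \<notin> K \<Longrightarrow> b x - a x = 0"
    using rCc_diff[OF cc(4,3)] unfolding rCc_iff by blast
  obtain \<theta> where \<theta>: "\<theta> \<in> rCc" "\<And>x. x \<in> K \<Longrightarrow> \<theta> x = 1" "\<And>x. 0 \<le> \<theta> x" "\<And>x. \<theta> x \<le> 1"
    using rCc_cutoff[OF K(1)] by blast
  have IS: "(\<lambda>k. I (S k)) \<longlonglongrightarrow> 0"
  proof (rule LIMSEQ_I)
    fix e :: real assume e: "e > 0"
    define s where "s = e / (2 * (I \<theta> + 1))"
    have I\<theta>: "I \<theta> \<ge> 0" by (rule pos[OF \<theta>(1,3)])
    have s: "s > 0" using e I\<theta> by (simp add: s_def)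
    have Sdec: "S (Suc k) x \<le> S k x" for k x by (simp add: S_def le)
    have Smono: "S l x \<le> S k x" if "k \<le> l" for k l x
      using that by (induction rule: dec_induct) (auto intro: order_trans Sdec)
    have Slim: "(\<lambda>k. S k x) \<longlonglongrightarrow> 0" for x
      using tendsto_diff[OF tendsto_const sm[of x, unfolded sums_def], of "b x - a x"] by (simp add: S_def)
    obtain k where k: "\<And>x. x \<in> K \<Longrightarrow> S k x < s"
      using dini[of K S s] K(1) rCc_continuous[OF Scc] Sdec Slim s by blast
    have "norm (I (S l) - 0) < e" if "l \<ge> k" for l
    proof -
      have "S l x \<le> s * \<theta> x" for x
      proof (cases "x \<in> K")
        case True then show ?thesis using k[OF True] Smono[OF that, of x] \<theta>(2)[OF True] by simp
      next
        case False
        have "S l x \<le> b x - a x" using le by (simp add: S_def sum_nonneg)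
        then show ?thesis using K(2)[OF False] \<theta>(3)[of x] s by (metis mult_nonneg_nonneg less_imp_le order_trans)
      qed
      then have "I (S l) \<le> I (\<lambda>x. s * \<theta> x)" by (intro mono Scc rCc_cmult \<theta>(1) S0)
      also have "\<dots> = s * I \<theta>" by (rule hom) (use \<theta> s in auto)
      also have "\<dots> \<le> s * (I \<theta> + 1)" using s by simp
      also have "\<dots> = e / 2" using I\<theta> by (simp add: s_def field_simps)
      also have "\<dots> < e" using e by simp
      finally show ?thesis using pos[OF Scc S0, of l] by simp
    qed
    then show "\<exists>k. \<forall>l\<ge>k. norm (I (S l) - 0) < e" by blast
  qed
  have "(\<lambda>k. \<Sum>n<k. I (\<lambda>x. B n x - A n x)) = (\<lambda>k. I (\<lambda>x. b x - a x) - I (S k))"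
    using split by (intro ext) (simp add: algebra_simps)
  then have "(\<lambda>n. I (\<lambda>x. B n x - A n x)) sums I (\<lambda>x. b x - a x)"
    unfolding sums_def using tendsto_diff[OF tendsto_const IS] by simp
  moreover have "0 \<le> I (\<lambda>x. B n x - A n x)" for n
    by (rule pos[OF rCc_diff[OF cc(2,1)]]) (simp add: le)
  ultimately show ?thesis by (rule suminf_ennreal_eq[rotated])
qed

lemma emeasure_region:
  assumes "region_bounds a b"
  shows "emeasure region_measure (region a b) = ennreal (I (\<lambda>x. b x - a x))"
proof (rule extend_measure_caratheodory_pair[OF region_measure_def assms semiring_regions])
  fix u v assume uv: "region_bounds u v" "region u v = {}"
  have "v x - u x = 0" for x
  proof -
    have "(x, u x) \<notin> region u v" using uv(2) by simp
    moreover have "u x \<le> v x" using uv(1) by (simp add: region_bounds_def)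
    ultimately show ?thesis by (simp add: region_def)
  qed
  then show "ennreal (I (\<lambda>x. v x - u x)) = 0" by (simp add: zero)
next
  fix u v u' v' assume b: "region_bounds u v" "region_bounds u' v'" and eq: "region u v = region u' v'"
  have "v x - u x = v' x - u' x" for x
  proof -
    have "{u x..<v x} = {u' x..<v' x}"
      using eq unfolding region_def set_eq_iff by simp
    then have "emeasure lborel {u x..<v x} = emeasure lborel {u' x..<v' x}" by simp
    then show ?thesis using b by (simp add: region_bounds_def)
  qed
  then show "ennreal (I (\<lambda>x. v x - u x)) = ennreal (I (\<lambda>x. v' x - u' x))" by simp
next
  fix A B :: "nat \<Rightarrow> real^'n \<Rightarrow> real" and a b assume "\<And>n. region_bounds (A n) (B n)" "region_bounds a b"
    "disjoint_family (\<lambda>n. region (A n) (B n))" "(\<Union>i. region (A i) (B i)) = region a b"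
  then show "(\<Sum>n. ennreal (I (\<lambda>x. B n x - A n x))) = ennreal (I (\<lambda>x. b x - a x))"
    by (rule region_countably_additive)
qed simp

lemma sets_region_measure: "sets region_measure = sigma_sets UNIV {region u v |u v. region_bounds u v}"
  and space_region_measure: "space region_measure = UNIV"
proof -
  have "(\<lambda>(u, v). region u v) ` {(u, v). region_bounds u v} = {region u v |u v. region_bounds u v}" by auto
  then show "sets region_measure = sigma_sets UNIV {region u v |u v. region_bounds u v}"
    unfolding region_measure_def by (subst sets_extend_measure) auto
  show "space region_measure = UNIV"
    unfolding region_measure_def by (rule space_extend_measure) auto
qed

lemma region_in_sets: "region_bounds u v \<Longrightarrow> region u v \<in> sets region_measure"
  unfolding sets_region_measure by (intro sigma_sets.Basic) auto

lemma strip_eq_Union_regions: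
  fixes u :: "nat \<Rightarrow> real^'n \<Rightarrow> real"
  assumes "\<And>x. x \<in> U \<Longrightarrow> \<exists>k. u k x = 1" "\<And>k x. u k x \<le> 1" "\<And>k x. x \<notin> U \<Longrightarrow> u k x = 0"
  shows "U \<times> {0..<1} = (\<Union>k. region (\<lambda>x. 0) (u k))"
proof (rule set_eqI)
  fix p :: "(real^'n) \<times> real"
  obtain x t where p: "p = (x, t)" by fastforce
  have "x \<in> U \<and> 0 \<le> t \<and> t < 1 \<longleftrightarrow> (\<exists>k. 0 \<le> t \<and> t < u k x)"
  proof
    assume "x \<in> U \<and> 0 \<le> t \<and> t < 1"
    then show "\<exists>k. 0 \<le> t \<and> t < u k x" using assms(1)[of x] by metis
  next
    assume "\<exists>k. 0 \<le> t \<and> t < u k x"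
    then obtain k where k: "0 \<le> t" "t < u k x" by blast
    then have "t < 1" using assms(2)[of k x] by linarith
    moreover have "x \<in> U" using assms(3)[of x k] k by linarith
    ultimately show "x \<in> U \<and> 0 \<le> t \<and> t < 1" using k by blast
  qed
  then show "p \<in> U \<times> {0..<1} \<longleftrightarrow> p \<in> (\<Union>k. region (\<lambda>x. 0) (u k))"
    unfolding p region_def by simp
qed

text \<open>
  The strip is a countable union of regions under test functions that vanish outside
  \<open>U\<close> and reach height 1 at every point of \<open>U\<close>.
\<close>

lemma open_strip_in_sets:
  assumes U: "open U" shows "U \<times> {0..<1} \<in> sets region_measure"
proof (cases "U = UNIV")
  case True
  \<comment> \<open>The distance to the empty complement is 0 by convention, so the whole space needs
      its own functions.\<close>
  define u where "u k x = max 0 (min 1 (real k - norm x))" for k and x :: "real^'n"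
  have b: "region_bounds (\<lambda>x. 0) (u k)" for k
    unfolding region_bounds_def rCc_iff u_def
    by (intro conjI continuous_intros exI[of _ "{}"] exI[of _ "cball 0 (real k)"]) auto
  have "\<exists>k. u k x = 1" for x
  proof -
    obtain k :: nat where "norm x + 1 \<le> k" using real_arch_simple by blast
    then show ?thesis by (auto simp: u_def intro!: exI[of _ k])
  qed
  moreover have "u k x \<le> 1" for k x by (simp add: u_def)
  ultimately have "U \<times> {0..<1} = (\<Union>k. region (\<lambda>x. 0) (u k))"
    using True by (intro strip_eq_Union_regions) auto
  then show ?thesis using region_in_sets[OF b] by auto
next
  case False
  define u where "u k x = max 0 (min (real k - norm x) (min 1 (real k * infdist x (-U))))" for k and x :: "real^'n"
  have ne: "- U \<noteq> {}" using False by auto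
  have b: "region_bounds (\<lambda>x. 0) (u k)" for k
    unfolding region_bounds_def rCc_iff u_def
    by (intro conjI continuous_intros exI[of _ "{}"] exI[of _ "cball 0 (real k)"]) auto
  have "\<exists>k. u k x = 1" if "x \<in> U" for x
  proof -
    have "x \<notin> closure (- U)" using that U by (simp add: closed_Compl)
    then have d: "infdist x (-U) > 0" using infdist_pos_not_in_closed[of "-U" x] U ne that by (simp add: closed_Compl)
    obtain k :: nat where k: "max (norm x + 1) (1 / infdist x (-U)) \<le> k" using real_arch_simple by blast
    then have "1 \<le> real k * infdist x (-U)" using d by (simp add: field_simps)
    then show ?thesis using k by (auto simp: u_def intro!: exI[of _ k])
  qed
  moreover have "u k x \<le> 1" for k x by (simp add: u_def)
  moreover have "u k x = 0" if "x \<notin> U" for k x using that by (simp add: u_def)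
  ultimately have "U \<times> {0..<1} = (\<Union>k. region (\<lambda>x. 0) (u k))"
    by (rule strip_eq_Union_regions)
  then show ?thesis using region_in_sets[OF b] by auto
qed

text \<open>
  A Borel set is measured by the strip of height 1 over it, the region below its indicator
  function.
\<close>

definition riesz_measure :: "(real^'n) measure" where
  "riesz_measure = distr (restrict_space region_measure (UNIV \<times> {0..<1})) borel fst"

lemma fst_measurable: "fst \<in> restrict_space region_measure (UNIV \<times> {0..<1}) \<rightarrow>\<^sub>M borel"
proof (rule borel_measurableI)
  fix U :: "(real^'n) set" assume "open U"
  then have "U \<times> {0..<1} \<in> sets region_measure" "UNIV \<times> {0..<1} \<in> sets region_measure"
    using open_strip_in_sets[of UNIV] open_strip_in_sets[of U] by auto
  moreover have "fst -` U \<inter> space (restrict_space region_measure (UNIV \<times> {0..<1})) = U \<times> {0..<1}"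
    by (auto simp: space_restrict_space space_region_measure)
  ultimately show "fst -` U \<inter> space (restrict_space region_measure (UNIV \<times> {0..<1}))
      \<in> sets (restrict_space region_measure (UNIV \<times> {0..<1}))"
    by (auto simp: sets_restrict_space_iff space_region_measure)
qed

lemma riesz_measure_strip:
  assumes "B \<in> sets borel"
  shows "B \<times> {0..<1} \<in> sets region_measure" "emeasure riesz_measure B = emeasure region_measure (B \<times> {0..<1})"
proof -
  have S: "UNIV \<times> {0..<1} \<inter> space region_measure \<in> sets region_measure"
    using open_strip_in_sets[of UNIV] by (simp add: space_region_measure)
  have eq: "fst -` B \<inter> space (restrict_space region_measure (UNIV \<times> {0..<1})) = B \<times> {0..<1}"
    by (auto simp: space_restrict_space space_region_measure)
  have "B \<times> {0..<1} \<in> sets (restrict_space region_measure (UNIV \<times> {0..<1}))"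
    using measurable_sets[OF fst_measurable assms] unfolding eq .
  then show "B \<times> {0..<1} \<in> sets region_measure"
    using sets_restrict_space_iff[OF S] by auto
  show "emeasure riesz_measure B = emeasure region_measure (B \<times> {0..<1})"
    unfolding riesz_measure_def emeasure_distr[OF fst_measurable assms] eq
    by (rule emeasure_restrict_space[OF S]) auto
qed

lemma riesz_measure_lower:
  assumes u: "u \<in> rCc" "\<And>x. 0 \<le> u x" "\<And>x. u x \<le> 1" and B: "B \<in> sets borel" "\<And>x. x \<notin> B \<Longrightarrow> u x = 0"
  shows "ennreal (I u) \<le> emeasure riesz_measure B"
proof -
  have b: "region_bounds (\<lambda>x. 0) u" using u by (simp add: region_bounds_def rCc_zero)
  have "region (\<lambda>x. 0) u \<subseteq> B \<times> {0..<1}"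
  proof
    fix p assume "p \<in> region (\<lambda>x. 0) u"
    then obtain x t where p: "p = (x, t)" "0 \<le> t" "t < u x" by (auto simp: region_def)
    then show "p \<in> B \<times> {0..<1}" using u(3)[of x] B(2)[of x] by force
  qed
  then have "emeasure region_measure (region (\<lambda>x. 0) u) \<le> emeasure region_measure (B \<times> {0..<1})"
    by (rule emeasure_mono) (rule riesz_measure_strip(1)[OF B(1)])
  then show ?thesis using emeasure_region[OF b] riesz_measure_strip(2)[OF B(1)] by simp
qed

lemma riesz_measure_upper:
  assumes u: "u \<in> rCc" "\<And>x. 0 \<le> u x" and B: "B \<in> sets borel" "\<And>x. x \<in> B \<Longrightarrow> 1 \<le> u x"
  shows "emeasure riesz_measure B \<le> ennreal (I u)"
proof -
  have b: "region_bounds (\<lambda>x. 0) u" using u by (simp add: region_bounds_def rCc_zero)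
  have "B \<times> {0..<1} \<subseteq> region (\<lambda>x. 0) u"
    using B(2) by (force simp: region_def)
  then have "emeasure region_measure (B \<times> {0..<1}) \<le> emeasure region_measure (region (\<lambda>x. 0) u)"
    by (rule emeasure_mono) (rule region_in_sets[OF b])
  then show ?thesis using emeasure_region[OF b] riesz_measure_strip(2)[OF B(1)] by simp
qed

lemma sets_riesz_measure [measurable_cong, simp]: "sets riesz_measure = sets borel"
  by (simp add: riesz_measure_def)

lemma space_riesz_measure [simp]: "space riesz_measure = UNIV"
  by (simp add: riesz_measure_def)

lemma riesz_measure_compact:
  assumes "compact A" shows "emeasure riesz_measure A < \<infinity>"
proof -
  obtain \<theta> where \<theta>: "\<theta> \<in> rCc" "\<And>x. x \<in> A \<Longrightarrow> \<theta> x = 1" "\<And>x. 0 \<le> \<theta> x" "\<And>x. \<theta> x \<le> 1"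
    using rCc_cutoff[OF assms] by blast
  have "emeasure riesz_measure A \<le> ennreal (I \<theta>)"
    by (rule riesz_measure_upper) (use \<theta> assms in \<open>auto intro: borel_compact\<close>)
  then show ?thesis by (simp add: order_le_less_trans)
qed

lemma integrable_riesz_measure:
  assumes u: "u \<in> rCc" shows "integrable riesz_measure u"
proof -
  obtain K where K: "compact K" "\<And>x. x \<notin> K \<Longrightarrow> u x = 0" using u unfolding rCc_iff by blast
  have c: "continuous_on UNIV u" using u by (rule rCc_continuous)
  obtain s where s: "\<And>x. x \<in> K \<Longrightarrow> norm (u x) \<le> s"
    using compact_imp_bounded[OF compact_continuous_image[OF continuous_on_subset[OF c] K(1)]]
    by (auto simp: bounded_iff)
  show ?thesis
  proof (rule Bochner_Integration.integrable_bound)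
    show "integrable riesz_measure (\<lambda>x. indicator K x * s)"
      using K(1) riesz_measure_compact[OF K(1)]
      by (intro integrable_mult_left integrable_real_indicator) (auto intro: borel_compact)
    show "u \<in> borel_measurable riesz_measure" using borel_measurable_continuous_onI[OF c] by simp
    show "AE x in riesz_measure. norm (u x) \<le> norm (indicator K x * s)"
      by (rule AE_I2) (use s K(2) in \<open>force simp: indicator_def\<close>)
  qed
qed

text \<open>
  Layer cake: \<open>u\<close> is cut into slices \<open>h * w k\<close> of height
  \<open>h\<close>. The function \<open>w k\<close> lies between the indicators of the sets
  where \<open>u\<close> exceeds \<open>(k + 1) * h\<close> and \<open>k * h\<close>, so both
  the functional and the integral at \<open>w k\<close> lie between the measures of these two
  sets. The sum of the differences telescopes to at most \<open>h\<close> times the measure of a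
  compact set outside which \<open>u\<close> vanishes.
\<close>

lemma riesz_measure_represents:
  assumes u: "u \<in> rCc" and u0: "\<And>x. 0 \<le> u x"
  shows "I u = (LINT x|riesz_measure. u x)"
proof -
  obtain K where K: "compact K" "\<And>x. x \<notin> K \<Longrightarrow> u x = 0" using u unfolding rCc_iff by blast
  have c: "continuous_on UNIV u" using u by (rule rCc_continuous)
  have um[measurable]: "u \<in> borel_measurable borel" using borel_measurable_continuous_onI[OF c] .
  obtain s where s: "\<And>x. u x \<le> s"
  proof -
    obtain s where "\<And>x. x \<in> K \<Longrightarrow> norm (u x) \<le> s"
      using compact_imp_bounded[OF compact_continuous_image[OF continuous_on_subset[OF c] K(1)]]
      by (auto simp: bounded_iff)
    then have "u x \<le> max s 0" for x using K(2)[of x] by (cases "x \<in> K") (force simp: max_def)+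
    then show ?thesis using that by blast
  qed
  define M where "M = measure riesz_measure K"
  have close: "\<bar>I u - (LINT x|riesz_measure. u x)\<bar> \<le> h * M" if h: "h > 0" for h
  proof -
    obtain k0 :: nat where "s / h \<le> k0" using real_arch_simple by blast
    then have k0: "u x / h \<le> k0" for x using s[of x] h by (meson divide_right_mono less_imp_le order_trans)
    define w where "w k x = min 1 (max 0 (u x / h - real k))" for k x
    have "(\<Sum>k<m. min 1 (max 0 (y - real k))) = min (real m) y" if "y \<ge> 0" for y :: real and m
      using that by (induction m) (auto simp: min_def max_def)
    then have "(\<Sum>k<k0. w k x) = min (real k0) (u x / h)" for x
      unfolding w_def using u0[of x] h by simp
    then have "(\<Sum>k<k0. w k x) = u x / h" for x using k0[of x] by simp
    then have usum: "u x = (\<Sum>k<k0. h * w k x)" for x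
      unfolding sum_distrib_left[symmetric] using h by simp
    have wcc: "w k \<in> rCc" for k unfolding rCc_iff w_def
      using h by (intro conjI exI[of _ K] continuous_intros c) (auto simp: K)
    have w01: "0 \<le> w k x" "w k x \<le> 1" for k x by (auto simp: w_def)
    define B where "B k = {x. u x > real k * h}" for k :: nat
    have Bm[measurable]: "B k \<in> sets borel" for k unfolding B_def by measurable
    have BK: "B k \<subseteq> K" for k
    proof
      fix x assume "x \<in> B k"
      then have "u x > real k * h" by (simp add: B_def)
      then have "u x \<noteq> 0" using h by (metis less_imp_le mult_nonneg_nonneg not_less of_nat_0_le_iff)
      then show "x \<in> K" using K(2) by blast
    qed
    have fin: "emeasure riesz_measure (B k) < \<infinity>" for k
      using emeasure_mono[OF BK, of riesz_measure k] riesz_measure_compact[OF K(1)] K(1)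
      by (auto intro: order_le_less_trans borel_compact)
    define c where "c k = measure riesz_measure (B k)" for k
    have ec: "emeasure riesz_measure (B k) = ennreal (c k)" for k
      unfolding c_def using fin[of k] by (intro emeasure_eq_ennreal_measure) auto
    have c0: "c k \<ge> 0" for k by (simp add: c_def)
    have out: "w k x = 0" if "x \<notin> B k" for k x using that h by (simp add: w_def B_def field_simps)
    have ins: "w k x = 1" if "x \<in> B (Suc k)" for k x using that h by (simp add: w_def B_def field_simps)
    have 1: "I (w k) \<le> c k" for k
      using riesz_measure_lower[OF wcc w01 Bm out, of k] c0 by (simp add: ec)
    have 2: "c (Suc k) \<le> I (w k)" for k
      using riesz_measure_upper[OF wcc w01(1) Bm[of "Suc k"], of k] ins pos[OF wcc w01(1), of k] by (simp add: ec)
    have iB: "integrable riesz_measure (indicator (B k) :: _ \<Rightarrow> real)" for k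
      using fin by (intro integrable_real_indicator) auto
    have 3: "(LINT x|riesz_measure. w k x) \<le> c k" for k
    proof -
      have "(LINT x|riesz_measure. w k x) \<le> (LINT x|riesz_measure. indicator (B k) x)"
        by (rule integral_mono[OF integrable_riesz_measure[OF wcc] iB])
           (use w01 out in \<open>auto simp: indicator_def\<close>)
      then show ?thesis by (simp add: c_def)
    qed
    have 4: "c (Suc k) \<le> (LINT x|riesz_measure. w k x)" for k
    proof -
      have "(LINT x|riesz_measure. indicator (B (Suc k)) x) \<le> (LINT x|riesz_measure. w k x)"
        by (rule integral_mono[OF iB integrable_riesz_measure[OF wcc]])
           (use w01 ins in \<open>auto simp: indicator_def\<close>)
      then show ?thesis by (simp add: c_def)
    qed
    have ueq: "u = (\<lambda>x. \<Sum>k<k0. h * w k x)" using usum by blast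
    have "I u = (\<Sum>k<k0. I (\<lambda>x. h * w k x))"
      by (subst ueq, rule sum) (use wcc w01 h in \<open>auto intro: rCc_cmult\<close>)
    then have Iu: "I u = (\<Sum>k<k0. h * I (w k))" using hom[OF wcc w01(1)] h by simp
    have "(LINT x|riesz_measure. u x) = (\<Sum>k<k0. (LINT x|riesz_measure. h * w k x))"
      by (subst ueq, rule Bochner_Integration.integral_sum) (use integrable_riesz_measure[OF wcc] in auto)
    then have Lu: "(LINT x|riesz_measure. u x) = (\<Sum>k<k0. h * (LINT x|riesz_measure. w k x))" by simp
    have "\<bar>I u - (LINT x|riesz_measure. u x)\<bar> = \<bar>\<Sum>k<k0. h * (I (w k) - (LINT x|riesz_measure. w k x))\<bar>"
      unfolding Iu Lu by (simp add: sum_subtractf algebra_simps)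
    also have "\<dots> \<le> (\<Sum>k<k0. h * (c k - c (Suc k)))"
    proof (rule order_trans[OF sum_abs sum_mono])
      fix k
      have "\<bar>I (w k) - (LINT x|riesz_measure. w k x)\<bar> \<le> c k - c (Suc k)"
        using 1[of k] 2[of k] 3[of k] 4[of k] by linarith
      then show "\<bar>h * (I (w k) - (LINT x|riesz_measure. w k x))\<bar> \<le> h * (c k - c (Suc k))"
        using h by (simp add: abs_mult)
    qed
    also have "\<dots> = h * (c 0 - c k0)" by (simp add: sum_distrib_left[symmetric] sum_lessThan_telescope')
    also have "\<dots> \<le> h * c 0" using c0[of k0] h by simp
    also have "\<dots> \<le> h * M"
    proof -
      have "c 0 \<le> M" unfolding c_def M_def
        using riesz_measure_compact[OF K(1)] K(1) by (intro measure_mono_fmeasurable BK) (auto simp: fmeasurable_def intro: borel_compact)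
      then show ?thesis using h by simp
    qed
    finally show ?thesis .
  qed
  have M: "M \<ge> 0" by (simp add: M_def)
  have "\<bar>I u - (LINT x|riesz_measure. u x)\<bar> \<le> 0"
  proof (rule field_le_epsilon)
    fix e :: real assume "e > 0"
    then have "\<bar>I u - (LINT x|riesz_measure. u x)\<bar> \<le> (e / (M + 1)) * M" using M by (intro close) simp
    also have "\<dots> \<le> e" using M \<open>e > 0\<close> by (simp add: field_simps)
    finally show "\<bar>I u - (LINT x|riesz_measure. u x)\<bar> \<le> 0 + e" by simp
  qed
  then show ?thesis by simp
qed

end

text \<open>
  The positive part at \<open>u\<close> is the supremum of \<open>T\<close> over the test
  functions between \<open>0\<close> and \<open>u\<close>, and the negative part is its
  difference to \<open>T\<close>. The positive part is additive because every \<open>w\<close>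
  between \<open>0\<close> and \<open>u + v\<close> splits into \<open>min w u\<close> and
  \<open>w - min w u\<close>, which lie below \<open>u\<close> and \<open>v\<close>.
\<close>

lemma jordan_decomposition:
  fixes T :: "(real^'n::finite \<Rightarrow> real) \<Rightarrow> real"
  assumes add: "\<And>u v. u \<in> rCc \<Longrightarrow> v \<in> rCc \<Longrightarrow> T (\<lambda>x. u x + v x) = T u + T v"
    and hom: "\<And>c u. u \<in> rCc \<Longrightarrow> T (\<lambda>x. c * u x) = c * T u"
    and bd: "\<And>A. compact A \<Longrightarrow> \<exists>C. \<forall>u\<in>rCc. \<forall>s. (\<forall>x. x \<notin> A \<longrightarrow> u x = 0) \<longrightarrow> (\<forall>x. \<bar>u x\<bar> \<le> s) \<longrightarrow> T u \<le> C * s"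
  obtains P Q where "positive_functional P" "positive_functional Q"
    "\<And>u. u \<in> rCc \<Longrightarrow> (\<And>x. 0 \<le> u x) \<Longrightarrow> T u = P u - Q u"
proof -
  define W where "W u = {w \<in> rCc. \<forall>x. 0 \<le> w x \<and> w x \<le> u x}" for u :: "real^'n \<Rightarrow> real"
  define P where "P u = Sup (T ` W u)" for u
  have WI: "w \<in> W u" if "w \<in> rCc" "\<And>x. 0 \<le> w x" "\<And>x. w x \<le> u x" for w u
    using that by (simp add: W_def)
  have WD: "w \<in> rCc" "\<And>x. 0 \<le> w x" "\<And>x. w x \<le> u x" if "w \<in> W u" for w u
    using that by (simp_all add: W_def)
  have z: "(\<lambda>x. 0) \<in> W u" if "\<And>x. 0 \<le> u x" for u
    using that by (intro WI rCc_zero) auto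
  have l0: "T (\<lambda>x. 0) = 0" using hom[OF rCc_zero, of 0] by simp
  have bdd: "bdd_above (T ` W u)" if u: "u \<in> rCc" for u
  proof -
    obtain K where K: "compact K" "\<And>x. x \<notin> K \<Longrightarrow> u x = 0" using u unfolding rCc_iff by blast
    have c: "continuous_on K u" using rCc_continuous[OF u] continuous_on_subset by blast
    obtain s where s: "\<And>x. x \<in> K \<Longrightarrow> norm (u x) \<le> s"
      using compact_imp_bounded[OF compact_continuous_image[OF c K(1)]] by (auto simp: bounded_iff)
    have us: "u x \<le> max s 0" for x
    proof (cases "x \<in> K")
      case True then show ?thesis using s[OF True] by simp
    qed (simp add: K(2))
    obtain C where C: "\<forall>u\<in>rCc. \<forall>s. (\<forall>x. x \<notin> K \<longrightarrow> u x = 0) \<longrightarrow> (\<forall>x. \<bar>u x\<bar> \<le> s) \<longrightarrow> T u \<le> C * s"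
      using bd[OF K(1)] by (rule exE)
    have "T w \<le> C * max s 0" if w: "w \<in> W u" for w
    proof (rule C[rule_format])
      show "w \<in> rCc" using WD[OF w] by simp
      show "w x = 0" if "x \<notin> K" for x using WD(2,3)[OF w, of x] K(2)[OF that] by simp
      show "\<bar>w x\<bar> \<le> max s 0" for x using WD(2,3)[OF w, of x] us[of x] by simp
    qed
    then show ?thesis by (intro bdd_aboveI[of _ "C * max s 0"]) auto
  qed
  have Pu: "T w \<le> P u" if "u \<in> rCc" "w \<in> W u" for w u
    unfolding P_def by (rule cSup_upper[OF imageI[OF that(2)] bdd[OF that(1)]])
  have Pl: "P u \<le> b" if "\<And>x. 0 \<le> u x" "\<And>w. w \<in> W u \<Longrightarrow> T w \<le> b" for u b
  proof -
    have "(\<lambda>x. 0) \<in> W u" by (rule z) (rule that(1))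
    then show ?thesis unfolding P_def by (intro cSup_least) (use that(2) in auto)
  qed
  have Phom1: "P (\<lambda>x. c * u x) \<le> c * P u" if u: "u \<in> rCc" "\<And>x. 0 \<le> u x" and c: "c > 0" for u c
  proof (rule Pl)
    show "0 \<le> c * u x" for x using u(2)[of x] c by simp
    fix w assume w: "w \<in> W (\<lambda>x. c * u x)"
    have "(\<lambda>x. inverse c * w x) \<in> W u"
    proof (rule WI)
      show "inverse c * w x \<le> u x" for x
      proof -
        have "inverse c * w x \<le> inverse c * (c * u x)"
          by (rule mult_left_mono[OF WD(3)[OF w]]) (use c in simp)
        also have "\<dots> = u x" using c by (simp only: mult.assoc[symmetric]) simp
        finally show ?thesis .
      qed
    qed (use WD[OF w] c in \<open>simp_all add: rCc_cmult\<close>)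
    from Pu[OF u(1) this] have "inverse c * T w \<le> P u" by (simp add: hom WD[OF w])
    then show "T w \<le> c * P u" using c by (simp add: field_simps)
  qed
  have Phom: "P (\<lambda>x. c * u x) = c * P u" if u: "u \<in> rCc" "\<And>x. 0 \<le> u x" and c: "c \<ge> 0" for u c
  proof (cases "c = 0")
    case True
    have "W (\<lambda>x. 0) = {\<lambda>x. 0}" using z[of "\<lambda>x. 0"] by (auto simp: W_def intro!: antisym ext)
    then show ?thesis using True by (simp add: P_def l0)
  next
    case False
    then have c: "c > 0" using c by simp
    have "P (\<lambda>x. inverse c * (c * u x)) \<le> inverse c * P (\<lambda>x. c * u x)"
      by (rule Phom1) (use u c in \<open>auto intro: rCc_cmult\<close>)
    then have "c * P u \<le> P (\<lambda>x. c * u x)" using c by (simp add: field_simps)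
    then show ?thesis using Phom1[OF u c] by simp
  qed
  have Padd: "P (\<lambda>x. u x + v x) = P u + P v"
    if u: "u \<in> rCc" "\<And>x. 0 \<le> u x" and v: "v \<in> rCc" "\<And>x. 0 \<le> v x" for u v
  proof (rule antisym)
    show "P (\<lambda>x. u x + v x) \<le> P u + P v"
    proof (rule Pl)
      show "0 \<le> u x + v x" for x using u(2) v(2) by simp
      fix w assume w: "w \<in> W (\<lambda>x. u x + v x)"
      have 1: "(\<lambda>x. min (w x) (u x)) \<in> W u"
        by (rule WI) (use WD[OF w] u in \<open>auto intro: rCc_min\<close>)
      have 2: "(\<lambda>x. w x - min (w x) (u x)) \<in> W v"
      proof (rule WI)
        show "(\<lambda>x. w x - min (w x) (u x)) \<in> rCc" by (intro rCc_diff rCc_min WD(1)[OF w] u(1))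
        show "0 \<le> w x - min (w x) (u x)" "w x - min (w x) (u x) \<le> v x" for x
          using WD(3)[OF w, of x] v(2)[of x] by (auto simp: min_def)
      qed
      have "T w = T (\<lambda>x. min (w x) (u x)) + T (\<lambda>x. w x - min (w x) (u x))"
        using add[OF WD(1)[OF 1] WD(1)[OF 2]] by simp
      then show "T w \<le> P u + P v" using Pu[OF u(1) 1] Pu[OF v(1) 2] by simp
    qed
    have "P v \<le> P (\<lambda>x. u x + v x) - P u"
    proof (rule Pl[OF v(2)])
      fix w2 assume w2: "w2 \<in> W v"
      have "P u \<le> P (\<lambda>x. u x + v x) - T w2"
      proof (rule Pl[OF u(2)])
        fix w1 assume w1: "w1 \<in> W u"
        have "(\<lambda>x. w1 x + w2 x) \<in> W (\<lambda>x. u x + v x)"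
          by (rule WI) (use WD[OF w1] WD[OF w2] in \<open>auto intro: rCc_add add_mono\<close>)
        from Pu[OF rCc_add[OF u(1) v(1)] this] show "T w1 \<le> P (\<lambda>x. u x + v x) - T w2"
          by (simp add: add WD[OF w1] WD[OF w2])
      qed
      then show "T w2 \<le> P (\<lambda>x. u x + v x) - P u" by simp
    qed
    then show "P u + P v \<le> P (\<lambda>x. u x + v x)" by simp
  qed
  show ?thesis
  proof (rule that[of P "\<lambda>u. P u - T u"])
    show "positive_functional P"
    proof
      show "P (\<lambda>x. u x + v x) = P u + P v" if "u \<in> rCc" "v \<in> rCc" "\<And>x. 0 \<le> u x" "\<And>x. 0 \<le> v x" for u v
        by (rule Padd) (use that in auto)
      show "0 \<le> P u" if "u \<in> rCc" "\<And>x. 0 \<le> u x" for u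
        using Pu[OF that(1) z[OF that(2)]] by (simp add: l0)
      show "P (\<lambda>x. c * u x) = c * P u" if "u \<in> rCc" "\<And>x. 0 \<le> u x" "0 \<le> c" for u c
        by (rule Phom) (use that in auto)
    qed
    show "positive_functional (\<lambda>u. P u - T u)"
    proof
      show "P (\<lambda>x. u x + v x) - T (\<lambda>x. u x + v x) = (P u - T u) + (P v - T v)"
        if "u \<in> rCc" "v \<in> rCc" "\<And>x. 0 \<le> u x" "\<And>x. 0 \<le> v x" for u v
        using Padd[OF that(1,3,2,4)] add[OF that(1,2)] by simp
      show "0 \<le> P u - T u" if "u \<in> rCc" "\<And>x. 0 \<le> u x" for u
        using Pu[OF that(1) WI[OF that(1,2) order_refl]] by simp
      show "P (\<lambda>x. c * u x) - T (\<lambda>x. c * u x) = c * (P u - T u)" if "u \<in> rCc" "\<And>x. 0 \<le> u x" "0 \<le> c" for u c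
        using Phom[OF that] hom[OF that(1), of c] by (simp add: algebra_simps)
    qed
  qed simp
qed

lemma riesz_real:
  fixes T :: "(real^'n::finite \<Rightarrow> real) \<Rightarrow> real"
  assumes add: "\<And>u v. u \<in> rCc \<Longrightarrow> v \<in> rCc \<Longrightarrow> T (\<lambda>x. u x + v x) = T u + T v"
    and hom: "\<And>c u. u \<in> rCc \<Longrightarrow> T (\<lambda>x. c * u x) = c * T u"
    and bd: "\<And>A. compact A \<Longrightarrow> \<exists>C. \<forall>u\<in>rCc. \<forall>s. (\<forall>x. x \<notin> A \<longrightarrow> u x = 0) \<longrightarrow> (\<forall>x. \<bar>u x\<bar> \<le> s) \<longrightarrow> T u \<le> C * s"
  obtains \<mu> \<nu> :: "(real^'n) measure" where
    "sets \<mu> = sets borel" "sets \<nu> = sets borel"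
    "\<And>A. compact A \<Longrightarrow> emeasure \<mu> A < \<infinity>" "\<And>A. compact A \<Longrightarrow> emeasure \<nu> A < \<infinity>"
    "\<And>u. u \<in> rCc \<Longrightarrow> integrable \<mu> u \<and> integrable \<nu> u \<and> T u = (LINT x|\<mu>. u x) - (LINT x|\<nu>. u x)"
proof -
  obtain P Q where PQ: "positive_functional P" "positive_functional Q"
    "\<And>u. u \<in> rCc \<Longrightarrow> (\<And>x. 0 \<le> u x) \<Longrightarrow> T u = P u - Q u"
    using jordan_decomposition[of T, OF add hom bd] by blast
  interpret P: positive_functional P by (rule PQ(1))
  interpret Q: positive_functional Q by (rule PQ(2))
  show ?thesis
  proof (rule that[of P.riesz_measure Q.riesz_measure])
    fix u :: "real^'n \<Rightarrow> real" assume u: "u \<in> rCc"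
    define p where "p x = max (u x) 0" for x
    define m where "m x = max (- u x) 0" for x
    have pm: "p \<in> rCc" "m \<in> rCc"
      using rCc_max[OF u rCc_zero] rCc_max[OF rCc_cmult[OF u, of "-1"] rCc_zero]
      by (simp_all add: p_def[abs_def] m_def[abs_def])
    have nn: "0 \<le> p x" "0 \<le> m x" for x by (auto simp: p_def m_def)
    have eq: "u x = p x - m x" for x by (auto simp: p_def m_def)
    have ueq: "u = (\<lambda>x. p x + (-1) * m x)" using eq by auto
    have lu: "T u = T p - T m"
      using add[OF pm(1) rCc_cmult[OF pm(2), of "-1"]] hom[OF pm(2), of "-1"] by (subst ueq) simp
    have iu: "integrable P.riesz_measure u" "integrable Q.riesz_measure u"
      by (rule P.integrable_riesz_measure[OF u], rule Q.integrable_riesz_measure[OF u])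
    have "(LINT x|P.riesz_measure. u x) = (LINT x|P.riesz_measure. p x) - (LINT x|P.riesz_measure. m x)"
      unfolding eq by (rule Bochner_Integration.integral_diff[OF P.integrable_riesz_measure[OF pm(1)] P.integrable_riesz_measure[OF pm(2)]])
    moreover have "(LINT x|Q.riesz_measure. u x) = (LINT x|Q.riesz_measure. p x) - (LINT x|Q.riesz_measure. m x)"
      unfolding eq by (rule Bochner_Integration.integral_diff[OF Q.integrable_riesz_measure[OF pm(1)] Q.integrable_riesz_measure[OF pm(2)]])
    moreover have "T p = P p - Q p" "T m = P m - Q m" using PQ(3) pm nn by blast+
    ultimately have "T u = (LINT x|P.riesz_measure. u x) - (LINT x|Q.riesz_measure. u x)"
      using lu P.riesz_measure_represents[OF pm(1) nn(1)] P.riesz_measure_represents[OF pm(2) nn(2)]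
        Q.riesz_measure_represents[OF pm(1) nn(1)] Q.riesz_measure_represents[OF pm(2) nn(2)] by simp
    then show "integrable P.riesz_measure u \<and> integrable Q.riesz_measure u \<and>
        T u = (LINT x|P.riesz_measure. u x) - (LINT x|Q.riesz_measure. u x)" using iu by blast
  qed (simp_all only: P.sets_riesz_measure Q.sets_riesz_measure P.riesz_measure_compact Q.riesz_measure_compact)
qed

text \<open>
  The real and the imaginary part of the functional are decomposed separately; this also shows
  that a representing family exists, which is what the choice in the definition of
  \<open>riesz\<close> requires.
\<close>

lemma represents_riesz:
  fixes L :: "'n::finite radon"
  assumes L: "L \<in> Radon" shows "represents (riesz L) L"
proof -
  let ?c = "\<lambda>u x. complex_of_real (u x)"
  have cc: "?c u \<in> Cc" if "u \<in> rCc" for u :: "real^'n \<Rightarrow> real" using that by (simp add: rCc_def)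
  have ladd: "L (?c (\<lambda>x. u x + v x)) = L (?c u) + L (?c v)" if "u \<in> rCc" "v \<in> rCc" for u v
    using Radon_add[OF L cc[OF that(1)] cc[OF that(2)]] by simp
  have lhom: "L (?c (\<lambda>x. a * u x)) = of_real a * L (?c u)" if "u \<in> rCc" for a u
    using Radon_cmult[OF L cc[OF that], of "of_real a"] by simp
  have lbd: "\<exists>C. \<forall>u\<in>rCc. \<forall>s. (\<forall>x. x \<notin> A \<longrightarrow> u x = 0) \<longrightarrow> (\<forall>x. \<bar>u x\<bar> \<le> s) \<longrightarrow> norm (L (?c u)) \<le> C * s"
    if A: "compact A" for A
  proof -
    obtain C where C: "C \<ge> 0" "\<And>\<phi> s. \<phi> \<in> Cc \<Longrightarrow> (\<And>x. x \<notin> A \<Longrightarrow> \<phi> x = 0) \<Longrightarrow> (\<And>x. norm (\<phi> x) \<le> s)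
        \<Longrightarrow> norm (L \<phi>) \<le> C * s"
      using Radon_bound[OF L A] by blast
    show ?thesis
      by (rule exI[of _ C], intro ballI allI impI, rule C(2)[OF cc]) simp_all
  qed
  have part: "\<exists>\<mu> \<nu> :: (real^'n) measure. sets \<mu> = sets borel \<and> sets \<nu> = sets borel \<and>
     (\<forall>A. compact A \<longrightarrow> emeasure \<mu> A < \<infinity>) \<and> (\<forall>A. compact A \<longrightarrow> emeasure \<nu> A < \<infinity>) \<and>
     (\<forall>u\<in>rCc. integrable \<mu> u \<and> integrable \<nu> u \<and> h (L (?c u)) = (LINT x|\<mu>. u x) - (LINT x|\<nu>. u x))"
    if h: "\<And>a b. h (a + b) = h a + h b" "\<And>r a. h (of_real r * a) = r * h a" "\<And>a. h a \<le> norm a"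
    for h :: "complex \<Rightarrow> real"
  proof -
    have 1: "h (L (?c (\<lambda>x. u x + v x))) = h (L (?c u)) + h (L (?c v))" if "u \<in> rCc" "v \<in> rCc" for u v
      by (simp only: ladd[OF that] h)
    have 2: "h (L (?c (\<lambda>x. a * u x))) = a * h (L (?c u))" if "u \<in> rCc" for a u
      by (simp only: lhom[OF that] h)
    have 3: "\<exists>C. \<forall>u\<in>rCc. \<forall>s. (\<forall>x. x \<notin> A \<longrightarrow> u x = 0) \<longrightarrow> (\<forall>x. \<bar>u x\<bar> \<le> s) \<longrightarrow> h (L (?c u)) \<le> C * s"
      if "compact A" for A
      using lbd[OF that] h(3) by (meson order_trans)
    show ?thesis
    proof (rule riesz_real[of "\<lambda>u. h (L (?c u))", OF 1 2 3])
      fix \<mu> \<nu> :: "(real^'n) measure"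
      assume "sets \<mu> = sets borel" "sets \<nu> = sets borel" "\<And>A. compact A \<Longrightarrow> emeasure \<mu> A < \<infinity>"
        "\<And>A. compact A \<Longrightarrow> emeasure \<nu> A < \<infinity>"
        "\<And>u. u \<in> rCc \<Longrightarrow> integrable \<mu> u \<and> integrable \<nu> u \<and> h (L (?c u)) = (LINT x|\<mu>. u x) - (LINT x|\<nu>. u x)"
      then show ?thesis by (intro exI[of _ \<mu>] exI[of _ \<nu>]) simp
    qed
  qed
  obtain \<mu>0 \<mu>2 where re: "sets \<mu>0 = sets borel" "sets \<mu>2 = sets borel"
     "\<forall>A. compact A \<longrightarrow> emeasure \<mu>0 A < \<infinity>" "\<forall>A. compact A \<longrightarrow> emeasure \<mu>2 A < \<infinity>"
     "\<forall>u\<in>rCc. integrable \<mu>0 u \<and> integrable \<mu>2 u \<and> Re (L (?c u)) = (LINT x|\<mu>0. u x) - (LINT x|\<mu>2. u x)"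
    using part[of Re] complex_Re_le_cmod by auto
  obtain \<mu>1 \<mu>3 where im: "sets \<mu>1 = sets borel" "sets \<mu>3 = sets borel"
     "\<forall>A. compact A \<longrightarrow> emeasure \<mu>1 A < \<infinity>" "\<forall>A. compact A \<longrightarrow> emeasure \<mu>3 A < \<infinity>"
     "\<forall>u\<in>rCc. integrable \<mu>1 u \<and> integrable \<mu>3 u \<and> Im (L (?c u)) = (LINT x|\<mu>1. u x) - (LINT x|\<mu>3. u x)"
    using part[of Im] order_trans[OF abs_ge_self abs_Im_le_cmod] by auto
  \<comment> \<open>The powers of \<open>\<i>\<close> are \<open>1, \<i>, -1, -\<i>\<close>: the even
      indices carry the real part and the odd ones the imaginary part.\<close>
  define \<mu> where "\<mu> k = (if k = 0 then \<mu>0 else if k = 1 then \<mu>1 else if k = 2 then \<mu>2 else \<mu>3)" for k :: nat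
  have "represents \<mu> L"
    unfolding represents_def
  proof (intro conjI allI impI ballI)
    show "sets (\<mu> k) = sets borel" for k using re(1,2) im(1,2) by (simp add: \<mu>_def)
    show "emeasure (\<mu> k) A < \<infinity>" if "compact A" for k A
      unfolding \<mu>_def using re(3,4) im(3,4) that by auto
    fix \<phi> :: "real^'n \<Rightarrow> complex" assume \<phi>: "\<phi> \<in> Cc"
    define u where "u x = Re (\<phi> x)" for x
    define v where "v x = Im (\<phi> x)" for x
    have u: "u \<in> rCc" unfolding rCc_iff u_def
      by (intro conjI exI[of _ "supp \<phi>"] continuous_on_Re Cc_continuous Cc_compact_supp \<phi>) (simp add: outside_supp)
    have v: "v \<in> rCc" unfolding rCc_iff v_def
      by (intro conjI exI[of _ "supp \<phi>"] continuous_on_Im Cc_continuous Cc_compact_supp \<phi>) (simp add: outside_supp)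
    have eq: "\<phi> x = ?c u x + \<i> * ?c v x" for x by (simp add: u_def v_def complex_eq_iff)
    then have \<phi>eq: "\<phi> = (\<lambda>x. ?c u x + \<i> * ?c v x)" by blast
    have "L \<phi> = L (?c u) + \<i> * L (?c v)"
      unfolding \<phi>eq using Radon_add[OF L cc[OF u] Cc_cmult[OF cc[OF v]], of \<i>] Radon_cmult[OF L cc[OF v], of \<i>] by simp
    moreover have int: "(LINT x|M. \<phi> x) = of_real (LINT x|M. u x) + \<i> * of_real (LINT x|M. v x)"
      if "integrable M u" "integrable M v" for M
    proof -
      have "(LINT x|M. ?c u x + \<i> * ?c v x) = (LINT x|M. ?c u x) + (LINT x|M. \<i> * ?c v x)"
        by (rule Bochner_Integration.integral_add) (use that in auto)
      then show ?thesis unfolding \<phi>eq by simp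
    qed
    moreover have "L (?c w) = of_real ((LINT x|\<mu>0. w x) - (LINT x|\<mu>2. w x)) + \<i> * of_real ((LINT x|\<mu>1. w x) - (LINT x|\<mu>3. w x))"
      if "w \<in> rCc" for w
      using re(5) im(5) that by (auto simp: complex_eq_iff)
    ultimately have "L \<phi> = (LINT x|\<mu>0. \<phi> x) + \<i> * (LINT x|\<mu>1. \<phi> x) - (LINT x|\<mu>2. \<phi> x) - \<i> * (LINT x|\<mu>3. \<phi> x)"
      using re(5) im(5) u v by (simp add: algebra_simps)
    then show "L \<phi> = (\<Sum>k<4. \<i> ^ k * (LINT x|\<mu> k. \<phi> x))"
      by (simp add: eval_nat_numeral \<mu>_def)
  qed
  then show ?thesis unfolding riesz_def by (rule someI[of "\<lambda>\<mu>. represents \<mu> L"])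
qed

section \<open>Densities\<close>

definition locally_finite_borel :: "(real^'n::finite) measure \<Rightarrow> bool" where
  "locally_finite_borel M \<longleftrightarrow> sets M = sets borel \<and> (\<forall>A. compact A \<longrightarrow> emeasure M A < \<infinity>)"

text \<open>
  The integrands to which dominated convergence is applied: a common compact support and a
  common bound provide an integrable majorant when the measures are locally finite and the
  densities continuous.
\<close>

definition admissible :: "(real^'n::finite) set \<Rightarrow> real \<Rightarrow> (real^'n \<Rightarrow> complex) set" where
  "admissible K s = {h \<in> borel_measurable borel. (\<forall>x. x \<notin> K \<longrightarrow> h x = 0) \<and> (\<forall>x. norm (h x) \<le> s)}"

lemma admissible_majorant:
  fixes g :: "real^'n::finite \<Rightarrow> complex"
  assumes M: "locally_finite_borel M" and g: "continuous_on UNIV g" and K: "compact K"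
  shows "\<exists>w. integrable M w \<and> (\<forall>h\<in>admissible K s. (\<forall>x. norm (h x * g x) \<le> w x) \<and> integrable M (\<lambda>x. h x * g x))"
proof -
  have [measurable_cong]: "sets M = sets borel" using M by (simp add: locally_finite_borel_def)
  have [measurable]: "g \<in> borel_measurable borel" using borel_measurable_continuous_onI[OF g] .
  obtain r where r: "\<And>x. x \<in> K \<Longrightarrow> norm (g x) \<le> r"
    using compact_imp_bounded[OF compact_continuous_image[OF continuous_on_subset[OF g] K]] by (auto simp: bounded_iff)
  define w where "w x = indicator K x * (s * r)" for x :: "real^'n"
  have w: "integrable M w" unfolding w_def
    using M K by (intro integrable_mult_left integrable_real_indicator)
      (auto simp: locally_finite_borel_def intro: borel_compact)
  have "(\<forall>x. norm (h x * g x) \<le> w x) \<and> integrable M (\<lambda>x. h x * g x)" if "h \<in> admissible K s" for h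
  proof
    have [measurable]: "h \<in> borel_measurable borel" and h: "\<And>x. x \<notin> K \<Longrightarrow> h x = 0" "\<And>x. norm (h x) \<le> s"
      using that by (simp_all add: admissible_def)
    have s: "s \<ge> 0" using order_trans[OF norm_ge_zero h(2)] .
    have b: "norm (h x * g x) \<le> w x" for x
    proof (cases "x \<in> K")
      case True
      then show ?thesis using mult_mono[OF h(2)[of x] r[OF True] s] by (simp add: w_def norm_mult)
    next
      case False then show ?thesis by (simp add: w_def h(1))
    qed
    then show "\<forall>x. norm (h x * g x) \<le> w x" by blast
    show "integrable M (\<lambda>x. h x * g x)"
    proof (rule Bochner_Integration.integrable_bound[OF w])
      show "AE x in M. norm (h x * g x) \<le> norm (w x)"
        unfolding real_norm_def by (rule AE_I2) (rule order_trans[OF b abs_ge_self])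
    qed measurable
  qed
  then show ?thesis using w by (intro exI[of _ w]) simp
qed

text \<open>
  A finite combination of measures with continuous complex densities. Whether it vanishes can be
  tested on continuous functions of compact support or on bounded Borel sets; the identity
  between a functional and a sum of functionals with densities is the case where all
  representing measures are collected on one side.
\<close>

locale density_combination =
  fixes J :: "'j set" and M :: "'j \<Rightarrow> (real^'n::finite) measure" and g :: "'j \<Rightarrow> real^'n \<Rightarrow> complex"
  assumes fin: "finite J" and lf: "\<And>j. j \<in> J \<Longrightarrow> locally_finite_borel (M j)"
    and gc: "\<And>j. j \<in> J \<Longrightarrow> continuous_on UNIV (g j)"
begin

definition val :: "(real^'n \<Rightarrow> complex) \<Rightarrow> complex" where
  "val h = (\<Sum>j\<in>J. LINT x|M j. h x * g j x)"

lemma integrable_admissible: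
  assumes K: "compact K" and h: "h \<in> admissible K s" and j: "j \<in> J"
  shows "integrable (M j) (\<lambda>x. h x * g j x)"
  using admissible_majorant[OF lf[OF j] gc[OF j] K, of s] h by (elim exE conjE) simp

lemma val_tendsto:
  assumes K: "compact K" and h: "\<And>i. h i \<in> admissible K s" "h' \<in> admissible K s"
    and lim: "\<And>x. (\<lambda>i. h i x) \<longlonglongrightarrow> h' x"
  shows "(\<lambda>i. val (h i)) \<longlonglongrightarrow> val h'"
  unfolding val_def
proof (rule tendsto_sum)
  fix j assume j: "j \<in> J"
  have s: "sets (M j) = sets borel" using lf[OF j] by (simp add: locally_finite_borel_def)
  obtain w where w': "integrable (M j) w \<and>
      (\<forall>h\<in>admissible K s. (\<forall>x. norm (h x * g j x) \<le> w x) \<and> integrable (M j) (\<lambda>x. h x * g j x))"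
    using admissible_majorant[OF lf[OF j] gc[OF j] K, of s] by (rule exE)
  then have w: "integrable (M j) w" "\<And>h x. h \<in> admissible K s \<Longrightarrow> norm (h x * g j x) \<le> w x"
    by simp_all
  show "(\<lambda>i. LINT x|M j. h i x * g j x) \<longlonglongrightarrow> (LINT x|M j. h' x * g j x)"
  proof (rule integral_dominated_convergence[OF _ _ w(1)])
    show "(\<lambda>x. h' x * g j x) \<in> borel_measurable (M j)" "(\<lambda>x. h i x * g j x) \<in> borel_measurable (M j)" for i
      using integrable_admissible[OF K _ j] h by auto
    show "AE x in M j. (\<lambda>i. h i x * g j x) \<longlonglongrightarrow> h' x * g j x"
      by (intro AE_I2 tendsto_mult lim tendsto_const)
    show "AE x in M j. norm (h i x * g j x) \<le> w x" for i
      by (intro AE_I2 w(2) h(1))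
  qed
qed

lemma val_add:
  assumes "compact K" "h \<in> admissible K s" "h' \<in> admissible K s'"
  shows "val (\<lambda>x. h x + h' x) = val h + val h'"
  unfolding val_def sum.distrib[symmetric]
  by (intro sum.cong refl) (simp add: distrib_right integrable_admissible[OF assms(1,2)] integrable_admissible[OF assms(1,3)])

lemma val_cmult: "val (\<lambda>x. c * h x) = c * val h"
  unfolding val_def sum_distrib_left by (intro sum.cong refl) (simp add: mult.assoc)

lemma indicator_admissible:
  assumes "B \<in> sets borel" "B \<subseteq> K" shows "(\<lambda>x. indicator B x) \<in> admissible K 1"
  unfolding admissible_def using assms by (auto simp: indicator_def split: if_splits)

text \<open>
  Within a ball containing \<open>B\<close>, indicators of open sets are increasing limits of
  test functions, and the sets with vanishing value form a Dynkin system containing them.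
\<close>

lemma val_indicator_of_Cc:
  assumes z: "\<And>\<phi>. \<phi> \<in> Cc \<Longrightarrow> val \<phi> = 0" and B: "B \<in> sets borel" "bounded B"
  shows "val (indicator B) = 0"
proof -
  obtain R where R: "B \<subseteq> ball 0 R" using bounded_subset_ballD[OF B(2)] by blast
  define K where "K = cball (0 :: real^'n) R"
  have K: "compact K" by (simp add: K_def)
  have opn: "val (indicator (U \<inter> ball 0 R)) = 0" if U: "open U" for U
  proof (cases "U \<inter> ball 0 R = {}")
    case True then show ?thesis by (simp add: val_def)
  next
    case False
    define V where "V = U \<inter> ball 0 R"
    have V: "open V" "V \<subseteq> K" unfolding V_def K_def using U by auto
    have ne: "- V \<noteq> {}"
      using V(2) K by (metis Compl_empty_eq boolean_algebra_class.boolean_algebra.double_compl bounded_subset compact_imp_bounded not_bounded_UNIV)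
    \<comment> \<open>These test functions increase to the indicator of \<open>V\<close>.\<close>
    define u where "u i x = complex_of_real (min 1 (real i * infdist x (- V)))" for i x
    have uc: "continuous_on UNIV (u i)" for i unfolding u_def by (intro continuous_intros)
    have u0: "u i x = 0" if "x \<notin> V" for i x using that by (simp add: u_def)
    have ucc: "u i \<in> Cc" for i
      by (rule in_Cc_and_supp(1)[OF uc K]) (use u0 V(2) in blast)
    have n1: "norm (u i x) \<le> 1" for i x
    proof -
      have "0 \<le> min 1 (real i * infdist x (- V))" by (simp add: infdist_nonneg)
      then show ?thesis unfolding u_def norm_of_real by simp
    qed
    have "(\<lambda>i. val (u i)) \<longlonglongrightarrow> val (indicator V)"
    proof (rule val_tendsto[OF K])
      show "u i \<in> admissible K 1" for i
        unfolding admissible_def using n1 u0 V(2) borel_measurable_continuous_onI[OF uc] by blast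
      show "indicator V \<in> admissible K 1" by (rule indicator_admissible) (use V in auto)
      fix x show "(\<lambda>i. u i x) \<longlonglongrightarrow> indicator V x"
      proof (cases "x \<in> V")
        case True
        then have d: "infdist x (- V) > 0"
          using infdist_pos_not_in_closed[of "- V" x] V(1) ne by (simp add: closed_Compl)
        obtain k :: nat where k: "1 / infdist x (- V) \<le> k" using real_arch_simple by blast
        have "u i x = 1" if "i \<ge> k" for i
        proof -
          have "1 / infdist x (- V) \<le> real i" using k that by linarith
          then have "1 \<le> real i * infdist x (- V)" using d by (simp add: field_simps)
          then show ?thesis by (simp add: u_def)
        qed
        then have "\<forall>\<^sub>F i in sequentially. u i x = 1" unfolding eventually_sequentially by blast
        then show ?thesis using True by (simp add: tendsto_eventually)
      next
        case False then show ?thesis by (simp add: u0)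
      qed
    qed
    then show ?thesis using z[OF ucc] by (simp add: LIMSEQ_const_iff V_def)
  qed
  define D where "D A \<longleftrightarrow> val (indicator (A \<inter> ball 0 R)) = 0" for A :: "(real^'n) set"
  have "D B"
  proof -
    have "Int_stable {S::(real^'n) set. open S}" "{S::(real^'n) set. open S} \<subseteq> Pow UNIV"
      by (auto simp: Int_stable_def)
    moreover have "B \<in> sigma_sets UNIV {S. open S}" using B(1) by (simp add: borel_def)
    ultimately show ?thesis
    proof (rule sigma_sets_induct_disjoint[where P=D])
      show "D {}" by (simp add: D_def val_def)
      show "D A" if "A \<in> {S. open S}" for A using opn that by (simp add: D_def)
    next
      fix A :: "(real^'n) set" assume A: "A \<in> sigma_sets UNIV {S. open S}" "D A"
      have Ab: "A \<in> sets borel" using A(1) by (simp add: borel_def)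
      have "indicator (ball 0 R) = (\<lambda>x :: real^'n. indicator (A \<inter> ball 0 R) x + indicator ((UNIV - A) \<inter> ball 0 R) x :: complex)"
        by (auto simp: indicator_def)
      moreover have "val (\<lambda>x. indicator (A \<inter> ball 0 R) x + indicator ((UNIV - A) \<inter> ball 0 R) x) =
          val (\<lambda>x. indicator (A \<inter> ball 0 R) x) + val (\<lambda>x. indicator ((UNIV - A) \<inter> ball 0 R) x)"
        by (rule val_add[OF K]; rule indicator_admissible) (use Ab in \<open>auto simp: K_def\<close>)
      ultimately show "D (UNIV - A)" using A(2) opn[of UNIV] by (simp add: D_def)
    next
      fix A :: "nat \<Rightarrow> (real^'n) set"
      assume dis: "disjoint_family A" and A: "range A \<subseteq> sigma_sets UNIV {S. open S}" and DA: "\<And>i. D (A i)"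
      have Ab: "A i \<in> sets borel" for i using A by (auto simp: borel_def)
      define S where "S k = (\<lambda>x. indicator ((\<Union>i<k. A i) \<inter> ball 0 R) x :: complex)" for k :: nat
      have S: "S k \<in> admissible K 1" for k
        unfolding S_def by (rule indicator_admissible) (use Ab in \<open>auto simp: K_def\<close>)
      have "val (S k) = 0" for k
      proof (induction k)
        case 0 then show ?case by (simp add: S_def val_def)
      next
        case (Suc k)
        have "x \<notin> (\<Union>i<k. A i)" if x: "x \<in> A k" for x
        proof
          assume "x \<in> (\<Union>i<k. A i)"
          then obtain i where i: "i < k" "x \<in> A i" by blast
          have "A i \<inter> A k = {}" by (rule disjoint_family_onD[OF dis]) (use i in auto)
          then show False using i(2) x by blast
        qed
        then have "S (Suc k) x = S k x + indicator (A k \<inter> ball 0 R) x" for x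
          unfolding S_def indicator_def by (auto simp: less_Suc_eq)
        then have "S (Suc k) = (\<lambda>x. S k x + indicator (A k \<inter> ball 0 R) x)" by blast
        moreover have "val (\<lambda>x. S k x + indicator (A k \<inter> ball 0 R) x) = val (S k) + val (\<lambda>x. indicator (A k \<inter> ball 0 R) x)"
          by (rule val_add[OF K S], rule indicator_admissible) (use Ab in \<open>auto simp: K_def\<close>)
        ultimately show ?case using Suc DA[of k] by (simp add: D_def)
      qed
      moreover have "(\<lambda>k. val (S k)) \<longlonglongrightarrow> val (indicator ((\<Union>i. A i) \<inter> ball 0 R))"
      proof (rule val_tendsto[OF K S])
        show "indicator ((\<Union>i. A i) \<inter> ball 0 R) \<in> admissible K 1"
          by (rule indicator_admissible) (use Ab in \<open>auto simp: K_def\<close>)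
        fix x show "(\<lambda>k. S k x) \<longlonglongrightarrow> indicator ((\<Union>i. A i) \<inter> ball 0 R) x"
        proof (cases "x \<in> (\<Union>i. A i) \<inter> ball 0 R")
          case True
          then obtain i where i: "x \<in> A i" by blast
          have "S k x = 1" if "k \<ge> Suc i" for k
            using i True that by (auto simp: S_def indicator_def intro!: bexI[of _ i])
          then have "\<forall>\<^sub>F k in sequentially. S k x = 1" unfolding eventually_sequentially by blast
          then show ?thesis using True by (simp add: tendsto_eventually)
        next
          case False
          then have "S k x = 0" for k by (auto simp: S_def indicator_def)
          then show ?thesis using False by simp
        qed
      qed
      ultimately show "D (\<Union>i. A i)" by (simp add: D_def LIMSEQ_const_iff)
    qed
  qed
  moreover have "B \<inter> ball 0 R = B" using R by blast
  ultimately show ?thesis by (simp add: D_def)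
qed

text \<open>
  A test function is a limit of simple functions dominated by twice its modulus, and their level
  sets are bounded.
\<close>

lemma val_Cc_of_indicator:
  assumes z: "\<And>B. B \<in> sets borel \<Longrightarrow> bounded B \<Longrightarrow> val (indicator B) = 0" and \<phi>: "\<phi> \<in> Cc"
  shows "val \<phi> = 0"
proof -
  define K where "K = supp \<phi>"
  have K: "compact K" unfolding K_def by (rule Cc_compact_supp[OF \<phi>])
  obtain s where s: "\<And>x. norm (\<phi> x) \<le> s" using Cc_bounded[OF \<phi>] by blast
  have \<phi>m: "\<phi> \<in> borel_measurable borel" by (rule borel_measurable_continuous_onI[OF Cc_continuous[OF \<phi>]])
  obtain F where F: "\<And>i. simple_function borel (F i)" "\<And>x. (\<lambda>i. F i x) \<longlonglongrightarrow> \<phi> x"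
    "\<And>i x. norm (F i x) \<le> 2 * norm (\<phi> x)"
    using borel_measurable_implies_sequence_metric[OF \<phi>m, of 0] by auto
  have out: "F i x = 0" if "x \<notin> K" for i x
    using F(3)[of i x] outside_supp[of x \<phi>] that by (simp add: K_def)
  have "val (F i) = 0" for i
  proof -
    have finr: "finite (range (F i))" using simple_functionD(1)[OF F(1)[of i]] by simp
    have sets: "F i -` {y} \<in> sets borel" for y
      using simple_functionD(2)[OF F(1)[of i], of "{y}"] by simp
    have "F i x = (\<Sum>y\<in>range (F i) - {0}. y * indicator (F i -` {y}) x)" for x
    proof -
      have "F i x = (\<Sum>y\<in>range (F i). indicator (F i -` {y}) x *\<^sub>R y)"
        using simple_function_indicator_representation_banach[OF F(1)[of i], of x]
        unfolding space_borel Int_UNIV_right by blast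
      also have "\<dots> = (\<Sum>y\<in>range (F i). y * indicator (F i -` {y}) x)"
        by (intro sum.cong refl) (simp add: indicator_def)
      also have "\<dots> = (\<Sum>y\<in>range (F i) - {0}. y * indicator (F i -` {y}) x)"
        by (rule sum.mono_neutral_right) (use finr in auto)
      finally show ?thesis .
    qed
    then have eq: "F i = (\<lambda>x. \<Sum>y\<in>range (F i) - {0}. y * indicator (F i -` {y}) x)" by (rule ext)
    have "val (\<lambda>x. \<Sum>y\<in>Y. y * indicator (F i -` {y}) x) = 0 \<and>
        (\<lambda>x. \<Sum>y\<in>Y. y * indicator (F i -` {y}) x) \<in> admissible K (\<Sum>y\<in>Y. norm y)"
      if "finite Y" "0 \<notin> Y" for Y
      using that
    proof (induction Y)
      case empty then show ?case by (simp add: val_def admissible_def)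
    next
      case (insert y Y)
      have sub: "F i -` {y} \<subseteq> K" using out insert.prems by auto
      have bd: "bounded (F i -` {y})" by (rule bounded_subset[OF compact_imp_bounded[OF K] sub])
      have a: "(\<lambda>x. y * indicator (F i -` {y}) x) \<in> admissible K (norm y)"
      proof -
        have "(\<lambda>x. y * indicator (F i -` {y}) x) \<in> borel_measurable borel"
          by (intro borel_measurable_times borel_measurable_const borel_measurable_indicator sets)
        then show ?thesis using sub unfolding admissible_def by (auto simp: norm_mult indicator_def)
      qed
      have b: "(\<lambda>x. \<Sum>y\<in>Y. y * indicator (F i -` {y}) x) \<in> admissible K (\<Sum>y\<in>Y. norm y)"
        and v: "val (\<lambda>x. \<Sum>y\<in>Y. y * indicator (F i -` {y}) x) = 0" using insert.IH insert.prems by simp_all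
      have "val (\<lambda>x. y * indicator (F i -` {y}) x) = 0" using z[OF sets bd] by (simp add: val_cmult)
      then have "val (\<lambda>x. y * indicator (F i -` {y}) x + (\<Sum>y\<in>Y. y * indicator (F i -` {y}) x)) = 0"
        using val_add[OF K a b] v by simp
      moreover have "(\<lambda>x. y * indicator (F i -` {y}) x + (\<Sum>y\<in>Y. y * indicator (F i -` {y}) x))
          \<in> admissible K (norm y + (\<Sum>y\<in>Y. norm y))"
        using a b unfolding admissible_def by (auto intro!: norm_triangle_mono)
      ultimately show ?case unfolding sum.insert[OF insert.hyps] by blast
    qed
    from this[of "range (F i) - {0}"] finr
    have "val (\<lambda>x. \<Sum>y\<in>range (F i) - {0}. y * indicator (F i -` {y}) x) = 0" by blast
    then show ?thesis by (subst eq)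
  qed
  moreover have "(\<lambda>i. val (F i)) \<longlonglongrightarrow> val \<phi>"
  proof (rule val_tendsto[OF K])
    have s0: "s \<ge> 0" by (rule order_trans[OF norm_ge_zero s])
    have "norm (F i x) \<le> 2 * s" for i x using F(3)[of i x] s[of x] by linarith
    then show "F i \<in> admissible K (2 * s)" for i
      unfolding admissible_def using borel_measurable_simple_function[OF F(1)[of i]] out by blast
    have "norm (\<phi> x) \<le> 2 * s" for x using s[of x] s0 by linarith
    then show "\<phi> \<in> admissible K (2 * s)"
      unfolding admissible_def K_def using \<phi>m outside_supp by blast
  qed (rule F(2))
  ultimately show ?thesis by (simp add: LIMSEQ_const_iff)
qed

end

text \<open>
  The measures of Borel sets under a Radon functional refer to the representing family picked by
  \<open>riesz\<close>, but the identity on test functions does not; so this equivalence makes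
  the formulation with Borel sets independent of that choice.
\<close>

lemma radon_density_iff:
  fixes L :: "'n::finite radon" and Ls :: "nat \<Rightarrow> 'n radon"
  assumes L: "L \<in> Radon" and Ls: "\<And>j. j \<in> {1..N} \<Longrightarrow> Ls j \<in> Radon"
    and g: "\<And>j. j \<in> {1..N} \<Longrightarrow> continuous_on UNIV (g j)"
  shows "(\<forall>B. bounded B \<longrightarrow> B \<in> sets borel \<longrightarrow> radon_measure L B = (\<Sum>j=1..N. radon_integral (Ls j) B (g j)))
    \<longleftrightarrow> (\<forall>\<phi>\<in>Cc. L \<phi> = (\<Sum>j=1..N. Ls j (\<lambda>x. g j x * \<phi> x)))"
proof -
  define LL where "LL j = (if j = 0 then L else Ls j)" for j
  \<comment> \<open>Index 0 carries the four measures of \<open>L\<close>; the measures of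
      \<open>Ls j\<close> enter with a minus sign, so that both sides of the equivalence
      say that \<open>val\<close> vanishes.\<close>
  define G where "G = (\<lambda>(j, k) x. if j = 0 then \<i> ^ k else - (\<i> ^ k * g j x))" 
  define J where "J = {0..N} \<times> {..<4::nat}"
  have rep: "represents (riesz (LL j)) (LL j)" if "j \<in> {0..N}" for j
    using that represents_riesz[OF L] represents_riesz[OF Ls] by (auto simp: LL_def)
  interpret density_combination J "\<lambda>(j, k). riesz (LL j) k" G
  proof
    show "finite J" by (simp add: J_def)
    fix p assume "p \<in> J"
    then obtain j k where p: "p = (j, k)" "j \<in> {0..N}" "k < 4" by (auto simp: J_def)
    show "locally_finite_borel (case p of (j, k) \<Rightarrow> riesz (LL j) k)"
      using rep[OF p(2)] p(3) unfolding p(1) represents_def locally_finite_borel_def by simp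
    show "continuous_on UNIV (G p)"
      using g[of j] p by (cases "j = 0") (auto simp: G_def intro!: continuous_intros)
  qed
  have split: "(\<Sum>p\<in>J. h p) = (\<Sum>k<4. h (0, k)) + (\<Sum>j=1..N. \<Sum>k<4. h (j, k))" for h :: "nat \<times> nat \<Rightarrow> complex"
  proof -
    have "(\<Sum>p\<in>J. h p) = (\<Sum>j=0..N. \<Sum>k<4. h (j, k))"
      unfolding J_def by (simp add: sum.cartesian_product)
    also have "\<dots> = (\<Sum>k<4. h (0, k)) + (\<Sum>j=1..N. \<Sum>k<4. h (j, k))"
      by (subst sum.atLeast_Suc_atMost) auto
    finally show ?thesis .
  qed
  have valsplit: "val h = (\<Sum>k<4. LINT x|riesz (LL 0) k. h x * G (0, k) x) +
      (\<Sum>j=1..N. \<Sum>k<4. LINT x|riesz (LL j) k. h x * G (j, k) x)" for h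
    unfolding val_def split by simp
  have vB: "val (indicator B) = radon_measure L B - (\<Sum>j=1..N. radon_integral (Ls j) B (g j))"
    if B: "B \<in> sets borel" for B
  proof -
    have 0: "(LINT x|riesz L k. indicator B x * \<i> ^ k) = \<i> ^ k * of_real (measure (riesz L k) B)" if "k < 4" for k
    proof -
      have "sets (riesz L k) = sets borel" using represents_riesz[OF L] that by (simp add: represents_def)
      then have "space (riesz L k) = UNIV" by (metis sets_eq_imp_space_eq space_borel)
      then have "(LINT x|riesz L k. indicator B x) = measure (riesz L k) B" by simp
      then have "(LINT x|riesz L k. complex_of_real (indicator B x)) = of_real (measure (riesz L k) B)"
        by (simp only: integral_complex_of_real)
      then have "(LINT x|riesz L k. indicator B x :: complex) = of_real (measure (riesz L k) B)"
        by (simp only: of_real_indicator)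
      then show ?thesis by (simp only: integral_mult_left_zero mult.commute)
    qed
    have 1: "(LINT x|M. indicator B x * - (\<i> ^ k * h x)) = - (\<i> ^ k * (LINT x:B|M. h x))" for M k and h :: "real^'n \<Rightarrow> complex"
    proof -
      have "(LINT x|M. indicator B x * - (\<i> ^ k * h x)) = (LINT x|M. - (\<i> ^ k) * (indicator B x *\<^sub>R h x))"
        by (intro Bochner_Integration.integral_cong refl) (simp add: indicator_def)
      also have "\<dots> = - (\<i> ^ k) * (LINT x|M. indicator B x *\<^sub>R h x)" by (rule integral_mult_right_zero)
      finally show ?thesis by (simp add: set_lebesgue_integral_def)
    qed
    have "val (indicator B) = (\<Sum>k<4. LINT x|riesz L k. indicator B x * \<i> ^ k) +
        (\<Sum>j=1..N. \<Sum>k<4. LINT x|riesz (Ls j) k. indicator B x * - (\<i> ^ k * g j x))"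
      unfolding valsplit by (intro arg_cong2[where f="(+)"] sum.cong refl) (simp_all add: G_def LL_def)
    also have "(\<Sum>k<4. LINT x|riesz L k. indicator B x * \<i> ^ k) = radon_measure L B"
      unfolding radon_measure_def by (intro sum.cong refl 0) simp
    also have "(\<Sum>j=1..N. \<Sum>k<4. LINT x|riesz (Ls j) k. indicator B x * - (\<i> ^ k * g j x))
        = (\<Sum>j=1..N. - radon_integral (Ls j) B (g j))"
      unfolding radon_integral_def sum_negf[symmetric] by (intro sum.cong refl 1)
    finally show ?thesis by (simp add: sum_negf)
  qed
  have vC: "val \<phi> = L \<phi> - (\<Sum>j=1..N. Ls j (\<lambda>x. g j x * \<phi> x))" if \<phi>: "\<phi> \<in> Cc" for \<phi>
  proof -
    have 0: "(\<Sum>k<4. LINT x|riesz L k. \<phi> x * \<i> ^ k) = L \<phi>"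
      using represents_riesz[OF L] \<phi> by (simp add: represents_def mult.commute)
    have 1: "(\<Sum>k<4. LINT x|riesz (Ls j) k. \<phi> x * - (\<i> ^ k * g j x)) = - Ls j (\<lambda>x. g j x * \<phi> x)"
      if j: "j \<in> {1..N}" for j
    proof -
      have "(\<lambda>x. g j x * \<phi> x) \<in> Cc" by (rule Cc_mult(1)[OF \<phi> g[OF j]])
      then have "Ls j (\<lambda>x. g j x * \<phi> x) = (\<Sum>k<4. \<i> ^ k * (LINT x|riesz (Ls j) k. g j x * \<phi> x))"
        using represents_riesz[OF Ls[OF j]] unfolding represents_def by blast
      moreover have "(LINT x|riesz (Ls j) k. \<phi> x * - (\<i> ^ k * g j x)) = - (\<i> ^ k * (LINT x|riesz (Ls j) k. g j x * \<phi> x))" for k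
      proof -
        have "(LINT x|riesz (Ls j) k. \<phi> x * - (\<i> ^ k * g j x)) = (LINT x|riesz (Ls j) k. - (\<i> ^ k) * (g j x * \<phi> x))"
          by (intro Bochner_Integration.integral_cong refl) simp
        also have "\<dots> = - (\<i> ^ k) * (LINT x|riesz (Ls j) k. g j x * \<phi> x)" by (rule integral_mult_right_zero)
        finally show ?thesis by simp
      qed
      ultimately show ?thesis by (simp add: sum_negf)
    qed
    have "val \<phi> = (\<Sum>k<4. LINT x|riesz L k. \<phi> x * \<i> ^ k) + (\<Sum>j=1..N. \<Sum>k<4. LINT x|riesz (Ls j) k. \<phi> x * - (\<i> ^ k * g j x))"
      unfolding valsplit by (intro arg_cong2[where f="(+)"] sum.cong refl) (simp_all add: G_def LL_def)
    also have "\<dots> = L \<phi> + (\<Sum>j=1..N. - Ls j (\<lambda>x. g j x * \<phi> x))"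
      unfolding 0 by (intro arg_cong2[where f="(+)"] refl sum.cong 1)
    finally show ?thesis by (simp add: sum_negf)
  qed
  show ?thesis
  proof
    assume *: "\<forall>B. bounded B \<longrightarrow> B \<in> sets borel \<longrightarrow> radon_measure L B = (\<Sum>j=1..N. radon_integral (Ls j) B (g j))"
    show "\<forall>\<phi>\<in>Cc. L \<phi> = (\<Sum>j=1..N. Ls j (\<lambda>x. g j x * \<phi> x))"
    proof
      fix \<phi> :: "real^'n \<Rightarrow> complex" assume \<phi>: "\<phi> \<in> Cc"
      have "val \<phi> = 0" by (rule val_Cc_of_indicator[OF _ \<phi>]) (use * vB in simp)
      then show "L \<phi> = (\<Sum>j=1..N. Ls j (\<lambda>x. g j x * \<phi> x))" by (simp add: vC[OF \<phi>])
    qed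
  next
    assume *: "\<forall>\<phi>\<in>Cc. L \<phi> = (\<Sum>j=1..N. Ls j (\<lambda>x. g j x * \<phi> x))"
    show "\<forall>B. bounded B \<longrightarrow> B \<in> sets borel \<longrightarrow> radon_measure L B = (\<Sum>j=1..N. radon_integral (Ls j) B (g j))"
    proof (intro allI impI)
      fix B :: "(real^'n) set" assume B: "bounded B" "B \<in> sets borel"
      have "val (indicator B) = 0" by (rule val_indicator_of_Cc[OF _ B(2,1)]) (use * vC in simp)
      then show "radon_measure L B = (\<Sum>j=1..N. radon_integral (Ls j) B (g j))" by (simp add: vB[OF B(2)])
    qed
  qed
qed

section \<open>Polynomial local functionals\<close>

lemma PLV_Radon: "\<Theta> \<in> PLV d \<Longrightarrow> f \<in> Conv \<Longrightarrow> \<Theta> f \<in> Radon"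
  and PLV_outside: "\<Theta> \<in> PLV d \<Longrightarrow> f \<notin> Conv \<Longrightarrow> \<Theta> f \<phi> = 0"
  by (auto simp: PLV_def)

lemma PLV_not_Cc: "\<Theta> \<in> PLV d \<Longrightarrow> \<phi> \<notin> Cc \<Longrightarrow> \<Theta> f \<phi> = 0"
  using PLV_Radon PLV_outside Radon_outside by metis

lemma PLV_continuous: "\<Theta> \<in> PLV d \<Longrightarrow> continuous_on Conv \<Theta>"
  and PLV_local: "\<Theta> \<in> PLV d \<Longrightarrow> local_functional \<Theta>"
  and PLV_polynomial: "\<Theta> \<in> PLV d \<Longrightarrow> f \<in> Conv \<Longrightarrow> polynomial_on_affine d (\<lambda>l. \<Theta> (f + l))"
  by (simp_all add: PLV_def)

lemma PLV_tendsto: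
  assumes "\<Theta> \<in> PLV d" "\<And>m. f m \<in> Conv" "g \<in> Conv" "f \<longlonglongrightarrow> g"
  shows "(\<lambda>m. \<Theta> (f m) \<phi>) \<longlonglongrightarrow> \<Theta> g \<phi>"
proof -
  from continuous_on_tendsto_compose[OF PLV_continuous[OF assms(1)] assms(4,3)]
  have "(\<lambda>m. \<Theta> (f m)) \<longlonglongrightarrow> \<Theta> g" using assms(2) by simp
  then show ?thesis unfolding tendsto_function_iff by (rule spec)
qed

lemma PLV_bounded_on_compact:
  assumes "\<Theta> \<in> PLV d" "compact K" "K \<subseteq> Conv"
  obtains C where "\<And>f. f \<in> K \<Longrightarrow> norm (\<Theta> f \<phi>) \<le> C"
proof -
  have "continuous_on Conv (\<lambda>f. \<Theta> f \<phi>)"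
    by (rule continuous_on_product_then_coordinatewise[OF PLV_continuous[OF assms(1)]])
  then have "compact ((\<lambda>f. \<Theta> f \<phi>) ` K)"
    by (intro compact_continuous_image assms(2) continuous_on_subset[OF _ assms(3)])
  then have "bounded ((\<lambda>f. \<Theta> f \<phi>) ` K)" by (rule compact_imp_bounded)
  then obtain C where "\<forall>z\<in>(\<lambda>f. \<Theta> f \<phi>) ` K. norm z \<le> C" unfolding bounded_iff by (rule exE)
  then show ?thesis by (intro that[of C]) simp
qed

text \<open>
  Continuity bounds the values at each test function on the compact set \<open>K\<close>;
  Banach-Steinhaus makes the bound uniform in the test function.
\<close>

lemma PLV_uniform_bound:
  assumes \<Theta>: "\<Theta> \<in> PLV d" and K: "compact K" "K \<subseteq> Conv" and A: "compact A"
  shows "\<exists>C\<ge>0. \<forall>f\<in>K. \<forall>\<phi>\<in>Cc. \<forall>s. (\<forall>x. x \<notin> A \<longrightarrow> \<phi> x = 0) \<longrightarrow> (\<forall>x. norm (\<phi> x) \<le> s) \<longrightarrow> norm (\<Theta> f \<phi>) \<le> C * s"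
proof -
  have sub: "\<Theta> ` K \<subseteq> Radon" using PLV_Radon[OF \<Theta>] K(2) by blast
  have pt: "\<exists>C. \<forall>L\<in>\<Theta> ` K. norm (L \<psi>) \<le> C" for \<psi>
  proof (rule PLV_bounded_on_compact[OF \<Theta> K, of \<psi>])
    fix C assume "\<And>f. f \<in> K \<Longrightarrow> norm (\<Theta> f \<psi>) \<le> C"
    then show ?thesis by (intro exI[of _ C]) auto
  qed
  show ?thesis
  proof (rule Radon_uniform_bound[OF sub pt A])
    fix C :: real
    assume C: "0 \<le> C" "\<And>L \<phi> s. L \<in> \<Theta> ` K \<Longrightarrow> \<phi> \<in> Cc \<Longrightarrow> (\<And>x. x \<notin> A \<Longrightarrow> \<phi> x = 0) \<Longrightarrow>
      (\<And>x. norm (\<phi> x) \<le> s) \<Longrightarrow> norm (L \<phi>) \<le> C * s"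
    show ?thesis
    proof (rule exI[of _ C], intro conjI C(1) ballI allI impI)
      fix f \<phi> s assume "f \<in> K" "\<phi> \<in> Cc" "\<forall>x. x \<notin> A \<longrightarrow> \<phi> x = 0" "\<forall>x. norm (\<phi> x) \<le> s"
      then show "norm (\<Theta> f \<phi>) \<le> C * s" by (intro C(2) imageI) simp_all
    qed
  qed
qed

lemma uniform_limit_translates:
  assumes \<phi>: "\<phi> \<in> Cc" and x: "x \<longlonglongrightarrow> a"
  shows "uniform_limit UNIV (\<lambda>m y. \<phi> (y + x m)) (\<lambda>y. \<phi> (y + a)) sequentially"
proof (rule uniform_limitI)
  fix e :: real assume "e > 0"
  then obtain \<delta> where \<delta>: "\<delta> > 0" "\<And>y z. dist y z < \<delta> \<Longrightarrow> norm (\<phi> y - \<phi> z) < e"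
    using Cc_uniformly_continuous[OF \<phi>, of e] by blast
  have "\<forall>\<^sub>F m in sequentially. dist (x m) a < \<delta>" using x \<delta>(1) by (rule tendstoD)
  then show "\<forall>\<^sub>F m in sequentially. \<forall>y\<in>UNIV. dist (\<phi> (y + x m)) (\<phi> (y + a)) < e"
    by eventually_elim (simp add: dist_norm \<delta>(2))
qed

lemma PLV_joint_tendsto:
  assumes \<Theta>: "\<Theta> \<in> PLV d" and f: "\<And>m. f m \<in> Conv" "g \<in> Conv" "f \<longlonglongrightarrow> g" and x: "x \<longlonglongrightarrow> a"
    and A: "compact A" and \<rho>: "\<And>m. \<rho> m \<in> Cc" "\<And>m y. y \<notin> A \<Longrightarrow> \<rho> m y = 0" "r \<in> Cc" "\<And>y. y \<notin> A \<Longrightarrow> r y = 0"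
    and unif: "uniform_limit UNIV \<rho> r sequentially" and \<phi>: "\<phi> \<in> Cc"
  shows "(\<lambda>m. \<Theta> (\<lambda>y. f m (y + x m)) (\<lambda>y. \<rho> m y * \<phi> (y + x m))) \<longlonglongrightarrow> \<Theta> (\<lambda>y. g (y + a)) (\<lambda>y. r y * \<phi> (y + a))"
proof (rule Radon_tendsto[where L="\<lambda>m. \<Theta> (\<lambda>y. f m (y + x m))" and L'="\<Theta> (\<lambda>y. g (y + a))"
      and \<psi>m="\<lambda>m y. \<rho> m y * \<phi> (y + x m)" and \<psi>="\<lambda>y. r y * \<phi> (y + a)", OF _ _ _ A])
  show "\<Theta> (\<lambda>y. f m (y + x m)) \<in> Radon" for m by (intro PLV_Radon[OF \<Theta>] Conv_translate f)
  show "\<Theta> (\<lambda>y. g (y + a)) \<in> Radon" by (intro PLV_Radon[OF \<Theta>] Conv_translate f)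
  show "(\<lambda>m. \<Theta> (\<lambda>y. f m (y + x m)) \<psi>) \<longlonglongrightarrow> \<Theta> (\<lambda>y. g (y + a)) \<psi>" for \<psi>
    by (intro PLV_tendsto[OF \<Theta>] Conv_translate f Conv_translate_tendsto x)
  have ct: "continuous_on UNIV (\<lambda>y. \<phi> (y + z))" for z by (intro Cc_continuous Cc_translate \<phi>)
  show "(\<lambda>y. \<rho> m y * \<phi> (y + x m)) \<in> Cc" "(\<lambda>y. r y * \<phi> (y + a)) \<in> Cc" for m
    by (intro Cc_mult(2) \<rho> ct)+
  show "\<rho> m y * \<phi> (y + x m) = 0" "r y * \<phi> (y + a) = 0" if "y \<notin> A" for m y
    using \<rho> that by simp_all
  have bd: "bounded (range \<psi>)" if "\<psi> \<in> Cc" for \<psi> :: "real^'a \<Rightarrow> complex"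
  proof (rule Cc_bounded[OF that])
    fix s assume "\<And>x. norm (\<psi> x) \<le> s"
    then show ?thesis unfolding bounded_iff by (intro exI[of _ s]) auto
  qed
  show "uniform_limit UNIV (\<lambda>m y. \<rho> m y * \<phi> (y + x m)) (\<lambda>y. r y * \<phi> (y + a)) sequentially"
    by (intro uniform_lim_mult unif uniform_limit_translates \<phi> x bd \<rho> Cc_translate)
qed

section \<open>Averages over translations\<close>

lemma integrable_compact_support:
  fixes G :: "real^'n::finite \<Rightarrow> complex"
  assumes "continuous_on UNIV G" "compact X" "\<And>x. x \<notin> X \<Longrightarrow> G x = 0"
  shows "integrable lborel G"
proof -
  have "integrable lborel (\<lambda>x. indicator X x *\<^sub>R G x)"
    by (rule borel_integrable_compact[OF assms(2) continuous_on_subset[OF assms(1)]]) simp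
  moreover have "(\<lambda>x. indicator X x *\<^sub>R G x) = G" using assms(3) by (auto simp: indicator_def)
  ultimately show ?thesis by simp
qed

lemma integral_bound_compact_support:
  fixes G :: "real^'n::finite \<Rightarrow> complex"
  assumes "continuous_on UNIV G" "compact X" "\<And>x. x \<notin> X \<Longrightarrow> G x = 0" "\<And>x. norm (G x) \<le> s"
  shows "norm (LINT x|lborel. G x) \<le> s * measure lborel X"
proof -
  have X: "X \<in> sets lborel" "emeasure lborel X < \<infinity>"
    using assms(2) emeasure_compact_finite[OF assms(2)] by (auto intro: borel_compact)
  have iX: "integrable lborel (\<lambda>x. indicator X x * s)"
    by (intro integrable_mult_left integrable_real_indicator X)
  have "norm (LINT x|lborel. G x) \<le> (LINT x|lborel. norm (G x))" by (rule integral_norm_bound)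
  also have "\<dots> \<le> (LINT x|lborel. indicator X x * s)"
    by (rule integral_mono[OF integrable_norm[OF integrable_compact_support[OF assms(1-3)]] iX])
       (use assms(3,4) in \<open>auto simp: indicator_def\<close>)
  also have "\<dots> = s * measure lborel X" by simp
  finally show ?thesis .
qed

text \<open>
  Continuous convergence on a compact set is uniform, so integrals converge. The hypothesis
  speaks of subsequences because a failure of uniform convergence produces a subsequence.
\<close>

lemma integral_tendsto_continuous_convergence:
  fixes G :: "nat \<Rightarrow> real^'n::finite \<Rightarrow> complex"
  assumes G: "\<And>m. continuous_on UNIV (G m)" "continuous_on UNIV H"
    and X: "compact X" "\<And>m x. x \<notin> X \<Longrightarrow> G m x = 0" "\<And>x. x \<notin> X \<Longrightarrow> H x = 0"
    and conv: "\<And>r x a. strict_mono r \<Longrightarrow> x \<longlonglongrightarrow> a \<Longrightarrow> (\<lambda>k. G (r k) (x k)) \<longlonglongrightarrow> H a"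
  shows "(\<lambda>m. LINT x|lborel. G m x) \<longlonglongrightarrow> (LINT x|lborel. H x)"
proof -
  have unif: "\<exists>M. \<forall>m\<ge>M. \<forall>x. norm (G m x - H x) < e" if e: "e > 0" for e :: real
  proof (rule ccontr)
    assume "\<not> ?thesis"
    then have *: "\<forall>M. \<exists>m\<ge>M. \<exists>x. \<not> norm (G m x - H x) < e" by blast
    define B where "B = {m. \<exists>x. \<not> norm (G m x - H x) < e}"
    have "infinite B" unfolding infinite_nat_iff_unbounded_le B_def using * by blast
    define r0 where "r0 = enumerate B"
    have r0: "strict_mono r0" "\<And>k. r0 k \<in> B"
      unfolding r0_def using \<open>infinite B\<close> by (simp_all add: strict_mono_enumerate enumerate_in_set)
    have "\<forall>k. \<exists>x. \<not> norm (G (r0 k) x - H x) < e" using r0(2) by (simp add: B_def)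
    from choice[OF this] obtain x where x: "\<forall>k. \<not> norm (G (r0 k) (x k) - H (x k)) < e" by (rule exE)
    have "x k \<in> X" for k
    proof (rule ccontr)
      assume "x k \<notin> X"
      then show False using x[rule_format, of k] e by (simp add: X)
    qed
    then have "\<exists>l\<in>X. \<exists>r. strict_mono (r :: nat \<Rightarrow> nat) \<and> (x \<circ> r) \<longlonglongrightarrow> l"
      by (intro X(1)[unfolded compact_def, rule_format]) simp
    then obtain a r1 where r1: "strict_mono (r1 :: nat \<Rightarrow> nat)" "(x \<circ> r1) \<longlonglongrightarrow> a"
      by (elim bexE exE conjE)
    have "(\<lambda>k. G ((r0 \<circ> r1) k) ((x \<circ> r1) k)) \<longlonglongrightarrow> H a"
      by (rule conv[OF strict_mono_o[OF r0(1) r1(1)] r1(2)])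
    moreover have "(\<lambda>k. H ((x \<circ> r1) k)) \<longlonglongrightarrow> H a"
      by (rule continuous_on_tendsto_compose[OF G(2) r1(2)]) auto
    ultimately have "(\<lambda>k. G ((r0 \<circ> r1) k) ((x \<circ> r1) k) - H ((x \<circ> r1) k)) \<longlonglongrightarrow> H a - H a"
      by (rule tendsto_diff)
    then have "(\<lambda>k. G ((r0 \<circ> r1) k) ((x \<circ> r1) k) - H ((x \<circ> r1) k)) \<longlonglongrightarrow> 0" by simp
    from LIMSEQ_D[OF this e] obtain k where "norm (G ((r0 \<circ> r1) k) ((x \<circ> r1) k) - H ((x \<circ> r1) k) - 0) < e"
      by blast
    then show False using x[rule_format, of "r1 k"] by simp
  qed
  have int: "integrable lborel (G m)" "integrable lborel H" for m
    by (rule integrable_compact_support[OF G(1) X(1,2)], assumption)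
       (rule integrable_compact_support[OF G(2) X(1,3)])
  show ?thesis
  proof (rule LIMSEQ_I)
    fix e :: real assume e: "e > 0"
    define c where "c = measure lborel X + 1"
    have c: "c > 0" by (simp add: c_def add_nonneg_pos)
    define s where "s = e / (2 * c)"
    have s: "s > 0" using e c by (simp add: s_def)
    obtain M where M: "\<forall>m\<ge>M. \<forall>x. norm (G m x - H x) < s" using unif[OF s] by (rule exE)
    have "norm ((LINT x|lborel. G m x) - (LINT x|lborel. H x)) < e" if "m \<ge> M" for m
    proof -
      have "norm (LINT x|lborel. G m x - H x) \<le> s * measure lborel X"
        by (rule integral_bound_compact_support[OF continuous_on_diff[OF G(1,2)] X(1)])
           (use M that X in \<open>auto intro: less_imp_le\<close>)
      also have "\<dots> \<le> s * c" using s by (simp add: c_def)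
      also have "\<dots> = e / 2" using c by (simp add: s_def)
      also have "\<dots> < e" using e by simp
      finally show ?thesis by (simp add: Bochner_Integration.integral_diff[OF int])
    qed
    then show "\<exists>M. \<forall>m\<ge>M. norm ((LINT x|lborel. G m x) - (LINT x|lborel. H x)) < e" by blast
  qed
qed

text \<open>
  The integral over \<open>x\<close> of the translates by \<open>x\<close> of the functional
  \<open>\<rho>\<Theta>\<close>, which multiplies the measure \<open>\<Theta> f\<close> by the
  density \<open>\<rho>\<close>.
\<close>

definition translation_average :: "(real^'n::finite \<Rightarrow> complex) \<Rightarrow> 'n functional \<Rightarrow> 'n functional" where
  "translation_average \<rho> \<Theta> = (\<lambda>f \<phi>. if \<phi> \<in> Cc
     then LINT x|lborel. \<Theta> (\<lambda>y. f (y + x)) (\<lambda>y. \<rho> y * \<phi> (y + x)) else 0)"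

text \<open>
  The translations that move some point of \<open>A\<close> into \<open>B\<close>. The integrand
  of an average vanishes outside such a compact set.
\<close>

definition shifts :: "(real^'n::finite) set \<Rightarrow> (real^'n) set \<Rightarrow> (real^'n) set" where
  "shifts A B = {b - a |b a. b \<in> B \<and> a \<in> A}"

lemma compact_shifts: "compact A \<Longrightarrow> compact B \<Longrightarrow> compact (shifts A B)"
  unfolding shifts_def by (rule compact_differences)

lemma outside_shifts:
  assumes "x \<notin> shifts A B" "\<And>y. y \<notin> A \<Longrightarrow> \<rho> y = 0" "\<And>y. y \<notin> B \<Longrightarrow> \<phi> y = (0::complex)"
  shows "(\<lambda>y. \<rho> y * \<phi> (y + x)) = (\<lambda>y. 0)"
proof
  fix y
  have "y \<notin> A \<or> y + x \<notin> B"
  proof (rule ccontr)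
    assume "\<not> ?thesis"
    then have "x = (y + x) - y \<and> y + x \<in> B \<and> y \<in> A" by simp
    then show False using assms(1) unfolding shifts_def by blast
  qed
  then show "\<rho> y * \<phi> (y + x) = 0" using assms(2,3) by auto
qed

context
  fixes d :: nat and \<Theta> :: "'n::finite functional" and \<rho> :: "real^'n \<Rightarrow> complex" and A :: "(real^'n) set"
  assumes \<Theta>: "\<Theta> \<in> PLV d" and \<rho>: "\<rho> \<in> Cc" and A: "compact A" and \<rho>A: "\<And>y. y \<notin> A \<Longrightarrow> \<rho> y = 0"
begin

lemma average_integrand_outside:
  assumes f: "f \<in> Conv" and "\<And>y. y \<notin> B \<Longrightarrow> \<phi> y = 0" "x \<notin> shifts A B"
  shows "\<Theta> (\<lambda>y. f (y + x)) (\<lambda>y. \<rho> y * \<phi> (y + x)) = 0"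
proof -
  have "(\<lambda>y. \<rho> y * \<phi> (y + x)) = (\<lambda>y. 0)"
    by (rule outside_shifts[OF assms(3)]) (use \<rho>A assms(2) in auto)
  then show ?thesis by (simp only: Radon_zero[OF PLV_Radon[OF \<Theta> Conv_translate[OF f]]])
qed

lemma average_integrand_outside_supp:
  assumes f: "f \<in> Conv" and "x \<notin> shifts A (supp \<phi>)"
  shows "\<Theta> (\<lambda>y. f (y + x)) (\<lambda>y. \<rho> y * \<phi> (y + x)) = 0"
  by (rule average_integrand_outside[OF f _ assms(2)]) (rule outside_supp)

lemma average_integrand_continuous:
  assumes f: "f \<in> Conv" and \<phi>: "\<phi> \<in> Cc"
  shows "continuous_on UNIV (\<lambda>x. \<Theta> (\<lambda>y. f (y + x)) (\<lambda>y. \<rho> y * \<phi> (y + x)))"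
  unfolding continuous_on_sequentially comp_def
proof (intro allI ballI impI, elim conjE)
  fix x :: "nat \<Rightarrow> real^'n" and a assume "x \<longlonglongrightarrow> a"
  show "(\<lambda>m. \<Theta> (\<lambda>y. f (y + x m)) (\<lambda>y. \<rho> y * \<phi> (y + x m))) \<longlonglongrightarrow> \<Theta> (\<lambda>y. f (y + a)) (\<lambda>y. \<rho> y * \<phi> (y + a))"
    by (rule PLV_joint_tendsto[OF \<Theta> f f tendsto_const \<open>x \<longlonglongrightarrow> a\<close> A \<rho> \<rho>A \<rho> \<rho>A uniform_limit_const \<phi>])
qed

lemma average_integrand_integrable:
  assumes f: "f \<in> Conv" and \<phi>: "\<phi> \<in> Cc"
  shows "integrable lborel (\<lambda>x. \<Theta> (\<lambda>y. f (y + x)) (\<lambda>y. \<rho> y * \<phi> (y + x)))"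
  by (rule integrable_compact_support[OF average_integrand_continuous[OF f \<phi>]
        compact_shifts[OF A Cc_compact_supp[OF \<phi>]] average_integrand_outside_supp[OF f]])

lemma average_Radon:
  assumes f: "f \<in> Conv"
  shows "translation_average \<rho> \<Theta> f \<in> Radon"
proof (rule RadonI)
  show "translation_average \<rho> \<Theta> f \<phi> = 0" if "\<phi> \<notin> Cc" for \<phi>
    using that by (simp add: translation_average_def)
next
  fix \<phi> \<psi> :: "real^'n \<Rightarrow> complex" assume c: "\<phi> \<in> Cc" "\<psi> \<in> Cc"
  have m: "(\<lambda>y. \<rho> y * \<phi> (y + x)) \<in> Cc" if "\<phi> \<in> Cc" for \<phi> x
    by (intro Cc_mult(2)[OF \<rho>] Cc_continuous Cc_translate that)
  have "\<Theta> (\<lambda>y. f (y + x)) (\<lambda>y. \<rho> y * (\<phi> (y + x) + \<psi> (y + x))) =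
      \<Theta> (\<lambda>y. f (y + x)) (\<lambda>y. \<rho> y * \<phi> (y + x)) + \<Theta> (\<lambda>y. f (y + x)) (\<lambda>y. \<rho> y * \<psi> (y + x))" for x
    unfolding distrib_left by (rule Radon_add[OF PLV_Radon[OF \<Theta> Conv_translate[OF f]] m m]) (rule c)+
  then show "translation_average \<rho> \<Theta> f (\<lambda>x. \<phi> x + \<psi> x) = translation_average \<rho> \<Theta> f \<phi> + translation_average \<rho> \<Theta> f \<psi>"
    using c by (simp add: translation_average_def Cc_add
        Bochner_Integration.integral_add[OF average_integrand_integrable[OF f] average_integrand_integrable[OF f]])
next
  fix a and \<phi> :: "real^'n \<Rightarrow> complex" assume c: "\<phi> \<in> Cc"
  have m: "(\<lambda>y. \<rho> y * \<phi> (y + x)) \<in> Cc" for x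
    by (intro Cc_mult(2)[OF \<rho>] Cc_continuous Cc_translate c)
  have "\<Theta> (\<lambda>y. f (y + x)) (\<lambda>y. \<rho> y * (a * \<phi> (y + x))) = a * \<Theta> (\<lambda>y. f (y + x)) (\<lambda>y. \<rho> y * \<phi> (y + x))" for x
    unfolding mult.left_commute[of _ a] by (rule Radon_cmult[OF PLV_Radon[OF \<Theta> Conv_translate[OF f]] m])
  then show "translation_average \<rho> \<Theta> f (\<lambda>x. a * \<phi> x) = a * translation_average \<rho> \<Theta> f \<phi>"
    using c by (simp add: translation_average_def Cc_cmult)
next
  fix B :: "(real^'n) set" assume B: "compact B"
  define X where "X = shifts A B"
  have X: "compact X" unfolding X_def by (rule compact_shifts[OF A B])
  obtain C where C: "C \<ge> 0" "\<forall>h\<in>(\<lambda>x y. f (y + x)) ` X. \<forall>\<phi>\<in>Cc. \<forall>s. (\<forall>x. x \<notin> A \<longrightarrow> \<phi> x = 0) \<longrightarrow>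
      (\<forall>x. norm (\<phi> x) \<le> s) \<longrightarrow> norm (\<Theta> h \<phi>) \<le> C * s"
  proof -
    have "(\<lambda>x y. f (y + x)) ` X \<subseteq> Conv" using Conv_translate[OF f] by blast
    from PLV_uniform_bound[OF \<Theta> compact_translates[OF f X] this A] show ?thesis
      by (elim exE conjE) (rule that)
  qed
  obtain t where t: "t > 0" "\<And>y. norm (\<rho> y) \<le> t" by (rule Cc_bounded[OF \<rho>]) blast
  have "norm (translation_average \<rho> \<Theta> f \<phi>) \<le> (C * t * measure lborel X) * s"
    if \<phi>: "\<phi> \<in> Cc" "\<forall>x. x \<notin> B \<longrightarrow> \<phi> x = 0" "\<forall>x. norm (\<phi> x) \<le> s" for \<phi> s
  proof -
    have s: "s \<ge> 0" using order_trans[OF norm_ge_zero \<phi>(3)[rule_format]] .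
    have b: "norm (\<Theta> (\<lambda>y. f (y + x)) (\<lambda>y. \<rho> y * \<phi> (y + x))) \<le> C * (t * s)" for x
    proof (cases "x \<in> X")
      case True
      show ?thesis
      proof (rule C(2)[rule_format])
        show "(\<lambda>y. f (y + x)) \<in> (\<lambda>x y. f (y + x)) ` X" using True by (rule imageI)
        show "(\<lambda>y. \<rho> y * \<phi> (y + x)) \<in> Cc" by (rule Cc_mult(2)[OF \<rho> Cc_continuous[OF Cc_translate[OF \<phi>(1)]]])
        show "\<rho> y * \<phi> (y + x) = 0" if "y \<notin> A" for y using \<rho>A[OF that] by simp
        show "norm (\<rho> y * \<phi> (y + x)) \<le> t * s" for y
          unfolding norm_mult by (rule mult_mono) (use t \<phi>(3) in \<open>auto intro: less_imp_le\<close>)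
      qed
    next
      case False
      then show ?thesis
        using average_integrand_outside[OF f, of B \<phi> x] \<phi>(2) C(1) t(1) s by (simp add: X_def)
    qed
    have "norm (LINT x|lborel. \<Theta> (\<lambda>y. f (y + x)) (\<lambda>y. \<rho> y * \<phi> (y + x))) \<le> C * (t * s) * measure lborel X"
      by (rule integral_bound_compact_support[OF average_integrand_continuous[OF f \<phi>(1)] X _ b])
         (use average_integrand_outside[OF f, of B \<phi>] \<phi>(2) in \<open>simp add: X_def\<close>)
    then show ?thesis using \<phi>(1) by (simp add: translation_average_def mult_ac)
  qed
  then show "\<exists>C. \<forall>\<phi>\<in>Cc. \<forall>s. (\<forall>x. x \<notin> B \<longrightarrow> \<phi> x = 0) \<longrightarrow> (\<forall>x. norm (\<phi> x) \<le> s) \<longrightarrow>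
      norm (translation_average \<rho> \<Theta> f \<phi>) \<le> C * s" by blast
qed

lemma average_tendsto:
  assumes f: "\<And>m. f m \<in> Conv" "g \<in> Conv" "f \<longlonglongrightarrow> g"
  shows "(\<lambda>m. translation_average \<rho> \<Theta> (f m) \<phi>) \<longlonglongrightarrow> translation_average \<rho> \<Theta> g \<phi>"
proof (cases "\<phi> \<in> Cc")
  case True
  have "(\<lambda>m. LINT x|lborel. \<Theta> (\<lambda>y. f m (y + x)) (\<lambda>y. \<rho> y * \<phi> (y + x))) \<longlonglongrightarrow>
      (LINT x|lborel. \<Theta> (\<lambda>y. g (y + x)) (\<lambda>y. \<rho> y * \<phi> (y + x)))"
  proof (rule integral_tendsto_continuous_convergence[OF average_integrand_continuous[OF f(1) True]
        average_integrand_continuous[OF f(2) True] compact_shifts[OF A Cc_compact_supp[OF True]]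
        average_integrand_outside_supp[OF f(1)] average_integrand_outside_supp[OF f(2)]])
    fix r :: "nat \<Rightarrow> nat" and x :: "nat \<Rightarrow> real^'n" and a
    assume r: "strict_mono r" and x: "x \<longlonglongrightarrow> a"
    have "(\<lambda>k. f (r k)) \<longlonglongrightarrow> g" using LIMSEQ_subseq_LIMSEQ[OF f(3) r] by (simp add: comp_def)
    from PLV_joint_tendsto[OF \<Theta> f(1) f(2) this x A \<rho> \<rho>A \<rho> \<rho>A uniform_limit_const True]
    show "(\<lambda>k. \<Theta> (\<lambda>y. f (r k) (y + x k)) (\<lambda>y. \<rho> y * \<phi> (y + x k))) \<longlonglongrightarrow> \<Theta> (\<lambda>y. g (y + a)) (\<lambda>y. \<rho> y * \<phi> (y + a))" .
  qed
  then show ?thesis using True by (simp add: translation_average_def)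
qed (simp add: translation_average_def)

text \<open>
  For each translation the integrand is a polynomial in the affine function, and interpolation
  at fixed nodes takes the coefficients out of the integral.
\<close>

lemma average_polynomial:
  assumes f: "f \<in> Conv"
  shows "polynomial_on_affine d (\<lambda>l. translation_average \<rho> \<Theta> (f + l))"
proof (rule polynomial_on_affineI)
  show "translation_average \<rho> \<Theta> (f + (\<lambda>x. v \<bullet> x + c)) \<in> Radon" for v c
    by (rule average_Radon[OF Conv_add_affine[OF f]])
  fix \<phi> :: "real^'n \<Rightarrow> complex"
  define F where "F z = f + (\<lambda>x. fst z \<bullet> x + snd z)" for z :: "(real^'n) \<times> real"
  define q where "q x z = \<Theta> (\<lambda>y. F z (y + x)) (\<lambda>y. \<rho> y * \<phi> (y + x))" for x z
  have Fc: "F z \<in> Conv" for z unfolding F_def by (rule Conv_add_affine[OF f])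
  have pq: "polynomial_fun d (q x)" for x
  proof -
    have "polynomial_on_affine d (\<lambda>l. \<Theta> ((\<lambda>y. f (y + x)) + l))"
      using \<Theta> Conv_translate[OF f] by (simp add: PLV_def)
    from polynomial_on_affineD[OF this, of "\<lambda>y. \<rho> y * \<phi> (y + x)"]
    have "polynomial_fun d (\<lambda>z. \<Theta> ((\<lambda>y. f (y + x)) + (\<lambda>y. fst z \<bullet> y + snd z)) (\<lambda>y. \<rho> y * \<phi> (y + x)))"
      by (simp add: split_beta')
    from polynomial_fun_affine[OF this, of x]
    have "polynomial_fun d (\<lambda>z. \<Theta> ((\<lambda>y. f (y + x)) + (\<lambda>y. fst z \<bullet> y + (snd z + fst z \<bullet> x))) (\<lambda>y. \<rho> y * \<phi> (y + x)))"
      by simp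
    moreover have "(\<lambda>y. f (y + x)) + (\<lambda>y. fst z \<bullet> y + (snd z + fst z \<bullet> x)) = (\<lambda>y. F z (y + x))" for z
      by (rule ext) (simp add: F_def inner_add_right)
    ultimately show ?thesis by (simp add: q_def[abs_def])
  qed
  show "polynomial_fun d (\<lambda>(v, c). translation_average \<rho> \<Theta> (f + (\<lambda>x. v \<bullet> x + c)) \<phi>)"
  proof (cases "\<phi> \<in> Cc")
    case False
    then show ?thesis unfolding polynomial_fun_def
      by (intro exI[of _ "\<lambda>_. 0"]) (simp add: translation_average_def split_beta)
  next
    case True
    obtain k :: nat and zs :: "nat \<Rightarrow> (real^'n) \<times> real" and e where
      e: "\<And>q z. polynomial_fun d q \<Longrightarrow> q z = (\<Sum>m<k. (\<Sum>p\<in>poly_index d. e m p * monomial p z) * q (zs m))"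
      by (rule polynomial_fun_nodes) blast
    define E where "E m z = (\<Sum>p\<in>poly_index d. e m p * monomial p z)" for m z
    have intq: "integrable lborel (\<lambda>x. q x z)" for z
      unfolding q_def by (rule average_integrand_integrable[OF Fc True])
    have "translation_average \<rho> \<Theta> (F z) \<phi> = (\<Sum>m<k. E m z * translation_average \<rho> \<Theta> (F (zs m)) \<phi>)" for z
    proof -
      have "translation_average \<rho> \<Theta> (F z) \<phi> = (LINT x|lborel. q x z)"
        using True by (simp add: translation_average_def q_def)
      also have "\<dots> = (LINT x|lborel. (\<Sum>m<k. E m z * q x (zs m)))"
        unfolding E_def by (rule Bochner_Integration.integral_cong[OF refl]) (rule e[OF pq])
      also have "\<dots> = (\<Sum>m<k. E m z * (LINT x|lborel. q x (zs m)))"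
        by (subst Bochner_Integration.integral_sum) (simp_all add: intq)
      finally show ?thesis using True by (simp add: translation_average_def q_def)
    qed
    then have "(\<lambda>z. translation_average \<rho> \<Theta> (F z) \<phi>) = (\<lambda>z. \<Sum>m<k. E m z * translation_average \<rho> \<Theta> (F (zs m)) \<phi>)"
      by (rule ext)
    moreover have "polynomial_fun d (\<lambda>z. \<Sum>m<k. E m z * translation_average \<rho> \<Theta> (F (zs m)) \<phi>)"
    proof (rule polynomial_fun_sum)
      show "polynomial_fun d (E m)" for m
        unfolding E_def[abs_def] mult.commute[of "e _ _"]
        by (rule polynomial_fun_sum) (rule polynomial_fun_monomial)
    qed
    ultimately show ?thesis by (simp add: F_def split_beta')
  qed
qed

text \<open>
  Invariance of Lebesgue measure under translations.
\<close>

lemma average_translate: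
  "trans_act z (translation_average \<rho> \<Theta>) = translation_average \<rho> \<Theta>"
proof (intro ext)
  fix f :: "real^'n \<Rightarrow> real" and \<phi> :: "real^'n \<Rightarrow> complex"
  have "(LINT x|lborel. \<Theta> (\<lambda>y. f (y + x + z)) (\<lambda>y. \<rho> y * \<phi> (y + x + z)))
      = (LINT x|distr lborel borel ((+) z). \<Theta> (\<lambda>y. f (y + x)) (\<lambda>y. \<rho> y * \<phi> (y + x)))"
    if "f \<in> Conv" "\<phi> \<in> Cc"
    using borel_measurable_integrable[OF average_integrand_integrable[OF that]]
    by (subst integral_distr) (simp_all add: add_ac)
  then have "(LINT x|lborel. \<Theta> (\<lambda>y. f (y + x + z)) (\<lambda>y. \<rho> y * \<phi> (y + x + z)))
      = (LINT x|lborel. \<Theta> (\<lambda>y. f (y + x)) (\<lambda>y. \<rho> y * \<phi> (y + x)))" if "f \<in> Conv" "\<phi> \<in> Cc"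
    using that by (simp add: lborel_distr_plus)
  moreover have "\<Theta> (\<lambda>y. f (y + x)) \<psi> = 0" if "f \<notin> Conv" for x \<psi>
    by (rule PLV_outside[OF \<Theta>]) (simp add: Conv_translate_iff that)
  moreover have "\<Theta> (\<lambda>y. f (y + x + z)) \<psi> = 0" if "f \<notin> Conv" for x \<psi>
    by (rule PLV_outside[OF \<Theta>]) (use that Conv_translate_iff[of f "x + z"] in \<open>simp add: add.assoc\<close>)
  ultimately show "trans_act z (translation_average \<rho> \<Theta>) f \<phi> = translation_average \<rho> \<Theta> f \<phi>"
    by (cases "f \<in> Conv"; cases "\<phi> \<in> Cc")
       (simp_all add: trans_act_def aff_act_def translation_average_def comp_def Cc_translate_iff)
qed

text \<open>
  Locality is inherited from the translates: if \<open>f\<close> and \<open>h\<close> agree on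
  \<open>U\<close>, then their translates agree on the translate of \<open>U\<close>, which
  contains the support of the translated test function.
\<close>

lemma average_in_PLV_tr: "translation_average \<rho> \<Theta> \<in> PLV_tr d"
  unfolding PLV_tr_def PLV_def mem_Collect_eq
proof (intro conjI allI impI ballI)
  fix f :: "real^'n \<Rightarrow> real" assume "f \<notin> Conv"
  then have "\<Theta> (\<lambda>y. f (y + x)) \<psi> = 0" for x \<psi>
    by (intro PLV_outside[OF \<Theta>]) (simp add: Conv_translate_iff)
  then show "translation_average \<rho> \<Theta> f = 0" by (auto simp: translation_average_def)
next
  show "translation_average \<rho> \<Theta> f \<in> Radon" if "f \<in> Conv" for f by (rule average_Radon[OF that])
  show "continuous_on Conv (translation_average \<rho> \<Theta>)"
    by (rule continuous_on_coordinatewise_then_product, rule Conv_continuous_on_sequentially, rule average_tendsto)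
  show "polynomial_on_affine d (\<lambda>l. translation_average \<rho> \<Theta> (f + l))" if "f \<in> Conv" for f
    by (rule average_polynomial[OF that])
  show "trans_act x (translation_average \<rho> \<Theta>) = translation_average \<rho> \<Theta>" for x
    by (rule average_translate)
  show "local_functional (translation_average \<rho> \<Theta>)"
    unfolding local_functional_def
  proof (intro ballI allI impI)
    fix f h :: "real^'n \<Rightarrow> real" and U and \<phi> :: "real^'n \<Rightarrow> complex"
    assume fh: "f \<in> Conv" "h \<in> Conv" and U: "open U" "\<forall>x\<in>U. f x = h x" and \<phi>: "\<phi> \<in> Cc" "supp \<phi> \<subseteq> U"
    have "\<Theta> (\<lambda>y. f (y + x)) (\<lambda>y. \<rho> y * \<phi> (y + x)) = \<Theta> (\<lambda>y. h (y + x)) (\<lambda>y. \<rho> y * \<phi> (y + x))" for x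
    proof -
      have loc: "local_functional \<Theta>" using \<Theta> by (simp add: PLV_def)
      let ?V = "(\<lambda>y. y - x) ` U"
      have V: "y \<in> ?V \<longleftrightarrow> y + x \<in> U" for y by (auto simp: image_iff intro!: bexI[of _ "y + x"])
      have "open ?V" using open_translation_subtract[OF U(1)] .
      moreover have "f (y + x) = h (y + x)" if "y \<in> ?V" for y using U(2) that V by blast
      moreover have "(\<lambda>y. \<rho> y * \<phi> (y + x)) \<in> Cc"
        by (intro Cc_mult(2)[OF \<rho>] Cc_continuous Cc_translate \<phi>)
      moreover have "supp (\<lambda>y. \<rho> y * \<phi> (y + x)) \<subseteq> ?V"
      proof -
        let ?K = "(\<lambda>y. y - x) ` supp \<phi>"
        have "compact ?K" using Cc_compact_supp[OF \<phi>(1)] by (intro compact_continuous_image continuous_intros)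
        then have "supp (\<lambda>y. \<rho> y * \<phi> (y + x)) \<subseteq> ?K"
        proof (rule in_Cc_and_supp(2)[rotated])
          show "continuous_on UNIV (\<lambda>y. \<rho> y * \<phi> (y + x))"
            by (intro continuous_on_mult Cc_continuous \<rho> Cc_translate \<phi>)
          fix y assume "y \<notin> ?K"
          then have "y + x \<notin> supp \<phi>" by (metis add_diff_cancel_right' image_eqI)
          then show "\<rho> y * \<phi> (y + x) = 0" by (simp add: outside_supp)
        qed
        then show ?thesis using \<phi>(2) by blast
      qed
      ultimately show ?thesis
        by (intro loc[unfolded local_functional_def, rule_format, of _ _ ?V] Conv_translate fh) simp_all
    qed
    then show "translation_average \<rho> \<Theta> f \<phi> = translation_average \<rho> \<Theta> h \<phi>" by (simp add: translation_average_def)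
  qed
qed

end

section \<open>Freezing coefficients\<close>

text \<open>
  A decomposition of \<open>\<psi>\<close> into pieces of small support around centres
  \<open>z\<close>, without cancellation: the total modulus of the pieces does not exceed that
  of \<open>\<psi>\<close>, which makes the error estimates independent of the number of pieces.
\<close>

definition fine_partition :: "(real^'n::finite \<Rightarrow> complex) \<Rightarrow> real \<Rightarrow> (real^'n) set \<Rightarrow> (real^'n \<Rightarrow> real^'n \<Rightarrow> complex) \<Rightarrow> bool" where
  "fine_partition \<psi> \<delta> Z \<zeta> \<longleftrightarrow> finite Z \<and> (\<forall>z\<in>Z. \<zeta> z \<in> Cc \<and> (\<forall>y. \<zeta> z y \<noteq> 0 \<longrightarrow> dist y z < \<delta> \<and> y \<in> supp \<psi>)) \<and>
     (\<forall>y. (\<Sum>z\<in>Z. \<zeta> z y) = \<psi> y) \<and> (\<forall>y. (\<Sum>z\<in>Z. norm (\<zeta> z y)) \<le> norm (\<psi> y))"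

lemma fine_partition_exists:
  fixes \<psi> :: "real^'n::finite \<Rightarrow> complex"
  assumes \<psi>: "\<psi> \<in> Cc" and \<delta>: "\<delta> > 0"
  shows "\<exists>Z \<zeta>. fine_partition \<psi> \<delta> Z \<zeta>"
proof -
  define K where "K = supp \<psi>"
  have K: "compact K" unfolding K_def by (rule Cc_compact_supp[OF \<psi>])
  have "\<exists>Z. finite Z \<and> Z \<subseteq> K \<and> K \<subseteq> (\<Union>z\<in>Z. ball z \<delta>)"
    using compactE_image[OF K, of K "\<lambda>z. ball z \<delta>"] \<delta> by (metis UN_I centre_in_ball open_ball subsetI)
  then obtain Z where Z: "finite Z" "K \<subseteq> (\<Union>z\<in>Z. ball z \<delta>)" by (elim exE conjE)
  define u where "u z y = max 0 (\<delta> - dist y z)" for z y :: "real^'n"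
  define S where "S y = (\<Sum>z\<in>Z. u z y)" for y
  have uc: "continuous_on UNIV (u z)" for z unfolding u_def by (intro continuous_intros)
  have Sc: "continuous_on UNIV S" unfolding S_def by (intro continuous_on_sum uc)
  have u0: "u z y \<ge> 0" for z y by (simp add: u_def)
  have Spos: "S y > 0" if y: "y \<in> K" for y
  proof -
    obtain z where z: "z \<in> Z" "y \<in> ball z \<delta>" using Z(2) y by blast
    have "0 < u z y" using z(2) by (simp add: u_def dist_commute)
    also have "\<dots> \<le> S y" unfolding S_def by (rule member_le_sum[OF z(1)]) (use u0 Z in auto)
    finally show ?thesis .
  qed
  have "\<exists>c>0. \<forall>y\<in>K. c \<le> S y"
  proof (cases "K = {}")
    case True then show ?thesis by (intro exI[of _ 1]) simp
  next
    case False
    from continuous_attains_inf[OF K False continuous_on_subset[OF Sc subset_UNIV]]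
    obtain y where "y \<in> K" "\<forall>x\<in>K. S y \<le> S x" by (elim bexE)
    then show ?thesis using Spos by (intro exI[of _ "S y"]) simp
  qed
  then obtain c where c: "c > 0" "\<forall>y\<in>K. c \<le> S y" by (elim exE conjE)
  \<comment> \<open>The maximum with \<open>c\<close> keeps the denominator positive outside the support
      of \<open>\<psi>\<close> and agrees with \<open>S\<close> on it.\<close>
  define \<zeta> where "\<zeta> z y = of_real (u z y / max (S y) c) * \<psi> y" for z y
  have tot: "(\<Sum>z\<in>Z. u z y / max (S y) c) = 1" if "y \<in> K" for y
  proof -
    have "max (S y) c = S y" using c(2) that by (intro max_absorb1) blast
    then show ?thesis using Spos[OF that] by (simp add: sum_divide_distrib[symmetric] S_def[symmetric])
  qed
  have "fine_partition \<psi> \<delta> Z \<zeta>"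
    unfolding fine_partition_def
  proof (intro conjI ballI allI impI)
    show "finite Z" by (rule Z(1))
    show "\<zeta> z \<in> Cc" for z
    proof -
      have "max (S y) c \<noteq> 0" for y using c(1) by (simp add: max_def)
      then have "continuous_on UNIV (\<lambda>y. complex_of_real (u z y / max (S y) c))"
        by (intro continuous_on_of_real continuous_on_divide uc continuous_on_max Sc continuous_on_const) auto
      then show ?thesis unfolding \<zeta>_def[abs_def] by (rule Cc_mult(1)[OF \<psi>])
    qed
    show "dist y z < \<delta>" if "\<zeta> z y \<noteq> 0" for z y
      using that by (auto simp: \<zeta>_def u_def max_def split: if_splits)
    show "y \<in> supp \<psi>" if "\<zeta> z y \<noteq> 0" for z y
      using that outside_supp[of y \<psi>] by (auto simp: \<zeta>_def)
    have eq: "(\<Sum>z\<in>Z. of_real (u z y / max (S y) c) * \<psi> y) = of_real (\<Sum>z\<in>Z. u z y / max (S y) c) * \<psi> y" for y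
      by (simp only: sum_distrib_right of_real_sum)
    show "(\<Sum>z\<in>Z. \<zeta> z y) = \<psi> y" for y
    proof (cases "y \<in> K")
      case True then show ?thesis unfolding \<zeta>_def eq tot[OF True] by simp
    next
      case False then show ?thesis by (simp add: \<zeta>_def K_def outside_supp)
    qed
    have n: "norm (\<zeta> z y) = u z y / max (S y) c * norm (\<psi> y)" for z y
    proof -
      have "0 \<le> u z y / max (S y) c" using u0[of z y] c(1) by (intro divide_nonneg_nonneg) auto
      then show ?thesis unfolding \<zeta>_def norm_mult norm_of_real by (simp only: abs_of_nonneg)
    qed
    show "(\<Sum>z\<in>Z. norm (\<zeta> z y)) \<le> norm (\<psi> y)" for y
    proof (cases "y \<in> K")
      case True then show ?thesis unfolding n sum_distrib_right[symmetric] tot[OF True] by simp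
    next
      case False then show ?thesis by (simp add: n K_def outside_supp)
    qed
  qed
  then show ?thesis by blast
qed

lemma fine_partition_estimate:
  assumes P: "fine_partition \<psi> \<delta> Z \<zeta>"
    and close: "\<And>z. z \<in> Z \<Longrightarrow> \<zeta> z y \<noteq> 0 \<Longrightarrow> norm (G z - h) \<le> \<eta>" and \<eta>: "\<eta> \<ge> 0"
  shows "norm ((\<Sum>z\<in>Z. G z * \<zeta> z y) - h * \<psi> y) \<le> \<eta> * norm (\<psi> y)"
proof -
  have "(\<Sum>z\<in>Z. G z * \<zeta> z y) - h * \<psi> y = (\<Sum>z\<in>Z. (G z - h) * \<zeta> z y)"
  proof -
    have "h * \<psi> y = (\<Sum>z\<in>Z. h * \<zeta> z y)" using P by (simp add: fine_partition_def sum_distrib_left[symmetric])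
    then show ?thesis by (simp add: sum_subtractf left_diff_distrib)
  qed
  also have "norm \<dots> \<le> (\<Sum>z\<in>Z. \<eta> * norm (\<zeta> z y))"
  proof (rule sum_norm_le)
    fix z assume z: "z \<in> Z"
    show "norm ((G z - h) * \<zeta> z y) \<le> \<eta> * norm (\<zeta> z y)"
      using close[OF z] by (cases "\<zeta> z y = 0") (auto simp: norm_mult intro: mult_right_mono)
  qed
  also have "\<dots> \<le> \<eta> * norm (\<psi> y)"
    unfolding sum_distrib_left[symmetric] using P \<eta> by (intro mult_left_mono) (auto simp: fine_partition_def)
  finally show ?thesis .
qed

lemma fine_partition_zero:
  "fine_partition \<psi> \<delta> Z \<zeta> \<Longrightarrow> y \<notin> supp \<psi> \<Longrightarrow> z \<in> Z \<Longrightarrow> \<zeta> z y = 0"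
  unfolding fine_partition_def by blast

text \<open>
  Replacing a density by a different one on each piece of a partition changes the value by at
  most the oscillation, with a constant that is the same for all partitions.
\<close>

lemma Radon_partition_estimate:
  assumes L: "L \<in> Radon" and \<psi>: "\<psi> \<in> Cc"
  obtains C where "C \<ge> 0"
    "\<And>\<delta> Z \<zeta> G h \<eta>. fine_partition \<psi> \<delta> Z \<zeta> \<Longrightarrow> \<eta> \<ge> 0 \<Longrightarrow> (\<And>z. z \<in> Z \<Longrightarrow> continuous_on UNIV (G z)) \<Longrightarrow>
      continuous_on UNIV h \<Longrightarrow> (\<And>z y. z \<in> Z \<Longrightarrow> \<zeta> z y \<noteq> 0 \<Longrightarrow> norm (G z y - h y) \<le> \<eta>) \<Longrightarrow>
      norm ((\<Sum>z\<in>Z. L (\<lambda>y. G z y * \<zeta> z y)) - L (\<lambda>y. h y * \<psi> y)) \<le> C * \<eta>"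
proof (rule Radon_bound[OF L Cc_compact_supp[OF \<psi>]])
  fix C :: real
  assume C: "0 \<le> C" "\<And>\<phi> s. \<phi> \<in> Cc \<Longrightarrow> (\<And>x. x \<notin> supp \<psi> \<Longrightarrow> \<phi> x = 0) \<Longrightarrow> (\<And>x. norm (\<phi> x) \<le> s) \<Longrightarrow> norm (L \<phi>) \<le> C * s"
  show ?thesis
  proof (rule Cc_bounded[OF \<psi>])
    fix s :: real assume s: "s > 0" "\<And>x. norm (\<psi> x) \<le> s"
    show ?thesis
    proof (rule that[of "C * s"])
      show "0 \<le> C * s" using C(1) s(1) by simp
      fix \<delta> Z \<zeta> and G :: "real^'a \<Rightarrow> real^'a \<Rightarrow> complex" and h \<eta>
      assume P: "fine_partition \<psi> \<delta> Z \<zeta>" and \<eta>: "\<eta> \<ge> 0" and G: "\<And>z. z \<in> Z \<Longrightarrow> continuous_on UNIV (G z)"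
        and h: "continuous_on UNIV h" and cl: "\<And>z y. z \<in> Z \<Longrightarrow> \<zeta> z y \<noteq> 0 \<Longrightarrow> norm (G z y - h y) \<le> \<eta>"
      have cc: "(\<lambda>y. G z y * \<zeta> z y) \<in> Cc" if "z \<in> Z" for z
        by (rule Cc_mult(1)[OF _ G[OF that]]) (use P that in \<open>simp add: fine_partition_def\<close>)
      have cs: "(\<lambda>y. \<Sum>z\<in>Z. G z y * \<zeta> z y) \<in> Cc" by (rule Cc_sum) (rule cc)
      have ch: "(\<lambda>y. h y * \<psi> y) \<in> Cc" by (rule Cc_mult(1)[OF \<psi> h])
      have "norm (L (\<lambda>y. (\<Sum>z\<in>Z. G z y * \<zeta> z y) - h y * \<psi> y)) \<le> C * (\<eta> * s)"
      proof (rule C(2)[OF Cc_diff[OF cs ch]])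
        show "(\<Sum>z\<in>Z. G z y * \<zeta> z y) - h y * \<psi> y = 0" if "y \<notin> supp \<psi>" for y
          using fine_partition_zero[OF P that] by (simp add: outside_supp[OF that])
        show "norm ((\<Sum>z\<in>Z. G z y * \<zeta> z y) - h y * \<psi> y) \<le> \<eta> * s" for y
          by (rule order_trans[OF fine_partition_estimate[OF P cl \<eta>]]) (use s \<eta> in \<open>auto intro: mult_left_mono\<close>)
      qed
      also have "L (\<lambda>y. (\<Sum>z\<in>Z. G z y * \<zeta> z y) - h y * \<psi> y) = L (\<lambda>y. \<Sum>z\<in>Z. G z y * \<zeta> z y) - L (\<lambda>y. h y * \<psi> y)"
        by (rule Radon_diff[OF L cs ch])
      also have "L (\<lambda>y. \<Sum>z\<in>Z. G z y * \<zeta> z y) = (\<Sum>z\<in>Z. L (\<lambda>y. G z y * \<zeta> z y))"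
        by (rule Radon_sum[OF L cc])
      finally show "norm ((\<Sum>z\<in>Z. L (\<lambda>y. G z y * \<zeta> z y)) - L (\<lambda>y. h y * \<psi> y)) \<le> C * s * \<eta>"
        by (simp add: mult_ac)
    qed
  qed
qed

lemma le_all_positive_multiples:
  fixes a C :: real
  assumes "\<And>e. e > 0 \<Longrightarrow> a \<le> C * e" "C \<ge> 0" shows "a \<le> 0"
proof (rule field_le_epsilon)
  fix e :: real assume e: "e > 0"
  have "a \<le> C * (e / (C + 1))" by (rule assms(1)) (use e assms(2) in simp)
  also have "\<dots> \<le> e" using e assms(2) by (simp add: field_simps)
  finally show "a \<le> 0 + e" by simp
qed

lemma PLV_tr_translate:
  "\<Theta> \<in> PLV_tr d \<Longrightarrow> \<Theta> (\<lambda>y. f (y + x)) (\<lambda>y. \<phi> (y + x)) = \<Theta> f \<phi>"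
  unfolding PLV_tr_def trans_act_def aff_act_def comp_def by (auto dest: fun_cong)

lemma PLV_tr_PLV: "\<Theta> \<in> PLV_tr d \<Longrightarrow> \<Theta> \<in> PLV d"
  by (simp add: PLV_tr_def)

text \<open>
  By translation invariance the piece of \<open>\<psi>\<close> near \<open>z\<close> may be
  moved to \<open>c\<close>, so that \<open>g j\<close> is evaluated only near \<open>c\<close>,
  where it is almost the constant \<open>g j c\<close>. Summing over the pieces of a fine
  partition gives the identity with constant coefficients up to an arbitrarily small error.
\<close>

lemma density_combination_frozen:
  fixes E :: "'j \<Rightarrow> 'n::finite functional"
  assumes J: "finite J" and E: "\<And>j. j \<in> J \<Longrightarrow> E j \<in> PLV_tr d" and g: "\<And>j. j \<in> J \<Longrightarrow> continuous_on UNIV (g j)"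
    and z: "\<And>f \<psi>. f \<in> Conv \<Longrightarrow> \<psi> \<in> Cc \<Longrightarrow> (\<Sum>j\<in>J. E j f (\<lambda>y. g j y * \<psi> y)) = 0"
    and f: "f \<in> Conv" and \<psi>: "\<psi> \<in> Cc"
  shows "(\<Sum>j\<in>J. g j c * E j f \<psi>) = 0"
proof -
  have R: "E j f \<in> Radon" if "j \<in> J" for j by (rule PLV_Radon[OF PLV_tr_PLV[OF E[OF that]] f])
  have "\<forall>j. \<exists>C. j \<in> J \<longrightarrow> C \<ge> 0 \<and> (\<forall>\<delta> Z \<zeta> G h \<eta>. fine_partition \<psi> \<delta> Z \<zeta> \<longrightarrow> \<eta> \<ge> 0 \<longrightarrow> (\<forall>z\<in>Z. continuous_on UNIV (G z)) \<longrightarrow>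
      continuous_on UNIV h \<longrightarrow> (\<forall>z y. z \<in> Z \<longrightarrow> \<zeta> z y \<noteq> 0 \<longrightarrow> norm (G z y - h y) \<le> \<eta>) \<longrightarrow>
      norm ((\<Sum>z\<in>Z. E j f (\<lambda>y. G z y * \<zeta> z y)) - E j f (\<lambda>y. h y * \<psi> y)) \<le> C * \<eta>)"
  proof (intro allI)
    fix j show "\<exists>C. j \<in> J \<longrightarrow> C \<ge> 0 \<and> (\<forall>\<delta> Z \<zeta> G h \<eta>. fine_partition \<psi> \<delta> Z \<zeta> \<longrightarrow> \<eta> \<ge> 0 \<longrightarrow> (\<forall>z\<in>Z. continuous_on UNIV (G z)) \<longrightarrow>
      continuous_on UNIV h \<longrightarrow> (\<forall>z y. z \<in> Z \<longrightarrow> \<zeta> z y \<noteq> 0 \<longrightarrow> norm (G z y - h y) \<le> \<eta>) \<longrightarrow>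
      norm ((\<Sum>z\<in>Z. E j f (\<lambda>y. G z y * \<zeta> z y)) - E j f (\<lambda>y. h y * \<psi> y)) \<le> C * \<eta>)"
    proof (cases "j \<in> J")
      case True
      show ?thesis
        by (rule Radon_partition_estimate[OF R[OF True] \<psi>], rule exI, intro impI conjI allI, assumption) simp
    qed simp
  qed
  from choice[OF this] obtain C where C': "\<forall>j. j \<in> J \<longrightarrow> C j \<ge> 0 \<and> (\<forall>\<delta> Z \<zeta> G h \<eta>. fine_partition \<psi> \<delta> Z \<zeta> \<longrightarrow> \<eta> \<ge> 0 \<longrightarrow> (\<forall>z\<in>Z. continuous_on UNIV (G z)) \<longrightarrow>
      continuous_on UNIV h \<longrightarrow> (\<forall>z y. z \<in> Z \<longrightarrow> \<zeta> z y \<noteq> 0 \<longrightarrow> norm (G z y - h y) \<le> \<eta>) \<longrightarrow>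
      norm ((\<Sum>z\<in>Z. E j f (\<lambda>y. G z y * \<zeta> z y)) - E j f (\<lambda>y. h y * \<psi> y)) \<le> C j * \<eta>)" by (rule exE)
  have "norm (\<Sum>j\<in>J. g j c * E j f \<psi>) \<le> 0"
  proof (rule le_all_positive_multiples)
    show "0 \<le> (\<Sum>j\<in>J. C j)" using C' by (intro sum_nonneg) simp
    fix e :: real assume e: "e > 0"
    have "\<forall>\<^sub>F y in nhds c. \<forall>j\<in>J. dist (g j y) (g j c) < e"
    proof (rule eventually_ball_finite[OF J], rule ballI)
      fix j assume "j \<in> J"
      then have "isCont (g j) c" using g by (simp add: continuous_on_eq_continuous_at)
      then have "(g j \<longlongrightarrow> g j c) (nhds c)" by (simp add: continuous_at tendsto_nhds_iff isCont_def)
      then show "\<forall>\<^sub>F y in nhds c. dist (g j y) (g j c) < e" using e by (rule tendstoD)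
    qed
    then obtain \<delta> where \<delta>: "\<delta> > 0" "\<forall>y. dist y c < \<delta> \<longrightarrow> (\<forall>j\<in>J. dist (g j y) (g j c) < e)"
      unfolding eventually_nhds_metric by (elim exE conjE)
    obtain Z \<zeta> where P: "fine_partition \<psi> \<delta> Z \<zeta>" using fine_partition_exists[OF \<psi> \<delta>(1)] by (elim exE)
    \<comment> \<open>The density seen by the piece at \<open>z\<close> after moving \<open>z\<close> to
        \<open>c\<close>.\<close>
    define G where "G j z y = g j (y + (c - z))" for j z y
    have "(\<Sum>j\<in>J. E j f (\<lambda>y. G j z y * \<zeta> z y)) = 0" if zZ: "z \<in> Z" for z
    proof -
      have cc: "\<zeta> z \<in> Cc" using P zZ by (simp add: fine_partition_def)
      have "E j f (\<lambda>y. G j z y * \<zeta> z y) = E j (\<lambda>y. f (y + (z - c))) (\<lambda>y. g j y * \<zeta> z (y + (z - c)))" if "j \<in> J" for j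
        using PLV_tr_translate[OF E[OF that], of f "z - c" "\<lambda>y. G j z y * \<zeta> z y"] by (simp add: G_def)
      then have "(\<Sum>j\<in>J. E j f (\<lambda>y. G j z y * \<zeta> z y)) = (\<Sum>j\<in>J. E j (\<lambda>y. f (y + (z - c))) (\<lambda>y. g j y * \<zeta> z (y + (z - c))))"
        by (rule sum.cong[OF refl])
      also have "\<dots> = 0" by (rule z[OF Conv_translate[OF f] Cc_translate[OF cc]])
      finally show ?thesis .
    qed
    then have "0 = (\<Sum>z\<in>Z. \<Sum>j\<in>J. E j f (\<lambda>y. G j z y * \<zeta> z y))" by simp
    also have "\<dots> = (\<Sum>j\<in>J. \<Sum>z\<in>Z. E j f (\<lambda>y. G j z y * \<zeta> z y))" by (rule sum.swap)
    finally have 0: "(\<Sum>j\<in>J. \<Sum>z\<in>Z. E j f (\<lambda>y. G j z y * \<zeta> z y)) = 0" by simp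
    have "norm ((\<Sum>z\<in>Z. E j f (\<lambda>y. G j z y * \<zeta> z y)) - E j f (\<lambda>y. g j c * \<psi> y)) \<le> C j * e" if j: "j \<in> J" for j
    proof (rule C'[rule_format, OF j, THEN conjunct2, rule_format, OF P])
      show "0 \<le> e" using e by simp
      show "continuous_on UNIV (G j z)" for z
        unfolding G_def by (rule continuous_on_compose2[OF g[OF j]]) (auto intro!: continuous_intros)
      show "continuous_on UNIV (\<lambda>y. g j c)" by (rule continuous_on_const)
      fix w y assume "w \<in> Z" "\<zeta> w y \<noteq> 0"
      then have "dist y w < \<delta>" using P by (auto simp: fine_partition_def)
      then have "dist (y + (c - w)) c < \<delta>" by (simp add: dist_norm)
      then have "dist (g j (y + (c - w))) (g j c) < e" using \<delta>(2) j by simp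
      then show "norm (G j w y - g j c) \<le> e" by (simp add: G_def dist_norm)
    qed
    then have 1: "norm (\<Sum>j\<in>J. (\<Sum>z\<in>Z. E j f (\<lambda>y. G j z y * \<zeta> z y)) - E j f (\<lambda>y. g j c * \<psi> y)) \<le> (\<Sum>j\<in>J. C j * e)"
      by (rule sum_norm_le)
    have "(\<Sum>j\<in>J. E j f (\<lambda>y. g j c * \<psi> y)) = (\<Sum>j\<in>J. g j c * E j f \<psi>)"
      by (rule sum.cong[OF refl], rule Radon_cmult[OF R \<psi>])
    with 1 show "norm (\<Sum>j\<in>J. g j c * E j f \<psi>) \<le> (\<Sum>j\<in>J. C j) * e"
      by (simp add: sum_subtractf 0 sum_distrib_right)
  qed
  then show ?thesis by simp
qed

lemma translates_continuous:
  assumes \<Theta>: "\<Theta> \<in> PLV d" and f: "f \<in> Conv" and \<psi>: "\<psi> \<in> Cc"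
  shows "continuous_on UNIV (\<lambda>x. \<Theta> (\<lambda>y. f (y + x)) (\<lambda>y. \<psi> (y + x)))"
  unfolding continuous_on_sequentially comp_def
proof (intro allI ballI impI, elim conjE)
  fix x :: "nat \<Rightarrow> real^'a" and a assume x: "x \<longlonglongrightarrow> a"
  define X where "X = insert a (range x)"
  have X: "compact X" unfolding X_def by (rule compact_sequence_with_limit[OF x])
  define A where "A = shifts X (supp \<psi>)"
  have A: "compact A" unfolding A_def by (rule compact_shifts[OF X Cc_compact_supp[OF \<psi>]])
  have out: "\<psi> (y + w) = 0" if "y \<notin> A" "w \<in> X" for y w
  proof (rule ccontr)
    assume "\<psi> (y + w) \<noteq> 0"
    then have "y + w \<in> supp \<psi>" using outside_supp by blast
    then have "y = (y + w) - w \<and> y + w \<in> supp \<psi> \<and> w \<in> X" using that by simp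
    then show False using that(1) unfolding A_def shifts_def by blast
  qed
  show "(\<lambda>m. \<Theta> (\<lambda>y. f (y + x m)) (\<lambda>y. \<psi> (y + x m))) \<longlonglongrightarrow> \<Theta> (\<lambda>y. f (y + a)) (\<lambda>y. \<psi> (y + a))"
  proof (rule Radon_tendsto[where L="\<lambda>m. \<Theta> (\<lambda>y. f (y + x m))" and L'="\<Theta> (\<lambda>y. f (y + a))"
      and \<psi>m="\<lambda>m y. \<psi> (y + x m)" and \<psi>="\<lambda>y. \<psi> (y + a)", OF _ _ _ A])
    show "\<Theta> (\<lambda>y. f (y + x m)) \<in> Radon" "\<Theta> (\<lambda>y. f (y + a)) \<in> Radon" for m
      by (intro PLV_Radon[OF \<Theta>] Conv_translate f)+
    show "(\<lambda>m. \<Theta> (\<lambda>y. f (y + x m)) \<phi>) \<longlonglongrightarrow> \<Theta> (\<lambda>y. f (y + a)) \<phi>" for \<phi>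
      by (intro PLV_tendsto[OF \<Theta>] Conv_translate f Conv_translate_tendsto x tendsto_const)
    show "(\<lambda>y. \<psi> (y + x m)) \<in> Cc" "(\<lambda>y. \<psi> (y + a)) \<in> Cc" for m by (intro Cc_translate \<psi>)+
    show "\<psi> (y + x m) = 0" "\<psi> (y + a) = 0" if "y \<notin> A" for m y
      by (rule out[OF that]; simp add: X_def)+
    show "uniform_limit UNIV (\<lambda>m y. \<psi> (y + x m)) (\<lambda>y. \<psi> (y + a)) sequentially"
      by (rule uniform_limit_translates[OF \<psi> x])
  qed
qed

lemma reflected_kernel:
  assumes \<rho>: "\<rho> \<in> Cc"
  shows "(\<lambda>y. \<rho> (z - y)) \<in> Cc" "compact ((\<lambda>a. z - a) ` supp \<rho>)"
    "y \<notin> (\<lambda>a. z - a) ` supp \<rho> \<Longrightarrow> \<rho> (z - y) = 0"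
proof -
  show K: "compact ((\<lambda>a. z - a) ` supp \<rho>)"
    using Cc_compact_supp[OF \<rho>] by (intro compact_continuous_image continuous_intros)
  show z: "y \<notin> (\<lambda>a. z - a) ` supp \<rho> \<Longrightarrow> \<rho> (z - y) = 0" for y
    by (rule outside_supp) (auto simp: image_iff algebra_simps)
  show "(\<lambda>y. \<rho> (z - y)) \<in> Cc"
    by (rule in_Cc_and_supp(1)[OF _ K z])
       (rule continuous_on_compose2[OF Cc_continuous[OF \<rho>]]; auto intro!: continuous_intros)
qed

lemma uniform_continuity_near_compact:
  assumes b: "continuous_on UNIV b" and A: "compact A" and e: "(e::real) > 0"
  shows "\<exists>\<delta>>0. \<forall>y\<in>A. \<forall>z :: real^'n::finite. dist y z < \<delta> \<longrightarrow> norm (b z - b y :: complex) \<le> e"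
proof -
  define A' where "A' = {y + z |y z. y \<in> A \<and> z \<in> cball (0 :: real^'n) 1}"
  have A': "compact A'" unfolding A'_def by (rule compact_sums[OF A compact_cball])
  have "uniformly_continuous_on A' b"
    by (rule compact_uniformly_continuous[OF continuous_on_subset[OF b subset_UNIV] A'])
  then obtain \<delta> where \<delta>: "\<delta> > 0" "\<forall>x\<in>A'. \<forall>x'\<in>A'. dist x' x < \<delta> \<longrightarrow> dist (b x') (b x) < e"
    unfolding uniformly_continuous_on_def using e by meson
  show ?thesis
  proof (intro exI[of _ "min \<delta> 1"] conjI ballI allI impI)
    fix y z assume y: "y \<in> A" and d: "dist y z < min \<delta> 1"
    have "z = y + (z - y) \<and> y \<in> A \<and> z - y \<in> cball 0 1" using y d by (simp add: dist_norm norm_minus_commute)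
    then have "z \<in> A'" unfolding A'_def by blast
    moreover have "y = y + 0 \<and> y \<in> A \<and> 0 \<in> cball (0 :: real^'n) 1" using y by simp
    then have "y \<in> A'" unfolding A'_def by blast
    ultimately have "dist (b z) (b y) < e" using \<delta>(2) d by (simp add: dist_commute)
    then show "norm (b z - b y) \<le> e" by (simp add: dist_norm)
  qed (use \<delta> in simp)
qed

text \<open>
  Both sides are compared with the sum over the pieces \<open>\<zeta> z\<close> of a fine
  partition of \<open>\<psi>\<close>, with the densities frozen at the centres. On the left,
  \<open>b j\<close> hardly varies on a piece. On the right, the frozen sum is by hypothesis a
  sum of averages with kernels \<open>\<rho>(z - y)\<close>; these are evaluated where
  \<open>y + x\<close> is near \<open>z\<close>, so the kernel is nearly
  \<open>\<rho> x\<close>, and the pieces add up to \<open>\<psi>\<close>.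
\<close>

lemma convolution_from_frozen_averages:
  fixes E :: "'j \<Rightarrow> 'n::finite functional"
  assumes J: "finite J" and E: "\<And>j. j \<in> J \<Longrightarrow> E j \<in> PLV d'" and b: "\<And>j. j \<in> J \<Longrightarrow> continuous_on UNIV (b j)"
    and \<Theta>: "\<Theta> \<in> PLV d" and \<rho>: "\<rho> \<in> Cc"
    and av: "\<And>z f \<psi>. f \<in> Conv \<Longrightarrow> \<psi> \<in> Cc \<Longrightarrow>
      translation_average (\<lambda>y. \<rho> (z - y)) \<Theta> f \<psi> = (\<Sum>j\<in>J. b j z * E j f \<psi>)"
    and f: "f \<in> Conv" and \<psi>: "\<psi> \<in> Cc"
  shows "(\<Sum>j\<in>J. E j f (\<lambda>y. b j y * \<psi> y)) = (LINT x|lborel. \<rho> x * \<Theta> (\<lambda>y. f (y + x)) (\<lambda>y. \<psi> (y + x)))"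
    (is "?L = ?R")
proof -
  have R: "E j f \<in> Radon" if "j \<in> J" for j by (rule PLV_Radon[OF E[OF that] f])
  have R\<Theta>: "\<Theta> (\<lambda>y. f (y + x)) \<in> Radon" for x by (rule PLV_Radon[OF \<Theta> Conv_translate[OF f]])
  define A where "A = supp \<rho>"
  have A: "compact A" unfolding A_def by (rule Cc_compact_supp[OF \<rho>])
  define X where "X = {a + y |a y. a \<in> A \<and> y \<in> cball (0 :: real^'n) 1}"
  have X: "compact X" unfolding X_def by (rule compact_sums[OF A compact_cball])
  have inX: "x \<in> X" if "w \<in> A" "dist w x \<le> 1" for w x
  proof -
    have "x = w + (x - w) \<and> w \<in> A \<and> x - w \<in> cball 0 1" using that by (simp add: dist_norm norm_minus_commute)
    then show ?thesis unfolding X_def by blast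
  qed
  define Y where "Y = shifts X (supp \<psi>)"
  have Y: "compact Y" unfolding Y_def by (rule compact_shifts[OF X Cc_compact_supp[OF \<psi>]])
  have inY: "y \<in> Y" if "y + x \<in> supp \<psi>" "x \<in> X" for x y
  proof -
    have "y = (y + x) - x \<and> y + x \<in> supp \<psi> \<and> x \<in> X" using that by simp
    then show ?thesis unfolding Y_def shifts_def by blast
  qed
  have "(\<lambda>x y. f (y + x)) ` X \<subseteq> Conv" using Conv_translate[OF f] by blast
  from PLV_uniform_bound[OF \<Theta> compact_translates[OF f X] this Y]
  obtain C0 where C0: "C0 \<ge> 0" "\<forall>h\<in>(\<lambda>x y. f (y + x)) ` X. \<forall>\<phi>\<in>Cc. \<forall>s. (\<forall>x. x \<notin> Y \<longrightarrow> \<phi> x = 0) \<longrightarrow>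
      (\<forall>x. norm (\<phi> x) \<le> s) \<longrightarrow> norm (\<Theta> h \<phi>) \<le> C0 * s" by (elim exE conjE) (rule that)
  have "\<forall>j. \<exists>C. j \<in> J \<longrightarrow> C \<ge> 0 \<and> (\<forall>\<delta> Z \<zeta> G h \<eta>. fine_partition \<psi> \<delta> Z \<zeta> \<longrightarrow> \<eta> \<ge> 0 \<longrightarrow> (\<forall>z\<in>Z. continuous_on UNIV (G z)) \<longrightarrow>
      continuous_on UNIV h \<longrightarrow> (\<forall>z y. z \<in> Z \<longrightarrow> \<zeta> z y \<noteq> 0 \<longrightarrow> norm (G z y - h y) \<le> \<eta>) \<longrightarrow>
      norm ((\<Sum>z\<in>Z. E j f (\<lambda>y. G z y * \<zeta> z y)) - E j f (\<lambda>y. h y * \<psi> y)) \<le> C * \<eta>)"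
  proof (intro allI)
    fix j show "\<exists>C. j \<in> J \<longrightarrow> C \<ge> 0 \<and> (\<forall>\<delta> Z \<zeta> G h \<eta>. fine_partition \<psi> \<delta> Z \<zeta> \<longrightarrow> \<eta> \<ge> 0 \<longrightarrow> (\<forall>z\<in>Z. continuous_on UNIV (G z)) \<longrightarrow>
      continuous_on UNIV h \<longrightarrow> (\<forall>z y. z \<in> Z \<longrightarrow> \<zeta> z y \<noteq> 0 \<longrightarrow> norm (G z y - h y) \<le> \<eta>) \<longrightarrow>
      norm ((\<Sum>z\<in>Z. E j f (\<lambda>y. G z y * \<zeta> z y)) - E j f (\<lambda>y. h y * \<psi> y)) \<le> C * \<eta>)"
    proof (cases "j \<in> J")
      case True
      show ?thesis
        by (rule Radon_partition_estimate[OF R[OF True] \<psi>], rule exI, intro impI conjI allI, assumption) simp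
    qed simp
  qed
  from choice[OF this] obtain C where C': "\<forall>j. j \<in> J \<longrightarrow> C j \<ge> 0 \<and> (\<forall>\<delta> Z \<zeta> G h \<eta>. fine_partition \<psi> \<delta> Z \<zeta> \<longrightarrow> \<eta> \<ge> 0 \<longrightarrow> (\<forall>z\<in>Z. continuous_on UNIV (G z)) \<longrightarrow>
      continuous_on UNIV h \<longrightarrow> (\<forall>z y. z \<in> Z \<longrightarrow> \<zeta> z y \<noteq> 0 \<longrightarrow> norm (G z y - h y) \<le> \<eta>) \<longrightarrow>
      norm ((\<Sum>z\<in>Z. E j f (\<lambda>y. G z y * \<zeta> z y)) - E j f (\<lambda>y. h y * \<psi> y)) \<le> C j * \<eta>)" by (rule exE)
  obtain s where s: "s > 0" "\<And>x. norm (\<psi> x) \<le> s" by (rule Cc_bounded[OF \<psi>]) blast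
  define T0 where "T0 x = \<rho> x * \<Theta> (\<lambda>y. f (y + x)) (\<lambda>y. \<psi> (y + x))" for x
  have T0c: "continuous_on UNIV T0" unfolding T0_def
    by (intro continuous_on_mult Cc_continuous[OF \<rho>] translates_continuous[OF \<Theta> f \<psi>])
  have T00: "T0 x = 0" if "x \<notin> X" for x
    using inX[of x x] that by (auto simp: T0_def A_def intro!: outside_supp)
  have "norm (?L - ?R) \<le> 0"
  proof (rule le_all_positive_multiples)
    show "0 \<le> (\<Sum>j\<in>J. C j) + C0 * s * measure lborel X"
      using C' C0(1) s(1) by (intro add_nonneg_nonneg sum_nonneg mult_nonneg_nonneg) simp_all
    fix e :: real assume e: "e > 0"
    have "\<exists>\<delta>>0. \<forall>j\<in>J. \<forall>y\<in>supp \<psi>. \<forall>z. dist y z < \<delta> \<longrightarrow> norm (b j z - b j y) \<le> e"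
      using J b
    proof (induction J)
      case empty then show ?case by (intro exI[of _ 1]) simp
    next
      case (insert j J)
      then obtain \<delta>1 where "\<delta>1 > 0" "\<forall>j\<in>J. \<forall>y\<in>supp \<psi>. \<forall>z. dist y z < \<delta>1 \<longrightarrow> norm (b j z - b j y) \<le> e"
        by auto
      moreover obtain \<delta>2 where "\<delta>2 > 0" "\<forall>y\<in>supp \<psi>. \<forall>z. dist y z < \<delta>2 \<longrightarrow> norm (b j z - b j y) \<le> e"
        using uniform_continuity_near_compact[OF insert.prems[of j] Cc_compact_supp[OF \<psi>] e] by auto
      ultimately show ?case by (intro exI[of _ "min \<delta>1 \<delta>2"]) simp
    qed
    then obtain \<delta>1 where \<delta>1: "\<delta>1 > 0" "\<forall>j\<in>J. \<forall>y\<in>supp \<psi>. \<forall>z. dist y z < \<delta>1 \<longrightarrow> norm (b j z - b j y) \<le> e"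
      by (elim exE conjE)
    obtain \<delta>2 where \<delta>2: "\<delta>2 > 0" "\<And>x y. dist x y < \<delta>2 \<Longrightarrow> norm (\<rho> x - \<rho> y) < e"
      by (rule Cc_uniformly_continuous[OF \<rho> e]) blast
    define \<delta> where "\<delta> = min 1 (min \<delta>1 \<delta>2)"
    have \<delta>: "\<delta> > 0" "\<delta> \<le> 1" "\<delta> \<le> \<delta>1" "\<delta> \<le> \<delta>2" using \<delta>1(1) \<delta>2(1) by (auto simp: \<delta>_def)
    obtain Z \<zeta> where P: "fine_partition \<psi> \<delta> Z \<zeta>" using fine_partition_exists[OF \<psi> \<delta>(1)] by (elim exE)
    have Zf: "finite Z" and \<zeta>: "\<And>z. z \<in> Z \<Longrightarrow> \<zeta> z \<in> Cc" and near: "\<And>z y. z \<in> Z \<Longrightarrow> \<zeta> z y \<noteq> 0 \<Longrightarrow> dist y z < \<delta> \<and> y \<in> supp \<psi>"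
      using P by (auto simp: fine_partition_def)
    define I where "I z x = \<Theta> (\<lambda>y. f (y + x)) (\<lambda>y. \<rho> (z - y) * \<zeta> z (y + x))" for z x
    have Ic: "continuous_on UNIV (I z)" and Ii: "integrable lborel (I z)"
      and Iav: "(LINT x|lborel. I z x) = translation_average (\<lambda>y. \<rho> (z - y)) \<Theta> f (\<zeta> z)" if "z \<in> Z" for z
      unfolding I_def
      using average_integrand_continuous[OF \<Theta> reflected_kernel[OF \<rho>, where z=z] f \<zeta>[OF that]]
        average_integrand_integrable[OF \<Theta> reflected_kernel[OF \<rho>, where z=z] f \<zeta>[OF that]] \<zeta>[OF that]
      by (simp_all add: translation_average_def)
    \<comment> \<open>The combination with densities frozen at the centres of the pieces.\<close>
    define M where "M = (\<Sum>z\<in>Z. \<Sum>j\<in>J. b j z * E j f (\<zeta> z))"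
    have M1: "M = (\<Sum>j\<in>J. \<Sum>z\<in>Z. E j f (\<lambda>y. b j z * \<zeta> z y))"
    proof -
      have "M = (\<Sum>j\<in>J. \<Sum>z\<in>Z. b j z * E j f (\<zeta> z))" unfolding M_def by (rule sum.swap)
      also have "\<dots> = (\<Sum>j\<in>J. \<Sum>z\<in>Z. E j f (\<lambda>y. b j z * \<zeta> z y))"
        by (intro sum.cong refl) (simp add: Radon_cmult[OF R \<zeta>])
      finally show ?thesis .
    qed
    have "norm ((\<Sum>z\<in>Z. E j f (\<lambda>y. b j z * \<zeta> z y)) - E j f (\<lambda>y. b j y * \<psi> y)) \<le> C j * e" if j: "j \<in> J" for j
    proof (rule C'[rule_format, OF j, THEN conjunct2, rule_format, OF P])
      show "0 \<le> e" using e by simp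
      show "continuous_on UNIV (\<lambda>y. b j z)" for z by (rule continuous_on_const)
      show "continuous_on UNIV (b j)" by (rule b[OF j])
      fix w y assume "w \<in> Z" "\<zeta> w y \<noteq> 0"
      from near[OF this] show "norm (b j w - b j y) \<le> e" using \<delta>1(2) j \<delta>(3) by auto
    qed
    then have "norm (\<Sum>j\<in>J. (\<Sum>z\<in>Z. E j f (\<lambda>y. b j z * \<zeta> z y)) - E j f (\<lambda>y. b j y * \<psi> y)) \<le> (\<Sum>j\<in>J. C j * e)"
      by (rule sum_norm_le)
    then have part1: "norm (M - ?L) \<le> (\<Sum>j\<in>J. C j) * e"
      by (simp add: sum_subtractf M1 sum_distrib_right)
    have "M = (\<Sum>z\<in>Z. LINT x|lborel. I z x)"
      unfolding M_def by (intro sum.cong refl) (simp add: Iav av[OF f \<zeta>])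
    also have "\<dots> = (LINT x|lborel. (\<Sum>z\<in>Z. I z x))" by (rule Bochner_Integration.integral_sum[symmetric]) (rule Ii)
    finally have M2: "M = (LINT x|lborel. (\<Sum>z\<in>Z. I z x))" .
    have Isum: "(\<Sum>z\<in>Z. I z x) = \<Theta> (\<lambda>y. f (y + x)) (\<lambda>y. \<Sum>z\<in>Z. \<rho> (z - y) * \<zeta> z (y + x))" for x
      unfolding I_def
      by (rule Radon_sum[OF R\<Theta>, symmetric])
         (rule Cc_mult(2)[OF reflected_kernel(1)[OF \<rho>] Cc_continuous[OF Cc_translate[OF \<zeta>]]])
    have T0eq: "T0 x = \<Theta> (\<lambda>y. f (y + x)) (\<lambda>y. \<rho> x * \<psi> (y + x))" for x
      unfolding T0_def by (rule Radon_cmult[OF R\<Theta> Cc_translate[OF \<psi>], symmetric])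
    have est: "norm ((\<Sum>z\<in>Z. \<rho> (z - y) * \<zeta> z (y + x)) - \<rho> x * \<psi> (y + x)) \<le> e * norm (\<psi> (y + x))" for x y
    proof (rule fine_partition_estimate[OF P])
      fix z assume "z \<in> Z" "\<zeta> z (y + x) \<noteq> 0"
      from near[OF this] have "dist (z - y) x < \<delta>2" using \<delta>(4) by (simp add: dist_norm norm_minus_commute algebra_simps)
      from \<delta>2(2)[OF this] show "norm (\<rho> (z - y) - \<rho> x) \<le> e" by simp
    qed (use e in simp)
    have zero: "(\<Sum>z\<in>Z. \<rho> (z - y) * \<zeta> z (y + x)) = 0" if "x \<notin> X" for x y
    proof (rule sum.neutral, rule ballI)
      fix z assume z: "z \<in> Z"
      show "\<rho> (z - y) * \<zeta> z (y + x) = 0"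
      proof (rule ccontr)
        assume "\<rho> (z - y) * \<zeta> z (y + x) \<noteq> 0"
        then have "\<rho> (z - y) \<noteq> 0" "\<zeta> z (y + x) \<noteq> 0" by auto
        then have "z - y \<in> A" "dist (y + x) z < \<delta>" using near[OF z] outside_supp[of "z - y" \<rho>] by (auto simp: A_def)
        then have "dist (z - y) x \<le> 1" using \<delta>(2) by (simp add: dist_norm norm_minus_commute algebra_simps)
        then show False using inX[OF \<open>z - y \<in> A\<close>] \<open>x \<notin> X\<close> by blast
      qed
    qed
    have diff: "norm ((\<Sum>z\<in>Z. I z x) - T0 x) \<le> C0 * (e * s)" for x
    proof (cases "x \<in> X")
      case False
      then show ?thesis using C0(1) e s(1)
        by (simp add: Isum zero[OF False] T00 Radon_zero[OF R\<Theta>])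
    next
      case True
      have c1: "(\<lambda>y. \<Sum>z\<in>Z. \<rho> (z - y) * \<zeta> z (y + x)) \<in> Cc"
        by (rule Cc_sum, rule Cc_mult(2)[OF reflected_kernel(1)[OF \<rho>] Cc_continuous[OF Cc_translate[OF \<zeta>]]])
      have c2: "(\<lambda>y. \<rho> x * \<psi> (y + x)) \<in> Cc" by (rule Cc_cmult[OF Cc_translate[OF \<psi>]])
      have "norm (\<Theta> (\<lambda>y. f (y + x)) (\<lambda>y. (\<Sum>z\<in>Z. \<rho> (z - y) * \<zeta> z (y + x)) - \<rho> x * \<psi> (y + x))) \<le> C0 * (e * s)"
      proof (rule C0(2)[rule_format])
        show "(\<lambda>y. f (y + x)) \<in> (\<lambda>x y. f (y + x)) ` X" using True by (rule imageI)
        show "(\<lambda>y. (\<Sum>z\<in>Z. \<rho> (z - y) * \<zeta> z (y + x)) - \<rho> x * \<psi> (y + x)) \<in> Cc" by (rule Cc_diff[OF c1 c2])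
        fix y
        show "norm ((\<Sum>z\<in>Z. \<rho> (z - y) * \<zeta> z (y + x)) - \<rho> x * \<psi> (y + x)) \<le> e * s"
          by (rule order_trans[OF est]) (use s(2) e in \<open>simp add: mult_left_mono\<close>)
        show "(\<Sum>z\<in>Z. \<rho> (z - y) * \<zeta> z (y + x)) - \<rho> x * \<psi> (y + x) = 0" if "y \<notin> Y"
        proof -
          have "\<psi> (y + x) = 0" using inY[of y x] True that outside_supp by blast
          then show ?thesis using est[of y x] by simp
        qed
      qed
      then show ?thesis unfolding Isum T0eq Radon_diff[OF R\<Theta> c1 c2] .
    qed
    have "norm (LINT x|lborel. (\<Sum>z\<in>Z. I z x) - T0 x) \<le> C0 * (e * s) * measure lborel X"
    proof (rule integral_bound_compact_support[OF _ X _ diff])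
      show "continuous_on UNIV (\<lambda>x. (\<Sum>z\<in>Z. I z x) - T0 x)"
        by (intro continuous_on_diff continuous_on_sum Ic T0c)
      show "(\<Sum>z\<in>Z. I z x) - T0 x = 0" if "x \<notin> X" for x
        by (simp add: Isum zero[OF that] T00[OF that] Radon_zero[OF R\<Theta>])
    qed
    also have "(LINT x|lborel. (\<Sum>z\<in>Z. I z x) - T0 x) = M - ?R"
      unfolding M2 T0_def[symmetric]
      by (intro Bochner_Integration.integral_diff Bochner_Integration.integrable_sum Ii
          integrable_compact_support[OF T0c X T00])
    finally have "norm (M - ?R) \<le> C0 * s * measure lborel X * e" by (simp add: mult_ac)
    moreover have "norm (?L - ?R) \<le> norm (M - ?L) + norm (M - ?R)"
      using norm_triangle_ineq4[of "M - ?R" "M - ?L"] by simp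
    ultimately show "norm (?L - ?R) \<le> ((\<Sum>j\<in>J. C j) + C0 * s * measure lborel X) * e"
      using part1 by (simp add: distrib_right)
  qed
  then show ?thesis by simp
qed

section \<open>Derivatives of smooth functionals\<close>

text \<open>
  The derivative at \<open>0\<close> of \<open>t \<mapsto> \<pi>(t e\<^sub>i)\<Psi>\<close> for
  the compact-to-weak* topology, in terms of the semi-norms.
\<close>

definition partial_derivative :: "'n::finite functional \<Rightarrow> 'n \<Rightarrow> 'n functional \<Rightarrow> bool" where
  "partial_derivative \<Psi> i \<Theta> \<longleftrightarrow>
     (\<forall>K \<psi> e. compact K \<longrightarrow> K \<noteq> {} \<longrightarrow> K \<subseteq> Conv \<longrightarrow> \<psi> \<in> Cc \<longrightarrow> e > 0 \<longrightarrow>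
       (\<forall>\<^sub>F t in at 0. \<forall>f\<in>K. norm (of_real (inverse t) * (trans_act (t *\<^sub>R axis i 1) \<Psi> f \<psi> - \<Psi> f \<psi>) - \<Theta> f \<psi>) < e))"

lemma trans_act_apply: "trans_act x \<Psi> f \<phi> = \<Psi> (\<lambda>y. f (y + x)) (\<lambda>y. \<phi> (y + x))"
  by (simp add: trans_act_def aff_act_def comp_def)

lemma trans_act_add: "trans_act (x + y) \<Psi> f \<phi> = trans_act y \<Psi> (\<lambda>z. f (z + x)) (\<lambda>z. \<phi> (z + x))"
  by (simp add: trans_act_apply add_ac)

lemma trans_act_0 [simp]: "trans_act 0 \<Psi> = \<Psi>"
  by (intro ext) (simp add: trans_act_apply)

lemma topspace_cw_topology: "topspace (cw_topology d) \<subseteq> PLV d"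
proof
  fix \<Psi> :: "'n::finite functional" assume "\<Psi> \<in> topspace (cw_topology d)"
  then obtain S where "S \<in> {{\<Psi> \<in> PLV d. cw_seminorm K \<phi> (\<Psi> - \<Psi>\<^sub>0) < r} | K \<phi> \<Psi>\<^sub>0 r.
        compact K \<and> K \<noteq> {} \<and> K \<subseteq> Conv \<and> \<phi> \<in> Cc \<and> \<Psi>\<^sub>0 \<in> PLV d \<and> r > 0}" "\<Psi> \<in> S"
    unfolding cw_topology_def topology_generated_by_topspace by (elim UnionE)
  then show "\<Psi> \<in> PLV d" by auto
qed

lemma cw_bdd_above:
  assumes "\<Psi> \<in> PLV d" "\<Phi> \<in> PLV d" "compact K" "K \<subseteq> Conv"
  shows "bdd_above ((\<lambda>f. norm ((\<Psi> - \<Phi>) f \<phi>)) ` K)"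
proof (rule PLV_bounded_on_compact[OF assms(1,3,4), of \<phi>])
  fix C assume C: "\<And>f. f \<in> K \<Longrightarrow> norm (\<Psi> f \<phi>) \<le> C"
  show ?thesis
  proof (rule PLV_bounded_on_compact[OF assms(2,3,4), of \<phi>])
    fix D assume D: "\<And>f. f \<in> K \<Longrightarrow> norm (\<Phi> f \<phi>) \<le> D"
    show ?thesis
    proof (rule bdd_aboveI)
      fix r assume "r \<in> (\<lambda>f. norm ((\<Psi> - \<Phi>) f \<phi>)) ` K"
      then obtain f where f: "f \<in> K" "r = norm (\<Psi> f \<phi> - \<Phi> f \<phi>)" by auto
      show "r \<le> C + D" using norm_triangle_ineq4[of "\<Psi> f \<phi>" "\<Phi> f \<phi>"] C[OF f(1)] D[OF f(1)] f(2) by linarith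
    qed
  qed
qed

lemma limitin_cw_topologyD:
  assumes lim: "limitin (cw_topology d) h l F" and K: "compact K" "K \<noteq> {}" "K \<subseteq> Conv" and \<phi>: "\<phi> \<in> Cc" and e: "e > 0"
  shows "l \<in> PLV d" "\<forall>\<^sub>F t in F. h t \<in> PLV d \<and> (\<forall>f\<in>K. norm (h t f \<phi> - l f \<phi>) < e)"
proof -
  have l: "l \<in> topspace (cw_topology d)" and ev: "\<And>U. openin (cw_topology d) U \<Longrightarrow> l \<in> U \<Longrightarrow> \<forall>\<^sub>F t in F. h t \<in> U"
    using lim by (simp_all add: limitin_def)
  show lP: "l \<in> PLV d" using l topspace_cw_topology by blast
  define U where "U = {\<Psi> \<in> PLV d. cw_seminorm K \<phi> (\<Psi> - l) < e}"
  have "openin (cw_topology d) U"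
    unfolding cw_topology_def U_def
    by (rule topology_generated_by_Basis, rule CollectI, rule exI[of _ K], rule exI[of _ \<phi>], rule exI[of _ l], rule exI[of _ e])
       (use K \<phi> e lP in simp)
  moreover have "l \<in> U"
    using lP K(2) e by (simp add: U_def cw_seminorm_def)
  ultimately have "\<forall>\<^sub>F t in F. h t \<in> U" by (rule ev)
  then show "\<forall>\<^sub>F t in F. h t \<in> PLV d \<and> (\<forall>f\<in>K. norm (h t f \<phi> - l f \<phi>) < e)"
  proof (rule eventually_mono)
    fix t assume t: "h t \<in> U"
    then have h: "h t \<in> PLV d" by (simp add: U_def)
    have "norm (h t f \<phi> - l f \<phi>) < e" if f: "f \<in> K" for f
    proof -
      have "norm ((h t - l) f \<phi>) \<le> cw_seminorm K \<phi> (h t - l)"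
        unfolding cw_seminorm_def by (rule cSUP_upper[OF f cw_bdd_above[OF h lP K(1,3)]])
      also have "\<dots> < e" using t by (simp add: U_def)
      finally show ?thesis by simp
    qed
    then show "h t \<in> PLV d \<and> (\<forall>f\<in>K. norm (h t f \<phi> - l f \<phi>) < e)" using h by blast
  qed
qed

lemma limitin_cw_topology_PLV: "limitin (cw_topology d) h l F \<Longrightarrow> l \<in> PLV d"
  using topspace_cw_topology by (auto simp: limitin_def)

lemma trans_act_in_PLV:
  assumes "smooth_functional d \<Psi>" shows "trans_act x \<Psi> \<in> PLV d"
proof -
  have "C_k 0 (cw_topology d) (\<lambda>r. scale_functional (of_real r)) (\<lambda>x. trans_act x \<Psi>)"
    using assms unfolding smooth_functional_def smooth_map_def by blast
  then have "continuous_map euclidean (cw_topology d) (\<lambda>x. trans_act x \<Psi>)" by simp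
  then have "trans_act x \<Psi> \<in> topspace (cw_topology d)" by (auto simp: continuous_map_def)
  then show ?thesis using topspace_cw_topology by blast
qed

text \<open>
  Translations act as a group, so the derivative of an orbit at \<open>x\<close> is the
  translate by \<open>x\<close> of its derivative at \<open>0\<close>, and the derivative of the
  orbit is again an orbit.
\<close>

lemma has_partial_derivative_trans_act:
  fixes \<Psi> :: "'n::finite functional"
  assumes G: "has_partial_derivative (cw_topology d) (\<lambda>r. scale_functional (of_real r)) (\<lambda>x. trans_act x \<Psi>) i G"
  shows "G x \<in> PLV d" "partial_derivative \<Psi> i (G 0)" "G x = trans_act x (G 0)"
    "f \<in> Conv \<Longrightarrow> \<phi> \<in> Cc \<Longrightarrow> ((\<lambda>t. of_real (inverse t) * (trans_act (t *\<^sub>R axis i 1) \<Psi> f \<phi> - \<Psi> f \<phi>)) \<longlongrightarrow> G 0 f \<phi>) (at 0)"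
proof -
  have lim: "limitin (cw_topology d) (\<lambda>t. scale_functional (of_real (inverse t)) (trans_act (x + t *\<^sub>R axis i 1) \<Psi> - trans_act x \<Psi>)) (G x) (at 0)" for x
    using G unfolding has_partial_derivative_def by blast
  have P: "G x \<in> PLV d" for x by (rule limitin_cw_topology_PLV[OF lim])
  then show "G x \<in> PLV d" .
  show pd: "partial_derivative \<Psi> i (G 0)"
    unfolding partial_derivative_def
  proof (intro allI impI)
    fix K :: "(real^'n \<Rightarrow> real) set" and \<psi> :: "real^'n \<Rightarrow> complex" and e :: real
    assume "compact K" "K \<noteq> {}" "K \<subseteq> Conv" "\<psi> \<in> Cc" "e > 0"
    from limitin_cw_topologyD(2)[OF lim this, of 0]
    show "\<forall>\<^sub>F t in at 0. \<forall>f\<in>K. norm (of_real (inverse t) * (trans_act (t *\<^sub>R axis i 1) \<Psi> f \<psi> - \<Psi> f \<psi>) - G 0 f \<psi>) < e"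
      by (rule eventually_mono) (simp add: scale_functional_def)
  qed
  have pt: "((\<lambda>t. of_real (inverse t) * (trans_act (x + t *\<^sub>R axis i 1) \<Psi> f \<phi> - trans_act x \<Psi> f \<phi>)) \<longlongrightarrow> G x f \<phi>) (at 0)"
    if "f \<in> Conv" "\<phi> \<in> Cc" for x f \<phi>
  proof (rule tendstoI)
    fix e :: real assume "e > 0"
    from limitin_cw_topologyD(2)[OF lim _ _ _ that(2) this, of "{f}" x] that(1)
    have "\<forall>\<^sub>F t in at 0. scale_functional (of_real (inverse t)) (trans_act (x + t *\<^sub>R axis i 1) \<Psi> - trans_act x \<Psi>) \<in> PLV d \<and>
      (\<forall>h\<in>{f}. norm (scale_functional (of_real (inverse t)) (trans_act (x + t *\<^sub>R axis i 1) \<Psi> - trans_act x \<Psi>) h \<phi> - G x h \<phi>) < e)" by simp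
    then show "\<forall>\<^sub>F t in at 0. dist (of_real (inverse t) * (trans_act (x + t *\<^sub>R axis i 1) \<Psi> f \<phi> - trans_act x \<Psi> f \<phi>)) (G x f \<phi>) < e"
      by (rule eventually_mono) (simp add: scale_functional_def dist_norm)
  qed
  show "((\<lambda>t. of_real (inverse t) * (trans_act (t *\<^sub>R axis i 1) \<Psi> f \<phi> - \<Psi> f \<phi>)) \<longlongrightarrow> G 0 f \<phi>) (at 0)"
    if "f \<in> Conv" "\<phi> \<in> Cc" using pt[OF that, of 0] by simp
  show "G x = trans_act x (G 0)"
  proof (intro ext)
    fix f :: "real^'n \<Rightarrow> real" and \<phi> :: "real^'n \<Rightarrow> complex"
    show "G x f \<phi> = trans_act x (G 0) f \<phi>"
    proof (cases "f \<in> Conv \<and> \<phi> \<in> Cc")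
      case True
      then have p: "((\<lambda>t. of_real (inverse t) * (trans_act (x + t *\<^sub>R axis i 1) \<Psi> f \<phi> - trans_act x \<Psi> f \<phi>)) \<longlongrightarrow> G x f \<phi>) (at 0)"
        by (intro pt) simp_all
      have p': "((\<lambda>t. of_real (inverse t) * (trans_act (x + t *\<^sub>R axis i 1) \<Psi> f \<phi> - trans_act x \<Psi> f \<phi>)) \<longlongrightarrow> G 0 (\<lambda>y. f (y + x)) (\<lambda>y. \<phi> (y + x))) (at 0)"
        using pt[of "\<lambda>y. f (y + x)" "\<lambda>y. \<phi> (y + x)" 0] True
        unfolding trans_act_add[of x] by (simp add: Conv_translate Cc_translate trans_act_apply)
      have "G x f \<phi> = G 0 (\<lambda>y. f (y + x)) (\<lambda>y. \<phi> (y + x))"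
        by (rule tendsto_unique[OF _ p p']) simp
      then show ?thesis by (simp add: trans_act_apply)
    next
      case False
      then consider "f \<notin> Conv" | "\<phi> \<notin> Cc" by blast
      then show ?thesis
      proof cases
        case 1
        then have "(\<lambda>y. f (y + x)) \<notin> Conv" by (simp add: Conv_translate_iff)
        with 1 show ?thesis by (simp add: trans_act_apply PLV_outside[OF P])
      next
        case 2
        then have "(\<lambda>y. \<phi> (y + x)) \<notin> Cc" by (simp add: Cc_translate_iff)
        with 2 show ?thesis by (simp add: trans_act_apply PLV_not_Cc[OF P])
      qed
    qed
  qed
qed

text \<open>
  The definition of smoothness supplies a possibly different derivative for every order of
  differentiability. They agree by uniqueness of limits, so a single functional generates them.
\<close>

lemma smooth_functional_derivative:
  fixes \<Psi> :: "'n::finite functional"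
  assumes \<Psi>: "smooth_functional d \<Psi>"
  shows "\<exists>\<Theta>. \<Theta> \<in> PLV d \<and> smooth_functional d \<Theta> \<and> partial_derivative \<Psi> i \<Theta>"
proof -
  let ?T = "cw_topology d" and ?sc = "\<lambda>r. scale_functional (complex_of_real r)"
  have "\<forall>k. \<exists>G. has_partial_derivative ?T ?sc (\<lambda>x. trans_act x \<Psi>) i G \<and> C_k k ?T ?sc G"
  proof
    fix k
    have "C_k (Suc k) ?T ?sc (\<lambda>x. trans_act x \<Psi>)"
      using \<Psi> unfolding smooth_functional_def smooth_map_def by blast
    then show "\<exists>G. has_partial_derivative ?T ?sc (\<lambda>x. trans_act x \<Psi>) i G \<and> C_k k ?T ?sc G" by simp
  qed
  from choice[OF this] obtain G where G: "\<forall>k. has_partial_derivative ?T ?sc (\<lambda>x. trans_act x \<Psi>) i (G k) \<and> C_k k ?T ?sc (G k)"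
    by (rule exE)
  then have D: "has_partial_derivative ?T ?sc (\<lambda>x. trans_act x \<Psi>) i (G k)" for k by blast
  have eq0: "G k 0 = G 0 0" for k
  proof (intro ext)
    fix f :: "real^'n \<Rightarrow> real" and \<phi> :: "real^'n \<Rightarrow> complex"
    show "G k 0 f \<phi> = G 0 0 f \<phi>"
    proof (cases "f \<in> Conv \<and> \<phi> \<in> Cc")
      case True
      then show ?thesis
        using tendsto_unique[OF _ has_partial_derivative_trans_act(4)[OF D] has_partial_derivative_trans_act(4)[OF D]] by simp
    next
      case False
      then show ?thesis
        using PLV_outside[OF has_partial_derivative_trans_act(1)[OF D]] PLV_not_Cc[OF has_partial_derivative_trans_act(1)[OF D]] by metis
    qed
  qed
  define \<Theta> where "\<Theta> = G 0 0"
  have eq: "G k = (\<lambda>x. trans_act x \<Theta>)" for k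
  proof
    fix x
    have "G k x = trans_act x (G k 0)" by (rule has_partial_derivative_trans_act(3)[OF D])
    also have "G k 0 = \<Theta>" unfolding \<Theta>_def by (rule eq0)
    finally show "G k x = trans_act x \<Theta>" .
  qed
  have "C_k k ?T ?sc (\<lambda>x. trans_act x \<Theta>)" for k
    using G[rule_format, of k, THEN conjunct2] unfolding eq .
  then have "smooth_functional d \<Theta>" by (simp add: smooth_functional_def smooth_map_def)
  moreover have "\<Theta> \<in> PLV d" "partial_derivative \<Psi> i \<Theta>"
    unfolding \<Theta>_def by (rule has_partial_derivative_trans_act(1)[OF D], rule has_partial_derivative_trans_act(2)[OF D])
  ultimately show ?thesis by (intro exI[of _ \<Theta>] conjI)
qed

section \<open>Smoothness of frozen coefficients\<close>

lemma has_partial_derivative_euclidean: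
  fixes F G :: "real^'n::finite \<Rightarrow> complex"
  shows "has_partial_derivative euclidean scaleR F i G \<longleftrightarrow>
    (\<forall>x. ((\<lambda>t. inverse t *\<^sub>R (F (x + t *\<^sub>R axis i 1) - F x)) \<longlongrightarrow> G x) (at 0))"
  by (simp add: has_partial_derivative_def)

lemma C_k_continuous: "C_k k T sc F \<Longrightarrow> continuous_map euclidean T F"
  by (cases k) auto

lemma C_k_add:
  fixes F G :: "real^'n::finite \<Rightarrow> complex"
  assumes "C_k k euclidean scaleR F" "C_k k euclidean scaleR G"
  shows "C_k k euclidean scaleR (\<lambda>x. F x + G x)"
  using assms
proof (induction k arbitrary: F G)
  case 0 then show ?case by (auto intro: continuous_on_add)
next
  case (Suc k)
  show ?case
  proof (simp only: C_k.simps, intro conjI allI)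
    show "continuous_map euclidean euclidean (\<lambda>x. F x + G x)"
      using Suc.prems by (auto intro: continuous_on_add)
    fix i
    obtain F' where F': "has_partial_derivative euclidean scaleR F i F'" "C_k k euclidean scaleR F'" using Suc.prems(1) by auto
    obtain G' where G': "has_partial_derivative euclidean scaleR G i G'" "C_k k euclidean scaleR G'" using Suc.prems(2) by auto
    have "has_partial_derivative euclidean scaleR (\<lambda>x. F x + G x) i (\<lambda>x. F' x + G' x)"
      unfolding has_partial_derivative_euclidean
    proof
      fix x
      have "((\<lambda>t. inverse t *\<^sub>R (F (x + t *\<^sub>R axis i 1) - F x) + inverse t *\<^sub>R (G (x + t *\<^sub>R axis i 1) - G x)) \<longlongrightarrow> F' x + G' x) (at 0)"
        using F'(1) G'(1) unfolding has_partial_derivative_euclidean by (intro tendsto_add) blast+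
      then show "((\<lambda>t. inverse t *\<^sub>R (F (x + t *\<^sub>R axis i 1) + G (x + t *\<^sub>R axis i 1) - (F x + G x))) \<longlongrightarrow> F' x + G' x) (at 0)"
        by (simp add: scaleR_add_right[symmetric] add_diff_add)
    qed
    then show "\<exists>H. has_partial_derivative euclidean scaleR (\<lambda>x. F x + G x) i H \<and> C_k k euclidean scaleR H"
      using Suc.IH[OF F'(2) G'(2)] by blast
  qed
qed

lemma C_k_cmult:
  fixes F :: "real^'n::finite \<Rightarrow> complex"
  assumes "C_k k euclidean scaleR F"
  shows "C_k k euclidean scaleR (\<lambda>x. c * F x)"
  using assms
proof (induction k arbitrary: F)
  case 0 then show ?case by (auto intro: continuous_on_mult_left)
next
  case (Suc k)
  show ?case
  proof (simp only: C_k.simps, intro conjI allI)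
    show "continuous_map euclidean euclidean (\<lambda>x. c * F x)"
      using Suc.prems by (auto intro: continuous_on_mult_left)
    fix i
    obtain F' where F': "has_partial_derivative euclidean scaleR F i F'" "C_k k euclidean scaleR F'" using Suc.prems by auto
    have "has_partial_derivative euclidean scaleR (\<lambda>x. c * F x) i (\<lambda>x. c * F' x)"
      unfolding has_partial_derivative_euclidean
    proof
      fix x
      have "((\<lambda>t. c * (inverse t *\<^sub>R (F (x + t *\<^sub>R axis i 1) - F x))) \<longlongrightarrow> c * F' x) (at 0)"
        using F'(1) unfolding has_partial_derivative_euclidean by (intro tendsto_mult_left) blast
      then show "((\<lambda>t. inverse t *\<^sub>R (c * F (x + t *\<^sub>R axis i 1) - c * F x)) \<longlongrightarrow> c * F' x) (at 0)"
        by (simp only: right_diff_distrib[symmetric] mult_scaleR_right)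
    qed
    then show "\<exists>H. has_partial_derivative euclidean scaleR (\<lambda>x. c * F x) i H \<and> C_k k euclidean scaleR H"
      using Suc.IH[OF F'(2)] by blast
  qed
qed

lemma C_k_zero: "C_k k euclidean scaleR (\<lambda>x :: real^'n::finite. 0 :: complex)"
proof (induction k)
  case (Suc k)
  have "has_partial_derivative euclidean scaleR (\<lambda>x :: real^'n. 0 :: complex) i (\<lambda>x. 0)" for i
    by (simp add: has_partial_derivative_euclidean)
  with Suc show ?case by auto
qed simp

lemma smooth_function_sum:
  fixes F :: "'j \<Rightarrow> real^'n::finite \<Rightarrow> complex"
  assumes "\<And>j. j \<in> J \<Longrightarrow> smooth_function (F j)"
  shows "smooth_function (\<lambda>x. \<Sum>j\<in>J. c j * F j x)"
proof -
  have "C_k k euclidean scaleR (\<lambda>x. \<Sum>j\<in>J. c j * F j x)" for k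
    using assms
  proof (induction J rule: infinite_finite_induct)
    case (insert j J)
    have "C_k k euclidean scaleR (\<lambda>x. c j * F j x + (\<Sum>j\<in>J. c j * F j x))"
      by (intro C_k_add C_k_cmult) (use insert in \<open>auto simp: smooth_function_def smooth_map_def\<close>)
    with insert show ?case by simp
  qed (simp_all add: C_k_zero)
  then show ?thesis by (simp add: smooth_function_def smooth_map_def)
qed

lemma smooth_function_continuous:
  assumes "smooth_function F" shows "continuous_on UNIV F"
proof -
  have "C_k 0 euclidean scaleR F" using assms unfolding smooth_function_def smooth_map_def by (rule spec)
  then show ?thesis by simp
qed

text \<open>
  Translating the functional translates the kernel. So derivatives of a coefficient with respect
  to the freezing point are coefficients of derivatives of the functional, up to the sign.
\<close>

lemma average_trans_act:
  assumes \<Psi>: "\<Psi> \<in> PLV d" and \<rho>: "\<rho> \<in> Cc" and f: "f \<in> Conv" and \<phi>: "\<phi> \<in> Cc"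
  shows "translation_average (\<lambda>y. \<rho> (z - y)) (trans_act w \<Psi>) f \<phi> = translation_average (\<lambda>y. \<rho> (z - w - y)) \<Psi> f \<phi>"
proof -
  let ?G = "\<lambda>x. \<Psi> (\<lambda>y. f (y + x)) (\<lambda>y. \<rho> (z - w - y) * \<phi> (y + x))"
  have m: "?G \<in> borel_measurable borel"
    using borel_measurable_integrable[OF average_integrand_integrable[OF \<Psi> reflected_kernel[OF \<rho>, where z="z - w"] f \<phi>]]
    by simp
  have "translation_average (\<lambda>y. \<rho> (z - y)) (trans_act w \<Psi>) f \<phi> = (LINT x|lborel. ?G (w + x))"
    using \<phi> by (simp add: translation_average_def trans_act_apply algebra_simps)
  also have "\<dots> = (LINT x|distr lborel borel ((+) w). ?G x)"
    by (subst integral_distr) (use m in simp_all)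
  also have "\<dots> = translation_average (\<lambda>y. \<rho> (z - w - y)) \<Psi> f \<phi>"
    using \<phi> by (simp add: translation_average_def lborel_distr_plus)
  finally show ?thesis .
qed

lemma frozen_coefficient_continuous:
  assumes \<Psi>: "\<Psi> \<in> PLV d" and \<rho>: "\<rho> \<in> Cc" and f: "f \<in> Conv" and \<phi>: "\<phi> \<in> Cc"
  shows "continuous_on UNIV (\<lambda>z. translation_average (\<lambda>y. \<rho> (z - y)) \<Psi> f \<phi>)"
  unfolding continuous_on_sequentially comp_def
proof (intro allI ballI impI, elim conjE)
  fix z :: "nat \<Rightarrow> real^'a" and a assume z: "z \<longlonglongrightarrow> a"
  define W where "W = insert a (range z)"
  have W: "compact W" unfolding W_def by (rule compact_sequence_with_limit[OF z])
  define A where "A = shifts (supp \<rho>) W"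
  have A: "compact A" unfolding A_def by (rule compact_shifts[OF Cc_compact_supp[OF \<rho>] W])
  have out: "\<rho> (w - y) = 0" if "y \<notin> A" "w \<in> W" for y w
  proof (rule ccontr)
    assume "\<rho> (w - y) \<noteq> 0"
    then have "w - y \<in> supp \<rho>" using outside_supp by blast
    then have "y = w - (w - y) \<and> w \<in> W \<and> w - y \<in> supp \<rho>" using that by simp
    then show False using that(1) unfolding A_def shifts_def by blast
  qed
  have oz: "\<rho> (z m - y) = 0" "\<rho> (a - y) = 0" if "y \<notin> A" for m y
    by (rule out[OF that]; simp add: W_def)+
  have unif: "uniform_limit UNIV (\<lambda>m y. \<rho> (z m - y)) (\<lambda>y. \<rho> (a - y)) sequentially"
  proof (rule uniform_limitI)
    fix e :: real assume e: "e > 0"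
    show "\<forall>\<^sub>F m in sequentially. \<forall>y\<in>UNIV. dist (\<rho> (z m - y)) (\<rho> (a - y)) < e"
    proof (rule Cc_uniformly_continuous[OF \<rho> e])
      fix \<delta> :: real assume \<delta>: "\<delta> > 0" "\<And>x y. dist x y < \<delta> \<Longrightarrow> norm (\<rho> x - \<rho> y) < e"
      have "\<forall>\<^sub>F m in sequentially. dist (z m) a < \<delta>" using z \<delta>(1) by (rule tendstoD)
      then show ?thesis by (rule eventually_mono) (simp add: dist_norm \<delta>(2))
    qed
  qed
  have "(\<lambda>m. LINT x|lborel. \<Psi> (\<lambda>y. f (y + x)) (\<lambda>y. \<rho> (z m - y) * \<phi> (y + x))) \<longlonglongrightarrow>
      (LINT x|lborel. \<Psi> (\<lambda>y. f (y + x)) (\<lambda>y. \<rho> (a - y) * \<phi> (y + x)))"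
  proof (rule integral_tendsto_continuous_convergence)
    show "continuous_on UNIV (\<lambda>x. \<Psi> (\<lambda>y. f (y + x)) (\<lambda>y. \<rho> (z m - y) * \<phi> (y + x)))" for m
      by (rule average_integrand_continuous[OF \<Psi> reflected_kernel(1)[OF \<rho>] A oz(1) f \<phi>])
    show "continuous_on UNIV (\<lambda>x. \<Psi> (\<lambda>y. f (y + x)) (\<lambda>y. \<rho> (a - y) * \<phi> (y + x)))"
      by (rule average_integrand_continuous[OF \<Psi> reflected_kernel(1)[OF \<rho>] A oz(2) f \<phi>])
    show "compact (shifts A (supp \<phi>))" by (rule compact_shifts[OF A Cc_compact_supp[OF \<phi>]])
    show "\<Psi> (\<lambda>y. f (y + x)) (\<lambda>y. \<rho> (z m - y) * \<phi> (y + x)) = 0" if "x \<notin> shifts A (supp \<phi>)" for m x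
      by (rule average_integrand_outside_supp[OF \<Psi> reflected_kernel(1)[OF \<rho>] A oz(1) f that])
    show "\<Psi> (\<lambda>y. f (y + x)) (\<lambda>y. \<rho> (a - y) * \<phi> (y + x)) = 0" if "x \<notin> shifts A (supp \<phi>)" for x
      by (rule average_integrand_outside_supp[OF \<Psi> reflected_kernel(1)[OF \<rho>] A oz(2) f that])
    fix r :: "nat \<Rightarrow> nat" and x :: "nat \<Rightarrow> real^'a" and b
    assume r: "strict_mono r" and x: "x \<longlonglongrightarrow> b"
    have u: "uniform_limit UNIV (\<lambda>k y. \<rho> (z (r k) - y)) (\<lambda>y. \<rho> (a - y)) sequentially"
      by (rule filterlim_compose[OF unif filterlim_subseq[OF r]])
    show "(\<lambda>k. \<Psi> (\<lambda>y. f (y + x k)) (\<lambda>y. \<rho> (z (r k) - y) * \<phi> (y + x k))) \<longlonglongrightarrow> \<Psi> (\<lambda>y. f (y + b)) (\<lambda>y. \<rho> (a - y) * \<phi> (y + b))"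
      by (rule PLV_joint_tendsto[OF \<Psi> f f tendsto_const x A reflected_kernel(1)[OF \<rho>] oz(1) reflected_kernel(1)[OF \<rho>] oz(2) u \<phi>])
  qed
  then show "(\<lambda>m. translation_average (\<lambda>y. \<rho> (z m - y)) \<Psi> f \<phi>) \<longlonglongrightarrow> translation_average (\<lambda>y. \<rho> (a - y)) \<Psi> f \<phi>"
    using \<phi> by (simp add: translation_average_def)
qed

text \<open>
  The difference quotient of the coefficient is the average of the difference quotient of the
  functional. The latter converges uniformly on the compact set of translates of
  \<open>f\<close> that occur, for each test function; Banach-Steinhaus turns this into
  continuous convergence of the integrand, whose test function also varies with
  \<open>x\<close>.
\<close>

lemma frozen_coefficient_derivative:
  fixes \<Psi> :: "'n::finite functional"
  assumes \<Psi>: "\<Psi> \<in> PLV d" "\<And>w. trans_act w \<Psi> \<in> PLV d" and \<Theta>: "\<Theta> \<in> PLV d" "partial_derivative \<Psi> i \<Theta>"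
    and \<rho>: "\<rho> \<in> Cc" and f: "f \<in> Conv" and \<phi>: "\<phi> \<in> Cc"
  shows "has_partial_derivative euclidean scaleR (\<lambda>z. translation_average (\<lambda>y. \<rho> (z - y)) \<Psi> f \<phi>) i
    (\<lambda>z. (-1) * translation_average (\<lambda>y. \<rho> (z - y)) \<Theta> f \<phi>)"
  unfolding has_partial_derivative_euclidean tendsto_at_iff_sequentially comp_def
proof (intro allI impI)
  fix z :: "real^'n" and X :: "nat \<Rightarrow> real" assume X0: "\<forall>m. X m \<in> UNIV - {0}" and X: "X \<longlonglongrightarrow> 0"
  let ?e = "axis i 1 :: real^'n"
  define A where "A = (\<lambda>a. z - a) ` supp \<rho>"
  have A: "compact A" and \<rho>A: "\<And>y. y \<notin> A \<Longrightarrow> \<rho> (z - y) = 0" and \<rho>z: "(\<lambda>y. \<rho> (z - y)) \<in> Cc"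
    unfolding A_def using reflected_kernel[OF \<rho>, where z=z] by auto
  define I where "I \<Phi> x = \<Phi> (\<lambda>y. f (y + x)) (\<lambda>y. \<rho> (z - y) * \<phi> (y + x))" for \<Phi> :: "'n functional" and x
  have Ic: "continuous_on UNIV (I \<Phi>)" and Ii: "integrable lborel (I \<Phi>)"
    and I0: "\<And>x. x \<notin> shifts A (supp \<phi>) \<Longrightarrow> I \<Phi> x = 0"
    and Iav: "(LINT x|lborel. I \<Phi> x) = translation_average (\<lambda>y. \<rho> (z - y)) \<Phi> f \<phi>" if "\<Phi> \<in> PLV d" for \<Phi>
    unfolding I_def
    using average_integrand_continuous[OF that \<rho>z A \<rho>A f \<phi>] average_integrand_integrable[OF that \<rho>z A \<rho>A f \<phi>]
      average_integrand_outside_supp[OF that \<rho>z A \<rho>A f] \<phi>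
    by (simp_all add: translation_average_def)
  \<comment> \<open>Moving the kernel by \<open>X m\<close> is translating the functional by the
      opposite amount.\<close>
  define t where "t m = - X m" for m
  have t0: "t m \<noteq> 0" for m using X0 by (simp add: t_def)
  have t: "t \<longlonglongrightarrow> 0" using tendsto_minus[OF X] by (simp add: t_def[abs_def])
  define Q where "Q m h \<psi> = of_real (inverse (t m)) * (trans_act (t m *\<^sub>R ?e) \<Psi> h \<psi> - \<Psi> h \<psi>)" for m h \<psi>
  have QI: "Q m (\<lambda>y. f (y + x)) (\<lambda>y. \<rho> (z - y) * \<phi> (y + x)) = of_real (inverse (t m)) * (I (trans_act (t m *\<^sub>R ?e) \<Psi>) x - I \<Psi> x)" for m x
    by (simp add: Q_def I_def)
  have QR: "Q m h \<in> Radon" if "h \<in> Conv" for m h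
  proof -
    have "(\<lambda>\<psi>. \<Sum>b\<in>{True, False}. (if b then of_real (inverse (t m)) else - of_real (inverse (t m))) *
        (if b then trans_act (t m *\<^sub>R ?e) \<Psi> h else \<Psi> h) \<psi>) \<in> Radon"
      by (rule Radon_lincomb) (use PLV_Radon[OF \<Psi>(2) that] PLV_Radon[OF \<Psi>(1) that] in auto)
    then show ?thesis by (simp add: Q_def[abs_def] algebra_simps)
  qed
  have "(\<lambda>m. LINT x|lborel. of_real (inverse (t m)) * (I (trans_act (t m *\<^sub>R ?e) \<Psi>) x - I \<Psi> x)) \<longlonglongrightarrow> (LINT x|lborel. I \<Theta> x)"
  proof (rule integral_tendsto_continuous_convergence[OF _ Ic[OF \<Theta>(1)] compact_shifts[OF A Cc_compact_supp[OF \<phi>]] _ I0[OF \<Theta>(1)]])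
    show "continuous_on UNIV (\<lambda>x. of_real (inverse (t m)) * (I (trans_act (t m *\<^sub>R ?e) \<Psi>) x - I \<Psi> x))" for m
      by (intro continuous_on_mult_left continuous_on_diff Ic \<Psi>)
    show "of_real (inverse (t m)) * (I (trans_act (t m *\<^sub>R ?e) \<Psi>) x - I \<Psi> x) = 0" if "x \<notin> shifts A (supp \<phi>)" for m x
      using I0[OF \<Psi>(1) that] I0[OF \<Psi>(2) that] by simp
    fix r :: "nat \<Rightarrow> nat" and x :: "nat \<Rightarrow> real^'n" and b
    assume r: "strict_mono r" and x: "x \<longlonglongrightarrow> b"
    have tr: "(\<lambda>k. t (r k)) \<longlonglongrightarrow> 0" using LIMSEQ_subseq_LIMSEQ[OF t r] by (simp add: comp_def)
    have "(\<lambda>k. Q (r k) (\<lambda>y. f (y + x k)) (\<lambda>y. \<rho> (z - y) * \<phi> (y + x k))) \<longlonglongrightarrow> \<Theta> (\<lambda>y. f (y + b)) (\<lambda>y. \<rho> (z - y) * \<phi> (y + b))"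
    proof (rule Radon_tendsto[where L="\<lambda>k. Q (r k) (\<lambda>y. f (y + x k))" and L'="\<Theta> (\<lambda>y. f (y + b))"
          and \<psi>m="\<lambda>k y. \<rho> (z - y) * \<phi> (y + x k)" and \<psi>="\<lambda>y. \<rho> (z - y) * \<phi> (y + b)", OF _ _ _ A])
      show "Q (r k) (\<lambda>y. f (y + x k)) \<in> Radon" for k by (rule QR[OF Conv_translate[OF f]])
      show "\<Theta> (\<lambda>y. f (y + b)) \<in> Radon" by (rule PLV_Radon[OF \<Theta>(1) Conv_translate[OF f]])
      show "(\<lambda>y. \<rho> (z - y) * \<phi> (y + x k)) \<in> Cc" "(\<lambda>y. \<rho> (z - y) * \<phi> (y + b)) \<in> Cc" for k
        by (intro Cc_mult(2)[OF \<rho>z] Cc_continuous Cc_translate \<phi>)+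
      show "\<rho> (z - y) * \<phi> (y + x k) = 0" "\<rho> (z - y) * \<phi> (y + b) = 0" if "y \<notin> A" for y k
        using \<rho>A[OF that] by simp_all
      have bd: "bounded (range \<psi>)" if "\<psi> \<in> Cc" for \<psi> :: "real^'n \<Rightarrow> complex"
      proof (rule Cc_bounded[OF that])
        fix s assume "\<And>x. norm (\<psi> x) \<le> s"
        then show ?thesis unfolding bounded_iff by (intro exI[of _ s]) auto
      qed
      show "uniform_limit UNIV (\<lambda>k y. \<rho> (z - y) * \<phi> (y + x k)) (\<lambda>y. \<rho> (z - y) * \<phi> (y + b)) sequentially"
        by (rule uniform_lim_mult[OF uniform_limit_const uniform_limit_translates[OF \<phi> x] bd[OF \<rho>z] bd[OF Cc_translate[OF \<phi>]]])
      fix \<psi> :: "real^'n \<Rightarrow> complex" assume \<psi>: "\<psi> \<in> Cc"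
      define W where "W = insert b (range x)"
      have W: "compact W" unfolding W_def by (rule compact_sequence_with_limit[OF x])
      define K where "K = (\<lambda>x y. f (y + x)) ` W"
      have K: "compact K" "K \<noteq> {}" "K \<subseteq> Conv"
        unfolding K_def using compact_translates[OF f W] Conv_translate[OF f] by (auto simp: W_def)
      have "(\<lambda>k. Q (r k) (\<lambda>y. f (y + x k)) \<psi> - \<Theta> (\<lambda>y. f (y + x k)) \<psi>) \<longlonglongrightarrow> 0"
      proof (rule tendstoI)
        fix e :: real assume e: "e > 0"
        have ev: "\<forall>\<^sub>F s in at 0. \<forall>h\<in>K. norm (of_real (inverse s) * (trans_act (s *\<^sub>R ?e) \<Psi> h \<psi> - \<Psi> h \<psi>) - \<Theta> h \<psi>) < e"
          using \<Theta>(2) K \<psi> e unfolding partial_derivative_def by simp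
        have "filterlim (\<lambda>k. t (r k)) (at 0) sequentially"
          using tr t0 by (simp add: filterlim_at)
        from eventually_compose_filterlim[OF ev this]
        show "\<forall>\<^sub>F k in sequentially. dist (Q (r k) (\<lambda>y. f (y + x k)) \<psi> - \<Theta> (\<lambda>y. f (y + x k)) \<psi>) 0 < e"
        proof (rule eventually_mono)
          fix k assume *: "\<forall>h\<in>K. norm (of_real (inverse (t (r k))) * (trans_act (t (r k) *\<^sub>R ?e) \<Psi> h \<psi> - \<Psi> h \<psi>) - \<Theta> h \<psi>) < e"
          have "(\<lambda>y. f (y + x k)) \<in> K" unfolding K_def W_def by blast
          from *[rule_format, OF this] show "dist (Q (r k) (\<lambda>y. f (y + x k)) \<psi> - \<Theta> (\<lambda>y. f (y + x k)) \<psi>) 0 < e"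
            by (simp only: Q_def dist_norm diff_0_right)
        qed
      qed
      moreover have "(\<lambda>k. \<Theta> (\<lambda>y. f (y + x k)) \<psi>) \<longlonglongrightarrow> \<Theta> (\<lambda>y. f (y + b)) \<psi>"
        by (intro PLV_tendsto[OF \<Theta>(1)] Conv_translate f Conv_translate_tendsto tendsto_const x)
      ultimately have "(\<lambda>k. (Q (r k) (\<lambda>y. f (y + x k)) \<psi> - \<Theta> (\<lambda>y. f (y + x k)) \<psi>) + \<Theta> (\<lambda>y. f (y + x k)) \<psi>) \<longlonglongrightarrow> 0 + \<Theta> (\<lambda>y. f (y + b)) \<psi>"
        by (rule tendsto_add)
      then show "(\<lambda>k. Q (r k) (\<lambda>y. f (y + x k)) \<psi>) \<longlonglongrightarrow> \<Theta> (\<lambda>y. f (y + b)) \<psi>" by simp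
    qed
    then show "(\<lambda>k. of_real (inverse (t (r k))) * (I (trans_act (t (r k) *\<^sub>R ?e) \<Psi>) (x k) - I \<Psi> (x k))) \<longlonglongrightarrow> I \<Theta> b"
      by (simp only: QI) (simp only: I_def)
  qed
  moreover have "(LINT x|lborel. of_real (inverse (t m)) * (I (trans_act (t m *\<^sub>R ?e) \<Psi>) x - I \<Psi> x)) =
      (-1) * (inverse (X m) *\<^sub>R (translation_average (\<lambda>y. \<rho> (z + X m *\<^sub>R ?e - y)) \<Psi> f \<phi> - translation_average (\<lambda>y. \<rho> (z - y)) \<Psi> f \<phi>))" for m
  proof -
    have "(LINT x|lborel. of_real (inverse (t m)) * (I (trans_act (t m *\<^sub>R ?e) \<Psi>) x - I \<Psi> x)) =
        of_real (inverse (t m)) * ((LINT x|lborel. I (trans_act (t m *\<^sub>R ?e) \<Psi>) x) - (LINT x|lborel. I \<Psi> x))"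
      by (simp only: integral_mult_right_zero Bochner_Integration.integral_diff[OF Ii[OF \<Psi>(2)] Ii[OF \<Psi>(1)]])
    also have "\<dots> = of_real (inverse (t m)) * (translation_average (\<lambda>y. \<rho> (z - t m *\<^sub>R ?e - y)) \<Psi> f \<phi> - translation_average (\<lambda>y. \<rho> (z - y)) \<Psi> f \<phi>)"
      by (simp only: Iav[OF \<Psi>(1)] Iav[OF \<Psi>(2)] average_trans_act[OF \<Psi>(1) \<rho> f \<phi>])
    finally show ?thesis by (simp add: t_def scaleR_conv_of_real)
  qed
  ultimately have "(\<lambda>m. (-1) * (inverse (X m) *\<^sub>R (translation_average (\<lambda>y. \<rho> (z + X m *\<^sub>R ?e - y)) \<Psi> f \<phi> - translation_average (\<lambda>y. \<rho> (z - y)) \<Psi> f \<phi>)))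
      \<longlonglongrightarrow> translation_average (\<lambda>y. \<rho> (z - y)) \<Theta> f \<phi>"
    by (simp only: Iav[OF \<Theta>(1)])
  from tendsto_mult_left[OF this, of "-1"]
  show "(\<lambda>m. inverse (X m) *\<^sub>R (translation_average (\<lambda>y. \<rho> (z + X m *\<^sub>R ?e - y)) \<Psi> f \<phi> - translation_average (\<lambda>y. \<rho> (z - y)) \<Psi> f \<phi>))
      \<longlonglongrightarrow> (-1) * translation_average (\<lambda>y. \<rho> (z - y)) \<Theta> f \<phi>"
    by simp
qed

lemma frozen_coefficient_smooth:
  assumes \<Psi>: "\<Psi> \<in> PLV d" "smooth_functional d \<Psi>" and \<rho>: "\<rho> \<in> Cc"
  shows "smooth_function (\<lambda>z. translation_average (\<lambda>y. \<rho> (z - y)) \<Psi> f \<phi>)"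
proof (cases "f \<in> Conv \<and> \<phi> \<in> Cc")
  case False
  then have "translation_average (\<lambda>y. \<rho> (z - y)) \<Psi> f \<phi> = 0" for z
    using PLV_outside[OF \<Psi>(1), of "\<lambda>y. f (y + _)"] by (auto simp: translation_average_def Conv_translate_iff)
  then show ?thesis by (simp add: smooth_function_def smooth_map_def C_k_zero)
next
  case True
  then have f: "f \<in> Conv" and \<phi>: "\<phi> \<in> Cc" by auto
  have "C_k k euclidean scaleR (\<lambda>z. translation_average (\<lambda>y. \<rho> (z - y)) \<Psi> f \<phi>)" for k
    using \<Psi>
  proof (induction k arbitrary: \<Psi>)
    case 0
    show ?case using frozen_coefficient_continuous[OF 0(1) \<rho> f \<phi>] by simp
  next
    case (Suc k)
    show ?case
    proof (simp only: C_k.simps, intro conjI allI)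
      show "continuous_map euclidean euclidean (\<lambda>z. translation_average (\<lambda>y. \<rho> (z - y)) \<Psi> f \<phi>)"
        using frozen_coefficient_continuous[OF Suc.prems(1) \<rho> f \<phi>] by simp
      fix i
      obtain \<Theta> where \<Theta>: "\<Theta> \<in> PLV d" "smooth_functional d \<Theta>" "partial_derivative \<Psi> i \<Theta>"
        using smooth_functional_derivative[OF Suc.prems(2), of i] by blast
      have "has_partial_derivative euclidean scaleR (\<lambda>z. translation_average (\<lambda>y. \<rho> (z - y)) \<Psi> f \<phi>) i
          (\<lambda>z. (-1) * translation_average (\<lambda>y. \<rho> (z - y)) \<Theta> f \<phi>)"
        by (rule frozen_coefficient_derivative[OF Suc.prems(1) trans_act_in_PLV[OF Suc.prems(2)] \<Theta>(1,3) \<rho> f \<phi>])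
      moreover have "C_k k euclidean scaleR (\<lambda>z. (-1) * translation_average (\<lambda>y. \<rho> (z - y)) \<Theta> f \<phi>)"
        by (rule C_k_cmult[OF Suc.IH[OF \<Theta>(1,2)]])
      ultimately show "\<exists>G. has_partial_derivative euclidean scaleR (\<lambda>z. translation_average (\<lambda>y. \<rho> (z - y)) \<Psi> f \<phi>) i G \<and>
          C_k k euclidean scaleR G" by blast
    qed
  qed
  then show ?thesis by (simp add: smooth_function_def smooth_map_def)
qed

section \<open>A parametrix on the unit cube\<close>

definition upd :: "'n::finite \<Rightarrow> real^'n \<Rightarrow> real \<Rightarrow> real^'n" where
  "upd i x t = (\<chi> j. if j = i then t else x $ j)"

definition cube :: "(real^'n::finite) set" where
  "cube = {x. \<forall>j. 0 < x $ j \<and> x $ j < 1}"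

lemma upd_nth: "upd i x t $ j = (if j = i then t else x $ j)"
  by (simp add: upd_def)

lemma cube_eq_box: "(cube :: (real^'n::finite) set) = box 0 (\<chi> j. 1)"
  by (auto simp: cube_def mem_box_cart)

lemma emeasure_box_cart:
  fixes l u :: "real^'n::finite"
  assumes "\<And>j. l $ j \<le> u $ j"
  shows "emeasure lborel (box l u) = ennreal (\<Prod>j\<in>UNIV. u $ j - l $ j)"
proof -
  have B: "(Basis :: (real^'n) set) = (\<lambda>j. axis j 1) ` UNIV" by (auto simp: Basis_vec_def)
  have inj: "inj (\<lambda>j. axis j (1::real) :: real^'n)" by (auto simp: inj_on_def axis_eq_axis)
  have "emeasure lborel (box l u) = ennreal (\<Prod>b\<in>Basis. (u - l) \<bullet> b)"
    by (rule emeasure_lborel_box) (use assms in \<open>auto simp: B inner_axis\<close>)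
  also have "(\<Prod>b\<in>Basis. (u - l) \<bullet> b) = (\<Prod>j\<in>UNIV. u $ j - l $ j)"
    unfolding B by (subst prod.reindex[OF inj]) (simp add: inner_axis)
  finally show ?thesis .
qed

lemma continuous_on_upd: "continuous_on UNIV (\<lambda>p. upd i (fst p) (snd p))"
  unfolding upd_def
proof (rule continuous_on_vec_lambda)
  fix j show "continuous_on UNIV (\<lambda>p :: (real^'a) \<times> real. if j = i then snd p else fst p $ j)"
    by (cases "j = i") (simp_all add: continuous_intros)
qed

lemma measurable_upd [measurable]: "(\<lambda>p. upd i (fst p) (snd p)) \<in> borel_measurable (lborel \<Otimes>\<^sub>M lborel)"
  using borel_measurable_continuous_onI[OF continuous_on_upd] by (simp add: lborel_prod)

text \<open>
  Lebesgue measure is unchanged if the coordinate \<open>i\<close> is first restricted to the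
  unit interval, where it has mass 1, and then overwritten by an independent variable. This
  gives Fubini's theorem in a single coordinate without splitting the index type.
\<close>

lemma lborel_replace_coordinate:
  fixes i :: "'n::finite"
  shows "(lborel :: (real^'n) measure) = distr (density (lborel \<Otimes>\<^sub>M lborel)
      (\<lambda>p. indicator {x. 0 < x $ i \<and> x $ i < 1} (fst p))) borel (\<lambda>p. upd i (fst p) (snd p))"
    (is "_ = distr ?D _ ?u")
proof (rule lborel_eqI)
  have [measurable]: "{x :: real^'n. 0 < x $ i \<and> x $ i < 1} \<in> sets borel"
    by measurable
  fix l u :: "real^'n" assume "\<And>b. b \<in> Basis \<Longrightarrow> l \<bullet> b \<le> u \<bullet> b"
  then have lu: "l $ j \<le> u $ j" for j
    by (metis axis_in_Basis_iff inner_axis inner_real_def mult.right_neutral real_inner_1_right Basis_real_def singletonI)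
  define l' where "l' = upd i l 0"
  define u' where "u' = upd i u 1"
  have "emeasure (distr ?D borel ?u) (box l u) = emeasure ?D (?u -` box l u \<inter> space ?D)"
    by (rule emeasure_distr) auto
  also have "\<dots> = (\<integral>\<^sup>+ p. indicator {x. 0 < x $ i \<and> x $ i < 1} (fst p) * indicator (?u -` box l u) p \<partial>(lborel \<Otimes>\<^sub>M lborel))"
  proof (subst emeasure_density)
    have "?u -` box l u \<inter> space (lborel \<Otimes>\<^sub>M lborel) \<in> sets (lborel \<Otimes>\<^sub>M lborel)"
      by (rule measurable_sets[OF measurable_upd]) simp
    then show "?u -` box l u \<inter> space ?D \<in> sets (lborel \<Otimes>\<^sub>M lborel)" by simp
  qed (auto simp: space_pair_measure)
  also have "\<dots> = (\<integral>\<^sup>+ p. indicator (box l' u' \<times> {l $ i<..<u $ i}) p \<partial>(lborel \<Otimes>\<^sub>M lborel))"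
  proof (rule nn_integral_cong)
    fix p :: "(real^'n) \<times> real"
    obtain x t where p: "p = (x, t)" by fastforce
    have "(0 < x $ i \<and> x $ i < 1) \<and> upd i x t \<in> box l u \<longleftrightarrow> x \<in> box l' u' \<and> l $ i < t \<and> t < u $ i"
      unfolding mem_box_cart l'_def u'_def upd_nth by (auto split: if_splits)
    then show "indicator {x. 0 < x $ i \<and> x $ i < 1} (fst p) * indicator (?u -` box l u) p
        = (indicator (box l' u' \<times> {l $ i<..<u $ i}) p :: ennreal)"
      by (auto simp: p indicator_def)
  qed
  also have "\<dots> = emeasure (lborel \<Otimes>\<^sub>M lborel) (box l' u' \<times> {l $ i<..<u $ i})"
    by (rule nn_integral_indicator) simp
  also have "\<dots> = emeasure lborel (box l' u') * emeasure lborel {l $ i<..<u $ i}"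
    by (rule lborel.emeasure_pair_measure_Times) auto
  also have "\<dots> = ennreal (\<Prod>j\<in>UNIV. u' $ j - l' $ j) * ennreal (u $ i - l $ i)"
    using lu by (subst emeasure_box_cart) (auto simp: l'_def u'_def upd_nth)
  also have "\<dots> = ennreal (\<Prod>j\<in>UNIV. u $ j - l $ j)"
  proof -
    have "(\<Prod>j\<in>UNIV. u' $ j - l' $ j) = (\<Prod>j\<in>UNIV - {i}. u $ j - l $ j)"
      by (subst prod.remove[of _ i]) (auto simp: l'_def u'_def upd_nth intro!: prod.cong)
    moreover have "(\<Prod>j\<in>UNIV. u $ j - l $ j) = (u $ i - l $ i) * (\<Prod>j\<in>UNIV - {i}. u $ j - l $ j)"
      by (rule prod.remove) auto
    moreover have "0 \<le> (\<Prod>j\<in>UNIV - {i}. u $ j - l $ j)" using lu by (intro prod_nonneg) simp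
    ultimately show ?thesis using lu by (simp add: ennreal_mult[symmetric] mult.commute)
  qed
  also have "\<dots> = emeasure lborel (box l u)" by (rule emeasure_box_cart[OF lu, symmetric])
  also have "\<dots> = ennreal (\<Prod>b\<in>Basis. (u - l) \<bullet> b)"
    by (rule emeasure_lborel_box) fact
  finally show "emeasure (distr ?D borel ?u) (box l u) = ennreal (\<Prod>b\<in>Basis. (u - l) \<bullet> b)" .
qed simp

lemma cube_measure: "emeasure lborel (cube :: (real^'n::finite) set) = 1" "cube \<in> sets borel"
  unfolding cube_eq_box by (subst emeasure_box_cart) simp_all

lemma integrable_cube:
  fixes H :: "real^'n::finite \<Rightarrow> complex"
  assumes "continuous_on UNIV H"
  shows "integrable lborel (\<lambda>x. indicator cube x *\<^sub>R H x)"
proof -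
  let ?B = "cbox 0 (\<chi> j. 1) :: (real^'n) set"
  have "integrable lborel (\<lambda>x. indicator ?B x *\<^sub>R H x)"
    by (rule borel_integrable_compact[OF compact_cbox continuous_on_subset[OF assms subset_UNIV]])
  then have "integrable lborel (\<lambda>x. indicator cube x *\<^sub>R (indicator ?B x *\<^sub>R H x))"
    by (rule integrable_mult_indicator[rotated]) (simp add: cube_measure(2))
  moreover have "indicator cube x *\<^sub>R (indicator ?B x *\<^sub>R H x) = indicator cube x *\<^sub>R H x" for x
    using box_subset_cbox[of "0 :: real^'n" "\<chi> j. 1"] unfolding cube_eq_box[symmetric] by (auto simp: indicator_def)
  then have "(\<lambda>x. indicator cube x *\<^sub>R (indicator ?B x *\<^sub>R H x)) = (\<lambda>x. indicator cube x *\<^sub>R H x)" by blast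
  ultimately show ?thesis by (simp only:)
qed

text \<open>
  The average over the coordinate \<open>i\<close> may be performed first; the outer integral
  still runs over the whole cube, whose coordinate \<open>i\<close> has become a dummy variable
  of total mass 1.
\<close>

lemma cube_fubini:
  fixes H :: "real^'n::finite \<Rightarrow> complex"
  assumes H: "continuous_on UNIV H"
  shows "(LINT x|lborel. indicator cube x *\<^sub>R H x) =
    (LINT x|lborel. indicator cube x *\<^sub>R (LINT t|lborel. indicator {0<..<1} t *\<^sub>R H (upd i x t)))"
proof -
  have [measurable]: "H \<in> borel_measurable borel" by (rule borel_measurable_continuous_onI[OF H])
  have [measurable]: "(cube :: (real^'n) set) \<in> sets borel" by (rule cube_measure(2))
  have [measurable]: "{x :: real^'n. 0 < x $ i \<and> x $ i < 1} \<in> sets borel" by measurable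
  let ?u = "\<lambda>p. upd i (fst p) (snd p)"
  define F where "F y = indicator cube y *\<^sub>R H y" for y
  have Fm[measurable]: "F \<in> borel_measurable borel" unfolding F_def by measurable
  define W where "W p = indicator (cube \<times> {0<..<1}) p *\<^sub>R H (?u p)" for p :: "(real^'n) \<times> real"
  have W: "indicator {x. 0 < x $ i \<and> x $ i < 1} (fst p) *\<^sub>R F (?u p) = W p" for p
  proof -
    obtain x t where p: "p = (x, t)" by fastforce
    have "(0 < x $ i \<and> x $ i < 1) \<and> upd i x t \<in> cube \<longleftrightarrow> x \<in> cube \<and> 0 < t \<and> t < 1"
      unfolding cube_def mem_Collect_eq upd_nth by (auto split: if_splits)
    then show ?thesis by (auto simp: p W_def F_def indicator_def)
  qed
  have Wi: "integrable (lborel \<Otimes>\<^sub>M lborel) W"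
  proof -
    let ?B = "cbox 0 (\<chi> j. 1) :: (real^'n) set"
    have "bounded (H ` ?B)"
      by (rule compact_imp_bounded[OF compact_continuous_image[OF continuous_on_subset[OF H subset_UNIV] compact_cbox]])
    then obtain M where "\<forall>z\<in>H ` ?B. norm z \<le> M" unfolding bounded_iff by (rule exE)
    then have M: "\<And>x. x \<in> ?B \<Longrightarrow> norm (H x) \<le> M" by blast
    have CI: "(cube :: (real^'n) set) \<times> {0<..<1 :: real} \<in> sets (lborel \<Otimes>\<^sub>M lborel)" by (intro pair_measureI) (simp_all add: cube_measure)
    have "emeasure (lborel \<Otimes>\<^sub>M lborel) ((cube :: (real^'n) set) \<times> {0<..<1 :: real}) = emeasure lborel (cube :: (real^'n) set) * emeasure lborel {0<..<1 :: real}"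
      by (rule lborel.emeasure_pair_measure_Times) (simp_all add: cube_measure)
    then have fin: "emeasure (lborel \<Otimes>\<^sub>M lborel) ((cube :: (real^'n) set) \<times> {0<..<1 :: real}) < \<infinity>"
      by (simp add: cube_measure)
    show ?thesis
    proof (rule Bochner_Integration.integrable_bound)
      show "integrable (lborel \<Otimes>\<^sub>M lborel) (\<lambda>p. indicator ((cube :: (real^'n) set) \<times> {0<..<1 :: real}) p * M)"
        by (intro integrable_mult_left integrable_real_indicator CI fin)
      have "(\<lambda>p. H (?u p)) \<in> borel_measurable (lborel \<Otimes>\<^sub>M lborel)"
        by (rule measurable_compose[OF measurable_upd]) simp
      then show "W \<in> borel_measurable (lborel \<Otimes>\<^sub>M lborel)"
        unfolding W_def[abs_def] using CI by (intro borel_measurable_scaleR borel_measurable_indicator)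
      show "AE p in lborel \<Otimes>\<^sub>M lborel. norm (W p) \<le> norm (indicator (cube \<times> {0<..<1}) p * M)"
      proof (rule AE_I2)
        fix p :: "(real^'n) \<times> real"
        show "norm (W p) \<le> norm (indicator (cube \<times> {0<..<1}) p * M)"
        proof (cases "p \<in> cube \<times> {0<..<1}")
          case True
          then have "?u p \<in> cube" by (auto simp: cube_def upd_nth)
          then have "?u p \<in> ?B" using box_subset_cbox[of "0 :: real^'n" "\<chi> j. 1"] unfolding cube_eq_box by blast
          from M[OF this] True show ?thesis by (simp add: W_def)
        qed (simp add: W_def)
      qed
    qed
  qed
  have "(LINT x|lborel. F x) = (LINT p|density (lborel \<Otimes>\<^sub>M lborel)
      (\<lambda>p. indicator {x. 0 < x $ i \<and> x $ i < 1} (fst p)). F (?u p))"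
    by (subst lborel_replace_coordinate[of i], subst integral_distr) auto
  also have "\<dots> = (LINT p|density (lborel \<Otimes>\<^sub>M lborel)
      (\<lambda>p. ennreal (indicator {x. 0 < x $ i \<and> x $ i < 1} (fst p))). F (?u p))"
    by (simp add: ennreal_indicator)
  also have "\<dots> = (LINT p|(lborel \<Otimes>\<^sub>M lborel). indicator {x. 0 < x $ i \<and> x $ i < 1} (fst p) *\<^sub>R F (?u p))"
    by (rule integral_density) auto
  also have "\<dots> = (LINT p|(lborel \<Otimes>\<^sub>M lborel). W p)" by (simp only: W)
  also have "\<dots> = (LINT x|lborel. LINT t|lborel. W (x, t))"
    using lborel_pair.integral_fst'[OF Wi] by simp
  also have "\<dots> = (LINT x|lborel. indicator cube x *\<^sub>R (LINT t|lborel. indicator {0<..<1} t *\<^sub>R H (upd i x t)))"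
  proof (rule Bochner_Integration.integral_cong[OF refl])
    fix x :: "real^'n"
    have "W (x, t) = indicator cube x *\<^sub>R (indicator {0<..<1} t *\<^sub>R H (upd i x t))" for t
      by (simp add: W_def indicator_times)
    then show "(LINT t|lborel. W (x, t)) = indicator cube x *\<^sub>R (LINT t|lborel. indicator {0<..<1} t *\<^sub>R H (upd i x t))"
      by (simp only: integral_scaleR_right)
  qed
  finally show ?thesis by (simp add: F_def)
qed

text \<open>
  The polynomial \<open>p t = t - 6 * t^3 + 8 * t^4 - 3 * t^5\<close> satisfies
  \<open>p 0 = p 1 = p' 1 = 0\<close>, \<open>p' 0 = 1\<close> and
  \<open>p'' 0 = p'' 1 = 0\<close>. Clamping the argument extends \<open>p\<close> and
  \<open>p''\<close> continuously by zero; \<open>kernel0\<close> is the extension of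
  \<open>- p''\<close>.
\<close>

definition kernel2 :: "real \<Rightarrow> real" where
  "kernel2 t = (let s = max 0 (min 1 t) in s - 6 * s^3 + 8 * s^4 - 3 * s^5)"

definition kernel0 :: "real \<Rightarrow> real" where
  "kernel0 t = (let s = max 0 (min 1 t) in 36 * s - 96 * s^2 + 60 * s^3)"

lemma kernel_continuous: "continuous_on A (\<lambda>x. kernel2 x)" "continuous_on A (\<lambda>x. kernel0 x)"
  unfolding kernel2_def kernel0_def Let_def by (intro continuous_intros)+

lemma kernel_outside:
  assumes "\<not> (0 < t \<and> t < 1)" shows "kernel2 t = 0" "kernel0 t = 0"
proof -
  have "max 0 (min 1 t) = 0 \<or> max 0 (min 1 t) = 1" using assms by auto
  then show "kernel2 t = 0" "kernel0 t = 0" unfolding kernel2_def kernel0_def Let_def by auto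
qed

text \<open>
  The integrand is the derivative of \<open>p g' - p' g\<close>, and the boundary values of
  \<open>p\<close> and \<open>p'\<close> leave only \<open>g 0\<close>.
\<close>

lemma parametrix_1d:
  fixes g g1 g2 :: "real \<Rightarrow> complex"
  assumes g: "\<And>t. (g has_vector_derivative g1 t) (at t)" and g1: "\<And>t. (g1 has_vector_derivative g2 t) (at t)"
    and g2: "continuous_on UNIV g2"
  shows "(LINT t|lborel. indicator {0<..<1} t *\<^sub>R (kernel2 t *\<^sub>R g2 t + kernel0 t *\<^sub>R g t)) = g 0"
proof -
  define p where "p t = t - 6 * t^3 + 8 * t^4 - 3 * t^5" for t :: real
  define p1 where "p1 t = 1 - 18 * t^2 + 32 * t^3 - 15 * t^4" for t :: real
  define p2 where "p2 t = - 36 * t + 96 * t^2 - 60 * t^3" for t :: real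
  have dp: "(p has_real_derivative p1 t) (at t within A)" for t A
    unfolding p_def p1_def by (auto intro!: derivative_eq_intros simp: eval_nat_numeral algebra_simps)
  have dp1: "(p1 has_real_derivative p2 t) (at t within A)" for t A
    unfolding p1_def p2_def by (auto intro!: derivative_eq_intros simp: eval_nat_numeral algebra_simps)
  define F where "F t = p t *\<^sub>R g1 t - p1 t *\<^sub>R g t" for t
  have gc: "continuous_on UNIV g"
    using g by (intro continuous_at_imp_continuous_on ballI has_vector_derivative_continuous)
  have dF: "(F has_vector_derivative (p t *\<^sub>R g2 t - p2 t *\<^sub>R g t)) (at t within {0..1})" for t
    unfolding F_def
    by (rule has_vector_derivative_eq_rhs[OF has_vector_derivative_diff[OF
          has_vector_derivative_scaleR[OF dp has_vector_derivative_at_within[OF g1]]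
          has_vector_derivative_scaleR[OF dp1 has_vector_derivative_at_within[OF g]]]]) simp
  have "(LINT t|lborel. indicator {0..1} t *\<^sub>R (p t *\<^sub>R g2 t - p2 t *\<^sub>R g t)) = F 1 - F 0"
  proof (rule integral_FTC_Icc)
    show "continuous_on {0..1} (\<lambda>t. p t *\<^sub>R g2 t - p2 t *\<^sub>R g t)"
      unfolding p_def p2_def
      by (intro continuous_intros continuous_on_subset[OF g2] continuous_on_subset[OF gc]) auto
  qed (use dF in auto)
  also have "F 1 - F 0 = g 0" by (simp add: F_def p_def p1_def)
  also have "(\<lambda>t. indicator {0..1} t *\<^sub>R (p t *\<^sub>R g2 t - p2 t *\<^sub>R g t)) =
      (\<lambda>t. indicator {0<..<1} t *\<^sub>R (kernel2 t *\<^sub>R g2 t + kernel0 t *\<^sub>R g t))"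
  proof
    fix t :: real
    consider "0 < t \<and> t < 1" | "t = 0" | "t = 1" | "t < 0 \<or> t > 1" by linarith
    then show "indicator {0..1} t *\<^sub>R (p t *\<^sub>R g2 t - p2 t *\<^sub>R g t) =
        indicator {0<..<1} t *\<^sub>R (kernel2 t *\<^sub>R g2 t + kernel0 t *\<^sub>R g t)"
    proof cases
      case 1
      then have "kernel2 t = p t" "kernel0 t = - p2 t" by (simp_all add: kernel2_def kernel0_def p_def p2_def)
      with 1 show ?thesis by simp
    qed (auto simp: p_def p2_def)
  qed
  finally show ?thesis .
qed

lemma partial_derivative_translates:
  assumes pd: "partial_derivative \<Psi> i \<Theta>" and f: "f \<in> Conv" and \<psi>: "\<psi> \<in> Cc"
  shows "((\<lambda>t. trans_act (w + t *\<^sub>R axis i 1) \<Psi> f \<psi>) has_vector_derivative trans_act (w + t *\<^sub>R axis i 1) \<Theta> f \<psi>) (at t)"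
proof -
  let ?e = "axis i 1 :: real^'a"
  define v where "v = w + t *\<^sub>R ?e"
  define D where "D = trans_act v \<Theta> f \<psi>"
  define h where "h s = trans_act (w + s *\<^sub>R ?e) \<Psi> f \<psi>" for s
  have ht: "h (t + s) = trans_act (s *\<^sub>R ?e) \<Psi> (\<lambda>y. f (y + v)) (\<lambda>y. \<psi> (y + v))" for s
  proof -
    have "h (t + s) = trans_act (v + s *\<^sub>R ?e) \<Psi> f \<psi>" by (simp add: h_def v_def scaleR_add_left add_ac)
    then show ?thesis by (simp only: trans_act_add)
  qed
  have "((\<lambda>s. norm (h (t + s) - h t - s *\<^sub>R D) / norm s) \<longlongrightarrow> 0) (at 0)"
  proof (rule tendstoI)
    fix e :: real assume e: "e > 0"
    have "\<forall>\<^sub>F s in at 0. \<forall>k\<in>{\<lambda>y. f (y + v)}. norm (of_real (inverse s) * (trans_act (s *\<^sub>R ?e) \<Psi> k (\<lambda>y. \<psi> (y + v)) - \<Psi> k (\<lambda>y. \<psi> (y + v))) - \<Theta> k (\<lambda>y. \<psi> (y + v))) < e"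
      by (rule pd[unfolded partial_derivative_def, rule_format])
         (use e Conv_translate[OF f] Cc_translate[OF \<psi>] in auto)
    moreover have "\<forall>\<^sub>F s in at (0::real). s \<noteq> 0" by (simp add: eventually_at_filter)
    ultimately show "\<forall>\<^sub>F s in at 0. dist (norm (h (t + s) - h t - s *\<^sub>R D) / norm s) 0 < e"
    proof eventually_elim
      case (elim s)
      have h0: "h t = \<Psi> (\<lambda>y. f (y + v)) (\<lambda>y. \<psi> (y + v))" by (simp add: h_def v_def trans_act_apply)
      have "norm (h (t + s) - h t - s *\<^sub>R D) / norm s = norm (inverse s *\<^sub>R (h (t + s) - h t - s *\<^sub>R D))"
        by (simp add: divide_inverse mult.commute)
      also have "inverse s *\<^sub>R (h (t + s) - h t - s *\<^sub>R D) = of_real (inverse s) * (h (t + s) - h t) - D"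
        using elim(2) by (simp add: scaleR_right_diff_distrib scaleR_conv_of_real algebra_simps)
      also have "norm \<dots> < e"
        using elim(1) by (simp add: ht h0 D_def trans_act_apply)
      finally show ?case by simp
    qed
  qed
  then have "(h has_vector_derivative D) (at t)"
    unfolding has_vector_derivative_def has_derivative_at by (simp add: bounded_linear_scaleR_left)
  then show ?thesis by (simp add: h_def[abs_def] D_def v_def)
qed

text \<open>
  Only the coordinates in \<open>I\<close> are kept. The representation formula is built up one
  coordinate at a time, and translations run over the coordinates treated so far.
\<close>

definition restr :: "'n::finite set \<Rightarrow> real^'n \<Rightarrow> real^'n" where
  "restr I x = (\<chi> j. if j \<in> I then x $ j else 0)"

definition cube_kernel :: "'n::finite set \<Rightarrow> (real^'n \<Rightarrow> real) \<Rightarrow> bool" where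
  "cube_kernel I \<rho> \<longleftrightarrow> continuous_on UNIV \<rho> \<and> (\<forall>x y. restr I x = restr I y \<longrightarrow> \<rho> x = \<rho> y) \<and>
     (\<forall>x. (\<exists>i\<in>I. \<not> (0 < x $ i \<and> x $ i < 1)) \<longrightarrow> \<rho> x = 0)"

lemma cube_kernel_continuous: "cube_kernel I \<rho> \<Longrightarrow> continuous_on UNIV \<rho>"
  unfolding cube_kernel_def by (rule conjunct1)

lemma cube_kernel_restr:
  assumes "cube_kernel I \<rho>" "restr I x = restr I y" shows "\<rho> x = \<rho> y"
proof -
  have "\<forall>x y. restr I x = restr I y \<longrightarrow> \<rho> x = \<rho> y"
    using assms(1) unfolding cube_kernel_def by (elim conjE)
  from this[rule_format, OF assms(2)] show ?thesis .
qed

lemma cube_kernel_outside: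
  assumes "cube_kernel I \<rho>" "i \<in> I" "\<not> (0 < x $ i \<and> x $ i < 1)" shows "\<rho> x = 0"
proof -
  have "\<forall>x. (\<exists>i\<in>I. \<not> (0 < x $ i \<and> x $ i < 1)) \<longrightarrow> \<rho> x = 0"
    using assms(1) unfolding cube_kernel_def by (elim conjE)
  then have "(\<exists>i\<in>I. \<not> (0 < x $ i \<and> x $ i < 1)) \<longrightarrow> \<rho> x = 0" by (rule spec)
  then show ?thesis by (rule mp) (rule bexI[where x=i], rule assms(3), rule assms(2))
qed

lemma continuous_on_restr: "continuous_on UNIV (restr I)"
  unfolding restr_def[abs_def]
proof (rule continuous_on_vec_lambda)
  fix j show "continuous_on UNIV (\<lambda>x :: real^'a. if j \<in> I then x $ j else 0)"
    by (cases "j \<in> I") (simp_all add: continuous_intros)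
qed

lemma trans_act_continuous:
  assumes "\<Theta> \<in> PLV d" "f \<in> Conv" "\<psi> \<in> Cc"
  shows "continuous_on UNIV (\<lambda>x. trans_act x \<Theta> f \<psi>)"
  using translates_continuous[OF assms] by (simp add: trans_act_apply)

text \<open>
  The one-dimensional formula along \<open>e\<^sub>i\<close> for the orbit through
  \<open>restr I x\<close>, integrated over the other coordinates.
\<close>

lemma parametrix_step:
  fixes \<Theta> :: "'n::finite functional"
  assumes \<Theta>: "\<Theta> \<in> PLV d" "\<Theta>' \<in> PLV d" "\<Theta>'' \<in> PLV d"
    and pd: "partial_derivative \<Theta> i \<Theta>'" "partial_derivative \<Theta>' i \<Theta>''"
    and k: "cube_kernel I \<rho>" and i: "i \<notin> I" and f: "f \<in> Conv" and \<psi>: "\<psi> \<in> Cc"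
  shows "(LINT x|lborel. indicator cube x *\<^sub>R (\<rho> x *\<^sub>R trans_act (restr I x) \<Theta> f \<psi>)) =
    (LINT x|lborel. indicator cube x *\<^sub>R ((\<rho> x * kernel2 (x $ i)) *\<^sub>R trans_act (restr (insert i I) x) \<Theta>'' f \<psi>)) +
    (LINT x|lborel. indicator cube x *\<^sub>R ((\<rho> x * kernel0 (x $ i)) *\<^sub>R trans_act (restr (insert i I) x) \<Theta> f \<psi>))"
proof -
  let ?I = "insert i I"
  note \<rho>c = cube_kernel_continuous[OF k] and \<rho>I = cube_kernel_restr[OF k]
  have Ac: "continuous_on UNIV (\<lambda>x. trans_act (restr ?I x) \<Phi> f \<psi>)" if "\<Phi> \<in> PLV d" for \<Phi>
    by (rule continuous_on_compose2[OF trans_act_continuous[OF that f \<psi>] continuous_on_restr]) simp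
  have xi: "continuous_on UNIV (\<lambda>x :: real^'n. x $ i)" by (intro continuous_intros)
  have kc: "continuous_on UNIV (\<lambda>x :: real^'n. kernel2 (x $ i))"
    by (rule continuous_on_compose2[OF kernel_continuous(1) xi subset_UNIV])
  have kc0: "continuous_on UNIV (\<lambda>x :: real^'n. kernel0 (x $ i))"
    by (rule continuous_on_compose2[OF kernel_continuous(2) xi subset_UNIV])
  define H2 where "H2 x = (\<rho> x * kernel2 (x $ i)) *\<^sub>R trans_act (restr ?I x) \<Theta>'' f \<psi>" for x
  define H0 where "H0 x = (\<rho> x * kernel0 (x $ i)) *\<^sub>R trans_act (restr ?I x) \<Theta> f \<psi>" for x
  have H2c: "continuous_on UNIV H2" unfolding H2_def
    by (intro continuous_on_scaleR continuous_on_mult \<rho>c kc kc0 Ac \<Theta>)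
  have H0c: "continuous_on UNIV H0" unfolding H0_def
    by (intro continuous_on_scaleR continuous_on_mult \<rho>c kc kc0 Ac \<Theta>)
  have "(LINT x|lborel. indicator cube x *\<^sub>R H2 x) + (LINT x|lborel. indicator cube x *\<^sub>R H0 x)
      = (LINT x|lborel. indicator cube x *\<^sub>R (H2 x + H0 x))"
    unfolding scaleR_add_right
    by (rule Bochner_Integration.integral_add[OF integrable_cube[OF H2c] integrable_cube[OF H0c], symmetric])
  also have "\<dots> = (LINT x|lborel. indicator cube x *\<^sub>R (LINT t|lborel. indicator {0<..<1} t *\<^sub>R (H2 (upd i x t) + H0 (upd i x t))))"
    by (rule cube_fubini[OF continuous_on_add[OF H2c H0c]])
  also have "\<dots> = (LINT x|lborel. indicator cube x *\<^sub>R (\<rho> x *\<^sub>R trans_act (restr I x) \<Theta> f \<psi>))"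
  proof (rule Bochner_Integration.integral_cong[OF refl])
    fix x :: "real^'n"
    let ?w = "restr I x"
    let ?e = "axis i 1 :: real^'n"
    have r1: "restr ?I (upd i x t) = ?w + t *\<^sub>R ?e" for t
      using i by (auto simp: vec_eq_iff restr_def upd_def axis_def)
    have r2: "\<rho> (upd i x t) = \<rho> x" for t
      by (rule \<rho>I) (use i in \<open>auto simp: vec_eq_iff restr_def upd_def\<close>)
    have r3: "upd i x t $ i = t" for t by (simp add: upd_nth)
    have "H2 (upd i x t) + H0 (upd i x t) = \<rho> x *\<^sub>R (kernel2 t *\<^sub>R trans_act (?w + t *\<^sub>R ?e) \<Theta>'' f \<psi> + kernel0 t *\<^sub>R trans_act (?w + t *\<^sub>R ?e) \<Theta> f \<psi>)" for t
      unfolding H2_def H0_def r1 r2 r3 by (simp add: scaleR_add_right)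
    then have "(LINT t|lborel. indicator {0<..<1} t *\<^sub>R (H2 (upd i x t) + H0 (upd i x t))) =
        (LINT t|lborel. \<rho> x *\<^sub>R (indicator {0<..<1} t *\<^sub>R (kernel2 t *\<^sub>R trans_act (?w + t *\<^sub>R ?e) \<Theta>'' f \<psi> + kernel0 t *\<^sub>R trans_act (?w + t *\<^sub>R ?e) \<Theta> f \<psi>)))"
      by (intro Bochner_Integration.integral_cong[OF refl]) (simp add: scaleR_left_commute)
    also have "\<dots> = \<rho> x *\<^sub>R (LINT t|lborel. indicator {0<..<1} t *\<^sub>R (kernel2 t *\<^sub>R trans_act (?w + t *\<^sub>R ?e) \<Theta>'' f \<psi> + kernel0 t *\<^sub>R trans_act (?w + t *\<^sub>R ?e) \<Theta> f \<psi>))"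
      by (rule integral_scaleR_right)
    also have "(LINT t|lborel. indicator {0<..<1} t *\<^sub>R (kernel2 t *\<^sub>R trans_act (?w + t *\<^sub>R ?e) \<Theta>'' f \<psi> + kernel0 t *\<^sub>R trans_act (?w + t *\<^sub>R ?e) \<Theta> f \<psi>))
        = trans_act (?w + 0 *\<^sub>R ?e) \<Theta> f \<psi>"
    proof (rule parametrix_1d[OF partial_derivative_translates[OF pd(1) f \<psi>] partial_derivative_translates[OF pd(2) f \<psi>]])
      show "continuous_on UNIV (\<lambda>t. trans_act (?w + t *\<^sub>R ?e) \<Theta>'' f \<psi>)"
        by (rule continuous_on_compose2[OF trans_act_continuous[OF \<Theta>(3) f \<psi>]]) (auto intro!: continuous_intros)
    qed
    finally show "indicator cube x *\<^sub>R (LINT t|lborel. indicator {0<..<1} t *\<^sub>R (H2 (upd i x t) + H0 (upd i x t)))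
        = indicator cube x *\<^sub>R (\<rho> x *\<^sub>R trans_act ?w \<Theta> f \<psi>)" by simp
  qed
  finally show ?thesis by (simp only: H2_def H0_def)
qed

definition cube_representation :: "nat \<Rightarrow> 'n::finite set \<Rightarrow> 'n functional \<Rightarrow> ((real^'n \<Rightarrow> real) \<times> 'n functional) list \<Rightarrow> bool" where
  "cube_representation d I \<Psi> xs \<longleftrightarrow>
     (\<forall>p\<in>set xs. cube_kernel I (fst p) \<and> snd p \<in> PLV d \<and> smooth_functional d (snd p)) \<and>
     (\<forall>f\<in>Conv. \<forall>\<psi>\<in>Cc. \<Psi> f \<psi> =
        (\<Sum>p\<leftarrow>xs. LINT x|lborel. indicator cube x *\<^sub>R (fst p x *\<^sub>R trans_act (restr I x) (snd p) f \<psi>)))"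

text \<open>
  For \<open>I = {}\<close> the integral over the cube of a constant is that constant. Each
  further coordinate replaces every term by two, one with the second derivative of its
  functional and one with the functional itself.
\<close>

lemma cube_representation_exists:
  fixes \<Psi> :: "'n::finite functional"
  assumes \<Psi>: "\<Psi> \<in> PLV d" "smooth_functional d \<Psi>" and "finite I"
  shows "\<exists>xs. cube_representation d I \<Psi> xs"
  using assms(3)
proof (induction I)
  case empty
  have r: "restr {} x = 0" for x :: "real^'n" by (simp add: restr_def vec_eq_iff)
  have m: "measure lborel (cube :: (real^'n) set) = 1" by (simp add: measure_def cube_measure)
  have "(LINT x|lborel. indicator cube (x :: real^'n) *\<^sub>R c) = c" for c :: complex
  proof -
    have "(LINT x|lborel. indicator cube (x :: real^'n) *\<^sub>R c) = (LINT x|lborel. indicator (cube :: (real^'n) set) x) *\<^sub>R c"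
      by (rule integral_scaleR_left) (simp add: cube_measure)
    then show ?thesis using m by simp
  qed
  then have "cube_representation d {} \<Psi> [(\<lambda>_. 1, \<Psi>)]"
    using \<Psi> by (simp add: cube_representation_def cube_kernel_def r)
  then show ?case by blast
next
  case (insert i I)
  then obtain xs where xs: "cube_representation d I \<Psi> xs" by (elim exE)
  define good where "good \<Theta> Q \<longleftrightarrow> fst Q \<in> PLV d \<and> snd Q \<in> PLV d \<and> smooth_functional d (snd Q) \<and>
      partial_derivative \<Theta> i (fst Q) \<and> partial_derivative (fst Q) i (snd Q)" for \<Theta> and Q :: "'n functional \<times> 'n functional"
  have exQ: "\<exists>Q. good \<Theta> Q" if \<Theta>: "smooth_functional d \<Theta>" for \<Theta>
  proof -
    obtain \<Theta>1 where 1: "\<Theta>1 \<in> PLV d \<and> smooth_functional d \<Theta>1 \<and> partial_derivative \<Theta> i \<Theta>1"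
      using smooth_functional_derivative[OF \<Theta>, of i] by (rule exE)
    then have "smooth_functional d \<Theta>1" by blast
    from smooth_functional_derivative[OF this, of i]
    obtain \<Theta>2 where 2: "\<Theta>2 \<in> PLV d \<and> smooth_functional d \<Theta>2 \<and> partial_derivative \<Theta>1 i \<Theta>2" by (rule exE)
    from 1 2 show ?thesis by (intro exI[of _ "(\<Theta>1, \<Theta>2)"]) (simp add: good_def)
  qed
  \<comment> \<open>First and second derivatives along \<open>e\<^sub>i\<close>, chosen as functions of
      \<open>\<Theta>\<close> so that they can be mapped over the list of terms.\<close>
  define sel where "sel \<Theta> = (SOME Q. good \<Theta> Q)" for \<Theta>
  have D: "good \<Theta> (sel \<Theta>)" if "smooth_functional d \<Theta>" for \<Theta>
    unfolding sel_def by (rule someI_ex[OF exQ[OF that]])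
  define D2 where "D2 \<Theta> = snd (sel \<Theta>)" for \<Theta>
  define a where "a p = (\<lambda>x :: real^'n. fst p x * kernel2 (x $ i), D2 (snd p))" for p :: "(real^'n \<Rightarrow> real) \<times> 'n functional"
  define b where "b p = (\<lambda>x :: real^'n. fst p x * kernel0 (x $ i), snd p)" for p :: "(real^'n \<Rightarrow> real) \<times> 'n functional"
  have item: "cube_kernel I (fst p)" "snd p \<in> PLV d" "smooth_functional d (snd p)" if "p \<in> set xs" for p
    using xs that by (auto simp: cube_representation_def)
  have ker: "cube_kernel (insert i I) (\<lambda>x. \<rho> x * k (x $ i))"
    if \<rho>: "cube_kernel I \<rho>" and k: "continuous_on UNIV k" "\<And>t. \<not> (0 < t \<and> t < 1) \<Longrightarrow> k t = 0" for \<rho> k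
    unfolding cube_kernel_def
  proof (intro conjI allI impI)
    show "continuous_on UNIV (\<lambda>x. \<rho> x * k (x $ i))"
    proof (rule continuous_on_mult[OF cube_kernel_continuous[OF \<rho>]])
      show "continuous_on UNIV (\<lambda>x :: real^'n. k (x $ i))"
        by (rule continuous_on_compose2[OF k(1) _ subset_UNIV]) (intro continuous_intros)
    qed
    show "\<rho> x * k (x $ i) = \<rho> y * k (y $ i)" if eq: "restr (insert i I) x = restr (insert i I) y" for x y
    proof -
      have e: "x $ j = y $ j" if "j \<in> insert i I" for j
        using arg_cong[OF eq, of "\<lambda>v. v $ j"] that by (simp add: restr_def)
      then have "restr I x = restr I y" by (simp add: restr_def vec_eq_iff)
      then have "\<rho> x = \<rho> y" by (rule cube_kernel_restr[OF \<rho>])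
      then show ?thesis using e[of i] by simp
    qed
    show "\<rho> x * k (x $ i) = 0" if "\<exists>j\<in>insert i I. \<not> (0 < x $ j \<and> x $ j < 1)" for x
    proof (cases "0 < x $ i \<and> x $ i < 1")
      case True
      with that obtain j where "j \<in> I" "\<not> (0 < x $ j \<and> x $ j < 1)" by blast
      then have "\<rho> x = 0" by (rule cube_kernel_outside[OF \<rho>])
      then show ?thesis by simp
    next
      case False then show ?thesis by (simp add: k(2))
    qed
  qed
  have "cube_representation d (insert i I) \<Psi> (map a xs @ map b xs)"
    unfolding cube_representation_def
  proof (intro conjI ballI)
    fix p assume "p \<in> set (map a xs @ map b xs)"
    then obtain q where q: "q \<in> set xs" "p = a q \<or> p = b q" by auto
    have g: "good (snd q) (sel (snd q))" by (rule D[OF item(3)[OF q(1)]])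
    show "cube_kernel (insert i I) (fst p)"
      using q(2) ker[OF item(1)[OF q(1)] kernel_continuous(1) kernel_outside(1)]
        ker[OF item(1)[OF q(1)] kernel_continuous(2) kernel_outside(2)] by (auto simp: a_def b_def)
    show "snd p \<in> PLV d" "smooth_functional d (snd p)"
      using q(2) item[OF q(1)] g by (auto simp: a_def b_def D2_def good_def)
  next
    fix f :: "real^'n \<Rightarrow> real" and \<psi> :: "real^'n \<Rightarrow> complex" assume f: "f \<in> Conv" and \<psi>: "\<psi> \<in> Cc"
    have "\<Psi> f \<psi> = (\<Sum>p\<leftarrow>xs. LINT x|lborel. indicator cube x *\<^sub>R (fst p x *\<^sub>R trans_act (restr I x) (snd p) f \<psi>))"
      using xs f \<psi> by (simp add: cube_representation_def)
    also have "\<dots> = (\<Sum>p\<leftarrow>xs. (LINT x|lborel. indicator cube x *\<^sub>R (fst (a p) x *\<^sub>R trans_act (restr (insert i I) x) (snd (a p)) f \<psi>)) +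
        (LINT x|lborel. indicator cube x *\<^sub>R (fst (b p) x *\<^sub>R trans_act (restr (insert i I) x) (snd (b p)) f \<psi>)))"
    proof (rule arg_cong[where f=sum_list], rule map_cong[OF refl])
      fix p assume p: "p \<in> set xs"
      have g: "good (snd p) (sel (snd p))" by (rule D[OF item(3)[OF p]])
      show "(LINT x|lborel. indicator cube x *\<^sub>R (fst p x *\<^sub>R trans_act (restr I x) (snd p) f \<psi>)) =
          (LINT x|lborel. indicator cube x *\<^sub>R (fst (a p) x *\<^sub>R trans_act (restr (insert i I) x) (snd (a p)) f \<psi>)) +
          (LINT x|lborel. indicator cube x *\<^sub>R (fst (b p) x *\<^sub>R trans_act (restr (insert i I) x) (snd (b p)) f \<psi>))"
        unfolding a_def b_def D2_def fst_conv snd_conv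
        by (rule parametrix_step[where \<Theta>'="fst (sel (snd p))", OF item(2)[OF p] _ _ _ _ item(1)[OF p] insert.hyps(2) f \<psi>])
           (use g in \<open>simp_all add: good_def\<close>)
    qed
    also have "\<dots> = (\<Sum>p\<leftarrow>map a xs @ map b xs. LINT x|lborel. indicator cube x *\<^sub>R (fst p x *\<^sub>R trans_act (restr (insert i I) x) (snd p) f \<psi>))"
      by (simp add: sum_list_addf comp_def)
    finally show "\<Psi> f \<psi> = (\<Sum>p\<leftarrow>map a xs @ map b xs. LINT x|lborel. indicator cube x *\<^sub>R (fst p x *\<^sub>R trans_act (restr (insert i I) x) (snd p) f \<psi>))" .
  qed
  then show ?case by blast
qed

text \<open>
  The case where all coordinates have been treated. A kernel vanishes outside the open cube, so
  the restriction of the integral to the cube can be dropped.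
\<close>

lemma parametrix:
  fixes \<Psi> :: "'n::finite functional"
  assumes \<Psi>: "\<Psi> \<in> PLV d" "smooth_functional d \<Psi>"
  obtains xs :: "((real^'n \<Rightarrow> complex) \<times> 'n functional) list" where
    "\<And>p. p \<in> set xs \<Longrightarrow> fst p \<in> Cc \<and> snd p \<in> PLV d \<and> smooth_functional d (snd p)"
    "\<And>f \<psi>. f \<in> Conv \<Longrightarrow> \<psi> \<in> Cc \<Longrightarrow>
      \<Psi> f \<psi> = (\<Sum>p\<leftarrow>xs. LINT x|lborel. fst p x * snd p (\<lambda>y. f (y + x)) (\<lambda>y. \<psi> (y + x)))"
proof -
  obtain xs where xs: "cube_representation d UNIV \<Psi> xs"
    using cube_representation_exists[OF \<Psi> finite] by (rule exE)
  define c where "c p = (\<lambda>x. complex_of_real (fst p x), snd p)" for p :: "(real^'n \<Rightarrow> real) \<times> 'n functional"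
  have item: "cube_kernel UNIV (fst p)" "snd p \<in> PLV d" "smooth_functional d (snd p)" if "p \<in> set xs" for p
    using xs that by (auto simp: cube_representation_def)
  have out: "fst p x = 0" if "p \<in> set xs" "x \<notin> cube" for p x
  proof -
    from that(2) have "\<exists>i. \<not> (0 < x $ i \<and> x $ i < 1)" by (simp add: cube_def)
    then obtain i where "\<not> (0 < x $ i \<and> x $ i < 1)" by (rule exE)
    from cube_kernel_outside[OF item(1)[OF that(1)] UNIV_I this] show ?thesis .
  qed
  show ?thesis
  proof (rule that[of "map c xs"])
    fix q assume "q \<in> set (map c xs)"
    then obtain p where p: "p \<in> set xs" "q = c p" by auto
    have "(\<lambda>x. complex_of_real (fst p x)) \<in> Cc"
    proof (rule in_Cc_and_supp(1))
      show "continuous_on UNIV (\<lambda>x. complex_of_real (fst p x))"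
        by (rule continuous_on_of_real[OF cube_kernel_continuous[OF item(1)[OF p(1)]]])
      show "compact (cbox 0 (\<chi> j. 1) :: (real^'n) set)" by (rule compact_cbox)
      fix x :: "real^'n" assume "x \<notin> cbox 0 (\<chi> j. 1)"
      then have "x \<notin> cube" using box_subset_cbox[of "0 :: real^'n" "\<chi> j. 1"] unfolding cube_eq_box by blast
      then show "complex_of_real (fst p x) = 0" using out[OF p(1)] by simp
    qed
    then show "fst q \<in> Cc \<and> snd q \<in> PLV d \<and> smooth_functional d (snd q)" using item[OF p(1)] p(2) by (simp add: c_def)
  next
    fix f :: "real^'n \<Rightarrow> real" and \<psi> :: "real^'n \<Rightarrow> complex" assume f: "f \<in> Conv" and \<psi>: "\<psi> \<in> Cc"
    have r: "restr UNIV x = x" for x :: "real^'n" by (simp add: restr_def vec_eq_iff)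
    have "\<Psi> f \<psi> = (\<Sum>p\<leftarrow>xs. LINT x|lborel. indicator cube x *\<^sub>R (fst p x *\<^sub>R trans_act (restr UNIV x) (snd p) f \<psi>))"
      using xs f \<psi> by (simp add: cube_representation_def)
    also have "\<dots> = (\<Sum>p\<leftarrow>xs. LINT x|lborel. fst (c p) x * snd (c p) (\<lambda>y. f (y + x)) (\<lambda>y. \<psi> (y + x)))"
    proof (rule arg_cong[where f=sum_list], rule map_cong[OF refl], rule Bochner_Integration.integral_cong[OF refl])
      fix p and x :: "real^'n" assume p: "p \<in> set xs"
      show "indicator cube x *\<^sub>R (fst p x *\<^sub>R trans_act (restr UNIV x) (snd p) f \<psi>) =
          fst (c p) x * snd (c p) (\<lambda>y. f (y + x)) (\<lambda>y. \<psi> (y + x))"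
        using out[OF p, of x] by (cases "x \<in> cube") (simp_all add: c_def r trans_act_apply scaleR_conv_of_real)
    qed
    finally show "\<Psi> f \<psi> = (\<Sum>p\<leftarrow>map c xs. LINT x|lborel. fst p x * snd p (\<lambda>y. f (y + x)) (\<lambda>y. \<psi> (y + x)))"
      by (simp add: comp_def)
  qed
qed

section \<open>Functionals with smooth densities\<close>

lemma limitin_cw_topologyI:
  assumes l: "l \<in> PLV d"
    and ev: "\<And>K \<phi> e. compact K \<Longrightarrow> K \<noteq> {} \<Longrightarrow> K \<subseteq> Conv \<Longrightarrow> \<phi> \<in> Cc \<Longrightarrow> (e::real) > 0 \<Longrightarrow>
      \<forall>\<^sub>F t in F. h t \<in> PLV d \<and> (\<forall>f\<in>K. norm (h t f \<phi> - l f \<phi>) \<le> e)"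
  shows "limitin (cw_topology d) h (l :: 'n::finite functional) F"
proof -
  let ?S = "{{\<Psi> \<in> PLV d. cw_seminorm K \<phi> (\<Psi> - \<Psi>\<^sub>0) < r} | K \<phi> (\<Psi>\<^sub>0 :: 'n functional) r.
        compact K \<and> K \<noteq> {} \<and> K \<subseteq> Conv \<and> \<phi> \<in> Cc \<and> \<Psi>\<^sub>0 \<in> PLV d \<and> r > 0}"
  have "l \<in> topspace (cw_topology d)"
  proof -
    have c: "(\<lambda>x :: real^'n. 0 :: real) \<in> Conv" by (simp add: Conv_def convex_on_const)
    have "{\<Psi> \<in> PLV d. cw_seminorm {\<lambda>x. 0} (\<lambda>x. 0) (\<Psi> - l) < 1} \<in> ?S"
      by (rule CollectI, rule exI[of _ "{\<lambda>x. 0}"], rule exI[of _ "\<lambda>x. 0"], rule exI[of _ l], rule exI[of _ 1])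
         (use c l Cc_zero in simp)
    moreover have "l \<in> {\<Psi> \<in> PLV d. cw_seminorm {\<lambda>x. 0} (\<lambda>x. 0) (\<Psi> - l) < 1}"
      using l by (simp add: cw_seminorm_def)
    ultimately show ?thesis unfolding cw_topology_def topology_generated_by_topspace by (rule UnionI)
  qed
  moreover have "\<forall>\<^sub>F t in F. h t \<in> U" if "generate_topology_on ?S U" "l \<in> U" for U
    using that
  proof induction
    case Empty then show ?case by simp
  next
    case (Int a b)
    then have "\<forall>\<^sub>F t in F. h t \<in> a" "\<forall>\<^sub>F t in F. h t \<in> b" by auto
    then show ?case by eventually_elim simp
  next
    case (UN K)
    then obtain k where k: "k \<in> K" "l \<in> k" by blast
    from UN.IH[OF this] show ?case by (rule eventually_mono) (use k in blast)
  next
    case (Basis s)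
    then obtain K \<phi> \<Psi>\<^sub>0 r where s: "s = {\<Psi> \<in> PLV d. cw_seminorm K \<phi> (\<Psi> - \<Psi>\<^sub>0) < r}"
      and K: "compact K" "K \<noteq> {}" "K \<subseteq> Conv" "\<phi> \<in> Cc" "\<Psi>\<^sub>0 \<in> PLV d" "r > 0" by blast
    define r0 where "r0 = cw_seminorm K \<phi> (l - \<Psi>\<^sub>0)"
    have r0: "r0 < r" using Basis(2) by (simp add: s r0_def)
    define e where "e = (r - r0) / 2"
    have e: "e > 0" using r0 by (simp add: e_def)
    from ev[OF K(1-4) e] show ?case
    proof (rule eventually_mono)
      fix t assume t: "h t \<in> PLV d \<and> (\<forall>f\<in>K. norm (h t f \<phi> - l f \<phi>) \<le> e)"
      have "cw_seminorm K \<phi> (h t - \<Psi>\<^sub>0) \<le> r0 + e"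
        unfolding cw_seminorm_def
      proof (rule cSUP_least[OF K(2)])
        fix f assume f: "f \<in> K"
        have "norm ((l - \<Psi>\<^sub>0) f \<phi>) \<le> r0"
          unfolding r0_def cw_seminorm_def by (rule cSUP_upper[OF f cw_bdd_above[OF l K(5,1,3)]])
        then have 1: "norm (l f \<phi> - \<Psi>\<^sub>0 f \<phi>) \<le> r0" by simp
        have 2: "norm (h t f \<phi> - l f \<phi>) \<le> e" using t f by blast
        have "norm (h t f \<phi> - \<Psi>\<^sub>0 f \<phi>) \<le> norm (h t f \<phi> - l f \<phi>) + norm (l f \<phi> - \<Psi>\<^sub>0 f \<phi>)"
          using norm_triangle_ineq[of "h t f \<phi> - l f \<phi>" "l f \<phi> - \<Psi>\<^sub>0 f \<phi>"] by simp
        then show "norm ((h t - \<Psi>\<^sub>0) f \<phi>) \<le> r0 + e" using 1 2 by simp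
      qed
      also have "\<dots> < r" using r0 by (simp add: e_def field_simps)
      finally show "h t \<in> s" using t by (simp add: s)
    qed
  qed
  ultimately show ?thesis
    unfolding limitin_def cw_topology_def openin_topology_generated_by_iff by blast
qed

lemma continuous_map_cw_topologyI:
  fixes F :: "real^'n::finite \<Rightarrow> 'n functional"
  assumes lim: "\<And>x. limitin (cw_topology d) F (F x) (nhds x)"
  shows "continuous_map euclidean (cw_topology d) F"
  unfolding continuous_map_def
proof (intro conjI allI impI)
  show "F \<in> topspace euclidean \<rightarrow> topspace (cw_topology d)"
    using lim by (simp add: limitin_def)
  fix U :: "'n functional set" assume U: "openin (cw_topology d) U"
  have "open {x. F x \<in> U}"
    unfolding open_subopen[of "{x. F x \<in> U}"]
  proof
    fix x assume "x \<in> {x. F x \<in> U}"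
    then have "\<forall>\<^sub>F y in nhds x. F y \<in> U" using lim[of x] U by (simp add: limitin_def)
    then show "\<exists>T. open T \<and> x \<in> T \<and> T \<subseteq> {x. F x \<in> U}" unfolding eventually_nhds by blast
  qed
  then show "openin euclidean {x \<in> topspace euclidean. F x \<in> U}" by simp
qed

text \<open>
  Value 0 at functions outside \<open>Cc\<close>, as for all Radon functionals.
\<close>

definition density_functional :: "nat \<Rightarrow> (nat \<Rightarrow> 'n::finite functional) \<Rightarrow> (nat \<Rightarrow> real^'n \<Rightarrow> complex) \<Rightarrow> 'n functional" where
  "density_functional N \<Psi>s g = (\<lambda>f \<psi>. if \<psi> \<in> Cc then \<Sum>j=1..N. \<Psi>s j f (\<lambda>y. g j y * \<psi> y) else 0)"

lemma Radon_density:
  assumes L: "L \<in> Radon" and g: "continuous_on UNIV g"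
  shows "(\<lambda>\<psi>. if \<psi> \<in> Cc then L (\<lambda>y. g y * \<psi> y) else 0) \<in> Radon"
proof (rule RadonI)
  fix \<phi> \<psi> :: "real^'a \<Rightarrow> complex" assume c: "\<phi> \<in> Cc" "\<psi> \<in> Cc"
  have "L (\<lambda>y. g y * (\<phi> y + \<psi> y)) = L (\<lambda>y. g y * \<phi> y) + L (\<lambda>y. g y * \<psi> y)"
    unfolding distrib_left by (rule Radon_add[OF L Cc_mult(1)[OF c(1) g] Cc_mult(1)[OF c(2) g]])
  then show "(if (\<lambda>x. \<phi> x + \<psi> x) \<in> Cc then L (\<lambda>y. g y * (\<phi> y + \<psi> y)) else 0) =
      (if \<phi> \<in> Cc then L (\<lambda>y. g y * \<phi> y) else 0) + (if \<psi> \<in> Cc then L (\<lambda>y. g y * \<psi> y) else 0)"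
    using c Cc_add[OF c] by simp
next
  fix a and \<phi> :: "real^'a \<Rightarrow> complex" assume c: "\<phi> \<in> Cc"
  have "L (\<lambda>y. g y * (a * \<phi> y)) = a * L (\<lambda>y. g y * \<phi> y)"
    unfolding mult.left_commute[of _ a] by (rule Radon_cmult[OF L Cc_mult(1)[OF c g]])
  then show "(if (\<lambda>x. a * \<phi> x) \<in> Cc then L (\<lambda>y. g y * (a * \<phi> y)) else 0) = a * (if \<phi> \<in> Cc then L (\<lambda>y. g y * \<phi> y) else 0)"
    using c Cc_cmult[OF c] by simp
next
  fix A :: "(real^'a) set" assume A: "compact A"
  have "bounded (g ` A)" by (rule compact_imp_bounded[OF compact_continuous_image[OF continuous_on_subset[OF g subset_UNIV] A]])
  then obtain r where r: "r > 0" "\<forall>z\<in>g ` A. norm z \<le> r" unfolding bounded_pos by (elim exE conjE)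
  show "\<exists>C. \<forall>\<phi>\<in>Cc. \<forall>s. (\<forall>x. x \<notin> A \<longrightarrow> \<phi> x = 0) \<longrightarrow> (\<forall>x. norm (\<phi> x) \<le> s) \<longrightarrow>
      norm (if \<phi> \<in> Cc then L (\<lambda>y. g y * \<phi> y) else 0) \<le> C * s"
  proof (rule Radon_bound[OF L A])
    fix C :: real
    assume C: "0 \<le> C" "\<And>\<phi> s. \<phi> \<in> Cc \<Longrightarrow> (\<And>x. x \<notin> A \<Longrightarrow> \<phi> x = 0) \<Longrightarrow> (\<And>x. norm (\<phi> x) \<le> s) \<Longrightarrow> norm (L \<phi>) \<le> C * s"
    show ?thesis
    proof (rule exI[of _ "C * r"], intro ballI allI impI)
      fix \<phi> :: "real^'a \<Rightarrow> complex" and s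
      assume \<phi>: "\<phi> \<in> Cc" "\<forall>x. x \<notin> A \<longrightarrow> \<phi> x = 0" "\<forall>x. norm (\<phi> x) \<le> s"
      have s: "0 \<le> s" using order_trans[OF norm_ge_zero \<phi>(3)[rule_format]] .
      have "norm (L (\<lambda>y. g y * \<phi> y)) \<le> C * (r * s)"
      proof (rule C(2)[OF Cc_mult(1)[OF \<phi>(1) g]])
        show "g x * \<phi> x = 0" if "x \<notin> A" for x using \<phi>(2) that by simp
        show "norm (g x * \<phi> x) \<le> r * s" for x
        proof (cases "x \<in> A")
          case True
          have "norm (g x) * norm (\<phi> x) \<le> r * s" by (rule mult_mono) (use r True \<phi>(3) in auto)
          then show ?thesis by (simp add: norm_mult)
        next
          case False then show ?thesis using \<phi>(2) r(1) s by simp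
        qed
      qed
      then show "norm (if \<phi> \<in> Cc then L (\<lambda>y. g y * \<phi> y) else 0) \<le> C * r * s" using \<phi>(1) by (simp add: mult.assoc)
    qed
  qed
qed simp

context
  fixes d N :: nat and \<Psi>s :: "nat \<Rightarrow> 'n::finite functional"
  assumes \<Psi>s: "\<And>j. j \<in> {1..N} \<Longrightarrow> \<Psi>s j \<in> PLV d"
begin

lemma density_functional_Radon:
  assumes g: "\<And>j. j \<in> {1..N} \<Longrightarrow> continuous_on UNIV (g j)" and f: "f \<in> Conv"
  shows "density_functional N \<Psi>s g f \<in> Radon"
proof -
  have "(\<lambda>\<psi>. \<Sum>j\<in>{1..N}. 1 * (if \<psi> \<in> Cc then \<Psi>s j f (\<lambda>y. g j y * \<psi> y) else 0)) \<in> Radon"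
    by (intro Radon_lincomb Radon_density PLV_Radon[OF \<Psi>s] f g)
  moreover have "density_functional N \<Psi>s g f = (\<lambda>\<psi>. \<Sum>j\<in>{1..N}. 1 * (if \<psi> \<in> Cc then \<Psi>s j f (\<lambda>y. g j y * \<psi> y) else 0))"
    by (rule ext) (simp add: density_functional_def)
  ultimately show ?thesis by simp
qed

lemma density_functional_PLV:
  assumes g: "\<And>j. j \<in> {1..N} \<Longrightarrow> continuous_on UNIV (g j)"
  shows "density_functional N \<Psi>s g \<in> PLV d"
  unfolding PLV_def mem_Collect_eq
proof (intro conjI allI impI ballI)
  show "density_functional N \<Psi>s g f = 0" if "f \<notin> Conv" for f
    by (rule ext) (simp add: density_functional_def PLV_outside[OF \<Psi>s that])
  show R: "density_functional N \<Psi>s g f \<in> Radon" if "f \<in> Conv" for f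
    by (rule density_functional_Radon[OF g that])
  show "continuous_on Conv (density_functional N \<Psi>s g)"
  proof (rule continuous_on_coordinatewise_then_product, rule Conv_continuous_on_sequentially)
    fix \<psi> and f :: "nat \<Rightarrow> real^'n \<Rightarrow> real" and h
    assume f: "\<And>m. f m \<in> Conv" "h \<in> Conv" "f \<longlonglongrightarrow> h"
    have "(\<lambda>m. \<Sum>j=1..N. \<Psi>s j (f m) (\<lambda>y. g j y * \<psi> y)) \<longlonglongrightarrow> (\<Sum>j=1..N. \<Psi>s j h (\<lambda>y. g j y * \<psi> y))"
      by (rule tendsto_sum, rule PLV_tendsto[OF \<Psi>s f])
    then show "(\<lambda>m. density_functional N \<Psi>s g (f m) \<psi>) \<longlonglongrightarrow> density_functional N \<Psi>s g h \<psi>"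
      by (simp add: density_functional_def)
  qed
  show "local_functional (density_functional N \<Psi>s g)"
    unfolding local_functional_def
  proof (intro ballI allI impI)
    fix f h :: "real^'n \<Rightarrow> real" and U and \<phi> :: "real^'n \<Rightarrow> complex"
    assume fh: "f \<in> Conv" "h \<in> Conv" and U: "open U" "\<forall>x\<in>U. f x = h x" and \<phi>: "\<phi> \<in> Cc" "supp \<phi> \<subseteq> U"
    have "\<Psi>s j f (\<lambda>y. g j y * \<phi> y) = \<Psi>s j h (\<lambda>y. g j y * \<phi> y)" if j: "j \<in> {1..N}" for j
    proof (rule PLV_local[OF \<Psi>s[OF j], unfolded local_functional_def, rule_format, OF fh U(1)])
      show "f x = h x" if "x \<in> U" for x using U(2) that by blast
      show c: "(\<lambda>y. g j y * \<phi> y) \<in> Cc" by (rule Cc_mult(1)[OF \<phi>(1) g[OF j]])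
      have "supp (\<lambda>y. g j y * \<phi> y) \<subseteq> supp \<phi>"
        by (rule in_Cc_and_supp(2)[OF Cc_continuous[OF c] Cc_compact_supp[OF \<phi>(1)]]) (simp add: outside_supp)
      then show "supp (\<lambda>y. g j y * \<phi> y) \<subseteq> U" using \<phi>(2) by blast
    qed
    then show "density_functional N \<Psi>s g f \<phi> = density_functional N \<Psi>s g h \<phi>"
      unfolding density_functional_def by (auto intro: sum.cong)
  qed
  show "polynomial_on_affine d (\<lambda>l. density_functional N \<Psi>s g (f + l))" if f: "f \<in> Conv" for f
  proof (rule polynomial_on_affineI)
    show "density_functional N \<Psi>s g (f + (\<lambda>x. v \<bullet> x + c)) \<in> Radon" for v c
      by (rule R[OF Conv_add_affine[OF f]])
    fix \<phi> :: "real^'n \<Rightarrow> complex"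
    show "polynomial_fun d (\<lambda>(v, c). density_functional N \<Psi>s g (f + (\<lambda>x. v \<bullet> x + c)) \<phi>)"
    proof (cases "\<phi> \<in> Cc")
      case False
      then show ?thesis unfolding polynomial_fun_def
        by (intro exI[of _ "\<lambda>_. 0"]) (simp add: density_functional_def split_beta)
    next
      case True
      have "polynomial_fun d (\<lambda>z. \<Sum>j=1..N. (\<lambda>(v, c). \<Psi>s j (f + (\<lambda>x. v \<bullet> x + c)) (\<lambda>y. g j y * \<phi> y)) z * 1)"
        by (rule polynomial_fun_sum, rule polynomial_on_affineD[OF PLV_polynomial[OF \<Psi>s f]])
      then show ?thesis using True by (simp add: density_functional_def split_beta')
    qed
  qed
qed

lemma density_functional_estimate:
  assumes K: "compact K" "K \<subseteq> Conv" and \<psi>: "\<psi> \<in> Cc"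
  shows "\<exists>C\<ge>0. \<forall>g h \<eta>. (\<forall>j\<in>{1..N}. continuous_on UNIV (g j) \<and> continuous_on UNIV (h j)) \<longrightarrow> \<eta> \<ge> 0 \<longrightarrow>
      (\<forall>j\<in>{1..N}. \<forall>y\<in>supp \<psi>. norm (g j y - h j y) \<le> \<eta>) \<longrightarrow>
      (\<forall>f\<in>K. norm (density_functional N \<Psi>s g f \<psi> - density_functional N \<Psi>s h f \<psi>) \<le> C * \<eta>)"
proof -
  have "\<forall>j. \<exists>C. j \<in> {1..N} \<longrightarrow> C \<ge> 0 \<and> (\<forall>f\<in>K. \<forall>\<phi>\<in>Cc. \<forall>s. (\<forall>x. x \<notin> supp \<psi> \<longrightarrow> \<phi> x = 0) \<longrightarrow> (\<forall>x. norm (\<phi> x) \<le> s) \<longrightarrow> norm (\<Psi>s j f \<phi>) \<le> C * s)"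
    using PLV_uniform_bound[OF \<Psi>s K Cc_compact_supp[OF \<psi>]] by blast
  from choice[OF this] obtain C where C: "\<forall>j. j \<in> {1..N} \<longrightarrow> C j \<ge> 0 \<and> (\<forall>f\<in>K. \<forall>\<phi>\<in>Cc. \<forall>s. (\<forall>x. x \<notin> supp \<psi> \<longrightarrow> \<phi> x = 0) \<longrightarrow> (\<forall>x. norm (\<phi> x) \<le> s) \<longrightarrow> norm (\<Psi>s j f \<phi>) \<le> C j * s)"
    by (rule exE)
  obtain s where s: "s > 0" "\<And>x. norm (\<psi> x) \<le> s" by (rule Cc_bounded[OF \<psi>]) blast
  show ?thesis
  proof (rule exI[of _ "(\<Sum>j=1..N. C j) * s"], intro conjI allI impI ballI)
    show "0 \<le> (\<Sum>j=1..N. C j) * s" using C s(1) by (intro mult_nonneg_nonneg sum_nonneg) auto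
    fix g h :: "nat \<Rightarrow> real^'n \<Rightarrow> complex" and \<eta> :: real and f
    assume gh: "\<forall>j\<in>{1..N}. continuous_on UNIV (g j) \<and> continuous_on UNIV (h j)" and \<eta>: "\<eta> \<ge> 0"
      and cl: "\<forall>j\<in>{1..N}. \<forall>y\<in>supp \<psi>. norm (g j y - h j y) \<le> \<eta>" and f: "f \<in> K"
    have "norm (\<Psi>s j f (\<lambda>y. g j y * \<psi> y) - \<Psi>s j f (\<lambda>y. h j y * \<psi> y)) \<le> C j * (\<eta> * s)" if j: "j \<in> {1..N}" for j
    proof -
      have c: "(\<lambda>y. g j y * \<psi> y) \<in> Cc" "(\<lambda>y. h j y * \<psi> y) \<in> Cc"
        using gh j by (auto intro: Cc_mult(1)[OF \<psi>])
      have R: "\<Psi>s j f \<in> Radon" using PLV_Radon[OF \<Psi>s[OF j]] f K(2) by blast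
      have "norm (\<Psi>s j f (\<lambda>y. g j y * \<psi> y - h j y * \<psi> y)) \<le> C j * (\<eta> * s)"
      proof (rule C[rule_format, OF j, THEN conjunct2, rule_format, OF f Cc_diff[OF c]])
        show "g j y * \<psi> y - h j y * \<psi> y = 0" if "y \<notin> supp \<psi>" for y using outside_supp[OF that] by simp
        show "norm (g j y * \<psi> y - h j y * \<psi> y) \<le> \<eta> * s" for y
        proof (cases "y \<in> supp \<psi>")
          case True
          have "norm (g j y - h j y) * norm (\<psi> y) \<le> \<eta> * s"
            by (rule mult_mono) (use cl j True s \<eta> in auto)
          then show ?thesis by (simp add: norm_mult[symmetric] left_diff_distrib)
        next
          case False then show ?thesis using outside_supp[OF False] \<eta> s(1) by simp
        qed
      qed
      then show ?thesis by (simp only: Radon_diff[OF R c])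
    qed
    then have "norm (\<Sum>j=1..N. \<Psi>s j f (\<lambda>y. g j y * \<psi> y) - \<Psi>s j f (\<lambda>y. h j y * \<psi> y)) \<le> (\<Sum>j=1..N. C j * (\<eta> * s))"
      by (rule sum_norm_le)
    also have "(\<Sum>j=1..N. C j * (\<eta> * s)) = (\<Sum>j=1..N. C j) * s * \<eta>"
      unfolding sum_distrib_right[symmetric] by (simp only: mult_ac)
    finally show "norm (density_functional N \<Psi>s g f \<psi> - density_functional N \<Psi>s h f \<psi>) \<le> (\<Sum>j=1..N. C j) * s * \<eta>"
      using \<psi> by (simp only: density_functional_def sum_subtractf if_True)
  qed
qed

lemma density_functional_limit:
  assumes G: "\<And>j. j \<in> {1..N} \<Longrightarrow> continuous_on UNIV (G j)"
    and q: "\<And>t j. j \<in> {1..N} \<Longrightarrow> continuous_on UNIV (q t j)"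
    and close: "\<And>A \<eta> j. compact A \<Longrightarrow> \<eta> > 0 \<Longrightarrow> j \<in> {1..N} \<Longrightarrow> \<forall>\<^sub>F t in F. \<forall>y\<in>A. norm (q t j y - G j y) \<le> \<eta>"
  shows "limitin (cw_topology d) (\<lambda>t. density_functional N \<Psi>s (q t)) (density_functional N \<Psi>s G) F"
proof (rule limitin_cw_topologyI)
  show "density_functional N \<Psi>s G \<in> PLV d" by (rule density_functional_PLV[OF G])
  fix K :: "(real^'n \<Rightarrow> real) set" and \<phi> :: "real^'n \<Rightarrow> complex" and e :: real
  assume K: "compact K" "K \<noteq> {}" "K \<subseteq> Conv" and \<phi>: "\<phi> \<in> Cc" and e: "e > 0"
  obtain C where C: "C \<ge> 0" "\<forall>g h \<eta>. (\<forall>j\<in>{1..N}. continuous_on UNIV (g j) \<and> continuous_on UNIV (h j)) \<longrightarrow> \<eta> \<ge> 0 \<longrightarrow>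
      (\<forall>j\<in>{1..N}. \<forall>y\<in>supp \<phi>. norm (g j y - h j y) \<le> \<eta>) \<longrightarrow>
      (\<forall>f\<in>K. norm (density_functional N \<Psi>s g f \<phi> - density_functional N \<Psi>s h f \<phi>) \<le> C * \<eta>)"
    using density_functional_estimate[OF K(1,3) \<phi>] by (elim exE conjE) (rule that)
  define \<eta> where "\<eta> = e / (C + 1)"
  have \<eta>: "\<eta> > 0" "C * \<eta> \<le> e" using e C(1) by (simp_all add: \<eta>_def field_simps)
  have "\<forall>\<^sub>F t in F. \<forall>j\<in>{1..N}. \<forall>y\<in>supp \<phi>. norm (q t j y - G j y) \<le> \<eta>"
    by (rule eventually_ball_finite) (auto intro: close[OF Cc_compact_supp[OF \<phi>] \<eta>(1)])
  then show "\<forall>\<^sub>F t in F. density_functional N \<Psi>s (q t) \<in> PLV d \<and>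
      (\<forall>f\<in>K. norm (density_functional N \<Psi>s (q t) f \<phi> - density_functional N \<Psi>s G f \<phi>) \<le> e)"
  proof (rule eventually_mono)
    fix t assume *: "\<forall>j\<in>{1..N}. \<forall>y\<in>supp \<phi>. norm (q t j y - G j y) \<le> \<eta>"
    have "norm (density_functional N \<Psi>s (q t) f \<phi> - density_functional N \<Psi>s G f \<phi>) \<le> C * \<eta>" if "f \<in> K" for f
      by (rule C(2)[rule_format, OF _ _ _ that]) (use q G * \<eta>(1) in auto)
    then show "density_functional N \<Psi>s (q t) \<in> PLV d \<and>
      (\<forall>f\<in>K. norm (density_functional N \<Psi>s (q t) f \<phi> - density_functional N \<Psi>s G f \<phi>) \<le> e)"
      using density_functional_PLV[OF q] \<eta>(2) by (auto intro: order_trans)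
  qed
qed

lemma translated_continuous:
  "continuous_on UNIV (g :: real^'n \<Rightarrow> complex) \<Longrightarrow> continuous_on UNIV (\<lambda>y. g (y - x))"
  by (erule continuous_on_compose2) (auto intro!: continuous_intros)

lemma density_functional_translates_continuous:
  assumes g: "\<And>j. j \<in> {1..N} \<Longrightarrow> continuous_on UNIV (g j)"
  shows "continuous_map euclidean (cw_topology d) (\<lambda>x. density_functional N \<Psi>s (\<lambda>j y. g j (y - x)))"
proof (rule continuous_map_cw_topologyI, rule density_functional_limit)
  fix x :: "real^'n" and j assume j: "j \<in> {1..N}"
  show "continuous_on UNIV (\<lambda>y. g j (y - z))" for z by (rule translated_continuous[OF g[OF j]])
  then show "continuous_on UNIV (\<lambda>y. g j (y - x))" .
  fix A :: "(real^'n) set" and \<eta> :: real assume A: "compact A" and \<eta>: "\<eta> > 0"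
  have A': "compact ((\<lambda>y. y - x) ` A)" using A by (intro compact_continuous_image continuous_intros)
  obtain \<delta> where \<delta>: "\<delta> > 0" "\<forall>y\<in>(\<lambda>y. y - x) ` A. \<forall>z. dist y z < \<delta> \<longrightarrow> norm (g j z - g j y) \<le> \<eta>"
    using uniform_continuity_near_compact[OF g[OF j] A' \<eta>] by (elim exE conjE) (rule that)
  have "\<forall>\<^sub>F z in nhds x. dist z x < \<delta>" unfolding eventually_nhds_metric using \<delta>(1) by blast
  then show "\<forall>\<^sub>F z in nhds x. \<forall>y\<in>A. norm (g j (y - z) - g j (y - x)) \<le> \<eta>"
  proof (rule eventually_mono)
    fix z assume "dist z x < \<delta>"
    then have "dist (y - x) (y - z) < \<delta>" for y by (simp add: dist_norm)
    then show "\<forall>y\<in>A. norm (g j (y - z) - g j (y - x)) \<le> \<eta>" using \<delta>(2) by blast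
  qed
qed

text \<open>
  By the mean value inequality the error of the difference quotient is bounded by the
  oscillation of the partial derivative, which is uniformly small near a compact set.
\<close>

lemma uniform_difference_quotient:
  fixes g G :: "real^'n \<Rightarrow> complex"
  assumes pd: "has_partial_derivative euclidean scaleR g i G" and G: "continuous_on UNIV G"
    and A: "compact A" and \<eta>: "\<eta> > 0"
  shows "\<forall>\<^sub>F t in at 0. \<forall>y\<in>A. norm (of_real (inverse t) * (g (y - t *\<^sub>R axis i 1) - g y) - (-1) * G y) \<le> \<eta>"
proof -
  let ?e = "axis i 1 :: real^'n"
  have D: "((\<lambda>s. g (y + s *\<^sub>R ?e)) has_vector_derivative G (y + s *\<^sub>R ?e)) (at s)" for y s
  proof -
    have l: "((\<lambda>t. inverse t *\<^sub>R (g (y + s *\<^sub>R ?e + t *\<^sub>R ?e) - g (y + s *\<^sub>R ?e))) \<longlongrightarrow> G (y + s *\<^sub>R ?e)) (at 0)"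
      using pd unfolding has_partial_derivative_euclidean by (rule spec)
    have "((\<lambda>t. norm (g (y + (s + t) *\<^sub>R ?e) - g (y + s *\<^sub>R ?e) - t *\<^sub>R G (y + s *\<^sub>R ?e)) / norm t) \<longlongrightarrow> 0) (at 0)"
    proof (rule tendstoI)
      fix e :: real assume "e > 0"
      from tendstoD[OF l this] have "\<forall>\<^sub>F t in at 0. dist (inverse t *\<^sub>R (g (y + s *\<^sub>R ?e + t *\<^sub>R ?e) - g (y + s *\<^sub>R ?e))) (G (y + s *\<^sub>R ?e)) < e" .
      moreover have "\<forall>\<^sub>F t in at (0::real). t \<noteq> 0" by (simp add: eventually_at_filter)
      ultimately show "\<forall>\<^sub>F t in at 0. dist (norm (g (y + (s + t) *\<^sub>R ?e) - g (y + s *\<^sub>R ?e) - t *\<^sub>R G (y + s *\<^sub>R ?e)) / norm t) 0 < e"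
      proof eventually_elim
        case (elim t)
        have "norm (g (y + (s + t) *\<^sub>R ?e) - g (y + s *\<^sub>R ?e) - t *\<^sub>R G (y + s *\<^sub>R ?e)) / norm t =
            norm (inverse t *\<^sub>R (g (y + (s + t) *\<^sub>R ?e) - g (y + s *\<^sub>R ?e) - t *\<^sub>R G (y + s *\<^sub>R ?e)))"
          by (simp add: divide_inverse mult.commute)
        also have "inverse t *\<^sub>R (g (y + (s + t) *\<^sub>R ?e) - g (y + s *\<^sub>R ?e) - t *\<^sub>R G (y + s *\<^sub>R ?e)) =
            inverse t *\<^sub>R (g (y + s *\<^sub>R ?e + t *\<^sub>R ?e) - g (y + s *\<^sub>R ?e)) - G (y + s *\<^sub>R ?e)"
          using elim(2) by (simp add: scaleR_right_diff_distrib scaleR_add_left add.assoc)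
        finally show ?case using elim(1) by (simp add: dist_norm)
      qed
    qed
    then show ?thesis
      unfolding has_vector_derivative_def has_derivative_at by (simp add: bounded_linear_scaleR_left)
  qed
  obtain \<delta> where \<delta>: "\<delta> > 0" "\<forall>y\<in>A. \<forall>z. dist y z < \<delta> \<longrightarrow> norm (G z - G y) \<le> \<eta>"
    using uniform_continuity_near_compact[OF G A \<eta>] by (elim exE conjE) (rule that)
  have "\<forall>\<^sub>F t in at (0::real). t \<noteq> 0 \<and> dist t 0 < \<delta>"
    using \<delta>(1) unfolding eventually_at by (intro exI[of _ \<delta>]) simp
  then show ?thesis
  proof (rule eventually_mono, intro ballI)
    fix t :: real and y assume t: "t \<noteq> 0 \<and> dist t 0 < \<delta>" and y: "y \<in> A"
    have "norm (g (y + (- t) *\<^sub>R ?e) - g (y + 0 *\<^sub>R ?e) - (- t - 0) *\<^sub>R G (y + 0 *\<^sub>R ?e)) \<le> norm (- t - 0) * \<eta>"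
    proof (rule vector_differentiable_bound_linearization[where f="\<lambda>s. g (y + s *\<^sub>R ?e)" and f'="\<lambda>s. G (y + s *\<^sub>R ?e)" and S="ball 0 \<delta>"])
      show "((\<lambda>s. g (y + s *\<^sub>R ?e)) has_vector_derivative G (y + x *\<^sub>R ?e)) (at x within ball 0 \<delta>)" for x
        by (rule has_vector_derivative_at_within[OF D])
      show "closed_segment 0 (- t) \<subseteq> ball 0 \<delta>"
        by (rule closed_segment_subset) (use t \<delta>(1) in \<open>auto simp: convex_ball\<close>)
      show "norm (G (y + x *\<^sub>R ?e) - G (y + 0 *\<^sub>R ?e)) \<le> \<eta>" if "x \<in> ball 0 \<delta>" for x
      proof -
        have "dist y (y + x *\<^sub>R ?e) < \<delta>" using that by (simp add: dist_norm)
        then show ?thesis using \<delta>(2) y by simp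
      qed
      show "0 \<in> ball 0 \<delta>" using \<delta>(1) by simp
    qed
    then have 1: "norm (g (y - t *\<^sub>R ?e) - g y + t *\<^sub>R G y) \<le> \<bar>t\<bar> * \<eta>" by simp
    have "of_real (inverse t) * (g (y - t *\<^sub>R ?e) - g y) - (-1) * G y = inverse t *\<^sub>R (g (y - t *\<^sub>R ?e) - g y + t *\<^sub>R G y)"
      using t by (simp add: scaleR_conv_of_real distrib_left mult.assoc[symmetric])
    then have "norm (of_real (inverse t) * (g (y - t *\<^sub>R ?e) - g y) - (-1) * G y) = \<bar>inverse t\<bar> * norm (g (y - t *\<^sub>R ?e) - g y + t *\<^sub>R G y)"
      by simp
    also have "\<dots> \<le> \<bar>inverse t\<bar> * (\<bar>t\<bar> * \<eta>)" by (rule mult_left_mono[OF 1]) simp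
    also have "\<dots> = \<eta>" using t by simp
    finally show "norm (of_real (inverse t) * (g (y - t *\<^sub>R ?e) - g y) - (-1) * G y) \<le> \<eta>" .
  qed
qed

lemma density_functional_lincomb:
  assumes g: "\<And>j. j \<in> {1..N} \<Longrightarrow> continuous_on UNIV (g j)" and h: "\<And>j. j \<in> {1..N} \<Longrightarrow> continuous_on UNIV (h j)"
  shows "scale_functional c (density_functional N \<Psi>s g - density_functional N \<Psi>s h) =
    density_functional N \<Psi>s (\<lambda>j y. c * (g j y - h j y))"
proof (intro ext)
  fix f :: "real^'n \<Rightarrow> real" and \<psi> :: "real^'n \<Rightarrow> complex"
  show "scale_functional c (density_functional N \<Psi>s g - density_functional N \<Psi>s h) f \<psi> =
    density_functional N \<Psi>s (\<lambda>j y. c * (g j y - h j y)) f \<psi>"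
  proof (cases "f \<in> Conv \<and> \<psi> \<in> Cc")
    case True
    have "\<Psi>s j f (\<lambda>y. c * (g j y - h j y) * \<psi> y) = c * (\<Psi>s j f (\<lambda>y. g j y * \<psi> y) - \<Psi>s j f (\<lambda>y. h j y * \<psi> y))"
      if j: "j \<in> {1..N}" for j
    proof -
      have R: "\<Psi>s j f \<in> Radon" using PLV_Radon[OF \<Psi>s[OF j]] True by blast
      have cg: "(\<lambda>y. g j y * \<psi> y) \<in> Cc" and ch: "(\<lambda>y. h j y * \<psi> y) \<in> Cc"
        using True by (auto intro: Cc_mult(1) g[OF j] h[OF j])
      have "(\<lambda>y. c * (g j y - h j y) * \<psi> y) = (\<lambda>y. c * (g j y * \<psi> y - h j y * \<psi> y))" by (simp add: algebra_simps)
      then have "\<Psi>s j f (\<lambda>y. c * (g j y - h j y) * \<psi> y) = c * \<Psi>s j f (\<lambda>y. g j y * \<psi> y - h j y * \<psi> y)"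
        using Radon_cmult[OF R Cc_diff[OF cg ch], of c] by simp
      then show ?thesis by (simp only: Radon_diff[OF R cg ch])
    qed
    then have "(\<Sum>j=1..N. \<Psi>s j f (\<lambda>y. c * (g j y - h j y) * \<psi> y)) = (\<Sum>j=1..N. c * (\<Psi>s j f (\<lambda>y. g j y * \<psi> y) - \<Psi>s j f (\<lambda>y. h j y * \<psi> y)))"
      by (intro sum.cong refl)
    also have "\<dots> = c * ((\<Sum>j=1..N. \<Psi>s j f (\<lambda>y. g j y * \<psi> y)) - (\<Sum>j=1..N. \<Psi>s j f (\<lambda>y. h j y * \<psi> y)))"
      unfolding sum_subtractf[symmetric] by (rule sum_distrib_left[symmetric])
    finally show ?thesis using True by (simp add: scale_functional_def density_functional_def)
  next
    case False
    then show ?thesis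
      by (auto simp: scale_functional_def density_functional_def PLV_outside[OF \<Psi>s])
  qed
qed

text \<open>
  The variable \<open>x\<close> enters only through the densities \<open>g j (y - x)\<close>,
  whose difference quotients converge locally uniformly to minus the partial derivatives; then
  induction on \<open>k\<close>.
\<close>

lemma density_functional_C_k:
  assumes "\<And>j. j \<in> {1..N} \<Longrightarrow> C_k k euclidean scaleR (g j)"
  shows "C_k k (cw_topology d) (\<lambda>r. scale_functional (of_real r)) (\<lambda>x. density_functional N \<Psi>s (\<lambda>j y. g j (y - x)))"
  using assms
proof (induction k arbitrary: g)
  case 0
  have "continuous_map euclidean (cw_topology d) (\<lambda>x. density_functional N \<Psi>s (\<lambda>j y. g j (y - x)))"
    by (rule density_functional_translates_continuous) (use 0 in simp)
  then show ?case by simp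
next
  case (Suc k)
  have gc: "continuous_on UNIV (g j)" if "j \<in> {1..N}" for j
    using C_k_continuous[OF Suc.prems[OF that]] by simp
  show ?case
  proof (simp only: C_k.simps, intro conjI allI)
    show "continuous_map euclidean (cw_topology d) (\<lambda>x. density_functional N \<Psi>s (\<lambda>j y. g j (y - x)))"
      by (rule density_functional_translates_continuous[OF gc])
    fix i
    have "\<forall>j. \<exists>G. j \<in> {1..N} \<longrightarrow> has_partial_derivative euclidean scaleR (g j) i G \<and> C_k k euclidean scaleR G"
      using Suc.prems by auto
    from choice[OF this] obtain G where G: "\<forall>j. j \<in> {1..N} \<longrightarrow> has_partial_derivative euclidean scaleR (g j) i (G j) \<and> C_k k euclidean scaleR (G j)"
      by (rule exE)
    have Gc: "continuous_on UNIV (G j)" if "j \<in> {1..N}" for j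
      using C_k_continuous[of k euclidean scaleR "G j"] G that by simp
    define H where "H j y = (-1) * G j y" for j y
    have Hc: "continuous_on UNIV (H j)" if "j \<in> {1..N}" for j
      unfolding H_def by (intro continuous_on_mult continuous_on_const Gc that)
    have "C_k k (cw_topology d) (\<lambda>r. scale_functional (of_real r)) (\<lambda>x. density_functional N \<Psi>s (\<lambda>j y. H j (y - x)))"
      by (rule Suc.IH) (use G in \<open>auto simp: H_def[abs_def] intro: C_k_cmult[where c="-1", simplified]\<close>)
    moreover have "has_partial_derivative (cw_topology d) (\<lambda>r. scale_functional (of_real r))
        (\<lambda>x. density_functional N \<Psi>s (\<lambda>j y. g j (y - x))) i (\<lambda>x. density_functional N \<Psi>s (\<lambda>j y. H j (y - x)))"
      unfolding has_partial_derivative_def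
    proof
      fix x :: "real^'n"
      let ?e = "axis i 1 :: real^'n"
      have "limitin (cw_topology d) (\<lambda>t. density_functional N \<Psi>s (\<lambda>j y. of_real (inverse t) * (g j (y - (x + t *\<^sub>R ?e)) - g j (y - x))))
          (density_functional N \<Psi>s (\<lambda>j y. H j (y - x))) (at 0)"
      proof (rule density_functional_limit)
        fix j assume j: "j \<in> {1..N}"
        show "continuous_on UNIV (\<lambda>y. H j (y - x))" by (rule translated_continuous[OF Hc[OF j]])
        show "continuous_on UNIV (\<lambda>y. of_real (inverse t) * (g j (y - (x + t *\<^sub>R ?e)) - g j (y - x)))" for t
          by (intro continuous_on_mult_left continuous_on_diff translated_continuous gc j)
        fix A :: "(real^'n) set" and \<eta> :: real assume A: "compact A" and \<eta>: "\<eta> > 0"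
        have A': "compact ((\<lambda>y. y - x) ` A)" using A by (intro compact_continuous_image continuous_intros)
        have "\<forall>\<^sub>F t in at 0. \<forall>y\<in>(\<lambda>y. y - x) ` A. norm (of_real (inverse t) * (g j (y - t *\<^sub>R ?e) - g j y) - (-1) * G j y) \<le> \<eta>"
          by (rule uniform_difference_quotient[OF _ Gc[OF j] A' \<eta>]) (use G j in blast)
        then show "\<forall>\<^sub>F t in at 0. \<forall>y\<in>A. norm (of_real (inverse t) * (g j (y - (x + t *\<^sub>R ?e)) - g j (y - x)) - H j (y - x)) \<le> \<eta>"
        proof (rule eventually_mono)
          fix t assume *: "\<forall>y\<in>(\<lambda>y. y - x) ` A. norm (of_real (inverse t) * (g j (y - t *\<^sub>R ?e) - g j y) - (-1) * G j y) \<le> \<eta>"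
          show "\<forall>y\<in>A. norm (of_real (inverse t) * (g j (y - (x + t *\<^sub>R ?e)) - g j (y - x)) - H j (y - x)) \<le> \<eta>"
          proof
            fix y assume "y \<in> A"
            from *[rule_format, OF imageI[OF this]]
            show "norm (of_real (inverse t) * (g j (y - (x + t *\<^sub>R ?e)) - g j (y - x)) - H j (y - x)) \<le> \<eta>"
              by (simp only: H_def diff_diff_eq)
          qed
        qed
      qed
      moreover have "scale_functional (of_real (inverse t)) (density_functional N \<Psi>s (\<lambda>j y. g j (y - (x + t *\<^sub>R ?e))) - density_functional N \<Psi>s (\<lambda>j y. g j (y - x)))
          = density_functional N \<Psi>s (\<lambda>j y. of_real (inverse t) * (g j (y - (x + t *\<^sub>R ?e)) - g j (y - x)))" for t
        by (rule density_functional_lincomb) (intro translated_continuous gc, assumption)+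
      ultimately show "limitin (cw_topology d) (\<lambda>t. scale_functional (of_real (inverse t)) (density_functional N \<Psi>s (\<lambda>j y. g j (y - (x + t *\<^sub>R ?e))) - density_functional N \<Psi>s (\<lambda>j y. g j (y - x))))
          (density_functional N \<Psi>s (\<lambda>j y. H j (y - x))) (at 0)" by (simp only:)
    qed
    ultimately show "\<exists>G. has_partial_derivative (cw_topology d) (\<lambda>r. scale_functional (of_real r)) (\<lambda>x. density_functional N \<Psi>s (\<lambda>j y. g j (y - x))) i G
        \<and> C_k k (cw_topology d) (\<lambda>r. scale_functional (of_real r)) G" by blast
  qed
qed

end

text \<open>
  Since the \<open>\<Psi>\<^sub>j\<close> are translation invariant, translating
  \<open>\<Psi>\<close> only translates its densities.
\<close>

lemma smooth_functional_of_smooth_densities: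
  fixes \<Psi>s :: "nat \<Rightarrow> 'n::finite functional"
  assumes \<Psi>s: "\<And>j. j \<in> {1..N} \<Longrightarrow> \<Psi>s j \<in> PLV_tr d" and \<Psi>: "\<Psi> \<in> PLV d"
    and g: "\<And>j. j \<in> {1..N} \<Longrightarrow> smooth_function (g j)"
    and rep: "\<And>f \<psi>. f \<in> Conv \<Longrightarrow> \<psi> \<in> Cc \<Longrightarrow> \<Psi> f \<psi> = (\<Sum>j=1..N. \<Psi>s j f (\<lambda>y. g j y * \<psi> y))"
  shows "smooth_functional d \<Psi>"
proof -
  have "trans_act x \<Psi> = density_functional N \<Psi>s (\<lambda>j y. g j (y - x))" for x
  proof (intro ext)
    fix f :: "real^'n \<Rightarrow> real" and \<psi> :: "real^'n \<Rightarrow> complex"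
    show "trans_act x \<Psi> f \<psi> = density_functional N \<Psi>s (\<lambda>j y. g j (y - x)) f \<psi>"
    proof (cases "f \<in> Conv \<and> \<psi> \<in> Cc")
      case True
      then have "trans_act x \<Psi> f \<psi> = (\<Sum>j=1..N. \<Psi>s j (\<lambda>y. f (y + x)) (\<lambda>y. g j y * \<psi> (y + x)))"
        unfolding trans_act_apply by (intro rep Conv_translate Cc_translate) auto
      also have "\<dots> = (\<Sum>j=1..N. \<Psi>s j f (\<lambda>y. g j (y - x) * \<psi> y))"
      proof (rule sum.cong[OF refl])
        fix j assume "j \<in> {1..N}"
        from PLV_tr_translate[OF \<Psi>s[OF this], of f x "\<lambda>y. g j (y - x) * \<psi> y"]
        show "\<Psi>s j (\<lambda>y. f (y + x)) (\<lambda>y. g j y * \<psi> (y + x)) = \<Psi>s j f (\<lambda>y. g j (y - x) * \<psi> y)" by simp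
      qed
      finally show ?thesis using True by (simp add: density_functional_def)
    next
      case False
      then consider "f \<notin> Conv" | "\<psi> \<notin> Cc" by blast
      then show ?thesis
      proof cases
        case 1
        then have "(\<lambda>y. f (y + x)) \<notin> Conv" by (simp add: Conv_translate_iff)
        with 1 show ?thesis by (simp add: trans_act_apply PLV_outside[OF \<Psi>] density_functional_def PLV_outside[OF PLV_tr_PLV[OF \<Psi>s]])
      next
        case 2
        then have "(\<lambda>y. \<psi> (y + x)) \<notin> Cc" by (simp add: Cc_translate_iff)
        with 2 show ?thesis by (simp add: trans_act_apply PLV_not_Cc[OF \<Psi>] density_functional_def)
      qed
    qed
  qed
  then have eq: "(\<lambda>x. trans_act x \<Psi>) = (\<lambda>x. density_functional N \<Psi>s (\<lambda>j y. g j (y - x)))" by (rule ext)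
  have "C_k k (cw_topology d) (\<lambda>r. scale_functional (of_real r)) (\<lambda>x. trans_act x \<Psi>)" for k
    unfolding eq
    by (rule density_functional_C_k) (use PLV_tr_PLV[OF \<Psi>s] g in \<open>auto simp: smooth_function_def smooth_map_def\<close>)
  then show ?thesis by (simp add: smooth_functional_def smooth_map_def)
qed

section \<open>Coefficients with respect to a basis\<close>

lemma functional_sum_apply:
  "finite S \<Longrightarrow> (\<Sum>v\<in>S. scale_functional (u v) (F v)) f \<phi> = (\<Sum>v\<in>S. u v * F v f \<phi>)"
  by (induction S rule: finite_induct) (simp_all add: scale_functional_def)

context
  fixes d N :: nat and \<Psi>s :: "nat \<Rightarrow> 'n::finite functional"
  assumes basis: "is_basis (PLV_tr d) N \<Psi>s"
begin

lemma basis_in_PLV_tr: "j \<in> {1..N} \<Longrightarrow> \<Psi>s j \<in> PLV_tr d"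
  using basis functional.span_base[of "\<Psi>s j" "\<Psi>s ` {1..N}"] unfolding is_basis_def by auto

lemma basis_expansion:
  assumes "E \<in> PLV_tr d"
  shows "\<exists>c. \<forall>f \<phi>. E f \<phi> = (\<Sum>j=1..N. c j * \<Psi>s j f \<phi>)"
proof -
  have inj: "inj_on \<Psi>s {1..N}" using basis by (simp add: is_basis_def)
  have "E \<in> functional_span (\<Psi>s ` {1..N})" using assms basis by (simp add: is_basis_def)
  then have "E \<in> range (\<lambda>u. \<Sum>v\<in>\<Psi>s ` {1..N}. scale_functional (u v) v)"
    by (simp only: functional.span_finite[OF finite_imageI[OF finite_atLeastAtMost]])
  then obtain u where u: "E = (\<Sum>v\<in>\<Psi>s ` {1..N}. scale_functional (u v) v)" by (rule rangeE)
  have "E f \<phi> = (\<Sum>j=1..N. u (\<Psi>s j) * \<Psi>s j f \<phi>)" for f \<phi>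
    unfolding u functional_sum_apply[OF finite_imageI[OF finite_atLeastAtMost]]
    by (subst sum.reindex[OF inj]) simp
  then show ?thesis by (intro exI[of _ "\<lambda>j. u (\<Psi>s j)"]) blast
qed

lemma basis_independent:
  assumes z: "\<And>f \<phi>. (\<Sum>j=1..N. c j * \<Psi>s j f \<phi>) = 0" and j: "j \<in> {1..N}"
  shows "c j = 0"
proof -
  have inj: "inj_on \<Psi>s {1..N}" and ind: "\<not> functional_dependent (\<Psi>s ` {1..N})" using basis by (simp_all add: is_basis_def)
  define u where "u v = c (the_inv_into {1..N} \<Psi>s v)" for v
  have uj: "u (\<Psi>s j) = c j" if "j \<in> {1..N}" for j
    unfolding u_def by (simp only: the_inv_into_f_f[OF inj that])
  have "(\<Sum>v\<in>\<Psi>s ` {1..N}. scale_functional (u v) v) = 0"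
  proof (intro ext)
    fix f \<phi>
    have "(\<Sum>v\<in>\<Psi>s ` {1..N}. scale_functional (u v) v) f \<phi> = (\<Sum>j=1..N. u (\<Psi>s j) * \<Psi>s j f \<phi>)"
      unfolding functional_sum_apply[OF finite_imageI[OF finite_atLeastAtMost]] by (subst sum.reindex[OF inj]) simp
    also have "\<dots> = (\<Sum>j=1..N. c j * \<Psi>s j f \<phi>)" by (rule sum.cong[OF refl]) (simp only: uj)
    also have "\<dots> = 0" by (rule z)
    finally show "(\<Sum>v\<in>\<Psi>s ` {1..N}. scale_functional (u v) v) f \<phi> = 0 f \<phi>" by (simp only: zero_fun_def)
  qed
  from functional.independentD[OF ind finite_imageI[OF finite_atLeastAtMost] subset_refl this imageI[OF j]]
  show ?thesis by (simp only: uj[OF j])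
qed

text \<open>
  At each point \<open>c\<close> the values of the differences of the densities are the
  coefficients of a vanishing linear combination of the basis.
\<close>

lemma densities_unique:
  assumes g: "\<And>j. j \<in> {1..N} \<Longrightarrow> continuous_on UNIV (g j)" and h: "\<And>j. j \<in> {1..N} \<Longrightarrow> continuous_on UNIV (h j)"
    and eq: "\<And>f \<psi>. f \<in> Conv \<Longrightarrow> \<psi> \<in> Cc \<Longrightarrow>
      (\<Sum>j=1..N. \<Psi>s j f (\<lambda>y. g j y * \<psi> y)) = (\<Sum>j=1..N. \<Psi>s j f (\<lambda>y. h j y * \<psi> y))"
    and j: "j \<in> {1..N}"
  shows "g j = h j"
proof
  fix c
  have z: "(\<Sum>j=1..N. \<Psi>s j f (\<lambda>y. (g j y - h j y) * \<psi> y)) = 0" if f: "f \<in> Conv" and \<psi>: "\<psi> \<in> Cc" for f \<psi>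
  proof -
    have "\<Psi>s j f (\<lambda>y. (g j y - h j y) * \<psi> y) = \<Psi>s j f (\<lambda>y. g j y * \<psi> y) - \<Psi>s j f (\<lambda>y. h j y * \<psi> y)" if j: "j \<in> {1..N}" for j
      unfolding left_diff_distrib
      by (rule Radon_diff[OF PLV_Radon[OF PLV_tr_PLV[OF basis_in_PLV_tr[OF j]] f] Cc_mult(1)[OF \<psi> g[OF j]] Cc_mult(1)[OF \<psi> h[OF j]]])
    then have "(\<Sum>j=1..N. \<Psi>s j f (\<lambda>y. (g j y - h j y) * \<psi> y)) = (\<Sum>j=1..N. \<Psi>s j f (\<lambda>y. g j y * \<psi> y) - \<Psi>s j f (\<lambda>y. h j y * \<psi> y))"
      by (intro sum.cong refl)
    then show ?thesis by (simp only: sum_subtractf eq[OF f \<psi>] diff_self)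
  qed
  have "(\<Sum>j=1..N. (g j c - h j c) * \<Psi>s j f \<phi>) = 0" for f \<phi>
  proof (cases "f \<in> Conv \<and> \<phi> \<in> Cc")
    case True
    then have f: "f \<in> Conv" and \<phi>: "\<phi> \<in> Cc" by blast+
    show ?thesis
      by (rule density_combination_frozen[where g="\<lambda>j y. g j y - h j y", OF finite_atLeastAtMost basis_in_PLV_tr continuous_on_diff[OF g h] z f \<phi>])
  next
    case False
    have "\<Psi>s j f \<phi> = 0" if "j \<in> {1..N}" for j
      using False PLV_outside[OF PLV_tr_PLV[OF basis_in_PLV_tr[OF that]]] PLV_not_Cc[OF PLV_tr_PLV[OF basis_in_PLV_tr[OF that]]] by blast
    then show ?thesis by simp
  qed
  from basis_independent[OF this j] show "g j c = h j c" by simp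
qed

text \<open>
  Each convolution in the parametrix has as densities the coefficients of the averages of its
  functional with kernel \<open>\<rho>(z - \<cdot>)\<close>. The coefficients are fixed
  combinations of finitely many evaluations of the averages, so they are smooth in
  \<open>z\<close>.
\<close>

lemma smooth_densities_exist:
  assumes \<Psi>: "\<Psi> \<in> PLV d" "smooth_functional d \<Psi>"
  shows "\<exists>\<phi>. (\<forall>j\<in>{1..N}. smooth_function (\<phi> j)) \<and>
    (\<forall>f\<in>Conv. \<forall>\<psi>\<in>Cc. \<Psi> f \<psi> = (\<Sum>j=1..N. \<Psi>s j f (\<lambda>y. \<phi> j y * \<psi> y)))"
proof -
  obtain k :: nat and p e where nodes: "\<forall>j\<in>{1..N}. \<forall>x. \<Psi>s j (fst x) (snd x) =
      (\<Sum>m<k. \<Psi>s j (fst (p m)) (snd (p m)) * (\<Sum>l\<in>{1..N}. e m l * \<Psi>s l (fst x) (snd x)))"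
    using interpolation_nodes[OF finite_atLeastAtMost, of 1 N "\<lambda>j x. \<Psi>s j (fst x) (snd x)"] by (elim exE)
  \<comment> \<open>The nodes \<open>p m\<close> are pairs of arguments \<open>(f, \<phi>)\<close>, and
      the coefficients of \<open>E\<close> are combinations of the values of
      \<open>E\<close> at them.\<close>
  have coeff: "E f \<phi> = (\<Sum>l=1..N. (\<Sum>m<k. e m l * E (fst (p m)) (snd (p m))) * \<Psi>s l f \<phi>)" if E: "E \<in> PLV_tr d" for E f \<phi>
  proof -
    obtain c where c: "\<forall>f \<phi>. E f \<phi> = (\<Sum>j=1..N. c j * \<Psi>s j f \<phi>)" using basis_expansion[OF E] by (rule exE)
    define B where "B m = (\<Sum>l=1..N. e m l * \<Psi>s l f \<phi>)" for m
    have nB: "\<Psi>s j f \<phi> = (\<Sum>m<k. \<Psi>s j (fst (p m)) (snd (p m)) * B m)" if "j \<in> {1..N}" for j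
      using nodes[rule_format, OF that, of "(f, \<phi>)"] unfolding fst_conv snd_conv B_def .
    have "E f \<phi> = (\<Sum>j=1..N. c j * \<Psi>s j f \<phi>)" using c by blast
    also have "\<dots> = (\<Sum>j=1..N. \<Sum>m<k. c j * \<Psi>s j (fst (p m)) (snd (p m)) * B m)"
      by (rule sum.cong[OF refl]) (simp only: nB sum_distrib_left mult.assoc)
    also have "\<dots> = (\<Sum>m<k. \<Sum>j=1..N. c j * \<Psi>s j (fst (p m)) (snd (p m)) * B m)" by (rule sum.swap)
    also have "\<dots> = (\<Sum>m<k. E (fst (p m)) (snd (p m)) * B m)"
      by (rule sum.cong[OF refl]) (simp only: sum_distrib_right[symmetric] c[rule_format, symmetric])
    also have "\<dots> = (\<Sum>m<k. \<Sum>l=1..N. e m l * E (fst (p m)) (snd (p m)) * \<Psi>s l f \<phi>)"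
      unfolding B_def sum_distrib_left by (intro sum.cong refl) (simp only: mult_ac)
    also have "\<dots> = (\<Sum>l=1..N. \<Sum>m<k. e m l * E (fst (p m)) (snd (p m)) * \<Psi>s l f \<phi>)" by (rule sum.swap)
    finally show ?thesis by (simp only: sum_distrib_right)
  qed
  define b where "b q l z = (\<Sum>m<k. e m l * translation_average (\<lambda>y. fst q (z - y)) (snd q) (fst (p m)) (snd (p m)))"
    for q :: "(real^'n \<Rightarrow> complex) \<times> 'n functional" and l z
  obtain xs :: "((real^'n \<Rightarrow> complex) \<times> 'n functional) list" where
    item0: "\<forall>q\<in>set xs. fst q \<in> Cc \<and> snd q \<in> PLV d \<and> smooth_functional d (snd q)" and
    rep0: "\<forall>f\<in>Conv. \<forall>\<psi>\<in>Cc.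
      \<Psi> f \<psi> = (\<Sum>q\<leftarrow>xs. LINT x|lborel. fst q x * snd q (\<lambda>y. f (y + x)) (\<lambda>y. \<psi> (y + x)))"
  proof (rule parametrix[OF \<Psi>], goal_cases)
    case (1 xs)
    show ?case by (rule 1(1)[OF ballI[OF 1(2)] ballI[OF ballI[OF 1(3)]]])
  qed
  note item = item0[rule_format] and rep = rep0[rule_format]
  have bs: "smooth_function (b q l)" if "q \<in> set xs" for q l
    unfolding b_def by (rule smooth_function_sum, rule frozen_coefficient_smooth[where d=d]) (simp_all only: item[OF that])
  have link: "(LINT x|lborel. fst q x * snd q (\<lambda>y. f (y + x)) (\<lambda>y. \<psi> (y + x))) = (\<Sum>l=1..N. \<Psi>s l f (\<lambda>y. b q l y * \<psi> y))"
    if q: "q \<in> set xs" and f: "f \<in> Conv" and \<psi>: "\<psi> \<in> Cc" for q f \<psi>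
  proof (rule convolution_from_frozen_averages[OF finite_atLeastAtMost PLV_tr_PLV[OF basis_in_PLV_tr] _ _ _ _ f \<psi>, symmetric])
    show "continuous_on UNIV (b q l)" for l by (rule smooth_function_continuous[OF bs[OF q]])
    show "snd q \<in> PLV d" "fst q \<in> Cc" by (simp_all only: item[OF q])
    fix z h \<phi>
    have "translation_average (\<lambda>y. fst q (z - y)) (snd q) \<in> PLV_tr d"
      by (rule average_in_PLV_tr[OF conjunct1[OF conjunct2[OF item[OF q]]] reflected_kernel[OF conjunct1[OF item[OF q]]]])
    from coeff[OF this, of h \<phi>]
    show "translation_average (\<lambda>y. fst q (z - y)) (snd q) h \<phi> = (\<Sum>l=1..N. b q l z * \<Psi>s l h \<phi>)"
      by (simp only: b_def)
  qed
  define \<phi> where "\<phi> l z = (\<Sum>q\<leftarrow>xs. b q l z)" for l z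
  have "smooth_function (\<lambda>z. \<Sum>q\<leftarrow>ys. b q l z) \<and> (\<forall>f\<in>Conv. \<forall>\<psi>\<in>Cc. l \<in> {1..N} \<longrightarrow>
      (\<Sum>q\<leftarrow>ys. \<Psi>s l f (\<lambda>y. b q l y * \<psi> y)) = \<Psi>s l f (\<lambda>y. (\<Sum>q\<leftarrow>ys. b q l y) * \<psi> y))"
    if "set ys \<subseteq> set xs" for ys l
    using that
  proof (induction ys)
    case Nil
    have "\<Psi>s l f (\<lambda>y. 0) = 0" if "f \<in> Conv" "l \<in> {1..N}" for f
      by (rule Radon_zero[OF PLV_Radon[OF PLV_tr_PLV[OF basis_in_PLV_tr[OF that(2)]] that(1)]])
    then have "\<forall>f\<in>Conv. \<forall>\<psi>\<in>(Cc :: (real^'n \<Rightarrow> complex) set). l \<in> {1..N} \<longrightarrow> 0 = \<Psi>s l f (\<lambda>y. 0)" by metis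
    moreover have "smooth_function (\<lambda>z :: real^'n. 0)" unfolding smooth_function_def smooth_map_def using C_k_zero by blast
    ultimately show ?case by (simp only: list.map sum_list.Nil mult_zero_left)
  next
    case (Cons q ys)
    then have q: "q \<in> set xs" and IH: "smooth_function (\<lambda>z. \<Sum>q\<leftarrow>ys. b q l z)"
      "\<forall>f\<in>Conv. \<forall>\<psi>\<in>Cc. l \<in> {1..N} \<longrightarrow>
      (\<Sum>q\<leftarrow>ys. \<Psi>s l f (\<lambda>y. b q l y * \<psi> y)) = \<Psi>s l f (\<lambda>y. (\<Sum>q\<leftarrow>ys. b q l y) * \<psi> y)" by auto
    have "smooth_function (\<lambda>z. b q l z + (\<Sum>q\<leftarrow>ys. b q l z))"
    proof -
      have "C_k k euclidean scaleR (b q l)" for k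
        using bs[OF q, of l] unfolding smooth_function_def smooth_map_def by (rule spec)
      moreover have "C_k k euclidean scaleR (\<lambda>z. \<Sum>q\<leftarrow>ys. b q l z)" for k
        using IH(1) unfolding smooth_function_def smooth_map_def by (rule spec)
      ultimately show ?thesis unfolding smooth_function_def smooth_map_def by (rule allI[OF C_k_add])
    qed
    moreover have "\<Psi>s l f (\<lambda>y. b q l y * \<psi> y) + (\<Sum>q\<leftarrow>ys. \<Psi>s l f (\<lambda>y. b q l y * \<psi> y)) =
        \<Psi>s l f (\<lambda>y. (b q l y + (\<Sum>q\<leftarrow>ys. b q l y)) * \<psi> y)" if f: "f \<in> Conv" and \<psi>: "\<psi> \<in> Cc" and l: "l \<in> {1..N}" for f \<psi>
    proof -
      have R: "\<Psi>s l f \<in> Radon" by (rule PLV_Radon[OF PLV_tr_PLV[OF basis_in_PLV_tr[OF l]] f])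
      have "\<Psi>s l f (\<lambda>y. b q l y * \<psi> y + (\<Sum>q\<leftarrow>ys. b q l y) * \<psi> y) = \<Psi>s l f (\<lambda>y. b q l y * \<psi> y) + \<Psi>s l f (\<lambda>y. (\<Sum>q\<leftarrow>ys. b q l y) * \<psi> y)"
        by (rule Radon_add[OF R Cc_mult(1)[OF \<psi> smooth_function_continuous[OF bs[OF q]]] Cc_mult(1)[OF \<psi> smooth_function_continuous[OF IH(1)]]])
      then show ?thesis using IH(2) f \<psi> l by (simp only: distrib_right)
    qed
    ultimately show ?case by (simp only: list.map sum_list.Cons) blast
  qed
  note all = this[OF subset_refl]
  have smooth: "smooth_function (\<phi> l)" for l
    using conjunct1[OF all[of l]] unfolding \<phi>_def[abs_def] .
  have comb: "\<And>f \<psi>. f \<in> Conv \<Longrightarrow> \<psi> \<in> Cc \<Longrightarrow> l \<in> {1..N} \<Longrightarrow>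
      (\<Sum>q\<leftarrow>xs. \<Psi>s l f (\<lambda>y. b q l y * \<psi> y)) = \<Psi>s l f (\<lambda>y. \<phi> l y * \<psi> y)" for l
    using conjunct2[OF all[of l], rule_format] unfolding \<phi>_def[abs_def] .
  have "\<Psi> f \<psi> = (\<Sum>l=1..N. \<Psi>s l f (\<lambda>y. \<phi> l y * \<psi> y))" if f: "f \<in> Conv" and \<psi>: "\<psi> \<in> Cc" for f \<psi>
  proof -
    have swap: "(\<Sum>q\<leftarrow>ys. \<Sum>l=1..N. \<Psi>s l f (\<lambda>y. b q l y * \<psi> y)) = (\<Sum>l=1..N. \<Sum>q\<leftarrow>ys. \<Psi>s l f (\<lambda>y. b q l y * \<psi> y))" for ys
      by (induction ys) (simp_all add: sum.distrib)
    have "\<Psi> f \<psi> = (\<Sum>q\<leftarrow>xs. \<Sum>l=1..N. \<Psi>s l f (\<lambda>y. b q l y * \<psi> y))"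
      unfolding rep[OF f \<psi>] by (rule arg_cong[where f=sum_list], rule map_cong[OF refl], rule link[OF _ f \<psi>])
    also have "\<dots> = (\<Sum>l=1..N. \<Psi>s l f (\<lambda>y. \<phi> l y * \<psi> y))"
      unfolding swap by (rule sum.cong[OF refl]) (rule comb[OF f \<psi>])
    finally show ?thesis .
  qed
  then show ?thesis using smooth by (intro exI[of _ \<phi>] conjI ballI)
qed

lemma has_densities_iff:
  assumes \<Psi>: "\<Psi> \<in> PLV d" and g: "\<And>j. j \<in> {1..N} \<Longrightarrow> continuous_on UNIV (g j)"
  shows "has_densities \<Psi> N \<Psi>s g \<longleftrightarrow> (\<forall>f\<in>Conv. \<forall>\<psi>\<in>Cc. \<Psi> f \<psi> = (\<Sum>j=1..N. \<Psi>s j f (\<lambda>y. g j y * \<psi> y)))"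
  unfolding has_densities_def
proof (rule ball_cong[OF refl])
  fix f :: "real^'n \<Rightarrow> real" assume f: "f \<in> Conv"
  show "(\<forall>B. bounded B \<longrightarrow> B \<in> sets borel \<longrightarrow> radon_measure (\<Psi> f) B = (\<Sum>j=1..N. radon_integral (\<Psi>s j f) B (g j)))
      \<longleftrightarrow> (\<forall>\<psi>\<in>Cc. \<Psi> f \<psi> = (\<Sum>j=1..N. \<Psi>s j f (\<lambda>y. g j y * \<psi> y)))"
    by (rule radon_density_iff[OF PLV_Radon[OF \<Psi> f] PLV_Radon[OF PLV_tr_PLV[OF basis_in_PLV_tr] f] g])
qed

end

theorem theorem2:
  fixes d N :: nat
    and \<Psi>s :: "nat \<Rightarrow> 'n::finite functional"
    and \<Psi> :: "'n functional"
  assumes "N = functional_dim (PLV_tr d :: 'n functional set)"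
    and "is_basis (PLV_tr d) N \<Psi>s"
    and "\<Psi> \<in> PLV d"
  shows "(smooth_functional d \<Psi> \<longleftrightarrow>
            (\<exists>\<phi>. (\<forall>j\<in>{1..N}. smooth_function (\<phi> j)) \<and> has_densities \<Psi> N \<Psi>s \<phi>)) \<and>
         (\<forall>\<phi> \<phi>'. (\<forall>j\<in>{1..N}. smooth_function (\<phi> j)) \<and> has_densities \<Psi> N \<Psi>s \<phi> \<and>
                 (\<forall>j\<in>{1..N}. smooth_function (\<phi>' j)) \<and> has_densities \<Psi> N \<Psi>s \<phi>' \<longrightarrow>
            (\<forall>j\<in>{1..N}. \<phi> j = \<phi>' j))"
proof -
  note basis = assms(2) and \<Psi> = assms(3)
  have iff: "has_densities \<Psi> N \<Psi>s g \<longleftrightarrow> (\<forall>f\<in>Conv. \<forall>\<psi>\<in>Cc. \<Psi> f \<psi> = (\<Sum>j=1..N. \<Psi>s j f (\<lambda>y. g j y * \<psi> y)))"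
    if "\<forall>j\<in>{1..N}. smooth_function (g j)" for g
    by (rule has_densities_iff[OF basis \<Psi> smooth_function_continuous]) (use that in blast)
  have "\<exists>\<phi>. (\<forall>j\<in>{1..N}. smooth_function (\<phi> j)) \<and> has_densities \<Psi> N \<Psi>s \<phi>" if "smooth_functional d \<Psi>"
    using smooth_densities_exist[OF basis \<Psi> that]
  proof (elim exE conjE)
    fix \<phi> assume s: "\<forall>j\<in>{1..N}. smooth_function (\<phi> j)" and "\<forall>f\<in>Conv. \<forall>\<psi>\<in>Cc. \<Psi> f \<psi> = (\<Sum>j=1..N. \<Psi>s j f (\<lambda>y. \<phi> j y * \<psi> y))"
    then have "has_densities \<Psi> N \<Psi>s \<phi>" by (simp only: iff[OF s])
    with s show ?thesis by (intro exI[of _ \<phi>] conjI)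
  qed
  moreover have "smooth_functional d \<Psi>" if "(\<forall>j\<in>{1..N}. smooth_function (\<phi> j)) \<and> has_densities \<Psi> N \<Psi>s \<phi>" for \<phi>
  proof -
    have s: "\<forall>j\<in>{1..N}. smooth_function (\<phi> j)" using that by (rule conjunct1)
    have r: "\<forall>f\<in>Conv. \<forall>\<psi>\<in>Cc. \<Psi> f \<psi> = (\<Sum>j=1..N. \<Psi>s j f (\<lambda>y. \<phi> j y * \<psi> y))"
      using that[THEN conjunct2] unfolding iff[OF s] .
    show ?thesis
      by (rule smooth_functional_of_smooth_densities[OF basis_in_PLV_tr[OF basis] \<Psi> s[rule_format] r[rule_format]])
  qed
  moreover have "\<phi> j = \<phi>' j" if "(\<forall>j\<in>{1..N}. smooth_function (\<phi> j)) \<and> has_densities \<Psi> N \<Psi>s \<phi> \<and>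
      (\<forall>j\<in>{1..N}. smooth_function (\<phi>' j)) \<and> has_densities \<Psi> N \<Psi>s \<phi>'" and j: "j \<in> {1..N}" for \<phi> \<phi>' j
  proof -
    have s: "\<forall>j\<in>{1..N}. smooth_function (\<phi> j)" "\<forall>j\<in>{1..N}. smooth_function (\<phi>' j)" using that(1) by blast+
    have r: "\<forall>f\<in>Conv. \<forall>\<psi>\<in>Cc. \<Psi> f \<psi> = (\<Sum>j=1..N. \<Psi>s j f (\<lambda>y. \<phi> j y * \<psi> y))"
      using that(1) iff[OF s(1)] by blast
    have r': "\<forall>f\<in>Conv. \<forall>\<psi>\<in>Cc. \<Psi> f \<psi> = (\<Sum>j=1..N. \<Psi>s j f (\<lambda>y. \<phi>' j y * \<psi> y))"
      using that(1) iff[OF s(2)] by blast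
    show ?thesis
    proof (rule densities_unique[OF basis smooth_function_continuous smooth_function_continuous _ j])
      fix f :: "real^'n \<Rightarrow> real" and \<psi> :: "real^'n \<Rightarrow> complex" assume f: "f \<in> Conv" and \<psi>: "\<psi> \<in> Cc"
      show "(\<Sum>j=1..N. \<Psi>s j f (\<lambda>y. \<phi> j y * \<psi> y)) = (\<Sum>j=1..N. \<Psi>s j f (\<lambda>y. \<phi>' j y * \<psi> y))"
        using r[rule_format, OF f \<psi>] r'[rule_format, OF f \<psi>] by (rule trans[OF sym])
    qed (use s in blast)+
  qed
  ultimately show ?thesis by blast
qed

end
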